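(* There exists $\mu_0>0$ such that for every $0<\mu<\mu_0$ the following hold. For every $(x,y)\in\mathcal H$ with $V^\mu(x,y)<+\infty$, $$V^\mu(x,y)=\min\Big\{I^\mu_{-\infty}(z)\ :\ z\in C((-\infty,0];\mathcal H),\ \lim_{t\to-\infty}|z(t)|_{\mathcal H}=0,\ z(0)=(x,y)\Big\},$$ and for every $x\in H$ with $V_\mu(x)<+\infty$, $$V_\mu(x)=\min\Big\{I^\mu_{-\infty}(z)\ :\ z\in C((-\infty,0];\mathcal H),\ \lim_{t\to-\infty}|z(t)|_{\mathcal H}=0,\ \Pi_1z(0)=x\Big\}$$ (in particular, both minima are attained).
   Context: Spaces. Let $d\ge 1$, let $D\subset\mathbb R^d$ be a bounded regular open domain, $H=L^2(D)$, and let $A$ be the realization in $H$ of the Laplacian with Dirichlet boundary conditions. Let $\{e_k\}$ be a complete orthonormal basis of $H$ with $Ae_k=-\alpha_ke_k$, $0<\alpha_1\le\alpha_k\le\alpha_{k+1}$; $D$ is regular enough that $\alpha_k\sim k^{2/d}$. For $\delta\in\mathbb R$, $H^\delta$ is the Hilbert space obtained by completing $\mathrm{span}\{e_k\}$ in the norm $|x|_{H^\delta}^2=\sum_k\alpha_k^\delta\langle x,e_k\rangle_H^2$ (so $H^0=H$). Set $\mathcal H_\delta=H^\delta\times H^{\delta-1}$ with $|(u,v)|^2_{\mathcal H_\delta}=|u|^2_{H^\delta}+|v|^2_{H^{\delta-1}}$, $\mathcal H=\mathcal H_0$, and $\Pi_1(u,v)=u$, $\Pi_2(u,v)=v$. Assumptions.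 $Q$ is a bounded linear operator on $H$ with $Qe_k=\lambda_ke_k$ and $\frac1c\alpha_k^{-\beta}\le\lambda_k\le c\,\alpha_k^{-\beta}$ for all $k$, for some $c>0$ and $\beta>(d-2)/4$. For every $\delta\in[0,1+2\beta]$ the map $B:H^\delta\to H^\delta$ is Lipschitz with Lipschitz constant $\gamma_\delta<\alpha_1$; $B(0)=0$; $B$ is differentiable in $H^{2\beta}$ with $\sup_{x\in H^{2\beta}}\|DB(x)\|_{\mathcal L(H^{2\beta})}=\gamma_{2\beta}$. Operators. For $\mu>0$, $S_\mu(t)$, $t\ge0$, is the semigroup on $\mathcal H_\delta$ generated by $A_\mu(u,v)=\left(v,\frac1\mu Au-\frac1\mu v\right)$, $D(A_\mu)=\mathcal H_{1+\delta}$. Put $B_\mu(u,v)=\frac1\mu(0,B(u))$ and $Q_\mu u=\frac1\mu(0,Qu)$. Action functional and quasi-potential. For $t_1<t_2$ and $z\in C([t_1,t_2];\mathcal H)$, $I^\mu_{t_1,t_2}(z)=\frac12\inf|\psi|^2_{L^2((t_1,t_2);H)}$, the infimum over all $\psi\in L^2((t_1,t_2);H)$ with $z(t)=S_\mu(t-t_1)z(t_1)+\int_{t_1}^tS_\mu(t-s)B_\mu(z(s))ds+\int_{t_1}^tS_\mu(t-s)Q_\mu\psi(s)ds$ for $t\in[t_1,t_2]$ ($\inf\emptyset=+\infty$). For $z\in C((-\infty,0];\mathcal H)$, $I^\mu_{-\infty}(z)=\sup_{t>0}I^\mu_{-t,0}(z)$. For $(x,y)\in\mathcal H$, $V^\mu(x,y)=\inf\{I^\mu_{0,T}(z):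 T>0,\ z\in C([0,T];\mathcal H),\ z(0)=0,\ z(T)=(x,y)\}$, and for $x\in H$, $V_\mu(x)=\inf_{y\in H^{-1}}V^\mu(x,y)$. *)

theory Defs
  imports "HOL-Analysis.Analysis" "HOL-Library.Landau_Symbols"
begin

section \<open>The space L2(D) and the Dirichlet Laplacian\<close>

text \<open>
  There is no type of classes of square integrable functions on a set \<open>D\<close>.  A Hilbert space type
  \<open>'h\<close> plays the role of \<open>L\<^sup>2(D)\<close>: the map \<open>rep\<close> selects a representative function for each element,
  every square integrable function is almost everywhere equal to a representative, and the inner
  product is the one of \<open>L\<^sup>2(D)\<close>.  (Preservation of the inner product makes \<open>rep\<close> linear and injective
  up to null sets.)
\<close>

definition is_L2_space :: "(real^'d) set \<Rightarrow> ('h::real_inner \<Rightarrow> real^'d \<Rightarrow> real) \<Rightarrow> bool" where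
  "is_L2_space D rep \<longleftrightarrow>
     (\<forall>u. rep u \<in> borel_measurable (lebesgue_on D) \<and>
          integrable (lebesgue_on D) (\<lambda>\<xi>. (rep u \<xi>)\<^sup>2)) \<and>
     (\<forall>u v. u \<bullet> v = (LINT \<xi>|lebesgue_on D. rep u \<xi> * rep v \<xi>)) \<and>
     (\<forall>f. f \<in> borel_measurable (lebesgue_on D) \<and> integrable (lebesgue_on D) (\<lambda>\<xi>. (f \<xi>)\<^sup>2) \<longrightarrow>
          (\<exists>u. AE \<xi> in lebesgue_on D. rep u \<xi> = f \<xi>))"

text \<open>\<open>F l\<close> is the iterated partial derivative of \<open>\<phi>\<close> in the directions listed in \<open>l\<close>.\<close>

definition smooth_fun :: "(real^'d \<Rightarrow> real) \<Rightarrow> bool" where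
  "smooth_fun \<phi> \<longleftrightarrow>
     (\<exists>F :: 'd list \<Rightarrow> real^'d \<Rightarrow> real. F [] = \<phi> \<and>
        (\<forall>l \<xi>. (F l has_derivative (\<lambda>h. \<Sum>i\<in>UNIV. F (i # l) \<xi> * h $ i)) (at \<xi>)))"

definition test_fun :: "(real^'d) set \<Rightarrow> (real^'d \<Rightarrow> real) \<Rightarrow> bool" where
  "test_fun D \<phi> \<longleftrightarrow> smooth_fun \<phi> \<and>
     compact (closure {\<xi>. \<phi> \<xi> \<noteq> 0}) \<and> closure {\<xi>. \<phi> \<xi> \<noteq> 0} \<subseteq> D"

definition partial_deriv :: "'d \<Rightarrow> (real^'d \<Rightarrow> real) \<Rightarrow> real^'d \<Rightarrow> real" where
  "partial_deriv i \<phi> \<xi> = frechet_derivative \<phi> (at \<xi>) (axis i 1)"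

text \<open>\<open>u\<close> lies in the closure of the test functions in the first order Sobolev norm, and has weak
  gradient \<open>g\<close>.\<close>

definition H01_gradient ::
  "(real^'d) set \<Rightarrow> ('h::real_inner \<Rightarrow> real^'d \<Rightarrow> real) \<Rightarrow> 'h \<Rightarrow> ('d \<Rightarrow> 'h) \<Rightarrow> bool" where
  "H01_gradient D rep u g \<longleftrightarrow>
     (\<exists>\<phi>. (\<forall>n::nat. test_fun D (\<phi> n)) \<and>
        (\<lambda>n. LINT \<xi>|lebesgue_on D. (\<phi> n \<xi> - rep u \<xi>)\<^sup>2) \<longlonglongrightarrow> 0 \<and>
        (\<forall>i. (\<lambda>n. LINT \<xi>|lebesgue_on D. (partial_deriv i (\<phi> n) \<xi> - rep (g i) \<xi>)\<^sup>2) \<longlonglongrightarrow> 0))"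

text \<open>The graph of the realization of the Laplacian in \<open>L\<^sup>2(D)\<close> with Dirichlet boundary conditions:
  \<open>u\<close> is in its domain and is mapped to \<open>f\<close>.\<close>

definition dirichlet_laplacian ::
  "(real^'d) set \<Rightarrow> ('h::real_inner \<Rightarrow> real^'d \<Rightarrow> real) \<Rightarrow> 'h \<Rightarrow> 'h \<Rightarrow> bool" where
  "dirichlet_laplacian D rep u f \<longleftrightarrow>
     (\<exists>g. H01_gradient D rep u g \<and>
        (\<forall>\<phi>. test_fun D \<phi> \<longrightarrow>
           (\<Sum>i\<in>UNIV. LINT \<xi>|lebesgue_on D. rep (g i) \<xi> * partial_deriv i \<phi> \<xi>)
             = - (LINT \<xi>|lebesgue_on D. rep f \<xi> * \<phi> \<xi>)))"


section \<open>The scale of Hilbert spaces\<close>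

text \<open>The sequences \<open>e\<close> and \<open>\<alpha>\<close> are indexed from 0.  For \<open>\<delta> \<ge> 0\<close> the completion of the span of the
  \<open>e k\<close> is realized as the subspace \<open>Hsp e \<alpha> \<delta>\<close> of \<open>H\<close>.\<close>

definition Hsp :: "(nat \<Rightarrow> 'h::real_inner) \<Rightarrow> (nat \<Rightarrow> real) \<Rightarrow> real \<Rightarrow> 'h set" where
  "Hsp e \<alpha> \<delta> = {x. summable (\<lambda>k. \<alpha> k powr \<delta> * (x \<bullet> e k)\<^sup>2)}"

definition Hnorm :: "(nat \<Rightarrow> 'h::real_inner) \<Rightarrow> (nat \<Rightarrow> real) \<Rightarrow> real \<Rightarrow> 'h \<Rightarrow> real" where
  "Hnorm e \<alpha> \<delta> x = sqrt (\<Sum>k. \<alpha> k powr \<delta> * (x \<bullet> e k)\<^sup>2)"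

text \<open>The complete space \<open>'m\<close> is, via the embedding \<open>\<iota>\<close> of \<open>H\<close>, the completion of the span of the \<open>e k\<close>
  in the norm of index \<open>-1\<close>.\<close>

definition is_Hminus1 ::
  "(nat \<Rightarrow> 'h::real_inner) \<Rightarrow> (nat \<Rightarrow> real) \<Rightarrow> ('h \<Rightarrow> 'm::{real_inner,banach}) \<Rightarrow> bool" where
  "is_Hminus1 e \<alpha> \<iota> \<longleftrightarrow> linear \<iota> \<and> (\<forall>x. norm (\<iota> x) = Hnorm e \<alpha> (-1) x) \<and>
     closure (\<iota> ` span (range e)) = UNIV"

definition bounded_op_on ::
  "(nat \<Rightarrow> 'h::real_inner) \<Rightarrow> (nat \<Rightarrow> real) \<Rightarrow> real \<Rightarrow> ('h \<Rightarrow> 'h) \<Rightarrow> bool" where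
  "bounded_op_on e \<alpha> \<delta> L \<longleftrightarrow>
     (\<forall>x\<in>Hsp e \<alpha> \<delta>. L x \<in> Hsp e \<alpha> \<delta>) \<and>
     (\<forall>x\<in>Hsp e \<alpha> \<delta>. \<forall>y\<in>Hsp e \<alpha> \<delta>. L (x + y) = L x + L y) \<and>
     (\<forall>r. \<forall>x\<in>Hsp e \<alpha> \<delta>. L (r *\<^sub>R x) = r *\<^sub>R L x) \<and>
     (\<exists>C. \<forall>x\<in>Hsp e \<alpha> \<delta>. Hnorm e \<alpha> \<delta> (L x) \<le> C * Hnorm e \<alpha> \<delta> x)"

definition op_norm_on ::
  "(nat \<Rightarrow> 'h::real_inner) \<Rightarrow> (nat \<Rightarrow> real) \<Rightarrow> real \<Rightarrow> ('h \<Rightarrow> 'h) \<Rightarrow> ereal" where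
  "op_norm_on e \<alpha> \<delta> L = (SUP x\<in>{x \<in> Hsp e \<alpha> \<delta>. Hnorm e \<alpha> \<delta> x \<le> 1}. ereal (Hnorm e \<alpha> \<delta> (L x)))"

text \<open>Frechet differentiability at \<open>x\<close> with respect to the norm of index \<open>\<delta>\<close>.\<close>

definition has_Hderivative ::
  "(nat \<Rightarrow> 'h::real_inner) \<Rightarrow> (nat \<Rightarrow> real) \<Rightarrow> real \<Rightarrow> ('h \<Rightarrow> 'h) \<Rightarrow> ('h \<Rightarrow> 'h) \<Rightarrow> 'h \<Rightarrow> bool" where
  "has_Hderivative e \<alpha> \<delta> B L x \<longleftrightarrow> bounded_op_on e \<alpha> \<delta> L \<and>
     (\<forall>\<epsilon>>0. \<exists>\<eta>>0. \<forall>h\<in>Hsp e \<alpha> \<delta>. Hnorm e \<alpha> \<delta> h < \<eta> \<longrightarrow>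
        Hnorm e \<alpha> \<delta> (B (x + h) - B x - L h) \<le> \<epsilon> * Hnorm e \<alpha> \<delta> h)"


section \<open>Semigroups\<close>

definition C0_semigroup :: "(real \<Rightarrow> 'a::real_normed_vector \<Rightarrow> 'a) \<Rightarrow> bool" where
  "C0_semigroup S \<longleftrightarrow>
     (\<forall>t\<ge>0. bounded_linear (S t)) \<and> S 0 = id \<and>
     (\<forall>s\<ge>0. \<forall>t\<ge>0. S (s + t) = S s \<circ> S t) \<and>
     (\<forall>z. ((\<lambda>t. S t z) \<longlongrightarrow> z) (at_right 0))"

definition has_generator ::
  "(real \<Rightarrow> 'a::real_normed_vector \<Rightarrow> 'a) \<Rightarrow> 'a set \<Rightarrow> ('a \<Rightarrow> 'a) \<Rightarrow> bool" where
  "has_generator S Dom G \<longleftrightarrow>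
     (\<forall>z w. ((\<lambda>t. (S t z - z) /\<^sub>R t) \<longlongrightarrow> w) (at_right 0) \<longleftrightarrow> z \<in> Dom \<and> w = G z)"


section \<open>The damped wave operators\<close>

text \<open>The extension of the Laplacian to an operator from \<open>Hsp e \<alpha> 1\<close> to the space of index \<open>-1\<close>.\<close>

definition lap_ext ::
  "(nat \<Rightarrow> 'h::real_inner) \<Rightarrow> (nat \<Rightarrow> real) \<Rightarrow> ('h \<Rightarrow> 'm::real_normed_vector) \<Rightarrow> 'h \<Rightarrow> 'm" where
  "lap_ext e \<alpha> \<iota> u = (\<Sum>k. (- \<alpha> k * (u \<bullet> e k)) *\<^sub>R \<iota> (e k))"

text \<open>The domain is the space of index 1, whose second component is \<open>H\<close>, here \<open>range \<iota>\<close>.\<close>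

definition A_dom ::
  "(nat \<Rightarrow> 'h::real_inner) \<Rightarrow> (nat \<Rightarrow> real) \<Rightarrow> ('h \<Rightarrow> 'm::real_normed_vector) \<Rightarrow> ('h \<times> 'm) set" where
  "A_dom e \<alpha> \<iota> = Hsp e \<alpha> 1 \<times> range \<iota>"

definition A_op ::
  "(nat \<Rightarrow> 'h::real_inner) \<Rightarrow> (nat \<Rightarrow> real) \<Rightarrow> ('h \<Rightarrow> 'm::real_normed_vector) \<Rightarrow> real \<Rightarrow>
     'h \<times> 'm \<Rightarrow> 'h \<times> 'm" where
  "A_op e \<alpha> \<iota> \<mu> z = (inv \<iota> (snd z), (1/\<mu>) *\<^sub>R lap_ext e \<alpha> \<iota> (fst z) - (1/\<mu>) *\<^sub>R snd z)"

definition B_op :: "('h \<Rightarrow> 'm::real_vector) \<Rightarrow> ('h \<Rightarrow> 'h) \<Rightarrow> real \<Rightarrow> 'h::real_vector \<times> 'm \<Rightarrow> 'h \<times> 'm" where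
  "B_op \<iota> B \<mu> z = (1/\<mu>) *\<^sub>R (0, \<iota> (B (fst z)))"

definition Q_op :: "('h \<Rightarrow> 'm::real_vector) \<Rightarrow> ('h \<Rightarrow> 'h) \<Rightarrow> real \<Rightarrow> 'h::real_vector \<Rightarrow> 'h \<times> 'm" where
  "Q_op \<iota> Q \<mu> u = (1/\<mu>) *\<^sub>R (0, \<iota> (Q u))"


section \<open>Action functional and quasi-potential\<close>

text \<open>Below, \<open>S\<close> is the family of semigroups \<open>\<mu> \<mapsto> S \<mu>\<close>.\<close>

definition controls :: "real \<Rightarrow> real \<Rightarrow> (real \<Rightarrow> 'h::{real_inner,banach,second_countable_topology}) set" where
  "controls t1 t2 = {\<psi>. set_borel_measurable lborel {t1<..<t2} \<psi> \<and>
                        set_integrable lborel {t1<..<t2} (\<lambda>s. (norm (\<psi> s))\<^sup>2)}"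

definition is_mild_solution ::
  "(real \<Rightarrow> real \<Rightarrow> 'h \<times> 'm \<Rightarrow> 'h \<times> 'm) \<Rightarrow>
   ('h::{real_inner,banach,second_countable_topology} \<Rightarrow> 'm::{real_inner,banach,second_countable_topology}) \<Rightarrow>
   ('h \<Rightarrow> 'h) \<Rightarrow> ('h \<Rightarrow> 'h) \<Rightarrow> real \<Rightarrow> real \<Rightarrow> real \<Rightarrow> (real \<Rightarrow> 'h) \<Rightarrow> (real \<Rightarrow> 'h \<times> 'm) \<Rightarrow> bool" where
  "is_mild_solution S \<iota> B Q \<mu> t1 t2 \<psi> z \<longleftrightarrow>
     (\<forall>t\<in>{t1..t2}. z t = S \<mu> (t - t1) (z t1)
        + (LINT s:{t1..t}|lborel. S \<mu> (t - s) (B_op \<iota> B \<mu> (z s)))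
        + (LINT s:{t1..t}|lborel. S \<mu> (t - s) (Q_op \<iota> Q \<mu> (\<psi> s))))"

definition action ::
  "(real \<Rightarrow> real \<Rightarrow> 'h \<times> 'm \<Rightarrow> 'h \<times> 'm) \<Rightarrow>
   ('h::{real_inner,banach,second_countable_topology} \<Rightarrow> 'm::{real_inner,banach,second_countable_topology}) \<Rightarrow>
   ('h \<Rightarrow> 'h) \<Rightarrow> ('h \<Rightarrow> 'h) \<Rightarrow> real \<Rightarrow> real \<Rightarrow> real \<Rightarrow> (real \<Rightarrow> 'h \<times> 'm) \<Rightarrow> ereal" where
  "action S \<iota> B Q \<mu> t1 t2 z =
     ereal (1/2) * (INF \<psi>\<in>{\<psi>\<in>controls t1 t2. is_mild_solution S \<iota> B Q \<mu> t1 t2 \<psi> z}.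
        ereal (LINT s:{t1<..<t2}|lborel. (norm (\<psi> s))\<^sup>2))"

definition action_neg_inf ::
  "(real \<Rightarrow> real \<Rightarrow> 'h \<times> 'm \<Rightarrow> 'h \<times> 'm) \<Rightarrow>
   ('h::{real_inner,banach,second_countable_topology} \<Rightarrow> 'm::{real_inner,banach,second_countable_topology}) \<Rightarrow>
   ('h \<Rightarrow> 'h) \<Rightarrow> ('h \<Rightarrow> 'h) \<Rightarrow> real \<Rightarrow> (real \<Rightarrow> 'h \<times> 'm) \<Rightarrow> ereal" where
  "action_neg_inf S \<iota> B Q \<mu> z = (SUP t\<in>{0<..}. action S \<iota> B Q \<mu> (- t) 0 z)"

definition quasi_potential ::
  "(real \<Rightarrow> real \<Rightarrow> 'h \<times> 'm \<Rightarrow> 'h \<times> 'm) \<Rightarrow>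
   ('h::{real_inner,banach,second_countable_topology} \<Rightarrow> 'm::{real_inner,banach,second_countable_topology}) \<Rightarrow>
   ('h \<Rightarrow> 'h) \<Rightarrow> ('h \<Rightarrow> 'h) \<Rightarrow> real \<Rightarrow> 'h \<times> 'm \<Rightarrow> ereal" where
  "quasi_potential S \<iota> B Q \<mu> p =
     Inf {action S \<iota> B Q \<mu> 0 T z | T z.
        T > 0 \<and> continuous_on {0..T} z \<and> z 0 = 0 \<and> z T = p}"

definition quasi_potential_pos ::
  "(real \<Rightarrow> real \<Rightarrow> 'h \<times> 'm \<Rightarrow> 'h \<times> 'm) \<Rightarrow>
   ('h::{real_inner,banach,second_countable_topology} \<Rightarrow> 'm::{real_inner,banach,second_countable_topology}) \<Rightarrow>
   ('h \<Rightarrow> 'h) \<Rightarrow> ('h \<Rightarrow> 'h) \<Rightarrow> real \<Rightarrow> 'h \<Rightarrow> ereal" where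
  "quasi_potential_pos S \<iota> B Q \<mu> x = (INF y. quasi_potential S \<iota> B Q \<mu> (x, y))"

definition is_minimum :: "'a::order \<Rightarrow> 'a set \<Rightarrow> bool" where
  "is_minimum v M \<longleftrightarrow> v \<in> M \<and> (\<forall>w\<in>M. v \<le> w)"

end

theory Submission
  imports Defs "HOL-Complex_Analysis.Great_Picard"
begin

text \<open>
  In the basis \<open>e\<close> a mild solution is a family of damped oscillators
  \<open>\<mu> u'' + u' + \<alpha>\<^sub>k u = f\<close>, coupled only through the forcing \<open>f = B(u) + Q \<psi>\<close>.  The Lyapunov function
  obtained by testing with \<open>u + 3 \<mu> u'\<close> controls each oscillator uniformly in \<open>k\<close>; for small \<open>\<mu>\<close> the
  gain from \<open>f\<close> to \<open>u\<close> is so close to \<open>1 / \<alpha>\<^sub>0\<close> that \<open>B\<close>, whose Lipschitz constant is less than \<open>\<alpha>\<^sub>0\<close>, can be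
  absorbed.  Hence a path that vanishes at \<open>-\<infinity>\<close> is bounded in terms of the energy of its control.

  Upper bound: a path of finite action gains one order of regularity with each use of the
  oscillator estimate, up to the regularity at which \<open>Q\<close> is invertible.  Multiplying \<open>u\<close> by a slowly
  varying cut-off then yields a path starting from \<open>0\<close> at a finite time, and its additional cost tends
  to \<open>0\<close>.

  Attainment: the paths of a minimizing sequence, extended by \<open>0\<close>, are bounded in the
  compactly embedded space of index 1 and equicontinuous in every mode, so a subsequence converges
  pointwise.  The limit is driven by a weak limit of the controls, and it vanishes at \<open>-\<infinity>\<close> because its
  squared norm of index 1 is integrable.
\<close>

subsection \<open>Absolutely continuous functions\<close>

text \<open>The obstacle is a mismatch of norms. At minus infinity a path is known to vanish only in
  the norm of \<open>'h \<times> 'm\<close>, while inverting \<open>Q\<close> on the cut-off error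
  needs the energy of index \<open>2 * \<beta>\<close>, which a priori may be infinite at every
  starting time. Energy estimates are therefore run on finitely many modes, the starting time
  recedes while the number of modes is fixed, and only then are all modes summed. Smallness of \<mu>
  is spent on a single estimate, at index 0; in the regularity steps B(u) is an ordinary forcing
  whose integrability in time comes from the preceding step. Any multiplier u + w \<mu> u' with w >
  1 gives a positive Lyapunov function and dissipation of u'; in squared norms the gain from f to u
  is 1/\<alpha>^2 + O(\<mu>/\<alpha>), so a Lipschitz constant strictly below the lowest eigenvalue
  leaves room for small \<mu>. Controls are merely square integrable, so the equations are read for
  absolutely continuous functions that carry an explicit integrable derivative.\<close>

definition primitive_on :: "real \<Rightarrow> real \<Rightarrow> (real \<Rightarrow> real) \<Rightarrow> (real \<Rightarrow> real) \<Rightarrow> bool" where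
  "primitive_on a b u u' \<longleftrightarrow> set_integrable lborel {a..b} u' \<and>
     (\<forall>t\<in>{a..b}. u t - u a = (LINT s:{a..t}|lborel. u' s))"

lemma set_integrable_subinterval:
  fixes f :: "real \<Rightarrow> 'a::{banach, second_countable_topology}"
  assumes "set_integrable lborel {a..b} f" "a \<le> c" "d \<le> b"
  shows "set_integrable lborel {c..d} f"
  by (rule set_integrable_subset[OF assms(1)]) (use assms in auto)

lemma primitive_on_integrable:
  assumes "primitive_on a b u u'" "a \<le> c" "d \<le> b"
  shows "set_integrable lborel {c..d} u'"
  by (rule set_integrable_subinterval) (use assms in \<open>auto simp: primitive_on_def\<close>)

lemma set_integral_Icc_combine:
  fixes f :: "real \<Rightarrow> 'a::{banach, second_countable_topology}"
  assumes "a \<le> b" "b \<le> c" "set_integrable lborel {a..c} f"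
  shows "(LINT s:{a..c}|lborel. f s) = (LINT s:{a..b}|lborel. f s) + (LINT s:{b..c}|lborel. f s)"
proof -
  have "{a..c} = {a..b} \<union> {b..c}" using assms by auto
  moreover have "(LINT s:{a..b} \<union> {b..c}|lborel. f s)
      = (LINT s:{a..b}|lborel. f s) + (LINT s:{b..c}|lborel. f s)"
  proof (rule set_integral_Un_AE)
    have "AE s in lborel. s \<noteq> b" by (rule AE_lborel_singleton)
    then show "AE x in lborel. \<not> (x \<in> {a..b} \<and> x \<in> {b..c})" by eventually_elim auto
    show "set_integrable lborel {a..b} f" "set_integrable lborel {b..c} f"
      by (rule set_integrable_subinterval[OF assms(3)]; use assms in simp)+
  qed auto
  ultimately show ?thesis by simp
qed

lemma primitive_on_diff:
  assumes "primitive_on a b u u'" "a \<le> s" "s \<le> t" "t \<le> b"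
  shows "u t - u s = (LINT r:{s..t}|lborel. u' r)"
proof -
  have "set_integrable lborel {a..t} u'"
    by (rule primitive_on_integrable[OF assms(1)]) (use assms in auto)
  then have "(LINT r:{a..t}|lborel. u' r) = (LINT r:{a..s}|lborel. u' r) + (LINT r:{s..t}|lborel. u' r)"
    using assms by (intro set_integral_Icc_combine) auto
  moreover have "u t - u a = (LINT r:{a..t}|lborel. u' r)" "u s - u a = (LINT r:{a..s}|lborel. u' r)"
    using assms by (auto simp: primitive_on_def)
  ultimately show ?thesis by simp
qed

lemma primitive_on_subinterval:
  assumes "primitive_on a b u u'" "a \<le> c" "d \<le> b"
  shows "primitive_on c d u u'"
  unfolding primitive_on_def
proof (intro conjI ballI)
  show "set_integrable lborel {c..d} u'"
    using primitive_on_integrable[OF assms] .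
  show "u t - u c = (LINT s:{c..t}|lborel. u' s)" if "t \<in> {c..d}" for t
    using primitive_on_diff[OF assms(1), of c t] assms that by auto
qed

lemma set_integral_zero_length:
  fixes f :: "real \<Rightarrow> 'a::{banach, second_countable_topology}"
  shows "(LINT s:{a..a}|lborel. f s) = 0"
proof -
  have "AE s in lborel. indicator {a..a} s *\<^sub>R f s = 0"
    using AE_lborel_singleton[of a] by eventually_elim auto
  then show ?thesis unfolding set_lebesgue_integral_def by (rule integral_eq_zero_AE)
qed

lemma primitive_on_combine:
  assumes "primitive_on a b u u'" "primitive_on b c u u'" "a \<le> b" "b \<le> c"
  shows "primitive_on a c u u'"
proof -
  have 1: "set_integrable lborel {a..c} u'"
  proof -
    have "{a..c} = {a..b} \<union> {b..c}" using assms by auto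
    then show ?thesis
      using assms set_integrable_Un[of lborel "{a..b}" u' "{b..c}"] by (auto simp: primitive_on_def)
  qed
  show ?thesis unfolding primitive_on_def
  proof (intro conjI ballI 1)
    fix t assume t: "t \<in> {a..c}"
    show "u t - u a = (LINT s:{a..t}|lborel. u' s)"
    proof (cases "t \<le> b")
      case True then show ?thesis using assms t by (auto simp: primitive_on_def)
    next
      case False
      then have "set_integrable lborel {a..t} u'"
        using t set_integrable_subinterval[OF 1] by auto
      then have "(LINT s:{a..t}|lborel. u' s) = (LINT s:{a..b}|lborel. u' s) + (LINT s:{b..t}|lborel. u' s)"
        using assms False by (intro set_integral_Icc_combine) auto
      moreover have "u b - u a = (LINT s:{a..b}|lborel. u' s)"
        using assms(1,3) by (auto simp: primitive_on_def)
      moreover have "u t - u b = (LINT s:{b..t}|lborel. u' s)"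
        using assms(2) False t by (auto simp: primitive_on_def)
      ultimately show ?thesis by simp
    qed
  qed
qed

lemma primitive_on_continuous: 
  assumes "primitive_on a b u u'" shows "continuous_on {a..b} u"
proof (cases "a \<le> b")
  case True
  have int: "set_integrable lborel {a..t} u'" if "t \<le> b" for t
    using primitive_on_integrable[OF assms] that by auto
  then have io: "u' integrable_on {a..b}"
    using set_borel_integral_eq_integral(1) by blast
  have "u t = u a + integral {a..t} u'" if "t \<in> {a..b}" for t
    using primitive_on_diff[OF assms, of a t] that int[of t] by (auto simp: set_borel_integral_eq_integral)
  moreover have "continuous_on {a..b} (\<lambda>t. u a + integral {a..t} u')"
    using indefinite_integral_continuous_1[OF io] by (intro continuous_on_add continuous_on_const)
  ultimately show ?thesis
    by (subst continuous_on_cong[OF refl]) 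
qed auto

lemma primitive_on_cong:
  assumes "primitive_on a b u u'" "\<And>t. t \<in> {a..b} \<Longrightarrow> u t = v t" "\<And>t. t \<in> {a..b} \<Longrightarrow> u' t = v' t"
  shows "primitive_on a b v v'"
proof -
  have "set_integrable lborel {a..b} v'"
    using assms(1) assms(3) set_integrable_cong[OF refl, where A="{a..b}" and A'="{a..b}"]
    unfolding primitive_on_def by metis
  moreover have "v t - v a = (LINT s:{a..t}|lborel. v' s)" if "t \<in> {a..b}" for t
  proof -
    have "(LINT s:{a..t}|lborel. v' s) = (LINT s:{a..t}|lborel. u' s)"
      using assms(3) that by (intro set_lebesgue_integral_cong) auto
    then show ?thesis using primitive_on_diff[OF assms(1), of a t] assms(2)[OF that] assms(2)[of a] that
      by auto
  qed
  ultimately show ?thesis by (simp add: primitive_on_def)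
qed

lemma primitive_on_add:
  assumes "primitive_on a b u u'" "primitive_on a b v v'"
  shows "primitive_on a b (\<lambda>t. u t + v t) (\<lambda>t. u' t + v' t)"
proof -
  have i: "set_integrable lborel {a..t} u'" "set_integrable lborel {a..t} v'" if "t \<le> b" for t
    using primitive_on_integrable[OF assms(1)] primitive_on_integrable[OF assms(2)] that by auto
  have "(LINT s:{a..t}|lborel. u' s + v' s) = (LINT s:{a..t}|lborel. u' s) + (LINT s:{a..t}|lborel. v' s)"
    if "t \<le> b" for t by (rule set_integral_add(2)[OF i[OF that]])
  moreover have "set_integrable lborel {a..b} (\<lambda>t. u' t + v' t)"
    using i[of b] by (intro set_integral_add(1)) auto
  ultimately show ?thesis using primitive_on_diff[OF assms(1), of a] primitive_on_diff[OF assms(2), of a]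
    unfolding primitive_on_def by (auto simp: add_diff_add)
qed

lemma primitive_on_cmult:
  assumes "primitive_on a b u u'" 
  shows "primitive_on a b (\<lambda>t. c * u t) (\<lambda>t. c * u' t)"
  using assms by (auto simp: primitive_on_def simp flip: right_diff_distrib)

lemma primitive_on_diff_fun:
  assumes "primitive_on a b u u'" "primitive_on a b v v'"
  shows "primitive_on a b (\<lambda>t. u t - v t) (\<lambda>t. u' t - v' t)"
  using primitive_on_add[OF assms(1) primitive_on_cmult[OF assms(2), of "-1"]] by simp

lemma primitive_on_derivative:
  assumes "\<And>t. t \<in> {a..b} \<Longrightarrow> (u has_real_derivative u' t) (at t within {a..b})"
    and "continuous_on {a..b} u'"
  shows "primitive_on a b u u'"
  unfolding primitive_on_def
proof (intro conjI ballI)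
  show *: "set_integrable lborel {a..b} u'"
    using assms(2) by (simp add: borel_integrable_atLeastAtMost' )
  fix t assume t: "t \<in> {a..b}"
  have "(u' has_integral (u t - u a)) {a..t}"
  proof (rule fundamental_theorem_of_calculus)
    fix x assume x: "x \<in> {a..t}"
    have "(u has_real_derivative u' x) (at x within {a..t})"
      by (rule DERIV_subset[OF assms(1)]) (use t x in auto)
    then show "(u has_vector_derivative u' x) (at x within {a..t})"
      by (simp add: has_real_derivative_iff_has_vector_derivative)
  qed (use t in auto)
  moreover have "set_integrable lborel {a..t} u'"
    using t set_integrable_subinterval[OF *] by auto
  ultimately show "u t - u a = (LINT s:{a..t}|lborel. u' s)"
    by (simp add: set_borel_integral_eq_integral integral_unique)
qed

lemma primitive_on_shift:
  assumes "primitive_on a b u u'"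
  shows "primitive_on (a - c) (b - c) (\<lambda>t. u (t + c)) (\<lambda>t. u' (t + c))"
proof -
  have ind: "indicator {a..t} (s + c) = (indicator {a - c..t - c} s :: real)" for s t
    by (auto simp: indicator_def)
  have "integrable lborel (\<lambda>s. indicator {a..b} s * u' s)"
    using assms by (simp add: primitive_on_def set_integrable_def)
  from lborel_integrable_real_affine[OF this, of 1 c]
  have "set_integrable lborel {a - c..b - c} (\<lambda>t. u' (t + c))"
    by (simp add: set_integrable_def ind add.commute)
  moreover have "(LINT s:{a - c..t - c}|lborel. u' (s + c)) = (LINT s:{a..t}|lborel. u' s)" for t
    using lborel_integral_real_affine[of 1 "\<lambda>s. indicator {a..t} s * u' s" c]
    by (simp add: set_lebesgue_integral_def ind add.commute)
  from this[of "t + c" for t] have "u (t + c) - u a = (LINT s:{a - c..t}|lborel. u' (s + c))"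
    if "t \<in> {a - c..b - c}" for t
    using primitive_on_diff[OF assms, of a "t + c"] that by simp
  ultimately show ?thesis by (auto simp: primitive_on_def)
qed

text \<open>The indicator of s <= t is inserted into the integrand on the square, where Fubini
  applies. The product rule and the differentiation of convolutions both rest on this
  exchange.\<close>

lemma Fubini_triangle:
  fixes k :: "real \<Rightarrow> real \<Rightarrow> real"
  assumes "integrable (lborel \<Otimes>\<^sub>M lborel) (\<lambda>(t, s). indicator {a..b} t * indicator {a..b} s * k t s)"
  shows "(LINT t:{a..b}|lborel. (LINT s:{a..t}|lborel. k t s))
       = (LINT s:{a..b}|lborel. (LINT t:{s..b}|lborel. k t s))"
    and "set_integrable lborel {a..b} (\<lambda>t. LINT s:{a..t}|lborel. k t s)"
proof -
  let ?f = "\<lambda>t s. indicator {a..b} t * indicator {a..b} s * k t s * indicator {..t} s"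
  have f1: "?f t s = indicator {a..b} t * (indicator {a..t} s * k t s)" for t s
    by (auto simp: indicator_def)
  have f2: "?f t s = indicator {a..b} s * (indicator {s..b} t * k t s)" for t s
    by (auto simp: indicator_def)
  have [measurable]: "(\<lambda>(t, s). indicator {a..b} t * indicator {a..b} s * k t s) \<in> borel_measurable (lborel \<Otimes>\<^sub>M lborel)"
    using assms by (rule borel_measurable_integrable)
  have [measurable]: "(\<lambda>x::real\<times>real. indicator {..fst x} (snd x) :: real) \<in> borel_measurable (lborel \<Otimes>\<^sub>M lborel)"
  proof -
    have eq: "(\<lambda>x. indicator {..fst x} (snd x) :: real) = indicator {x::real\<times>real. snd x \<le> fst x}"
      by (auto simp: indicator_def)
    have "closed {x::real\<times>real. snd x \<le> fst x}"
      by (intro closed_Collect_le continuous_intros)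
    then show ?thesis
      unfolding eq lborel_prod measurable_lborel1 by (intro borel_measurable_indicator) (simp add: borel_closed)
  qed
  have int: "integrable (lborel \<Otimes>\<^sub>M lborel) (case_prod ?f)"
  proof (rule Bochner_Integration.integrable_bound[OF assms])
    have "(\<lambda>x. (case x of (t, s) \<Rightarrow> indicator {a..b} t * indicator {a..b} s * k t s) * indicator {..fst x} (snd x))
       \<in> borel_measurable (lborel \<Otimes>\<^sub>M lborel)" by measurable
    then show "case_prod ?f \<in> borel_measurable (lborel \<Otimes>\<^sub>M lborel)"
      by (simp add: case_prod_beta')
  qed (auto simp: indicator_def)
  have "(\<integral>t. (\<integral>s. ?f t s \<partial>lborel) \<partial>lborel) = (\<integral>s. (\<integral>t. ?f t s \<partial>lborel) \<partial>lborel)"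
    using lborel_pair.Fubini_integral[OF int] by simp
  then show "(LINT t:{a..b}|lborel. (LINT s:{a..t}|lborel. k t s))
       = (LINT s:{a..b}|lborel. (LINT t:{s..b}|lborel. k t s))"
    unfolding set_lebesgue_integral_def
    by (subst (asm) f1, subst (asm) f2) simp
  show "set_integrable lborel {a..b} (\<lambda>t. LINT s:{a..t}|lborel. k t s)"
    using lborel_pair.integrable_fst[OF int] unfolding f1 set_lebesgue_integral_def set_integrable_def
    by simp
qed

lemma integrable_lborel_prod_mult:
  fixes p q :: "real \<Rightarrow> real"
  assumes "integrable lborel p" "integrable lborel q"
  shows "integrable (lborel \<Otimes>\<^sub>M lborel) (\<lambda>(t, s). p t * q s)"
proof (rule lborel_pair.Fubini_integrable)
  have [measurable]: "p \<in> borel_measurable borel" "q \<in> borel_measurable borel" 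
    using assms by auto
  show "(\<lambda>(t, s). p t * q s) \<in> borel_measurable (lborel \<Otimes>\<^sub>M lborel)"
    by measurable
qed (use assms in \<open>auto simp: abs_mult\<close>)

lemma continuous_on_Icc_bounded:
  fixes g :: "real \<Rightarrow> real"
  assumes "continuous_on {a..b} g"
  obtains C where "C \<ge> 0" "\<And>t. a \<le> t \<Longrightarrow> t \<le> b \<Longrightarrow> \<bar>g t\<bar> \<le> C"
proof -
  have "bounded (g ` {a..b})"
    by (intro compact_imp_bounded compact_continuous_image assms compact_Icc)
  then obtain C where C: "\<forall>x\<in>g ` {a..b}. norm x \<le> C" by (auto simp: bounded_iff)
  show ?thesis
  proof (rule that[of "\<bar>C\<bar>"])
    show "\<bar>g t\<bar> \<le> \<bar>C\<bar>" if "a \<le> t" "t \<le> b" for t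
    proof -
      have "norm (g t) \<le> C" using C that by auto
      then show ?thesis by simp
    qed
  qed simp
qed

text \<open>The product rule for absolutely continuous functions is the exchange of the order of
  integration in the double integral of u'(r) v'(s) over s <= r.\<close>

lemma primitive_on_mult:
  assumes u: "primitive_on a b u u'" and v: "primitive_on a b v v'"
  shows "primitive_on a b (\<lambda>t. u t * v t) (\<lambda>t. u' t * v t + u t * v' t)"
proof -
  have cu: "continuous_on {a..b} u" and cv: "continuous_on {a..b} v"
    using assms primitive_on_continuous by blast+
  have iu: "set_integrable lborel {a..b} u'" and iv: "set_integrable lborel {a..b} v'"
    using assms by (auto simp: primitive_on_def)
  have bnd: "set_integrable lborel {a..b} (\<lambda>t. f t * g t)"
    if f: "set_integrable lborel {a..b} f" and g: "continuous_on {a..b} g" for f g :: "real \<Rightarrow> real"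
  proof -
    obtain C where C: "C \<ge> 0" "\<And>t. a \<le> t \<Longrightarrow> t \<le> b \<Longrightarrow> \<bar>g t\<bar> \<le> C"
      using continuous_on_Icc_bounded[OF g] by blast
    have gm: "set_borel_measurable borel {a..b} g"
      using g by (intro set_measurable_continuous_on) auto
    have fm: "(\<lambda>x. indicator {a..b} x *\<^sub>R f x) \<in> borel_measurable borel"
      using f by (auto simp: set_integrable_def)
    show ?thesis
    proof (rule set_integrable_bound[where f = "\<lambda>t. C * f t"])
      show "set_integrable lborel {a..b} (\<lambda>t. C * f t)" using f by simp
      have "(\<lambda>x. (indicator {a..b} x *\<^sub>R f x) * (indicator {a..b} x *\<^sub>R g x)) \<in> borel_measurable lborel"
        using fm gm by (simp add: set_borel_measurable_def)
      moreover have "(\<lambda>x. (indicator {a..b} x *\<^sub>R f x) * (indicator {a..b} x *\<^sub>R g x))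
          = (\<lambda>x. indicator {a..b} x *\<^sub>R (f x * g x))"
        by (auto simp: indicator_def)
      ultimately show "set_borel_measurable lborel {a..b} (\<lambda>t. f t * g t)"
        unfolding set_borel_measurable_def by metis
      show "AE x in lborel. x \<in> {a..b} \<longrightarrow> norm (f x * g x) \<le> norm (C * f x)"
      proof (intro AE_I2 impI)
        fix x assume "x \<in> {a..b}"
        then have "\<bar>g x\<bar> \<le> \<bar>C\<bar>" using C(2)[of x] C(1) by auto
        then show "norm (f x * g x) \<le> norm (C * f x)"
          using mult_left_mono[of "\<bar>g x\<bar>" "\<bar>C\<bar>" "\<bar>f x\<bar>"] by (simp add: abs_mult ac_simps)
      qed
    qed
  qed
  have i1: "set_integrable lborel {a..b} (\<lambda>t. u' t * v t)" using bnd[OF iu cv] .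
  have i2: "set_integrable lborel {a..b} (\<lambda>t. u t * v' t)" using bnd[OF iv cu] by (simp add: mult.commute)
  show ?thesis unfolding primitive_on_def
  proof (intro conjI ballI set_integral_add(1) i1 i2)
    fix t assume t: "t \<in> {a..b}"
    let ?k = "\<lambda>r s. u' r * v' s"
    have iut: "set_integrable lborel {a..t} u'" and ivt: "set_integrable lborel {a..t} v'"
      and i1t: "set_integrable lborel {a..t} (\<lambda>t. u' t * v t)" and i2t: "set_integrable lborel {a..t} (\<lambda>t. u t * v' t)"
      using t set_integrable_subinterval[OF iu] set_integrable_subinterval[OF iv]
        set_integrable_subinterval[OF i1] set_integrable_subinterval[OF i2] by auto
    have "integrable (lborel \<Otimes>\<^sub>M lborel) (\<lambda>(r, s). (indicator {a..t} r *\<^sub>R u' r) * (indicator {a..t} s *\<^sub>R v' s))"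
      using iut ivt unfolding set_integrable_def by (rule integrable_lborel_prod_mult)
    then have "integrable (lborel \<Otimes>\<^sub>M lborel) (\<lambda>(r, s). indicator {a..t} r * indicator {a..t} s * ?k r s)"
      by (simp add: ac_simps)
    from Fubini_triangle(1)[OF this]
    have "(LINT r:{a..t}|lborel. u' r * (LINT s:{a..r}|lborel. v' s)) = (LINT s:{a..t}|lborel. (LINT r:{s..t}|lborel. u' r) * v' s)"
      by simp
    moreover have "(LINT r:{a..t}|lborel. u' r * (LINT s:{a..r}|lborel. v' s)) = (LINT r:{a..t}|lborel. u' r * v r - u' r * v a)"
    proof (rule set_lebesgue_integral_cong)
      show "\<forall>x. x \<in> {a..t} \<longrightarrow> u' x * (LINT s:{a..x}|lborel. v' s) = u' x * v x - u' x * v a"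
      proof (intro allI impI)
        fix x assume "x \<in> {a..t}"
        then have "v x - v a = (LINT s:{a..x}|lborel. v' s)" using v t by (auto simp: primitive_on_def)
        then show "u' x * (LINT s:{a..x}|lborel. v' s) = u' x * v x - u' x * v a" by (metis right_diff_distrib)
      qed
    qed auto
    moreover have "\<dots> = (LINT r:{a..t}|lborel. u' r * v r) - (LINT r:{a..t}|lborel. u' r) * v a"
      using i1t iut by (subst set_integral_diff) auto
    moreover have "(LINT s:{a..t}|lborel. (LINT r:{s..t}|lborel. u' r) * v' s) = (LINT s:{a..t}|lborel. u t * v' s - u s * v' s)"
    proof (rule set_lebesgue_integral_cong)
      show "\<forall>x. x \<in> {a..t} \<longrightarrow> (LINT r:{x..t}|lborel. u' r) * v' x = u t * v' x - u x * v' x"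
        using primitive_on_diff[OF u, of _ t] t by (auto simp flip: left_diff_distrib)
    qed auto
    moreover have "\<dots> = u t * (LINT r:{a..t}|lborel. v' r) - (LINT r:{a..t}|lborel. u r * v' r)"
      using i2t ivt by (subst set_integral_diff) auto
    moreover have "(LINT s:{a..t}|lborel. u' s * v s + u s * v' s) = (LINT s:{a..t}|lborel. u' s * v s) + (LINT s:{a..t}|lborel. u s * v' s)"
      using i1t i2t by (rule set_integral_add(2))
    moreover have "(LINT s:{a..t}|lborel. u' s) = u t - u a" "(LINT s:{a..t}|lborel. v' s) = v t - v a"
      using u v t by (auto simp: primitive_on_def)
    ultimately show "u t * v t - u a * v a = (LINT s:{a..t}|lborel. u' s * v s + u s * v' s)"
      by (simp add: algebra_simps)
  qed
qed

text \<open>Write K(t - s) = K(0) + integral of K' from 0 to t - s and exchange the order of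
  integration over the triangle; the constant K(0) produces the boundary term. With K a fundamental
  solution this is what makes Duhamel's formula solve the oscillator equation for a forcing that is
  only integrable.\<close>

lemma primitive_on_convolution:
  fixes g K K' :: "real \<Rightarrow> real"
  assumes g: "set_integrable lborel {a..b} g"
    and K: "primitive_on 0 (b - a) K K'" and K': "continuous_on {0..b - a} K'"
  shows "primitive_on a b (\<lambda>t. LINT s:{a..t}|lborel. K (t - s) * g s)
           (\<lambda>t. K 0 * g t + (LINT s:{a..t}|lborel. K' (t - s) * g s))"
proof -
  have main: "set_integrable lborel {a..t} (\<lambda>t. LINT s:{a..t}|lborel. K' (t - s) * g s) \<and>
     (LINT s:{a..t}|lborel. K (t - s) * g s) = (LINT s:{a..t}|lborel. K 0 * g s + (LINT r:{a..s}|lborel. K' (s - r) * g r))"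
    if t: "t \<in> {a..b}" for t
  proof -
    have K'm: "continuous_on {0..t - a} K'" using K' t by (auto intro: continuous_on_subset)
    have gt: "set_integrable lborel {a..t} g" using t set_integrable_subinterval[OF g, of a t] by auto
    have gm [measurable]: "(\<lambda>s. indicator {a..t} s * g s) \<in> borel_measurable borel"
      using gt by (auto simp: set_integrable_def)
    obtain C where C: "C \<ge> 0" "\<And>r. 0 \<le> r \<Longrightarrow> r \<le> t - a \<Longrightarrow> \<bar>K' r\<bar> \<le> C"
      using continuous_on_Icc_bounded[OF K'm] by blast
    \<comment> \<open>Extension of K' by 0: Borel measurable on the whole line, and equal to K' at r
      - s for all points of the triangle.\<close>
    define K2 where "K2 r = indicator {0..t-a} r * K' r" for r
    have [measurable]: "K2 \<in> borel_measurable borel"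
      using set_measurable_continuous_on[OF _ K'm] by (simp add: K2_def[abs_def] set_borel_measurable_def)
    have K2_K': "K2 (r - s) = K' (r - s)" if "a \<le> s" "s \<le> r" "r \<le> t" for r s
      using that by (simp add: K2_def)
    have "integrable (lborel \<Otimes>\<^sub>M lborel) (\<lambda>(r, s). (C * indicator {a..t} r) * (indicator {a..t} s * g s))"
    proof (rule integrable_lborel_prod_mult)
      have "integrable lborel (indicator {a..t} :: real \<Rightarrow> real)"
        by (intro integrable_real_indicator) (auto simp: emeasure_lborel_Icc_eq)
      then show "integrable lborel (\<lambda>r. C * indicator {a..t} r)" by simp
    qed (use gt in \<open>auto simp: set_integrable_def\<close>)
    then have int: "integrable (lborel \<Otimes>\<^sub>M lborel) (\<lambda>(r, s). indicator {a..t} r * indicator {a..t} s * (K2 (r - s) * g s))"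
    proof (rule Bochner_Integration.integrable_bound)
      have "(\<lambda>(r, s). indicator {a..t} r * K2 (r - s) * (indicator {a..t} s * g s)) \<in> borel_measurable (lborel \<Otimes>\<^sub>M lborel)"
        by measurable
      then show "(\<lambda>(r, s). indicator {a..t} r * indicator {a..t} s * (K2 (r - s) * g s)) \<in> borel_measurable (lborel \<Otimes>\<^sub>M lborel)"
        by (simp add: ac_simps)
      have "\<bar>K2 r\<bar> \<le> \<bar>C\<bar>" for r using C(2)[of r] C(1) by (auto simp: K2_def indicator_def)
      then show "AE x in lborel \<Otimes>\<^sub>M lborel. norm (case x of (r, s) \<Rightarrow> indicator {a..t} r * indicator {a..t} s * (K2 (r - s) * g s))
           \<le> norm (case x of (r, s) \<Rightarrow> C * indicator {a..t} r * (indicator {a..t} s * g s))"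
        by (intro AE_I2) (auto simp: abs_mult indicator_def mult_right_mono)
    qed
    have cong1: "(LINT s:{a..r}|lborel. K2 (r - s) * g s) = (LINT s:{a..r}|lborel. K' (r - s) * g s)" if "r \<in> {a..t}" for r
      using that by (intro set_lebesgue_integral_cong) (auto simp: K2_K')
    have I: "set_integrable lborel {a..t} (\<lambda>r. LINT s:{a..r}|lborel. K' (r - s) * g s)"
      using Fubini_triangle(2)[OF int] cong1 by (subst (asm) set_integrable_cong[OF refl refl cong1]) auto
    have "(LINT r:{a..t}|lborel. (LINT s:{a..r}|lborel. K' (r - s) * g s)) = (LINT r:{a..t}|lborel. (LINT s:{a..r}|lborel. K2 (r - s) * g s))"
      by (intro set_lebesgue_integral_cong) (auto simp: cong1)
    also have "\<dots> = (LINT s:{a..t}|lborel. (LINT r:{s..t}|lborel. K2 (r - s) * g s))"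
      by (rule Fubini_triangle(1)[OF int])
    also have "\<dots> = (LINT s:{a..t}|lborel. K (t - s) * g s - K 0 * g s)"
    proof (rule set_lebesgue_integral_cong)
      show "\<forall>s. s \<in> {a..t} \<longrightarrow> (LINT r:{s..t}|lborel. K2 (r - s) * g s) = K (t - s) * g s - K 0 * g s"
      proof (intro allI impI)
        fix s assume s: "s \<in> {a..t}"
        have "primitive_on 0 (t - s) K K'" using primitive_on_subinterval[OF K, of 0 "t - s"] s t by auto
        from primitive_on_shift[OF this, of "-s"] have p: "primitive_on s t (\<lambda>r. K (r - s)) (\<lambda>r. K' (r - s))" by simp
        have "(LINT r:{s..t}|lborel. K2 (r - s) * g s) = (LINT r:{s..t}|lborel. K' (r - s)) * g s"
          using s by (subst set_integral_mult_left[symmetric], intro set_lebesgue_integral_cong) (auto simp: K2_K')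
        also have "(LINT r:{s..t}|lborel. K' (r - s)) = K (t - s) - K 0"
          using primitive_on_diff[OF p, of s t] s by auto
        finally show "(LINT r:{s..t}|lborel. K2 (r - s) * g s) = K (t - s) * g s - K 0 * g s"
          by (simp add: left_diff_distrib)
      qed
    qed auto
    also have "\<dots> = (LINT s:{a..t}|lborel. K (t - s) * g s) - (LINT s:{a..t}|lborel. K 0 * g s)"
    proof (rule set_integral_diff(2))
      have cK: "continuous_on {0..t - a} K"
        using primitive_on_continuous[OF K] t by (auto intro: continuous_on_subset)
      obtain D where D: "D \<ge> 0" "\<And>r. 0 \<le> r \<Longrightarrow> r \<le> t - a \<Longrightarrow> \<bar>K r\<bar> \<le> D"
        using continuous_on_Icc_bounded[OF cK] by blast
      have [measurable]: "(\<lambda>r. indicator {0..t-a} r * K r) \<in> borel_measurable borel"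
        using set_measurable_continuous_on[OF _ cK] by (simp add: set_borel_measurable_def)
      show "set_integrable lborel {a..t} (\<lambda>s. K (t - s) * g s)"
      proof (rule set_integrable_bound[where f = "\<lambda>t. D * g t"])
        have "(\<lambda>s. (indicator {0..t-a} (t-s) * K (t-s)) * (indicator {a..t} s * g s)) \<in> borel_measurable borel"
          by measurable
        moreover have "(\<lambda>s. (indicator {0..t-a} (t-s) * K (t-s)) * (indicator {a..t} s * g s))
            = (\<lambda>s. indicator {a..t} s *\<^sub>R (K (t - s) * g s))"
          by (auto simp: indicator_def)
        ultimately show "set_borel_measurable lborel {a..t} (\<lambda>s. K (t - s) * g s)"
          unfolding set_borel_measurable_def by simp
        show "AE x in lborel. x \<in> {a..t} \<longrightarrow> norm (K (t - x) * g x) \<le> norm (D * g x)"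
        proof (intro AE_I2 impI)
          fix x assume "x \<in> {a..t}"
          then have "\<bar>K (t - x)\<bar> \<le> \<bar>D\<bar>" using D(2)[of "t - x"] D(1) by auto
          then show "norm (K (t - x) * g x) \<le> norm (D * g x)" by (simp add: abs_mult mult_right_mono)
        qed
      qed (use gt in auto)
    qed (use gt in auto)
    finally have "(LINT r:{a..t}|lborel. (LINT s:{a..r}|lborel. K' (r - s) * g s)) = (LINT s:{a..t}|lborel. K (t - s) * g s) - (LINT s:{a..t}|lborel. K 0 * g s)" .
    moreover have "(LINT s:{a..t}|lborel. K 0 * g s + (LINT r:{a..s}|lborel. K' (s - r) * g r))
       = (LINT s:{a..t}|lborel. K 0 * g s) + (LINT s:{a..t}|lborel. (LINT r:{a..s}|lborel. K' (s - r) * g r))"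
      using gt I by (intro set_integral_add(2)) auto
    ultimately show ?thesis using I by simp
  qed
  show ?thesis unfolding primitive_on_def
  proof (intro conjI ballI)
    show "set_integrable lborel {a..b} (\<lambda>t. K 0 * g t + (LINT s:{a..t}|lborel. K' (t - s) * g s))"
    proof (cases "a \<le> b")
      case True then show ?thesis using main[of b] g by (intro set_integral_add(1)) auto
    qed (simp add: set_integrable_def)
    show "(LINT s:{a..t}|lborel. K (t - s) * g s) - (LINT s:{a..a}|lborel. K (a - s) * g s) =
         (LINT s:{a..t}|lborel. K 0 * g s + (LINT r:{a..s}|lborel. K' (s - r) * g r))" if "t \<in> {a..b}" for t
      using main[OF that] set_integral_zero_length[of a "\<lambda>s. K (a - s) * g s"] by simp
  qed
qed

subsection \<open>The damped oscillator\<close>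

definition oscillator ::
  "real \<Rightarrow> real \<Rightarrow> real \<Rightarrow> real \<Rightarrow> (real \<Rightarrow> real) \<Rightarrow> (real \<Rightarrow> real) \<Rightarrow> (real \<Rightarrow> real) \<Rightarrow> bool" where
  "oscillator \<mu> \<alpha> a b u v f \<longleftrightarrow>
     primitive_on a b u v \<and> primitive_on a b v (\<lambda>t. (- \<alpha> * u t - v t + f t) / \<mu>)"

text \<open>The Lyapunov function obtained by testing the equation with \<open>u + 3 * \<mu> * v\<close>.\<close>

definition osc_lyap :: "real \<Rightarrow> real \<Rightarrow> real \<Rightarrow> real \<Rightarrow> real" where
  "osc_lyap \<mu> \<alpha> u v = \<mu> * u * v + u\<^sup>2 / 2 + 3 * \<mu> / 2 * (\<mu> * v\<^sup>2 + \<alpha> * u\<^sup>2)"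

text \<open>With a weight w in place of 3, completing the square in u^2/2 + \<mu> u v + w \<mu>^2
  v^2/2 leaves (w - 1) \<mu>^2 v^2/2. Hence w > 1 is needed for positivity, and w = 3 leaves exactly
  \<mu>^2 v^2.\<close>

lemma osc_lyap_lower: "osc_lyap \<mu> \<alpha> u v \<ge> \<mu>\<^sup>2 * v\<^sup>2 + 3 / 2 * \<mu> * \<alpha> * u\<^sup>2"
proof -
  have "osc_lyap \<mu> \<alpha> u v - (\<mu>\<^sup>2 * v\<^sup>2 + 3 / 2 * \<mu> * \<alpha> * u\<^sup>2) = (u + \<mu> * v)\<^sup>2 / 2"
    by (simp add: osc_lyap_def power2_eq_square algebra_simps)
  then show ?thesis by (smt (verit) divide_nonneg_nonneg zero_le_power2)
qed

lemma osc_lyap_upper: "osc_lyap \<mu> \<alpha> u v \<le> u\<^sup>2 + 2 * \<mu>\<^sup>2 * v\<^sup>2 + 3 / 2 * \<mu> * \<alpha> * u\<^sup>2"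
proof -
  have "(u\<^sup>2 + 2 * \<mu>\<^sup>2 * v\<^sup>2 + 3 / 2 * \<mu> * \<alpha> * u\<^sup>2) - osc_lyap \<mu> \<alpha> u v = (u - \<mu> * v)\<^sup>2 / 2"
    by (simp add: osc_lyap_def power2_eq_square algebra_simps)
  then show ?thesis by (smt (verit) divide_nonneg_nonneg zero_le_power2)
qed

lemma osc_lyap_nonneg: "\<mu> > 0 \<Longrightarrow> \<alpha> > 0 \<Longrightarrow> 0 \<le> osc_lyap \<mu> \<alpha> u v"
  by (rule order_trans[OF _ osc_lyap_lower]) auto

text \<open>The left side is the derivative of \<open>osc_lyap\<close> along the equation. Young's
  inequality pays for u f with half of \<alpha> u^2 and for 3 \<mu> v f with half of 2 \<mu> v^2.
  Comparing the surviving \<alpha> u^2/2 with the coefficient of f^2 gives the squared gain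
  1/\<alpha>^2 + 9 \<mu>/(2 \<alpha>), the quantity that reappears in the small gain
  condition.\<close>

lemma osc_lyap_pointwise:
  fixes \<mu> \<alpha> u v f :: real
  assumes "\<mu> > 0" "\<alpha> > 0"
  shows "- \<alpha> * u\<^sup>2 - 2 * \<mu> * v\<^sup>2 + u * f + 3 * \<mu> * v * f
    \<le> - (\<alpha> / 2 * u\<^sup>2 + \<mu> * v\<^sup>2) + (1 / (2 * \<alpha>) + 9 * \<mu> / 4) * f\<^sup>2"
proof -
  have "- (\<alpha> / 2 * u\<^sup>2 + \<mu> * v\<^sup>2) + (1 / (2 * \<alpha>) + 9 * \<mu> / 4) * f\<^sup>2
     - (- \<alpha> * u\<^sup>2 - 2 * \<mu> * v\<^sup>2 + u * f + 3 * \<mu> * v * f)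
     = (\<alpha> * u - f)\<^sup>2 / (2 * \<alpha>) + \<mu> * (v - 3 / 2 * f)\<^sup>2"
    using assms by (simp add: power2_eq_square field_simps)
  moreover have "\<dots> \<ge> 0" using assms by simp
  ultimately show ?thesis by linarith
qed

lemma oscillator_subinterval:
  "oscillator \<mu> \<alpha> a b u v f \<Longrightarrow> a \<le> c \<Longrightarrow> d \<le> b \<Longrightarrow> oscillator \<mu> \<alpha> c d u v f"
  unfolding oscillator_def using primitive_on_subinterval by blast

lemma oscillator_cong:
  assumes "oscillator \<mu> \<omega> a b u v f" "\<And>t. t \<in> {a..b} \<Longrightarrow> u t = u2 t" "\<And>t. t \<in> {a..b} \<Longrightarrow> v t = v2 t" "\<And>t. t \<in> {a..b} \<Longrightarrow> f t = f2 t"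
  shows "oscillator \<mu> \<omega> a b u2 v2 f2"
  unfolding oscillator_def
proof
  show "primitive_on a b u2 v2"
    by (rule primitive_on_cong[OF conjunct1[OF assms(1)[unfolded oscillator_def]]]) (use assms in auto)
  show "primitive_on a b v2 (\<lambda>t. (- \<omega> * u2 t - v2 t + f2 t) / \<mu>)"
    by (rule primitive_on_cong[OF conjunct2[OF assms(1)[unfolded oscillator_def]]]) (use assms in auto)
qed

lemma oscillator_cmult_add:
  assumes "oscillator \<mu> \<omega> a b u1 v1 f1" "oscillator \<mu> \<omega> a b u2 v2 f2"
  shows "oscillator \<mu> \<omega> a b (\<lambda>t. x * u1 t + y * u2 t) (\<lambda>t. x * v1 t + y * v2 t) (\<lambda>t. x * f1 t + y * f2 t)"
proof -
  have "primitive_on a b (\<lambda>t. x * u1 t + y * u2 t) (\<lambda>t. x * v1 t + y * v2 t)"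
    using assms unfolding oscillator_def by (intro primitive_on_add primitive_on_cmult) auto
  moreover have "primitive_on a b (\<lambda>t. x * v1 t + y * v2 t)
     (\<lambda>t. x * ((- \<omega> * u1 t - v1 t + f1 t) / \<mu>) + y * ((- \<omega> * u2 t - v2 t + f2 t) / \<mu>))"
    using assms unfolding oscillator_def by (intro primitive_on_add primitive_on_cmult) auto
  then have "primitive_on a b (\<lambda>t. x * v1 t + y * v2 t)
     (\<lambda>t. (- \<omega> * (x * u1 t + y * u2 t) - (x * v1 t + y * v2 t) + (x * f1 t + y * f2 t)) / \<mu>)"
    by (rule primitive_on_cong) (auto simp: add_divide_distrib diff_divide_distrib algebra_simps)
  ultimately show ?thesis by (simp add: oscillator_def)
qed

text \<open>The equation recovers f from u, v and the integrable derivative of v, so a solution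
  already determines the integrability of its forcing.\<close>

lemma oscillator_forcing_measurable:
  assumes "oscillator \<mu> \<alpha> a b u v f" "\<mu> > 0"
  shows "set_integrable lborel {a..b} f"
proof -
  have "primitive_on a b u v" and p: "primitive_on a b v (\<lambda>t. (- \<alpha> * u t - v t + f t) / \<mu>)"
    using assms by (auto simp: oscillator_def)
  then have "continuous_on {a..b} u" "continuous_on {a..b} v"
    using primitive_on_continuous by blast+
  then have "set_integrable lborel {a..b} (\<lambda>t. \<alpha> * u t + v t)"
    by (intro borel_integrable_atLeastAtMost' continuous_intros)
  moreover have "set_integrable lborel {a..b} (\<lambda>t. \<mu> * ((- \<alpha> * u t - v t + f t) / \<mu>))"
    using primitive_on_integrable[OF p] by (intro set_integrable_mult_right) auto
  ultimately have "set_integrable lborel {a..b} (\<lambda>t. (\<alpha> * u t + v t) + \<mu> * ((- \<alpha> * u t - v t + f t) / \<mu>))"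
    by (rule set_integral_add(1))
  then show ?thesis using assms(2) by simp
qed

lemma oscillator_energy_real:
  assumes osc: "oscillator \<mu> \<alpha> a b u v f" and pos: "\<mu> > 0" "\<alpha> > 0" "a \<le> b"
    and f2: "set_integrable lborel {a..b} (\<lambda>t. (f t)\<^sup>2)"
  shows "osc_lyap \<mu> \<alpha> (u b) (v b) + (LINT t:{a..b}|lborel. \<alpha> / 2 * (u t)\<^sup>2 + \<mu> * (v t)\<^sup>2)
    \<le> osc_lyap \<mu> \<alpha> (u a) (v a) + (1 / (2 * \<alpha>) + 9 * \<mu> / 4) * (LINT t:{a..b}|lborel. (f t)\<^sup>2)"
proof -
  define w where "w = (\<lambda>t. (- \<alpha> * u t - v t + f t) / \<mu>)"
  have pu: "primitive_on a b u v" and pv: "primitive_on a b v w"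
    using osc by (auto simp: oscillator_def w_def)
  have cu: "continuous_on {a..b} u" and cv: "continuous_on {a..b} v"
    using primitive_on_continuous[OF pu] primitive_on_continuous[OF pv] by auto
  note uv = primitive_on_mult[OF pu pv] and uu = primitive_on_mult[OF pu pu] and vv = primitive_on_mult[OF pv pv]
  have "primitive_on a b
     (\<lambda>t. \<mu> * (u t * v t) + ((1/2) * (u t * u t) + (3 * \<mu> / 2 * \<mu> * (v t * v t) + (3 * \<mu> / 2 * \<alpha>) * (u t * u t))))
     (\<lambda>t. \<mu> * (v t * v t + u t * w t) + ((1/2) * (v t * u t + u t * v t)
        + (3 * \<mu> / 2 * \<mu> * (w t * v t + v t * w t) + (3 * \<mu> / 2 * \<alpha>) * (v t * u t + u t * v t))))"
    by (intro primitive_on_add primitive_on_cmult uv uu vv)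
  then have P: "primitive_on a b (\<lambda>t. osc_lyap \<mu> \<alpha> (u t) (v t))
     (\<lambda>t. - \<alpha> * (u t)\<^sup>2 - 2 * \<mu> * (v t)\<^sup>2 + u t * f t + 3 * \<mu> * v t * f t)"
  proof (rule primitive_on_cong)
    fix t
    have w: "\<mu> * w t = - \<alpha> * u t - v t + f t" using pos by (simp add: w_def)
    have "\<mu> * (v t * v t + u t * w t) + (1/2 * (v t * u t + u t * v t)
        + (3 * \<mu> / 2 * \<mu> * (w t * v t + v t * w t) + 3 * \<mu> / 2 * \<alpha> * (v t * u t + u t * v t)))
      = \<mu> * (v t)\<^sup>2 + u t * (\<mu> * w t) + u t * v t + 3 * \<mu> * v t * (\<mu> * w t) + 3 * \<mu> * \<alpha> * (u t * v t)"
      by (simp add: algebra_simps power2_eq_square)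
    also have "\<dots> = - \<alpha> * (u t)\<^sup>2 - 2 * \<mu> * (v t)\<^sup>2 + u t * f t + 3 * \<mu> * v t * f t"
      unfolding w by (simp add: algebra_simps power2_eq_square)
    finally show "\<mu> * (v t * v t + u t * w t) + (1/2 * (v t * u t + u t * v t)
        + (3 * \<mu> / 2 * \<mu> * (w t * v t + v t * w t) + 3 * \<mu> / 2 * \<alpha> * (v t * u t + u t * v t)))
      = - \<alpha> * (u t)\<^sup>2 - 2 * \<mu> * (v t)\<^sup>2 + u t * f t + 3 * \<mu> * v t * f t" .
  qed (simp add: osc_lyap_def power2_eq_square algebra_simps)
  have i1: "set_integrable lborel {a..b} (\<lambda>t. \<alpha> / 2 * (u t)\<^sup>2 + \<mu> * (v t)\<^sup>2)"
    by (intro borel_integrable_atLeastAtMost' continuous_intros cu cv)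
  have i2: "set_integrable lborel {a..b} (\<lambda>t. (1 / (2 * \<alpha>) + 9 * \<mu> / 4) * (f t)\<^sup>2)"
    using f2 by simp
  have "(LINT t:{a..b}|lborel. - \<alpha> * (u t)\<^sup>2 - 2 * \<mu> * (v t)\<^sup>2 + u t * f t + 3 * \<mu> * v t * f t)
     \<le> (LINT t:{a..b}|lborel. (1 / (2 * \<alpha>) + 9 * \<mu> / 4) * (f t)\<^sup>2 - (\<alpha> / 2 * (u t)\<^sup>2 + \<mu> * (v t)\<^sup>2))"
  proof (rule set_integral_mono)
    show "set_integrable lborel {a..b} (\<lambda>t. - \<alpha> * (u t)\<^sup>2 - 2 * \<mu> * (v t)\<^sup>2 + u t * f t + 3 * \<mu> * v t * f t)"
      using primitive_on_integrable[OF P] by simp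
    show "set_integrable lborel {a..b} (\<lambda>t. (1 / (2 * \<alpha>) + 9 * \<mu> / 4) * (f t)\<^sup>2 - (\<alpha> / 2 * (u t)\<^sup>2 + \<mu> * (v t)\<^sup>2))"
      by (rule set_integral_diff(1)[OF i2 i1])
    fix t
    show "- \<alpha> * (u t)\<^sup>2 - 2 * \<mu> * (v t)\<^sup>2 + u t * f t + 3 * \<mu> * v t * f t
       \<le> (1 / (2 * \<alpha>) + 9 * \<mu> / 4) * (f t)\<^sup>2 - (\<alpha> / 2 * (u t)\<^sup>2 + \<mu> * (v t)\<^sup>2)"
      using osc_lyap_pointwise[OF pos(1,2), of "u t" "v t" "f t"] by linarith
  qed
  also have "\<dots> = (1 / (2 * \<alpha>) + 9 * \<mu> / 4) * (LINT t:{a..b}|lborel. (f t)\<^sup>2)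
     - (LINT t:{a..b}|lborel. \<alpha> / 2 * (u t)\<^sup>2 + \<mu> * (v t)\<^sup>2)"
    using set_integral_diff(2)[OF i2 i1] by simp
  finally show ?thesis using primitive_on_diff[OF P, of a b] pos by simp
qed

lemma set_integrable_if_nn_finite:
  fixes f :: "real \<Rightarrow> real"
  assumes "set_borel_measurable lborel A f" "(\<integral>\<^sup>+t\<in>A. ennreal (f t) \<partial>lborel) < \<infinity>" "\<And>t. f t \<ge> 0"
  shows "set_integrable lborel A f"
  unfolding set_integrable_def
proof (rule integrableI_nonneg)
  have "(\<integral>\<^sup>+ x. ennreal (indicator A x *\<^sub>R f x) \<partial>lborel) = (\<integral>\<^sup>+t\<in>A. ennreal (f t) \<partial>lborel)"
    by (intro nn_integral_cong) (auto simp: indicator_def)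
  then show "(\<integral>\<^sup>+ x. ennreal (indicator A x *\<^sub>R f x) \<partial>lborel) < \<infinity>" using assms(2) by simp
qed (use assms in \<open>auto simp: set_borel_measurable_def\<close>)

lemma nn_set_integral_eq_LINT:
  fixes f :: "real \<Rightarrow> real"
  assumes "set_integrable lborel A f" "\<And>t. f t \<ge> 0"
  shows "(\<integral>\<^sup>+t\<in>A. ennreal (f t) \<partial>lborel) = ennreal (LINT t:A|lborel. f t)"
proof -
  have "(\<integral>\<^sup>+t\<in>A. ennreal (f t) \<partial>lborel) = (\<integral>\<^sup>+ x. ennreal (indicator A x *\<^sub>R f x) \<partial>lborel)"
    by (intro nn_integral_cong) (auto simp: indicator_def)
  also have "\<dots> = ennreal (LINT t:A|lborel. f t)"
    unfolding set_lebesgue_integral_def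
    by (rule nn_integral_eq_integral) (use assms in \<open>auto simp: set_integrable_def\<close>)
  finally show ?thesis .
qed

text \<open>The values are in \<open>ennreal\<close> so that the modes can later be summed without
  summability conditions. If the forcing is not square integrable, the right side is infinite
  because the coefficient of its integral is positive.\<close>

lemma oscillator_energy:
  assumes osc: "oscillator \<mu> \<alpha> a b u v f" and pos: "\<mu> > 0" "\<alpha> > 0" "a \<le> b"
  shows "ennreal (osc_lyap \<mu> \<alpha> (u b) (v b)) + (\<integral>\<^sup>+t\<in>{a..b}. ennreal (\<alpha> / 2 * (u t)\<^sup>2 + \<mu> * (v t)\<^sup>2) \<partial>lborel)
    \<le> ennreal (osc_lyap \<mu> \<alpha> (u a) (v a)) + ennreal (1 / (2 * \<alpha>) + 9 * \<mu> / 4) * (\<integral>\<^sup>+t\<in>{a..b}. ennreal ((f t)\<^sup>2) \<partial>lborel)"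
proof (cases "(\<integral>\<^sup>+t\<in>{a..b}. ennreal ((f t)\<^sup>2) \<partial>lborel) < \<infinity>")
  case True
  have "set_borel_measurable lborel {a..b} f"
    using oscillator_forcing_measurable[OF osc pos(1)] by (simp add: set_borel_measurable_def set_integrable_def)
  then have "(\<lambda>x. (indicator {a..b} x *\<^sub>R f x)\<^sup>2) \<in> borel_measurable lborel"
    unfolding set_borel_measurable_def by (rule borel_measurable_power)
  moreover have "(\<lambda>x. (indicator {a..b} x *\<^sub>R f x)\<^sup>2) = (\<lambda>x. indicator {a..b} x *\<^sub>R (f x)\<^sup>2)"
    by (auto simp: indicator_def)
  ultimately have "set_borel_measurable lborel {a..b} (\<lambda>t. (f t)\<^sup>2)"
    unfolding set_borel_measurable_def by metis
  then have f2: "set_integrable lborel {a..b} (\<lambda>t. (f t)\<^sup>2)"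
    by (rule set_integrable_if_nn_finite) (use True in auto)
  have cu: "continuous_on {a..b} u" and cv: "continuous_on {a..b} v"
    using osc primitive_on_continuous by (auto simp: oscillator_def)
  have i1: "set_integrable lborel {a..b} (\<lambda>t. \<alpha> / 2 * (u t)\<^sup>2 + \<mu> * (v t)\<^sup>2)"
    by (intro borel_integrable_atLeastAtMost' continuous_intros cu cv)
  have n1: "(\<integral>\<^sup>+t\<in>{a..b}. ennreal (\<alpha> / 2 * (u t)\<^sup>2 + \<mu> * (v t)\<^sup>2) \<partial>lborel)
      = ennreal (LINT t:{a..b}|lborel. \<alpha> / 2 * (u t)\<^sup>2 + \<mu> * (v t)\<^sup>2)"
    using pos by (intro nn_set_integral_eq_LINT[OF i1]) auto
  have n2: "(\<integral>\<^sup>+t\<in>{a..b}. ennreal ((f t)\<^sup>2) \<partial>lborel) = ennreal (LINT t:{a..b}|lborel. (f t)\<^sup>2)"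
    by (intro nn_set_integral_eq_LINT[OF f2]) auto
  have p1: "0 \<le> (LINT t:{a..b}|lborel. \<alpha> / 2 * (u t)\<^sup>2 + \<mu> * (v t)\<^sup>2)"
    using pos by (auto simp: set_lebesgue_integral_def intro!: integral_nonneg_AE)
  have p2: "0 \<le> (LINT t:{a..b}|lborel. (f t)\<^sup>2)"
    by (auto simp: set_lebesgue_integral_def intro!: integral_nonneg_AE)
  have p3: "0 \<le> 1 / (2 * \<alpha>) + 9 * \<mu> / 4" using pos by simp
  have "ennreal (osc_lyap \<mu> \<alpha> (u b) (v b) + (LINT t:{a..b}|lborel. \<alpha> / 2 * (u t)\<^sup>2 + \<mu> * (v t)\<^sup>2))
     \<le> ennreal (osc_lyap \<mu> \<alpha> (u a) (v a) + (1 / (2 * \<alpha>) + 9 * \<mu> / 4) * (LINT t:{a..b}|lborel. (f t)\<^sup>2))"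
    by (rule ennreal_leI[OF oscillator_energy_real[OF osc pos f2]])
  then show ?thesis
    unfolding n1 n2
    by (simp only: ennreal_plus[OF osc_lyap_nonneg[OF pos(1,2)] p1] ennreal_mult[OF p3 p2]
        ennreal_plus[OF osc_lyap_nonneg[OF pos(1,2)] mult_nonneg_nonneg[OF p3 p2]])
next
  case False
  have "0 < 1 / (2 * \<alpha>) + 9 * \<mu> / 4" using pos by (intro add_pos_pos) auto
  moreover have "(\<integral>\<^sup>+t\<in>{a..b}. ennreal ((f t)\<^sup>2) \<partial>lborel) = \<infinity>" using False by (metis infinity_ennreal_def less_top)
  ultimately show ?thesis by (simp only:) (simp add: ennreal_mult_top)
qed

text \<open>The difference of two solutions has zero forcing and zero initial data, so its Lyapunov
  function starts at 0, cannot grow, and is positive definite.\<close>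

lemma oscillator_unique:
  assumes 1: "oscillator \<mu> \<alpha> a b u1 v1 f" and 2: "oscillator \<mu> \<alpha> a b u2 v2 f"
    and pos: "\<mu> > 0" "\<alpha> > 0" and init: "u1 a = u2 a" "v1 a = v2 a" and t: "a \<le> t" "t \<le> b"
  shows "u1 t = u2 t" "v1 t = v2 t"
proof -
  let ?u = "\<lambda>t. u1 t - u2 t" and ?v = "\<lambda>t. v1 t - v2 t"
  have "primitive_on a b ?u ?v"
    using 1 2 by (auto simp: oscillator_def intro: primitive_on_diff_fun)
  moreover have "primitive_on a b ?v (\<lambda>t. (- \<alpha> * ?u t - ?v t + 0) / \<mu>)"
  proof (rule primitive_on_cong)
    show "primitive_on a b ?v (\<lambda>t. (- \<alpha> * u1 t - v1 t + f t) / \<mu> - (- \<alpha> * u2 t - v2 t + f t) / \<mu>)"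
      using 1 2 by (auto simp: oscillator_def intro: primitive_on_diff_fun)
    fix t
    show "(- \<alpha> * u1 t - v1 t + f t) / \<mu> - (- \<alpha> * u2 t - v2 t + f t) / \<mu> = (- \<alpha> * ?u t - ?v t + 0) / \<mu>"
      by (subst diff_divide_distrib[symmetric]) (simp add: algebra_simps)
  qed simp
  ultimately have "oscillator \<mu> \<alpha> a b ?u ?v (\<lambda>_. 0)"
    by (auto simp: oscillator_def)
  then have "oscillator \<mu> \<alpha> a t ?u ?v (\<lambda>_. 0)"
    using t by (auto intro: oscillator_subinterval)
  then have "ennreal (osc_lyap \<mu> \<alpha> (?u t) (?v t)) \<le> ennreal (osc_lyap \<mu> \<alpha> (?u a) (?v a))"
  proof -
    have "ennreal (osc_lyap \<mu> \<alpha> (?u t) (?v t)) + I \<le> R + c * (\<integral>\<^sup>+s\<in>{a..t}. ennreal (0\<^sup>2) \<partial>lborel)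
      \<Longrightarrow> ennreal (osc_lyap \<mu> \<alpha> (?u t) (?v t)) \<le> R" for I R c
      by (simp add: order_trans[OF add_increasing2[OF zero_le order_refl]])
    then show ?thesis using oscillator_energy[OF \<open>oscillator \<mu> \<alpha> a t ?u ?v (\<lambda>_. 0)\<close> pos t(1)] by blast
  qed
  then have "osc_lyap \<mu> \<alpha> (?u t) (?v t) \<le> 0"
  proof -
    have "osc_lyap \<mu> \<alpha> (?u a) (?v a) = 0" using init by (simp add: osc_lyap_def)
    then show ?thesis using \<open>ennreal _ \<le> ennreal _\<close> by (simp add: ennreal_eq_0_iff)
  qed
  with osc_lyap_lower[of \<mu> "?v t" \<alpha> "?u t"] have "\<mu>\<^sup>2 * (?v t)\<^sup>2 + 3 / 2 * \<mu> * \<alpha> * (?u t)\<^sup>2 \<le> 0" by linarith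
  moreover have "0 \<le> \<mu>\<^sup>2 * (?v t)\<^sup>2" "0 \<le> 3 / 2 * \<mu> * \<alpha> * (?u t)\<^sup>2" using pos by auto
  ultimately have "\<mu>\<^sup>2 * (?v t)\<^sup>2 = 0" "3 / 2 * \<mu> * \<alpha> * (?u t)\<^sup>2 = 0" by linarith+
  then show "u1 t = u2 t" "v1 t = v2 t" using pos by auto
qed

subsection \<open>Weak limits of square integrable functions\<close>

text \<open>Riesz-Fischer for functions with values in a Hilbert space. Along a fast subsequence
  consecutive squared distances are at most (1/4)^j; the weight 2^j keeps their sum finite, and D <=
  (1/2)^j + 2^j D^2 turns this into almost everywhere summability of the increments. Fatou's lemma
  then upgrades pointwise convergence of the subsequence to convergence of the full sequence in the
  square norm.\<close>

lemma L2_complete: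
  fixes g :: "nat \<Rightarrow> 'a \<Rightarrow> 'h::{real_inner,banach,second_countable_topology}"
  assumes [measurable]: "\<And>n. g n \<in> borel_measurable M"
    and Cauchy: "\<And>\<epsilon>. \<epsilon> > 0 \<Longrightarrow> \<exists>N. \<forall>m\<ge>N. \<forall>n\<ge>N. (\<integral>\<^sup>+x. ennreal ((norm (g m x - g n x))\<^sup>2) \<partial>M) \<le> ennreal \<epsilon>"
  obtains g0 r where "g0 \<in> borel_measurable M" "strict_mono (r :: nat \<Rightarrow> nat)" "AE x in M. (\<lambda>j. g (r j) x) \<longlonglongrightarrow> g0 x"
    "\<And>\<epsilon>. \<epsilon> > 0 \<Longrightarrow> \<exists>N. \<forall>n\<ge>N. (\<integral>\<^sup>+x. ennreal ((norm (g n x - g0 x))\<^sup>2) \<partial>M) \<le> ennreal \<epsilon>"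
proof -
  have "\<exists>r::nat\<Rightarrow>nat. strict_mono r \<and> (\<forall>j. \<forall>m\<ge>r j. \<forall>n\<ge>r j. (\<integral>\<^sup>+x. ennreal ((norm (g m x - g n x))\<^sup>2) \<partial>M) \<le> ennreal ((1/4)^j))"
  proof -
    have "\<forall>j. \<exists>N. \<forall>m\<ge>N. \<forall>n\<ge>N. (\<integral>\<^sup>+x. ennreal ((norm (g m x - g n x))\<^sup>2) \<partial>M) \<le> ennreal ((1/4)^j)"
      using Cauchy by simp
    then obtain N where N: "\<And>j m n. m \<ge> N j \<Longrightarrow> n \<ge> N j \<Longrightarrow> (\<integral>\<^sup>+x. ennreal ((norm (g m x - g n x))\<^sup>2) \<partial>M) \<le> ennreal ((1/4)^j)"
      by metis
    define r where "r j = (\<Sum>i\<le>j. N i) + j" for j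
    have "strict_mono r" by (rule strict_mono_Suc_iff[THEN iffD2]) (auto simp: r_def)
    moreover have "N j \<le> r j" for j
      unfolding r_def by (simp add: member_le_sum trans_le_add1)
    ultimately show ?thesis using N by (intro exI[of _ r]) (meson order_trans)
  qed
  then obtain r :: "nat \<Rightarrow> nat" where r: "strict_mono r"
    and rj: "\<And>j m n. m \<ge> r j \<Longrightarrow> n \<ge> r j \<Longrightarrow> (\<integral>\<^sup>+x. ennreal ((norm (g m x - g n x))\<^sup>2) \<partial>M) \<le> ennreal ((1/4)^j)"
    by blast
  define D where "D j x = norm (g (r (Suc j)) x - g (r j) x)" for j x
  have "(\<integral>\<^sup>+x. (\<Sum>j. ennreal (2^j * (D j x)\<^sup>2)) \<partial>M) = (\<Sum>j. \<integral>\<^sup>+x. ennreal (2^j * (D j x)\<^sup>2) \<partial>M)"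
    by (intro nn_integral_suminf) (auto simp: D_def)
  also have "\<dots> \<le> (\<Sum>j. ennreal ((1/2)^j))"
  proof (intro suminf_le allI summableI)
    fix j
    have "(\<integral>\<^sup>+x. ennreal (2^j * (D j x)\<^sup>2) \<partial>M) = ennreal (2^j) * (\<integral>\<^sup>+x. ennreal ((D j x)\<^sup>2) \<partial>M)"
      by (subst nn_integral_cmult[symmetric]) (auto simp: D_def ennreal_mult)
    also have "\<dots> \<le> ennreal (2^j) * ennreal ((1/4)^j)"
      using rj[of j "r (Suc j)" "r j"] r by (intro mult_left_mono) (auto simp: D_def strict_mono_less_eq)
    also have "\<dots> = ennreal ((1/2)^j)"
      by (simp flip: ennreal_mult add: power_mult_distrib[symmetric])
    finally show "(\<integral>\<^sup>+x. ennreal (2^j * (D j x)\<^sup>2) \<partial>M) \<le> ennreal ((1/2)^j)" .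
  qed
  also have "\<dots> < \<infinity>"
  proof -
    have "(\<lambda>j. (1/2::real)^j) sums (1 / (1 - 1/2))" by (rule geometric_sums) simp
    then have "(\<Sum>j. ennreal ((1/2)^j)) = ennreal 2" by (simp add: suminf_ennreal_eq sums_unique[symmetric])
    then show ?thesis by simp
  qed
  finally have "AE x in M. (\<Sum>j. ennreal (2^j * (D j x)\<^sup>2)) \<noteq> \<infinity>"
    by (intro nn_integral_PInf_AE) (auto simp: D_def)
  then have conv: "AE x in M. convergent (\<lambda>j. g (r j) x)"
  proof eventually_elim
    case (elim x)
    then have "summable (\<lambda>j. 2^j * (D j x)\<^sup>2)"
      by (intro summable_suminf_not_top) auto
    then have s: "summable (\<lambda>j. (1/2)^j + 2^j * (D j x)\<^sup>2)" by (intro summable_add) auto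
    have "D j x \<le> (1/2)^j + 2^j * (D j x)\<^sup>2" for j
    proof -
      have "0 \<le> ((1/2)^j - D j x)\<^sup>2 * 2^j" by simp
      also have "\<dots> = (1/2)^j - 2 * D j x + 2^j * (D j x)\<^sup>2"
        by (simp add: power2_eq_square algebra_simps flip: power_mult_distrib)
      finally have "2 * D j x \<le> (1/2)^j + 2^j * (D j x)\<^sup>2" by simp
      moreover have "D j x \<ge> 0" by (simp add: D_def)
      ultimately show ?thesis by linarith
    qed
    then have "summable (\<lambda>j. D j x)"
      by (intro summable_comparison_test'[OF s, of 0]) (simp add: D_def)
    then have "summable (\<lambda>j. g (r (Suc j)) x - g (r j) x)"
      unfolding D_def by (rule summable_norm_cancel)
    then have "(\<lambda>n. \<Sum>j<n. g (r (Suc j)) x - g (r j) x) \<longlonglongrightarrow> (\<Sum>j. g (r (Suc j)) x - g (r j) x)"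
      by (rule summable_LIMSEQ)
    then have "(\<lambda>n. (g (r n) x - g (r 0) x) + g (r 0) x) \<longlonglongrightarrow> (\<Sum>j. g (r (Suc j)) x - g (r j) x) + g (r 0) x"
      unfolding sum_lessThan_telescope[of "\<lambda>j. g (r j) x"] by (intro tendsto_intros)
    then show ?case by (simp add: convergentI)
  qed
  define g0 where "g0 x = lim (\<lambda>j. g (r j) x)" for x
  have [measurable]: "g0 \<in> borel_measurable M" unfolding g0_def by measurable
  have lim: "AE x in M. (\<lambda>j. g (r j) x) \<longlonglongrightarrow> g0 x"
    using conv by eventually_elim (simp add: g0_def convergent_LIMSEQ_iff)
  show ?thesis
  proof (rule that[OF _ r lim])
    fix \<epsilon> :: real assume "\<epsilon> > 0"
    then obtain N where N: "\<And>m n. m \<ge> N \<Longrightarrow> n \<ge> N \<Longrightarrow> (\<integral>\<^sup>+x. ennreal ((norm (g m x - g n x))\<^sup>2) \<partial>M) \<le> ennreal \<epsilon>"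
      using Cauchy by blast
    have "(\<integral>\<^sup>+x. ennreal ((norm (g n x - g0 x))\<^sup>2) \<partial>M) \<le> ennreal \<epsilon>" if n: "n \<ge> N" for n
    proof -
      have "(\<integral>\<^sup>+x. ennreal ((norm (g n x - g0 x))\<^sup>2) \<partial>M) = (\<integral>\<^sup>+x. liminf (\<lambda>j. ennreal ((norm (g n x - g (r j) x))\<^sup>2)) \<partial>M)"
      proof (rule nn_integral_cong_AE)
        show "AE x in M. ennreal ((norm (g n x - g0 x))\<^sup>2) = liminf (\<lambda>j. ennreal ((norm (g n x - g (r j) x))\<^sup>2))"
          using lim
        proof eventually_elim
          case (elim x)
          then have "(\<lambda>j. ennreal ((norm (g n x - g (r j) x))\<^sup>2)) \<longlonglongrightarrow> ennreal ((norm (g n x - g0 x))\<^sup>2)"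
            by (intro tendsto_intros)
          then show ?case by (metis lim_imp_Liminf sequentially_bot)
        qed
      qed
      also have "\<dots> \<le> liminf (\<lambda>j. \<integral>\<^sup>+x. ennreal ((norm (g n x - g (r j) x))\<^sup>2) \<partial>M)"
        by (rule nn_integral_liminf) measurable
      also have "\<dots> \<le> liminf (\<lambda>j. ennreal \<epsilon>)"
      proof (rule Liminf_mono)
        have "r j \<ge> N" if "j \<ge> N" for j using seq_suble[OF r, of j] that by simp
        then show "\<forall>\<^sub>F j in sequentially. (\<integral>\<^sup>+x. ennreal ((norm (g n x - g (r j) x))\<^sup>2) \<partial>M) \<le> ennreal \<epsilon>"
          using N n by (intro eventually_sequentiallyI[of N]) auto
      qed
      finally show ?thesis by (simp add: Liminf_const)
    qed
    then show "\<exists>N. \<forall>n\<ge>N. (\<integral>\<^sup>+x. ennreal ((norm (g n x - g0 x))\<^sup>2) \<partial>M) \<le> ennreal \<epsilon>" by blast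
  qed simp
qed

lemma L2_inner_integrable:
  fixes f g :: "'a \<Rightarrow> 'h::{real_inner,banach,second_countable_topology}"
  assumes [measurable]: "f \<in> borel_measurable M" "g \<in> borel_measurable M"
    and f: "(\<integral>\<^sup>+x. ennreal ((norm (f x))\<^sup>2) \<partial>M) < \<infinity>" and g: "(\<integral>\<^sup>+x. ennreal ((norm (g x))\<^sup>2) \<partial>M) < \<infinity>"
  shows "integrable M (\<lambda>x. f x \<bullet> g x)"
proof -
  have "integrable M (\<lambda>x. (norm (f x))\<^sup>2)" "integrable M (\<lambda>x. (norm (g x))\<^sup>2)"
    using f g by (auto intro!: integrableI_nonneg)
  then have "integrable M (\<lambda>x. (norm (f x))\<^sup>2 + (norm (g x))\<^sup>2)" by simp
  then show ?thesis
  proof (rule Bochner_Integration.integrable_bound)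
    have "\<bar>f x \<bullet> g x\<bar> \<le> (norm (f x))\<^sup>2 + (norm (g x))\<^sup>2" for x
    proof -
      have "\<bar>f x \<bullet> g x\<bar> \<le> norm (f x) * norm (g x)" by (rule Cauchy_Schwarz_ineq2)
      also have "\<dots> \<le> (norm (f x))\<^sup>2 + (norm (g x))\<^sup>2"
      proof -
        have "2 * (norm (f x) * norm (g x)) \<le> (norm (f x))\<^sup>2 + (norm (g x))\<^sup>2"
          using sum_squares_bound[of "norm (f x)" "norm (g x)"] by (simp add: mult.assoc)
        moreover have "0 \<le> norm (f x) * norm (g x)" by simp
        ultimately show ?thesis by linarith
      qed
      finally show ?thesis .
    qed
    then show "AE x in M. norm (f x \<bullet> g x) \<le> norm ((norm (f x))\<^sup>2 + (norm (g x))\<^sup>2)"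
      by (intro AE_I2) auto
  qed simp
qed

text \<open>A form with a free parameter that avoids square roots: Young's inequality with weight s,
  where the factor 1/2 is dropped. Taking s large suits the case where A is the small
  quantity.\<close>

lemma L2_Cauchy_Schwarz:
  fixes f g :: "'a \<Rightarrow> 'h::{real_inner,banach,second_countable_topology}"
  assumes [measurable]: "f \<in> borel_measurable M" "g \<in> borel_measurable M"
    and f: "(\<integral>\<^sup>+x. ennreal ((norm (f x))\<^sup>2) \<partial>M) \<le> ennreal A" and g: "(\<integral>\<^sup>+x. ennreal ((norm (g x))\<^sup>2) \<partial>M) \<le> ennreal B"
    and "A \<ge> 0" "B \<ge> 0" "s > 0"
  shows "\<bar>\<integral>x. f x \<bullet> g x \<partial>M\<bar> \<le> s * A + B / s"
proof -
  have fi: "integrable M (\<lambda>x. (norm (f x))\<^sup>2)" and gi: "integrable M (\<lambda>x. (norm (g x))\<^sup>2)"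
    using f g by (auto intro!: integrableI_nonneg simp: order_le_less_trans)
  have "ennreal (\<integral>x. (norm (f x))\<^sup>2 \<partial>M) \<le> ennreal A" "ennreal (\<integral>x. (norm (g x))\<^sup>2 \<partial>M) \<le> ennreal B"
    using f g by (auto simp flip: nn_integral_eq_integral[OF fi] nn_integral_eq_integral[OF gi])
  then have AB: "(\<integral>x. (norm (f x))\<^sup>2 \<partial>M) \<le> A" "(\<integral>x. (norm (g x))\<^sup>2 \<partial>M) \<le> B"
    using assms by (simp_all add: ennreal_le_iff)
  have "\<bar>\<integral>x. f x \<bullet> g x \<partial>M\<bar> \<le> (\<integral>x. s * (norm (f x))\<^sup>2 + (norm (g x))\<^sup>2 / s \<partial>M)"
  proof (rule order_trans[OF integral_abs_bound integral_mono])
    show "integrable M (\<lambda>x. \<bar>f x \<bullet> g x\<bar>)"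
      using f g by (intro integrable_abs L2_inner_integrable) (auto simp: order_le_less_trans)
    show "integrable M (\<lambda>x. s * (norm (f x))\<^sup>2 + (norm (g x))\<^sup>2 / s)" using fi gi by simp
    fix x
    have "\<bar>f x \<bullet> g x\<bar> \<le> norm (f x) * norm (g x)" by (rule Cauchy_Schwarz_ineq2)
    also have "\<dots> \<le> s * (norm (f x))\<^sup>2 + (norm (g x))\<^sup>2 / s"
    proof -
      have "0 \<le> (s * norm (f x) - norm (g x))\<^sup>2 / s" using \<open>s > 0\<close> by simp
      also have "\<dots> = s * (norm (f x))\<^sup>2 + (norm (g x))\<^sup>2 / s - 2 * (norm (f x) * norm (g x))"
        using \<open>s > 0\<close> by (simp add: power2_eq_square field_simps)
      finally have "2 * (norm (f x) * norm (g x)) \<le> s * (norm (f x))\<^sup>2 + (norm (g x))\<^sup>2 / s" by simp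
      moreover have "0 \<le> norm (f x) * norm (g x)" by simp
      ultimately show ?thesis by linarith
    qed
    finally show "\<bar>f x \<bullet> g x\<bar> \<le> s * (norm (f x))\<^sup>2 + (norm (g x))\<^sup>2 / s" .
  qed
  also have "\<dots> = s * (\<integral>x. (norm (f x))\<^sup>2 \<partial>M) + (\<integral>x. (norm (g x))\<^sup>2 \<partial>M) / s"
    using fi gi by simp
  also have "\<dots> \<le> s * A + B / s"
    using AB \<open>s > 0\<close> by (intro add_mono mult_left_mono divide_right_mono) auto
  finally show ?thesis .
qed

text \<open>Midpoints replace general convex combinations: the parallelogram law uses nothing else,
  and properties of the elements follow by a two-case induction.\<close>

inductive_set midpoint_hull :: "('a \<Rightarrow> 'h::real_vector) set \<Rightarrow> ('a \<Rightarrow> 'h) set" for F where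
  base: "f \<in> F \<Longrightarrow> f \<in> midpoint_hull F"
| midpoint: "f \<in> midpoint_hull F \<Longrightarrow> g \<in> midpoint_hull F \<Longrightarrow> (\<lambda>x. (1/2) *\<^sub>R (f x + g x)) \<in> midpoint_hull F"

lemma midpoint_hull_mono: "F \<subseteq> G \<Longrightarrow> midpoint_hull F \<subseteq> midpoint_hull G"
proof
  fix f assume "F \<subseteq> G" "f \<in> midpoint_hull F"
  from this(2,1) show "f \<in> midpoint_hull G"
    by induction (auto intro: midpoint_hull.intros)
qed

lemma L2_parallelogram:
  fixes f g :: "'a \<Rightarrow> 'h::{real_inner,banach,second_countable_topology}"
  assumes [measurable]: "f \<in> borel_measurable M" "g \<in> borel_measurable M"
  shows "4 * (\<integral>\<^sup>+x. ennreal ((norm ((1/2) *\<^sub>R (f x + g x)))\<^sup>2) \<partial>M) + (\<integral>\<^sup>+x. ennreal ((norm (f x - g x))\<^sup>2) \<partial>M)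
    = 2 * (\<integral>\<^sup>+x. ennreal ((norm (f x))\<^sup>2) \<partial>M) + 2 * (\<integral>\<^sup>+x. ennreal ((norm (g x))\<^sup>2) \<partial>M)"
proof -
  have "4 * ennreal ((norm ((1/2) *\<^sub>R (f x + g x)))\<^sup>2) + ennreal ((norm (f x - g x))\<^sup>2)
     = 2 * ennreal ((norm (f x))\<^sup>2) + 2 * ennreal ((norm (g x))\<^sup>2)" for x
  proof -
    have "4 * (norm ((1/2) *\<^sub>R (f x + g x)))\<^sup>2 + (norm (f x - g x))\<^sup>2 = 2 * (norm (f x))\<^sup>2 + 2 * (norm (g x))\<^sup>2"
      by (simp add: power2_norm_eq_inner inner_add_left inner_add_right inner_diff_left inner_diff_right inner_commute power_divide)
        (simp add: field_simps)
    then have "ennreal (4 * (norm ((1/2) *\<^sub>R (f x + g x)))\<^sup>2 + (norm (f x - g x))\<^sup>2) = ennreal (2 * (norm (f x))\<^sup>2 + 2 * (norm (g x))\<^sup>2)"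
      by (rule arg_cong)
    then show ?thesis by (simp only: ennreal_plus ennreal_mult zero_le_power2 mult_nonneg_nonneg zero_le_numeral ennreal_numeral)
  qed
  then show ?thesis by (simp flip: nn_integral_cmult nn_integral_add)
qed

text \<open>The weak limit is found as the strong limit of elements of almost minimal norm in the
  midpoint hulls of the tails, which avoids weak compactness of balls.\<close>

lemma L2_weak_limit:
  fixes \<psi> :: "nat \<Rightarrow> 'a \<Rightarrow> 'h::{real_inner,banach,second_countable_topology}"
  assumes meas[measurable]: "\<And>n. \<psi> n \<in> borel_measurable M"
    and bnd: "\<And>n. (\<integral>\<^sup>+x. ennreal ((norm (\<psi> n x))\<^sup>2) \<partial>M) \<le> ennreal (l + 1 / real (Suc n))" and l: "l \<ge> 0"
  obtains \<psi>0 where "\<psi>0 \<in> borel_measurable M" "(\<integral>\<^sup>+x. ennreal ((norm (\<psi>0 x))\<^sup>2) \<partial>M) \<le> ennreal l"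
    "\<And>\<phi> J. \<phi> \<in> borel_measurable M \<Longrightarrow> (\<integral>\<^sup>+x. ennreal ((norm (\<phi> x))\<^sup>2) \<partial>M) < \<infinity> \<Longrightarrow>
       (\<lambda>n. \<integral>x. \<psi> n x \<bullet> \<phi> x \<partial>M) \<longlonglongrightarrow> J \<Longrightarrow> (\<integral>x. \<psi>0 x \<bullet> \<phi> x \<partial>M) = J"
proof -
  define N2 where "N2 f = (\<integral>\<^sup>+x. ennreal ((norm (f x :: 'h))\<^sup>2) \<partial>M)" for f
  define C where "C m = midpoint_hull (\<psi> ` {m..})" for m
  have Cmeas: "f \<in> borel_measurable M" if "f \<in> C m" for f m
    using that unfolding C_def by induction auto
  have par: "4 * N2 (\<lambda>x. (1/2) *\<^sub>R (f x + g x)) + N2 (\<lambda>x. f x - g x) = 2 * N2 f + 2 * N2 g"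
    if "f \<in> C m" "g \<in> C n" for f g m n
    unfolding N2_def by (rule L2_parallelogram[OF Cmeas[OF that(1)] Cmeas[OF that(2)]])
  have Cmono: "C n \<subseteq> C m" if "m \<le> n" for m n
    unfolding C_def using that by (intro midpoint_hull_mono image_mono) auto
  have Cfin: "N2 f < \<infinity>" if "f \<in> C m" for f m
    using that unfolding C_def
  proof induction
    case (base f)
    then obtain n where "f = \<psi> n" by auto
    then show ?case using bnd[of n] by (simp add: N2_def order_le_less_trans)
  next
    case (midpoint f g)
    then have "2 * N2 f + 2 * N2 g < \<infinity>" by (simp add: ennreal_mult_less_top)
    moreover have "f \<in> C m" "g \<in> C m" using midpoint by (auto simp: C_def)
    ultimately have "4 * N2 (\<lambda>x. (1/2) *\<^sub>R (f x + g x)) + N2 (\<lambda>x. f x - g x) < \<infinity>"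
      using par by metis
    then show ?case by (auto simp: ennreal_mult_less_top)
  qed
  \<comment> \<open>The hulls of the tails shrink as m grows, so this minimal squared norm is
    nondecreasing; it is bounded by l. Its convergence is what makes almost minimal elements a
    Cauchy sequence.\<close>
  define d where "d m = (INF f\<in>C m. N2 f)" for m
  have d_le: "d m \<le> N2 f" if "f \<in> C m" for f m
    using that unfolding d_def by (rule INF_lower)
  have d_l: "d m \<le> ennreal l" for m
  proof -
    have "d m \<le> ennreal (l + 1 / real (Suc n))" if "n \<ge> m" for n
    proof -
      have "d m \<le> N2 (\<psi> n)" by (rule d_le) (use that in \<open>auto simp: C_def intro: midpoint_hull.base\<close>)
      also have "\<dots> \<le> ennreal (l + 1 / real (Suc n))" unfolding N2_def by (rule bnd)
      finally show ?thesis .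
    qed
    moreover have "(\<lambda>n. ennreal (l + 1 / real (Suc n))) \<longlonglongrightarrow> ennreal (l + 0)"
      by (intro tendsto_intros LIMSEQ_inverse_real_of_nat[unfolded inverse_eq_divide])
    ultimately show ?thesis using LIMSEQ_le_const[of _ "ennreal (l + 0)" "d m"] by auto
  qed
  have d_mono: "d m \<le> d n" if "m \<le> n" for m n
    unfolding d_def using Cmono[OF that] by (rule INF_superset_mono) simp
  define \<delta> where "\<delta> m = enn2real (d m)" for m
  have d_eq: "d m = ennreal (\<delta> m)" for m
    unfolding \<delta>_def using d_l[of m] by (simp add: ennreal_enn2real order_le_less_trans)
  have \<delta>0: "\<delta> m \<ge> 0" for m by (simp add: \<delta>_def)
  have \<delta>_mono: "\<delta> m \<le> \<delta> n" if "m \<le> n" for m n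
    using d_mono[OF that] \<delta>0 by (simp add: d_eq ennreal_le_iff)
  have \<delta>_l: "\<delta> m \<le> l" for m using d_l[of m] \<delta>0 l by (simp add: d_eq ennreal_le_iff)
  have "\<exists>g. g \<in> C m \<and> N2 g < ennreal (\<delta> m + 1 / real (Suc m))" for m
  proof -
    have "d m < ennreal (\<delta> m + 1 / real (Suc m))" using \<delta>0[of m] by (simp add: d_eq ennreal_less_iff)
    then show ?thesis unfolding d_def by (auto simp: INF_less_iff)
  qed
  then obtain g where gC: "\<And>m. g m \<in> C m" and gd: "\<And>m. N2 (g m) < ennreal (\<delta> m + 1 / real (Suc m))"
    by metis
  have [measurable]: "g m \<in> borel_measurable M" for m using Cmeas[OF gC] .
  \<comment> \<open>The midpoint of \<open>g m\<close> and \<open>g n\<close> lies in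
    \<open>C m\<close>, so its squared norm is at least \<open>d m\<close>. The parallelogram law
    then leaves little room for the difference.\<close>
  have gg: "N2 (\<lambda>x. g m x - g n x) \<le> ennreal (2 * (\<delta> n - \<delta> m) + 4 / real (Suc m))" if "m \<le> n" for m n
  proof -
    have gn: "g n \<in> C m" using gC Cmono[OF that] by blast
    have "(\<lambda>x. (1/2) *\<^sub>R (g m x + g n x)) \<in> C m"
      using gC[of m] gn unfolding C_def by (rule midpoint_hull.midpoint)
    then have "4 * d m + N2 (\<lambda>x. g m x - g n x) \<le> 4 * N2 (\<lambda>x. (1/2) *\<^sub>R (g m x + g n x)) + N2 (\<lambda>x. g m x - g n x)"
      by (intro add_right_mono mult_left_mono d_le) auto
    also have "\<dots> = 2 * N2 (g m) + 2 * N2 (g n)" by (rule par[OF gC[of m] gn])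
    also have "\<dots> \<le> 2 * ennreal (\<delta> m + 1 / real (Suc m)) + 2 * ennreal (\<delta> n + 1 / real (Suc n))"
      using gd[of m] gd[of n] by (intro add_mono mult_left_mono) (auto simp: less_imp_le)
    also have "\<dots> \<le> ennreal (2 * (\<delta> m + 1 / real (Suc m)) + 2 * (\<delta> n + 1 / real (Suc m)))"
    proof -
      have "1 / real (Suc n) \<le> 1 / real (Suc m)" using that by (intro divide_left_mono) auto
      then have "2 * ennreal (\<delta> n + 1 / real (Suc n)) \<le> 2 * ennreal (\<delta> n + 1 / real (Suc m))"
        by (intro mult_left_mono ennreal_leI) auto
      moreover have "ennreal (2 * (\<delta> m + 1 / real (Suc m)) + 2 * (\<delta> n + 1 / real (Suc m)))
         = 2 * ennreal (\<delta> m + 1 / real (Suc m)) + 2 * ennreal (\<delta> n + 1 / real (Suc m))"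
      proof -
        have "0 \<le> \<delta> m + 1 / real (Suc m)" "0 \<le> \<delta> n + 1 / real (Suc m)" using \<delta>0[of m] \<delta>0[of n] by auto
        then show ?thesis by (simp only: ennreal_plus ennreal_mult mult_nonneg_nonneg zero_le_numeral ennreal_numeral)
      qed
      ultimately show ?thesis by (simp only: add_left_mono)
    qed
    finally have le: "4 * d m + N2 (\<lambda>x. g m x - g n x) \<le> ennreal (2 * (\<delta> m + 1 / real (Suc m)) + 2 * (\<delta> n + 1 / real (Suc m)))" .
    then have "N2 (\<lambda>x. g m x - g n x) \<le> ennreal (2 * (\<delta> m + 1 / real (Suc m)) + 2 * (\<delta> n + 1 / real (Suc m)))"
      by (rule order_trans[OF add_increasing[OF zero_le order_refl]])
    then have "N2 (\<lambda>x. g m x - g n x) < \<infinity>" by (rule order_le_less_trans) simp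
    then obtain X where X: "N2 (\<lambda>x. g m x - g n x) = ennreal X" "X \<ge> 0"
      by (cases "N2 (\<lambda>x. g m x - g n x)") auto
    have "ennreal (4 * \<delta> m + X) \<le> ennreal (2 * (\<delta> m + 1 / real (Suc m)) + 2 * (\<delta> n + 1 / real (Suc m)))"
      using le X \<delta>0[of m] by (simp add: d_eq ennreal_plus ennreal_mult del: of_nat_Suc)
    then have "4 * \<delta> m + X \<le> 2 * (\<delta> m + 1 / real (Suc m)) + 2 * (\<delta> n + 1 / real (Suc m))"
      using \<delta>0[of m] \<delta>0[of n] by (subst (asm) ennreal_le_iff) (auto simp del: of_nat_Suc)
    then show ?thesis using X by (intro order_trans[OF eq_refl[OF X(1)]] ennreal_leI) (simp add: algebra_simps)
  qed
  have cau: "\<exists>N. \<forall>m\<ge>N. \<forall>n\<ge>N. (\<integral>\<^sup>+x. ennreal ((norm (g m x - g n x))\<^sup>2) \<partial>M) \<le> ennreal \<epsilon>" if "\<epsilon> > 0" for \<epsilon>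
  proof -
    have "incseq \<delta>" using \<delta>_mono by (simp add: incseq_def)
    then obtain L where L: "\<delta> \<longlonglongrightarrow> L" "\<And>i. \<delta> i \<le> L" using incseq_convergent[of \<delta> l] \<delta>_l by blast
    obtain N1 where N1: "\<And>m. m \<ge> N1 \<Longrightarrow> L - \<delta> m < \<epsilon> / 4"
    proof -
      obtain no where no: "\<forall>n\<ge>no. norm (\<delta> n - L) < \<epsilon> / 4"
        using LIMSEQ_D[OF L(1), of "\<epsilon> / 4"] \<open>\<epsilon> > 0\<close> by auto
      have "L - \<delta> m < \<epsilon> / 4" if "m \<ge> no" for m
      proof -
        have "\<bar>\<delta> m - L\<bar> < \<epsilon> / 4" using no that by auto
        then show ?thesis by linarith
      qed
      then show ?thesis using that by blast
    qed
    obtain N2' where N2': "4 / real (Suc N2') < \<epsilon> / 2"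
    proof -
      obtain k where "inverse (real (Suc k)) < \<epsilon> / 8" using reals_Archimedean[of "\<epsilon> / 8"] \<open>\<epsilon> > 0\<close> by auto
      then show ?thesis by (intro that[of k]) (auto simp: inverse_eq_divide)
    qed
    have main: "N2 (\<lambda>x. g m x - g n x) \<le> ennreal \<epsilon>" if "m \<ge> max N1 N2'" "m \<le> n" for m n
    proof (rule order_trans[OF gg[OF that(2)] ennreal_leI])
      have "4 / real (Suc m) \<le> 4 / real (Suc N2')" using that by (intro divide_left_mono) auto
      then show "2 * (\<delta> n - \<delta> m) + 4 / real (Suc m) \<le> \<epsilon>"
        using N1[of m] N2' L(2)[of n] that by auto
    qed
    have "N2 (\<lambda>x. g m x - g n x) \<le> ennreal \<epsilon>" if "m \<ge> max N1 N2'" "n \<ge> max N1 N2'" for m n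
    proof (cases "m \<le> n")
      case False
      then have "N2 (\<lambda>x. g n x - g m x) \<le> ennreal \<epsilon>" using main that by auto
      then show ?thesis by (simp add: N2_def norm_minus_commute)
    qed (use main that in auto)
    then show ?thesis unfolding N2_def by blast
  qed
  obtain \<psi>0 r where [measurable]: "\<psi>0 \<in> borel_measurable M" and r: "strict_mono r"
    and AEc: "AE x in M. (\<lambda>j. g (r j) x) \<longlonglongrightarrow> \<psi>0 x"
    and lim: "\<And>\<epsilon>. \<epsilon> > 0 \<Longrightarrow> \<exists>N. \<forall>n\<ge>N. (\<integral>\<^sup>+x. ennreal ((norm (g n x - \<psi>0 x))\<^sup>2) \<partial>M) \<le> ennreal \<epsilon>"
    by (rule L2_complete[of g M, OF _ cau]) auto
  have \<psi>0_l: "(\<integral>\<^sup>+x. ennreal ((norm (\<psi>0 x))\<^sup>2) \<partial>M) \<le> ennreal l"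
  proof -
    have "(\<integral>\<^sup>+x. ennreal ((norm (\<psi>0 x))\<^sup>2) \<partial>M) = (\<integral>\<^sup>+x. liminf (\<lambda>j. ennreal ((norm (g (r j) x))\<^sup>2)) \<partial>M)"
    proof (rule nn_integral_cong_AE)
      show "AE x in M. ennreal ((norm (\<psi>0 x))\<^sup>2) = liminf (\<lambda>j. ennreal ((norm (g (r j) x))\<^sup>2))"
        using AEc
      proof eventually_elim
        case (elim x)
        then have "(\<lambda>j. ennreal ((norm (g (r j) x))\<^sup>2)) \<longlonglongrightarrow> ennreal ((norm (\<psi>0 x))\<^sup>2)"
          by (intro tendsto_intros)
        then show ?case by (metis lim_imp_Liminf sequentially_bot)
      qed
    qed
    also have "\<dots> \<le> liminf (\<lambda>j. \<integral>\<^sup>+x. ennreal ((norm (g (r j) x))\<^sup>2) \<partial>M)"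
      by (rule nn_integral_liminf) measurable
    also have "\<dots> \<le> liminf (\<lambda>j. ennreal (l + 1 / real (Suc (r j))))"
    proof (rule Liminf_mono, intro always_eventually allI)
      fix j
      show "(\<integral>\<^sup>+x. ennreal ((norm (g (r j) x))\<^sup>2) \<partial>M) \<le> ennreal (l + 1 / real (Suc (r j)))"
        using less_imp_le[OF gd[of "r j"]] \<delta>_l[of "r j"] unfolding N2_def
        by (elim order_trans) (intro ennreal_leI, simp)
    qed
    also have "\<dots> = ennreal (l + 0)"
    proof (rule lim_imp_Liminf)
      have "(\<lambda>n. ennreal (l + 1 / real (Suc n))) \<longlonglongrightarrow> ennreal (l + 0)"
        by (intro tendsto_intros LIMSEQ_inverse_real_of_nat[unfolded inverse_eq_divide])
      from LIMSEQ_subseq_LIMSEQ[OF this r]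
      show "(\<lambda>j. ennreal (l + 1 / real (Suc (r j)))) \<longlonglongrightarrow> ennreal (l + 0)" by (simp add: o_def)
    qed simp
    finally show ?thesis by simp
  qed
  show ?thesis
  proof (rule that[OF _ \<psi>0_l])
    fix \<phi> :: "'a \<Rightarrow> 'h" and J
    assume \<phi>m[measurable]: "\<phi> \<in> borel_measurable M" and \<phi>2: "(\<integral>\<^sup>+x. ennreal ((norm (\<phi> x))\<^sup>2) \<partial>M) < \<infinity>"
      and J: "(\<lambda>n. \<integral>x. \<psi> n x \<bullet> \<phi> x \<partial>M) \<longlonglongrightarrow> J"
    obtain B where B: "(\<integral>\<^sup>+x. ennreal ((norm (\<phi> x))\<^sup>2) \<partial>M) \<le> ennreal B" "B \<ge> 0"
      using \<phi>2 by (cases "\<integral>\<^sup>+x. ennreal ((norm (\<phi> x))\<^sup>2) \<partial>M") auto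
    have int: "integrable M (\<lambda>x. f x \<bullet> \<phi> x)" if "f \<in> C m" for f m
      using Cfin[OF that] Cmeas[OF that] \<phi>2 by (intro L2_inner_integrable) (auto simp: N2_def)
    \<comment> \<open>Being within \<epsilon> of J is preserved by midpoints. Thus
      \<open>g n\<close> inherits the limit of the pairings from the tail although it need not be a
      term of the sequence.\<close>
    have close: "\<bar>(\<integral>x. f x \<bullet> \<phi> x \<partial>M) - J\<bar> \<le> \<epsilon>"
      if "f \<in> C m" "\<And>n. n \<ge> m \<Longrightarrow> \<bar>(\<integral>x. \<psi> n x \<bullet> \<phi> x \<partial>M) - J\<bar> \<le> \<epsilon>" for f m \<epsilon>
      using that(1) unfolding C_def
    proof induction
      case (base f) then show ?case using that(2) by auto
    next
      case (midpoint f h)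
      then have fh: "f \<in> C m" "h \<in> C m" by (auto simp: C_def)
      have "(\<integral>x. ((1/2) *\<^sub>R (f x + h x)) \<bullet> \<phi> x \<partial>M) = (1/2) * ((\<integral>x. f x \<bullet> \<phi> x \<partial>M) + (\<integral>x. h x \<bullet> \<phi> x \<partial>M))"
        using int[OF fh(1)] int[OF fh(2)] by (simp add: inner_add_left)
      then show ?case using midpoint.IH by (simp add: abs_if field_simps split: if_splits)
    qed
    have "\<bar>(\<integral>x. \<psi>0 x \<bullet> \<phi> x \<partial>M) - J\<bar> \<le> \<epsilon>" if "\<epsilon> > 0" for \<epsilon>
    proof -
      obtain m1 where m1: "\<And>n. n \<ge> m1 \<Longrightarrow> \<bar>(\<integral>x. \<psi> n x \<bullet> \<phi> x \<partial>M) - J\<bar> \<le> \<epsilon> / 2"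
      proof -
        obtain no where "\<forall>n\<ge>no. norm ((\<integral>x. \<psi> n x \<bullet> \<phi> x \<partial>M) - J) < \<epsilon> / 2"
          using LIMSEQ_D[OF J, of "\<epsilon> / 2"] \<open>\<epsilon> > 0\<close> by auto
        then show ?thesis using that[of no] by (auto intro: less_imp_le)
      qed
      \<comment> \<open>Both terms of the weighted Cauchy-Schwarz bound become at most \<epsilon>/4.
        The summand 1 keeps s positive when B = 0.\<close>
      define s where "s = 4 * (B + 1) / \<epsilon>"
      have s: "s > 0" using B that by (simp add: s_def)
      obtain m2 where m2: "\<And>n. n \<ge> m2 \<Longrightarrow> (\<integral>\<^sup>+x. ennreal ((norm (g n x - \<psi>0 x))\<^sup>2) \<partial>M) \<le> ennreal (\<epsilon> / (4 * s))"
        using lim[of "\<epsilon> / (4 * s)"] \<open>\<epsilon> > 0\<close> s by auto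
      define n where "n = max m1 m2"
      have "\<bar>\<integral>x. (g n x - \<psi>0 x) \<bullet> \<phi> x \<partial>M\<bar> \<le> s * (\<epsilon> / (4 * s)) + B / s"
        using m2[of n] B s that by (intro L2_Cauchy_Schwarz) (auto simp: n_def)
      also have "\<dots> \<le> \<epsilon> / 2"
      proof -
        have "B / s \<le> \<epsilon> / 4" using B that by (simp add: s_def field_simps)
        moreover have "s * (\<epsilon> / (4 * s)) = \<epsilon> / 4" using s by simp
        ultimately show ?thesis by linarith
      qed
      finally have 1: "\<bar>\<integral>x. (g n x - \<psi>0 x) \<bullet> \<phi> x \<partial>M\<bar> \<le> \<epsilon> / 2" .
      have "integrable M (\<lambda>x. \<psi>0 x \<bullet> \<phi> x)"
        using \<psi>0_l \<phi>2 by (intro L2_inner_integrable) (auto simp: order_le_less_trans)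
      then have "(\<integral>x. (g n x - \<psi>0 x) \<bullet> \<phi> x \<partial>M) = (\<integral>x. g n x \<bullet> \<phi> x \<partial>M) - (\<integral>x. \<psi>0 x \<bullet> \<phi> x \<partial>M)"
        using int[OF gC[of n]] by (simp add: inner_diff_left)
      moreover have "\<bar>(\<integral>x. g n x \<bullet> \<phi> x \<partial>M) - J\<bar> \<le> \<epsilon> / 2"
        by (rule close[OF gC[of n]], rule m1) (simp add: n_def)
      ultimately show ?thesis using 1 by linarith
    qed
    then show "(\<integral>x. \<psi>0 x \<bullet> \<phi> x \<partial>M) = J"
      by (metis abs_le_zero_iff eq_iff_diff_eq_0 field_le_epsilon add.left_neutral)
  qed simp
qed

subsection \<open>Strongly continuous semigroups\<close>

text \<open>Banach-Steinhaus. By Baire one of the closed sets \<open>F N\<close> contains a ball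
  around some x0; writing T y = T (x0 + y) - T x0 for y on the sphere of radius r gives the bound 2
  N / r. The sequence form suffices because it is applied along times tending to 0.\<close>

lemma uniform_boundedness:
  fixes T :: "nat \<Rightarrow> 'a::banach \<Rightarrow> 'b::real_normed_vector"
  assumes T: "\<And>n. bounded_linear (T n)" and pw: "\<And>x. \<exists>C. \<forall>n. norm (T n x) \<le> C"
  shows "\<exists>M. \<forall>n x. norm (T n x) \<le> M * norm x"
proof -
  define F where "F N = {x. \<forall>n. norm (T n x) \<le> real N}" for N :: nat
  have cont: "continuous_on UNIV (T n)" for n
    using T[of n] by (simp add: linear_continuous_on)
  have closed: "closed (F N)" for N
  proof -
    have "F N = (\<Inter>n. {x. norm (T n x) \<le> real N})" by (auto simp: F_def)
    moreover have "closed {x. norm (T n x) \<le> real N}" for n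
      by (intro closed_Collect_le continuous_intros cont)
    ultimately show ?thesis by auto
  qed
  have "(\<Union>N. F N) = UNIV"
  proof -
    have "\<exists>N. x \<in> F N" for x
    proof -
      obtain C where "\<forall>n. norm (T n x) \<le> C" using pw by blast
      moreover obtain N :: nat where "C \<le> real N" using real_arch_simple by blast
      ultimately show ?thesis by (auto simp: F_def intro: order_trans)
    qed
    then show ?thesis by auto
  qed
  moreover have "interior (\<Union>(range F)) = {}" if "\<And>N. interior (F N) = {}"
    using Baire_category_alt[of "euclidean :: 'a topology" "range F"] that closed
    by (auto simp: completely_metrizable_space_euclidean)
  ultimately obtain N x0 where "x0 \<in> interior (F N)" by fastforce
  then obtain r where r: "r > 0" "cball x0 r \<subseteq> F N"
    by (meson interior_subset mem_interior_cball)
  have FN: "norm (T n z) \<le> real N" if "z \<in> cball x0 r" for n z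
    using r(2) that unfolding F_def by blast
  have "norm (T n x) \<le> (2 * real N / r) * norm x" for n x
  proof (cases "x = 0")
    case True then show ?thesis using linear_0[OF bounded_linear.linear[OF T]] by simp
  next
    case False
    interpret bounded_linear "T n" by (rule T)
    define y where "y = (r / norm x) *\<^sub>R x"
    have "x0 + y \<in> cball x0 r" "x0 \<in> cball x0 r" using r False by (auto simp: y_def dist_norm)
    then have "norm (T n (x0 + y)) \<le> N" "norm (T n x0) \<le> N" using FN by blast+
    moreover have "T n y = T n (x0 + y) - T n x0" by (simp add: add)
    ultimately have "norm (T n y) \<le> 2 * real N" using norm_triangle_ineq4[of "T n (x0 + y)" "T n x0"] by simp
    moreover have "norm (T n y) = (r / norm x) * norm (T n x)" using r False by (simp add: y_def scaleR)
    ultimately show ?thesis using r False by (simp add: field_simps)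
  qed
  then show ?thesis by blast
qed

section \<open>Local bounds, joint continuity and differentiability of orbits\<close>

context
  fixes S :: "real \<Rightarrow> 'a::banach \<Rightarrow> 'a"
  assumes C0: "C0_semigroup S"
begin

lemma C0_linear: "t \<ge> 0 \<Longrightarrow> bounded_linear (S t)"
  using C0 by (simp add: C0_semigroup_def)

lemma C0_zero: "S 0 x = x"
  using C0 by (simp add: C0_semigroup_def)

lemma C0_add: "s \<ge> 0 \<Longrightarrow> t \<ge> 0 \<Longrightarrow> S (s + t) x = S s (S t x)"
  using C0 by (simp add: C0_semigroup_def)

lemma C0_right: "((\<lambda>t. S t x) \<longlongrightarrow> x) (at_right 0)"
  using C0 by (simp add: C0_semigroup_def)

text \<open>If no bound held near 0, there would be times \<open>t n\<close> tending to 0 along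
  which the operators exceed every bound. But every orbit converges along these times, so it is
  bounded on them, which contradicts uniform boundedness.\<close>

lemma C0_bounded_near_zero: "\<exists>h>0. \<exists>M\<ge>1. \<forall>t\<in>{0..h}. \<forall>x. norm (S t x) \<le> M * norm x"
proof (rule ccontr)
  assume neg: "\<not> ?thesis"
  have "\<exists>t x. 0 \<le> t \<and> t \<le> 1 / real (Suc n) \<and> norm (S t x) > real (Suc n) * norm x" for n
  proof (rule ccontr)
    assume "\<not> ?thesis"
    then have "\<forall>t\<in>{0..1 / real (Suc n)}. \<forall>x. norm (S t x) \<le> real (Suc n) * norm x" by (meson atLeastAtMost_iff not_le)
    moreover have "1 / real (Suc n) > 0" "real (Suc n) \<ge> 1" by auto
    ultimately show False using neg by blast
  qed
  then obtain t x where t: "\<And>n. 0 \<le> t n" "\<And>n. t n \<le> 1 / real (Suc n)"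
    and x: "\<And>n. norm (S (t n) (x n)) > real (Suc n) * norm (x n)"
    by metis
  have "\<exists>C. \<forall>n. norm (S (t n) y) \<le> C" for y
  proof -
    have t0: "t \<longlonglongrightarrow> 0"
      by (rule real_tendsto_sandwich[OF _ _ tendsto_const LIMSEQ_inverse_real_of_nat[unfolded inverse_eq_divide]])
        (use t in auto)
    have "((\<lambda>t. S t y) \<longlongrightarrow> S 0 y) (at 0 within {0..})"
      using C0_right[of y] by (simp add: C0_zero at_within_Ici_at_right)
    then have "(\<lambda>n. S (t n) y) \<longlonglongrightarrow> S 0 y"
      using t0 t(1) continuous_within_sequentially[of 0 "{0..}" "\<lambda>t. S t y"]
      by (auto simp: continuous_within o_def)
    then have "Bseq (\<lambda>n. S (t n) y)" by (intro convergent_imp_Bseq convergentI)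
    then show ?thesis by (auto simp: Bseq_def)
  qed
  then obtain M where M: "\<And>n x. norm (S (t n) x) \<le> M * norm x"
    using uniform_boundedness[of "\<lambda>n. S (t n)"] C0_linear t(1) by blast
  obtain n :: nat where n: "M \<le> real n" using real_arch_simple by blast
  have "real (Suc n) * norm (x n) < M * norm (x n)" using x[of n] M[of n "x n"] by linarith
  moreover have "M * norm (x n) \<le> real (Suc n) * norm (x n)" using n by (intro mult_right_mono) auto
  ultimately show False by simp
qed

lemma C0_bounded: "\<exists>M\<ge>0. \<forall>t\<in>{0..T}. \<forall>x. norm (S t x) \<le> M * norm x"
proof -
  obtain h M where h: "h > 0" "M \<ge> 1" and M: "\<And>t x. 0 \<le> t \<Longrightarrow> t \<le> h \<Longrightarrow> norm (S t x) \<le> M * norm x"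
    using C0_bounded_near_zero by (metis atLeastAtMost_iff)
  have ind: "norm (S t x) \<le> M ^ Suc n * norm x" if "0 \<le> t" "t \<le> real (Suc n) * h" for n t x
    using that
  proof (induction n arbitrary: t)
    case 0 then show ?case using M by simp
  next
    case (Suc n)
    show ?case
    proof (cases "t \<le> h")
      case True
      have "norm (S t x) \<le> M * norm x" using M Suc True by simp
      also have "\<dots> \<le> M ^ Suc (Suc n) * norm x"
        using h by (intro mult_right_mono self_le_power) auto
      finally show ?thesis .
    next
      case False
      have "S t x = S h (S (t - h) x)" using C0_add[of h "t - h" x] h False by simp
      then have "norm (S t x) \<le> M * norm (S (t - h) x)" using M[of h] h by simp
      also have "\<dots> \<le> M * (M ^ Suc n * norm x)"
        using h Suc.prems False by (intro mult_left_mono Suc.IH) (auto simp: algebra_simps)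
      finally show ?thesis by simp
    qed
  qed
  obtain n :: nat where "T / h \<le> real n" using real_arch_simple by blast
  then have "T \<le> real (Suc n) * h" using h by (simp add: field_simps)
  then show ?thesis using ind[of _ n] h by (intro exI[of _ "M ^ Suc n"]) auto
qed

text \<open>For s < t, S s x - S t x = S s (x - S (t - s) x), so continuity from the left as well as
  from the right reduces to right continuity at 0 and the local bound; the bound also makes the
  continuity uniform in x. Joint continuity is needed because in the mild equation both the time and
  the vector move with the integration variable.\<close>

lemma C0_joint_continuous: "continuous_on ({0..} \<times> UNIV) (\<lambda>(t, x). S t x)"
proof -
  have orbit: "\<exists>d>0. \<forall>s\<ge>0. \<bar>s - t\<bar> < d \<longrightarrow> norm (S s x - S t x) < \<epsilon>" if t: "t \<ge> 0" and e: "\<epsilon> > 0" for t x \<epsilon>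
  proof -
    obtain M where M: "M \<ge> 0" "\<And>s y. 0 \<le> s \<Longrightarrow> s \<le> t + 1 \<Longrightarrow> norm (S s y) \<le> M * norm y"
      using C0_bounded[of "t + 1"] by auto
    have "\<forall>\<^sub>F r in at_right 0. dist (S r x) x < \<epsilon> / (M + 1)"
      using C0_right[of x] e M(1) by (intro tendstoD) auto
    then obtain d where d: "d > 0" "\<And>r. 0 < r \<Longrightarrow> r < d \<Longrightarrow> dist (S r x) x < \<epsilon> / (M + 1)"
      by (auto simp: eventually_at_right_field)
    have "norm (S s x - S t x) < \<epsilon>" if s: "s \<ge> 0" "\<bar>s - t\<bar> < min d 1" for s
    proof (cases "s = t")
      case False
      define m where "m = min s t" 
      define r where "r = \<bar>s - t\<bar>"
      have mr: "0 \<le> m" "m \<le> t + 1" "0 < r" "r < d" using s t False by (auto simp: m_def r_def)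
      interpret bounded_linear "S m" using C0_linear mr by simp
      have "norm (S s x - S t x) = norm (S m (S r x) - S m x)"
        using C0_add[of m r x] mr by (cases "s \<le> t") (auto simp: m_def r_def norm_minus_commute min_def)
      also have "\<dots> = norm (S m (S r x - x))" by (simp add: diff)
      also have "\<dots> \<le> M * norm (S r x - x)" using M mr by simp
      also have "\<dots> \<le> M * (\<epsilon> / (M + 1))"
        using d(2)[OF mr(3,4)] M(1) by (intro mult_left_mono) (auto simp: dist_norm)
      also have "\<dots> < \<epsilon>" using M(1) e by (simp add: field_simps)
      finally show ?thesis .
    qed (use e in simp)
    then show ?thesis using d(1) by (intro exI[of _ "min d 1"]) auto
  qed
  show ?thesis
    unfolding continuous_on_iff
  proof (intro ballI allI impI)
    fix tx :: "real \<times> 'a" and \<epsilon> :: real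
    assume "tx \<in> {0..} \<times> UNIV" and e: "0 < \<epsilon>"
    then obtain t x where tx: "tx = (t, x)" and t: "t \<in> {0..}" by auto
    obtain M where M: "M \<ge> 0" "\<And>s y. 0 \<le> s \<Longrightarrow> s \<le> t + 1 \<Longrightarrow> norm (S s y) \<le> M * norm y"
      using C0_bounded[of "t + 1"] by auto
    obtain d where d: "d > 0" "\<And>s. s \<ge> 0 \<Longrightarrow> \<bar>s - t\<bar> < d \<Longrightarrow> norm (S s x - S t x) < \<epsilon> / 2"
      using orbit[of t "\<epsilon> / 2" x] t e by auto
    define d' where "d' = min (min d 1) (\<epsilon> / (2 * (M + 1)))"
    have "d' > 0" using d e M(1) by (simp add: d'_def)
    moreover have "dist (S s y) (S t x) < \<epsilon>" if s: "s \<in> {0..}" and dd: "dist (s, y) (t, x) < d'" for s y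
    proof -
      have 1: "\<bar>s - t\<bar> < d'" "norm (y - x) < d'"
        using dd dist_fst_le[of "(s, y)" "(t, x)"] dist_snd_le[of "(s, y)" "(t, x)"] by (auto simp: dist_norm)
      interpret bounded_linear "S s" using C0_linear s by simp
      have "norm (S s y - S s x) = norm (S s (y - x))" by (simp add: diff)
      also have "\<dots> \<le> M * norm (y - x)" using M 1 s by (auto simp: d'_def)
      also have "\<dots> \<le> M * (\<epsilon> / (2 * (M + 1)))" using 1 M(1) by (intro mult_left_mono) (auto simp: d'_def)
      also have "\<dots> \<le> \<epsilon> / 2" using M(1) e by (simp add: field_simps)
      finally have "norm (S s y - S s x) \<le> \<epsilon> / 2" .
      moreover have "norm (S s x - S t x) < \<epsilon> / 2" using d(2)[of s] s 1 by (auto simp: d'_def)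
      ultimately show ?thesis
        using dist_triangle[of "S s y" "S t x" "S s x"] by (simp add: dist_norm)
    qed
    ultimately show "\<exists>d>0. \<forall>x'\<in>{0..} \<times> UNIV. dist x' tx < d \<longrightarrow>
        dist (case x' of (t, x) \<Rightarrow> S t x) (case tx of (t, x) \<Rightarrow> S t x) < \<epsilon>"
      unfolding tx by (intro exI[of _ d']) auto
  qed
qed

lemma C0_tendsto:
  assumes "(f \<longlongrightarrow> t) F" "(g \<longlongrightarrow> x) F" "\<forall>\<^sub>F y in F. f y \<ge> 0" "t \<ge> 0"
  shows "((\<lambda>y. S (f y) (g y)) \<longlongrightarrow> S t x) F"
  using continuous_on_tendsto_compose[OF C0_joint_continuous tendsto_Pair[OF assms(1,2)]] assms(3,4) by simp

lemma C0_continuous_on: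
  assumes "continuous_on A f" "continuous_on A g" "\<And>y. y \<in> A \<Longrightarrow> f y \<ge> 0"
  shows "continuous_on A (\<lambda>y. S (f y) (g y))"
  using continuous_on_compose2[OF C0_joint_continuous continuous_on_Pair[OF assms(1,2)]] assms(3) by auto

context
  fixes Dom G
  assumes gen: "has_generator S Dom G"
begin

text \<open>On either side of t the difference quotient equals S (min s t) applied to the right
  difference quotient of p at step |s - t|. Joint continuity absorbs the moving time min s t, so
  left and right derivatives are obtained together.\<close>

lemma C0_generator_derivative:
  assumes p: "p \<in> Dom" and t: "t \<ge> 0"
  shows "((\<lambda>t. S t p) has_vector_derivative S t (G p)) (at t within {0..})"
proof -
  have lim: "((\<lambda>r. (S r p - p) /\<^sub>R r) \<longlongrightarrow> G p) (at_right 0)"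
    using gen p by (auto simp: has_generator_def)
  have "((\<lambda>s. (S s p - S t p) /\<^sub>R (s - t)) \<longlongrightarrow> S t (G p)) (at t within {0..})"
  proof (rule Lim_transform_eventually)
    have f: "LIM s (at t within {0..}). \<bar>s - t\<bar> :> at_right 0"
      unfolding filterlim_at
    proof
      have "((\<lambda>s. \<bar>s - t\<bar>) \<longlongrightarrow> \<bar>t - t\<bar>) (at t within {0..})" by (intro tendsto_intros)
      then show "((\<lambda>s. \<bar>s - t\<bar>) \<longlongrightarrow> 0) (at t within {0..})" by simp
      show "\<forall>\<^sub>F x in at t within {0..}. \<bar>x - t\<bar> \<in> {0<..} \<and> \<bar>x - t\<bar> \<noteq> 0"
        by (auto simp: eventually_at intro: exI[of _ 1])
    qed
    have "((\<lambda>s. min s t) \<longlongrightarrow> min t t) (at t within {0..})" by (intro tendsto_intros)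
    then show "((\<lambda>s. S (min s t) ((S \<bar>s - t\<bar> p - p) /\<^sub>R \<bar>s - t\<bar>)) \<longlongrightarrow> S t (G p)) (at t within {0..})"
      using t by (intro C0_tendsto filterlim_compose[OF lim f]) (auto simp: eventually_at intro: exI[of _ 1])
    have "S (min s t) ((S \<bar>s - t\<bar> p - p) /\<^sub>R \<bar>s - t\<bar>) = (S s p - S t p) /\<^sub>R (s - t)"
      if "s \<ge> 0" for s
    proof -
      interpret bounded_linear "S (min s t)" using C0_linear that t by simp
      have "S (min s t) ((S \<bar>s - t\<bar> p - p) /\<^sub>R \<bar>s - t\<bar>) = (S (min s t) (S \<bar>s - t\<bar> p) - S (min s t) p) /\<^sub>R \<bar>s - t\<bar>"
        by (simp add: scaleR diff)
      also have "S (min s t) (S \<bar>s - t\<bar> p) = S (min s t + \<bar>s - t\<bar>) p"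
        using that t by (subst C0_add) auto
      also have "min s t + \<bar>s - t\<bar> = max s t" by auto
      also have "(S (max s t) p - S (min s t) p) /\<^sub>R \<bar>s - t\<bar> = (S s p - S t p) /\<^sub>R (s - t)"
      proof (cases "s \<le> t")
        case True
        then have "(S (max s t) p - S (min s t) p) /\<^sub>R \<bar>s - t\<bar> = inverse (t - s) *\<^sub>R (S t p - S s p)" by (simp add: max_def min_def)
        also have "\<dots> = inverse (s - t) *\<^sub>R (S s p - S t p)"
        proof -
          have "inverse (t - s) = - inverse (s - t)" by (metis inverse_minus_eq minus_diff_eq)
          moreover have "S t p - S s p = - (S s p - S t p)" by simp
          ultimately show ?thesis by (simp only: scaleR_minus_left scaleR_minus_right minus_minus)
        qed
        finally show ?thesis .
      qed (simp add: max_def min_def)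
      finally show ?thesis .
    qed
    then show "\<forall>\<^sub>F s in at t within {0..}. S (min s t) ((S \<bar>s - t\<bar> p - p) /\<^sub>R \<bar>s - t\<bar>) = (S s p - S t p) /\<^sub>R (s - t)"
      by (auto simp: eventually_at intro: exI[of _ 1])
  qed
  then have "((\<lambda>s. norm ((S s p - S t p) /\<^sub>R (s - t) - S t (G p))) \<longlongrightarrow> 0) (at t within {0..})"
    by (simp add: tendsto_norm_zero LIM_zero)
  moreover have "\<forall>\<^sub>F s in at t within {0..}. norm ((1 / norm (s - t)) *\<^sub>R (S s p - (S t p + (s - t) *\<^sub>R S t (G p))))
      \<le> norm ((S s p - S t p) /\<^sub>R (s - t) - S t (G p))"
  proof -
    have "norm ((1 / norm (s - t)) *\<^sub>R (S s p - (S t p + (s - t) *\<^sub>R S t (G p))))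
      = norm ((S s p - S t p) /\<^sub>R (s - t) - S t (G p))" if "s \<noteq> t" for s
    proof -
      have "(S s p - S t p) /\<^sub>R (s - t) - S t (G p) = (1 / (s - t)) *\<^sub>R (S s p - (S t p + (s - t) *\<^sub>R S t (G p)))"
      proof -
        have "(1 / (s - t)) *\<^sub>R (S s p - (S t p + (s - t) *\<^sub>R S t (G p)))
          = (1 / (s - t)) *\<^sub>R (S s p - S t p) - (1 / (s - t) * (s - t)) *\<^sub>R S t (G p)"
          by (simp only: scaleR_diff_right scaleR_scaleR diff_diff_eq[symmetric])
        then show ?thesis using that by (simp add: inverse_eq_divide)
      qed
      then show ?thesis by simp
    qed
    then show ?thesis by (auto simp: eventually_at intro: exI[of _ 1])
  qed
  ultimately have "((\<lambda>s. (1 / norm (s - t)) *\<^sub>R (S s p - (S t p + (s - t) *\<^sub>R S t (G p)))) \<longlongrightarrow> 0) (at t within {0..})"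
    by (rule Lim_null_comparison[rotated])
  then show ?thesis
    unfolding has_vector_derivative_def has_derivative_within by (simp add: bounded_linear_scaleR_left)
qed

lemma C0_generator_invariant:
  assumes p: "p \<in> Dom" and t: "t \<ge> 0"
  shows "S t p \<in> Dom" "G (S t p) = S t (G p)"
proof -
  interpret bounded_linear "S t" using C0_linear t .
  have lim: "((\<lambda>r. (S r p - p) /\<^sub>R r) \<longlongrightarrow> G p) (at_right 0)"
    using gen p by (auto simp: has_generator_def)
  have "((\<lambda>r. (S r (S t p) - S t p) /\<^sub>R r) \<longlongrightarrow> S t (G p)) (at_right 0)"
  proof (rule Lim_transform_eventually)
    show "((\<lambda>r. S t ((S r p - p) /\<^sub>R r)) \<longlongrightarrow> S t (G p)) (at_right 0)"
      by (rule tendsto[OF lim])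
    have "S t ((S r p - p) /\<^sub>R r) = (S r (S t p) - S t p) /\<^sub>R r" if "r > 0" for r
      using C0_add[of t r p] C0_add[of r t p] t that by (simp add: scaleR diff add.commute)
    then show "\<forall>\<^sub>F r in at_right 0. S t ((S r p - p) /\<^sub>R r) = (S r (S t p) - S t p) /\<^sub>R r"
      by (auto simp: eventually_at intro: exI[of _ 1])
  qed
  then show "S t p \<in> Dom" "G (S t p) = S t (G p)"
    using gen by (auto simp: has_generator_def)
qed

end

end

subsection \<open>Orthonormal bases\<close>

text \<open>Instantiated twice: for \<open>e\<close> in H, and for
  \<open>sqrt (\<alpha> k) *\<^sub>R \<iota> (e k)\<close> in the space of index -1.\<close>

locale onb =
  fixes f :: "nat \<Rightarrow> 'a::{real_inner, banach}"
  assumes orthonormal: "f j \<bullet> f k = (if j = k then 1 else 0)"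
    and total: "closure (span (range f)) = UNIV"
begin

definition proj where "proj n x = (\<Sum>k<n. (x \<bullet> f k) *\<^sub>R f k)"

lemma proj_inner: "k < n \<Longrightarrow> proj n x \<bullet> f k = x \<bullet> f k"
  by (simp add: proj_def inner_sum_left orthonormal if_distrib cong: if_cong)

lemma norm_sum_sq: "(norm (\<Sum>k\<in>A. c k *\<^sub>R f k))\<^sup>2 = (\<Sum>k\<in>A. (c k)\<^sup>2)" if "finite A"
proof -
  have "(norm (\<Sum>k\<in>A. c k *\<^sub>R f k))\<^sup>2 = (\<Sum>k\<in>A. c k *\<^sub>R f k) \<bullet> (\<Sum>k\<in>A. c k *\<^sub>R f k)"
    by (rule power2_norm_eq_inner)
  also have "\<dots> = (\<Sum>k\<in>A. (c k)\<^sup>2)"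
    using that
    by (simp add: inner_sum_left inner_sum_right orthonormal power2_eq_square if_distrib cong: if_cong)
  finally show ?thesis .
qed

lemma norm_proj: "(norm (proj n x))\<^sup>2 = (\<Sum>k<n. (x \<bullet> f k)\<^sup>2)"
  unfolding proj_def by (rule norm_sum_sq) simp

lemma span_subset: "y \<in> span (range f) \<Longrightarrow> \<exists>n. \<exists>c. y = (\<Sum>k<n. c k *\<^sub>R f k)"
proof (induction rule: span_induct_alt)
  case base
  show ?case by (intro exI[of _ 0]) simp
next
  case (step c x y)
  then obtain k n b where k: "x = f k" and y: "y = (\<Sum>k<n. b k *\<^sub>R f k)" by auto
  define N where "N = max n (Suc k)"
  have 1: "y = (\<Sum>i<N. (if i < n then b i else 0) *\<^sub>R f i)"
    unfolding y by (rule sum.mono_neutral_cong_left) (auto simp: N_def)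
  have 2: "c *\<^sub>R x = (\<Sum>i<N. (if i = k then c else 0) *\<^sub>R f i)"
    unfolding k by (subst sum.mono_neutral_cong_right[of _ "{k}" _ "\<lambda>i. c *\<^sub>R f i"]) (auto simp: N_def)
  have "c *\<^sub>R x + y = (\<Sum>i<N. ((if i = k then c else 0) + (if i < n then b i else 0)) *\<^sub>R f i)"
    by (subst 2, subst (1) 1) (simp only: sum.distrib[symmetric] scaleR_add_left)
  then show ?case by (intro exI)
qed

lemma pythagoras: "(norm x)\<^sup>2 = (norm (proj n x))\<^sup>2 + (norm (x - proj n x))\<^sup>2"
proof -
  have "proj n x \<bullet> proj n x = x \<bullet> proj n x"
  proof -
    have "proj n x \<bullet> proj n x = (\<Sum>k<n. (x \<bullet> f k) * (proj n x \<bullet> f k))"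
      by (subst (2) proj_def) (simp add: inner_sum_right)
    also have "\<dots> = (\<Sum>k<n. (x \<bullet> f k) * (x \<bullet> f k))" by (intro sum.cong) (auto simp: proj_inner)
    also have "\<dots> = x \<bullet> proj n x" by (simp add: proj_def inner_sum_right)
    finally show ?thesis .
  qed
  then show ?thesis
    by (simp add: power2_norm_eq_inner inner_diff_left inner_diff_right inner_commute)
qed

lemma proj_tendsto: "(\<lambda>n. proj n x) \<longlonglongrightarrow> x"
proof (rule LIMSEQ_I)
  fix r :: real assume r: "r > 0"
  have "x \<in> closure (span (range f))" using total by simp
  then obtain y where y: "y \<in> span (range f)" "dist y x < r / 2"
    using r closure_approachable[of x] by (metis half_gt_zero)
  then obtain n c where yn: "y = (\<Sum>k<n. c k *\<^sub>R f k)" using span_subset by blast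
  have "norm (proj m x - x) < r" if "m \<ge> n" for m
  proof -
    have pm: "proj m y = y"
    proof -
      have in1: "y \<bullet> f k = (if k < n then c k else 0)" for k
        by (simp add: yn inner_sum_left orthonormal if_distrib cong: if_cong)
      have "proj m y = (\<Sum>k<m. (if k < n then c k else 0) *\<^sub>R f k)" by (simp add: proj_def in1)
      also have "\<dots> = y" unfolding yn using that by (intro sum.mono_neutral_cong_right) auto
      finally show ?thesis .
    qed
    have "proj m (x - y) = proj m x - proj m y"
      by (simp add: proj_def inner_diff_left scaleR_diff_left sum_subtractf)
    moreover have "norm (proj m (x - y)) \<le> norm (x - y)"
      by (rule power2_le_imp_le) (use pythagoras[of "x - y" m] in auto)
    moreover have "proj m x - x = (proj m x - proj m y) - (x - y)" by (simp add: pm)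
    ultimately have "norm (proj m x - x) \<le> norm (x - y) + norm (x - y)"
      using norm_triangle_ineq4[of "proj m x - proj m y" "x - y"] by simp
    then show ?thesis using y(2) by (simp add: dist_norm norm_minus_commute)
  qed
  then show "\<exists>no. \<forall>n\<ge>no. norm (proj n x - x) < r" by blast
qed

lemma expansion: "(\<lambda>k. (x \<bullet> f k) *\<^sub>R f k) sums x"
  unfolding sums_def using proj_tendsto[of x] by (simp add: proj_def)

lemma Parseval: "(\<lambda>k. (x \<bullet> f k)\<^sup>2) sums (norm x)\<^sup>2"
proof -
  have "(\<lambda>n. (norm (proj n x))\<^sup>2) \<longlonglongrightarrow> (norm x)\<^sup>2"
    by (intro tendsto_intros proj_tendsto)
  then show ?thesis by (simp add: sums_def norm_proj)
qed

lemma eq_iff: "x = y \<longleftrightarrow> (\<forall>k. x \<bullet> f k = y \<bullet> f k)"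
  using expansion[of x] expansion[of y] sums_unique2 by auto

lemma series_sums:
  assumes "summable (\<lambda>k. (c k)\<^sup>2)"
  shows "summable (\<lambda>k. c k *\<^sub>R f k)" "(\<Sum>k. c k *\<^sub>R f k) \<bullet> f j = c j"
proof -
  show s: "summable (\<lambda>k. c k *\<^sub>R f k)"
    unfolding summable_Cauchy
  proof (intro allI impI)
    fix r :: real assume "r > 0"
    then obtain N where N: "\<And>m n. m \<ge> N \<Longrightarrow> norm (\<Sum>k=m..<n. (c k)\<^sup>2) < r\<^sup>2"
      using assms unfolding summable_Cauchy by (metis zero_less_power)
    have "norm (\<Sum>k=m..<n. c k *\<^sub>R f k) < r" if "m \<ge> N" for m n
    proof (rule power2_less_imp_less)
      show "(norm (\<Sum>k=m..<n. c k *\<^sub>R f k))\<^sup>2 < r\<^sup>2"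
        using N[OF that, of n] by (simp add: norm_sum_sq)
    qed (use \<open>r > 0\<close> in simp)
    then show "\<exists>N. \<forall>m\<ge>N. \<forall>n. norm (\<Sum>k = m..<n. c k *\<^sub>R f k) < r" by blast
  qed
  have "(\<lambda>k. (c k *\<^sub>R f k) \<bullet> f j) sums ((\<Sum>k. c k *\<^sub>R f k) \<bullet> f j)"
    by (rule bounded_linear.sums[OF bounded_linear_inner_left summable_sums[OF s]])
  moreover have "(\<lambda>k. (c k *\<^sub>R f k) \<bullet> f j) = (\<lambda>k. if k = j then c j else 0)"
    by (auto simp: orthonormal)
  then have "(\<lambda>k. (c k *\<^sub>R f k) \<bullet> f j) sums c j" using sums_single[of j "\<lambda>_. c j"] by simp
  ultimately show "(\<Sum>k. c k *\<^sub>R f k) \<bullet> f j = c j" by (rule sums_unique2)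
qed

end

subsection \<open>Modes of the damped wave equation\<close>

abbreviation sq_integral :: "real set \<Rightarrow> (real \<Rightarrow> 'a::real_normed_vector) \<Rightarrow> ennreal" where
  "sq_integral A f \<equiv> (\<integral>\<^sup>+t\<in>A. ennreal ((norm (f t))\<^sup>2) \<partial>lborel)"

lemma L2_Icc_integrable:
  fixes \<psi> :: "real \<Rightarrow> 'a::{banach, second_countable_topology}"
  assumes [measurable]: "\<psi> \<in> borel_measurable borel"
    and "sq_integral {a..b} \<psi> < \<infinity>"
  shows "set_integrable lborel {a..b} \<psi>"
proof -
  have "set_integrable lborel {a..b} (\<lambda>t. (norm (\<psi> t))\<^sup>2)"
    using assms(2) by (intro set_integrable_if_nn_finite) (auto simp: set_borel_measurable_def)
  moreover have "set_integrable lborel {a..b} (\<lambda>t. 1 :: real)"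
    by (intro borel_integrable_atLeastAtMost' continuous_intros)
  ultimately have "set_integrable lborel {a..b} (\<lambda>t. (norm (\<psi> t))\<^sup>2 + 1)"
    by (rule set_integral_add(1))
  then show ?thesis
  proof (rule set_integrable_bound)
    have "norm (\<psi> t) \<le> (norm (\<psi> t))\<^sup>2 + 1" for t
    proof -
      have "2 * norm (\<psi> t) \<le> (norm (\<psi> t))\<^sup>2 + 1"
        using sum_squares_bound[of "norm (\<psi> t)" 1] by simp
      then show ?thesis using norm_ge_zero[of "\<psi> t"] by linarith
    qed
    then show "AE x in lborel. x \<in> {a..b} \<longrightarrow> norm (\<psi> x) \<le> norm ((norm (\<psi> x))\<^sup>2 + 1)"
      by (intro AE_I2) (auto intro: order_trans)
  qed (auto simp: set_borel_measurable_def)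
qed

lemma bounded_linear_set_integral:
  assumes "bounded_linear T" "set_integrable lborel A f"
  shows "(LINT s:A|lborel. T (f s)) = T (LINT s:A|lborel. f s)" "set_integrable lborel A (\<lambda>s. T (f s))"
proof -
  interpret T: bounded_linear T by fact
  show "(LINT s:A|lborel. T (f s)) = T (LINT s:A|lborel. f s)"
    using integral_bounded_linear[OF assms(1) assms(2)[unfolded set_integrable_def]]
    unfolding set_lebesgue_integral_def by (simp add: T.scaleR)
  show "set_integrable lborel A (\<lambda>s. T (f s))"
    using integrable_bounded_linear[OF assms(1) assms(2)[unfolded set_integrable_def]]
    unfolding set_integrable_def by (simp add: T.scaleR)
qed

text \<open>The facts on which the estimates rest, for one fixed \<mu>. Two Lipschitz constants of B
  are kept apart: \<gamma> belongs to the norm of H and must satisfy the strict small gain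
  condition, while for all indices up to \<open>2 * \<beta>\<close> the common bound
  \<open>\<alpha> 0\<close> is recorded, since there B(u) is only estimated and never
  absorbed.\<close>

locale damped_wave =
  fixes e :: "nat \<Rightarrow> 'h::{real_inner,banach,second_countable_topology}"
    and \<alpha> lam :: "nat \<Rightarrow> real"
    and \<iota> :: "'h \<Rightarrow> 'm::{real_inner,banach,second_countable_topology}"
    and Q B :: "'h \<Rightarrow> 'h"
    and \<beta> c \<gamma> \<mu> :: real
    and S :: "real \<Rightarrow> real \<Rightarrow> 'h \<times> 'm \<Rightarrow> 'h \<times> 'm"
  assumes e_orthonormal: "e j \<bullet> e k = (if j = k then 1 else 0)"
    and e_total: "closure (span (range e)) = UNIV"
    and \<alpha>_0: "0 < \<alpha> 0" and \<alpha>_Suc: "\<alpha> k \<le> \<alpha> (Suc k)"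
    and \<alpha>_lim: "filterlim \<alpha> at_top sequentially"
    and Hminus1: "is_Hminus1 e \<alpha> \<iota>"
    and Q_linear: "bounded_linear Q" and Q_e: "Q (e k) = lam k *\<^sub>R e k"
    and c_pos: "c > 0"
    and lam_bounds: "(1/c) * \<alpha> k powr (- \<beta>) \<le> lam k" "lam k \<le> c * \<alpha> k powr (- \<beta>)"
    and \<beta>_nonneg: "\<beta> \<ge> 0"
    and B_Hsp: "0 \<le> \<delta> \<Longrightarrow> \<delta> \<le> 2 * \<beta> \<Longrightarrow> x \<in> Hsp e \<alpha> \<delta> \<Longrightarrow> B x \<in> Hsp e \<alpha> \<delta>"
    and B_Hnorm: "0 \<le> \<delta> \<Longrightarrow> \<delta> \<le> 2 * \<beta> \<Longrightarrow> x \<in> Hsp e \<alpha> \<delta> \<Longrightarrow> y \<in> Hsp e \<alpha> \<delta> \<Longrightarrow>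
          Hnorm e \<alpha> \<delta> (B x - B y) \<le> \<alpha> 0 * Hnorm e \<alpha> \<delta> (x - y)"
    and B_Lipschitz: "norm (B x - B y) \<le> \<gamma> * norm (x - y)" and \<gamma>_nonneg: "\<gamma> \<ge> 0"
    and B_zero: "B 0 = 0"
    and \<mu>_pos: "\<mu> > 0"
    \<comment> \<open>the squared \<open>L\<^sup>2\<close> gain of the linear oscillators from the forcing to \<open>u\<close> is at most the first factor\<close>
    and small_gain: "(1 / (\<alpha> 0)\<^sup>2 + 9 * \<mu> / (2 * \<alpha> 0)) * \<gamma>\<^sup>2 < 1"
    and S_C0: "C0_semigroup (S \<mu>)"
    and S_generator: "has_generator (S \<mu>) (A_dom e \<alpha> \<iota>) (A_op e \<alpha> \<iota> \<mu>)"
begin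

sublocale E: onb e
  by standard (use e_orthonormal e_total in auto)

lemma \<alpha>_ge: "\<alpha> 0 \<le> \<alpha> k"
  by (rule lift_Suc_mono_le[of \<alpha>]) (use \<alpha>_Suc in auto)

lemma \<alpha>_mono: "j \<le> k \<Longrightarrow> \<alpha> j \<le> \<alpha> k"
  by (rule lift_Suc_mono_le[of \<alpha>]) (use \<alpha>_Suc in auto)

lemma \<alpha>_pos: "0 < \<alpha> k"
  using \<alpha>_ge[of k] \<alpha>_0 by linarith

lemma \<alpha>_nonzero [simp]: "\<alpha> k \<noteq> 0"
  using \<alpha>_pos[of k] by simp

section \<open>The embedding into the space of index -1 and an orthonormal basis there\<close>

lemma \<iota>_linear: "linear \<iota>"
  using Hminus1 by (simp add: is_Hminus1_def)

lemma summable_Hminus1: "summable (\<lambda>k. \<alpha> k powr (- 1) * (x \<bullet> e k)\<^sup>2)"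
proof (rule summable_comparison_test'[of "\<lambda>k. (1 / \<alpha> 0) * (x \<bullet> e k)\<^sup>2" 0])
  show "summable (\<lambda>k. (1 / \<alpha> 0) * (x \<bullet> e k)\<^sup>2)"
    using E.Parseval[of x] by (intro summable_mult) (simp add: sums_iff)
  show "norm (\<alpha> k powr (- 1) * (x \<bullet> e k)\<^sup>2) \<le> (1 / \<alpha> 0) * (x \<bullet> e k)\<^sup>2" for k
    using \<alpha>_ge[of k] \<alpha>_0 \<alpha>_pos[of k]
    by (simp add: powr_minus_divide abs_mult) (intro divide_left_mono; simp)
qed

lemma norm_\<iota>: "(norm (\<iota> x))\<^sup>2 = (\<Sum>k. (x \<bullet> e k)\<^sup>2 / \<alpha> k)"
proof -
  have "norm (\<iota> x) = Hnorm e \<alpha> (- 1) x" using Hminus1 by (simp add: is_Hminus1_def)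
  moreover have "(\<Sum>k. \<alpha> k powr (- 1) * (x \<bullet> e k)\<^sup>2) \<ge> 0"
    by (intro suminf_nonneg summable_Hminus1) simp
  ultimately have "(norm (\<iota> x))\<^sup>2 = (\<Sum>k. \<alpha> k powr (- 1) * (x \<bullet> e k)\<^sup>2)"
    by (simp add: Hnorm_def)
  also have "\<dots> = (\<Sum>k. (x \<bullet> e k)\<^sup>2 / \<alpha> k)"
    using \<alpha>_pos by (simp add: powr_minus_divide less_imp_le)
  finally show ?thesis .
qed

lemma \<iota>_summable: "summable (\<lambda>k. (x \<bullet> e k)\<^sup>2 / \<alpha> k)"
  using summable_Hminus1[of x] \<alpha>_pos by (simp add: powr_minus_divide less_imp_le)

lemma norm_\<iota>_le: "norm (\<iota> x) \<le> (1 / sqrt (\<alpha> 0)) * norm x"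
proof (rule power2_le_imp_le)
  have "(norm (\<iota> x))\<^sup>2 \<le> (\<Sum>k. (1 / \<alpha> 0) * (x \<bullet> e k)\<^sup>2)"
    unfolding norm_\<iota>
  proof (rule suminf_le)
    show "(x \<bullet> e k)\<^sup>2 / \<alpha> k \<le> (1 / \<alpha> 0) * (x \<bullet> e k)\<^sup>2" for k
      using \<alpha>_ge[of k] \<alpha>_0 \<alpha>_pos[of k] by simp (intro divide_left_mono; simp)
    show "summable (\<lambda>k. (1 / \<alpha> 0) * (x \<bullet> e k)\<^sup>2)"
      using E.Parseval[of x] by (intro summable_mult) (simp add: sums_iff)
  qed (rule \<iota>_summable)
  also have "\<dots> = (1 / \<alpha> 0) * (norm x)\<^sup>2"
    using E.Parseval[of x] by (subst suminf_mult) (auto simp: sums_iff)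
  also have "\<dots> = ((1 / sqrt (\<alpha> 0)) * norm x)\<^sup>2"
    using \<alpha>_0 by (simp add: power_mult_distrib power_divide)
  finally show "(norm (\<iota> x))\<^sup>2 \<le> ((1 / sqrt (\<alpha> 0)) * norm x)\<^sup>2" .
qed (use \<alpha>_0 in simp)

lemma \<iota>_bounded_linear: "bounded_linear \<iota>"
proof -
  interpret linear \<iota> by (rule \<iota>_linear)
  show ?thesis
    by (rule bounded_linear_intro[of _ "1 / sqrt (\<alpha> 0)"]) (use norm_\<iota>_le in \<open>auto simp: add scale mult.commute\<close>)
qed

text \<open>Polarization: the hypothesis prescribes only the norm of \<open>\<iota> x\<close>, so
  the inner product is read off from the norms of the images of x + e k and x - e k.\<close>

lemma \<iota>_inner: "\<iota> x \<bullet> \<iota> (e k) = (x \<bullet> e k) / \<alpha> k"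
proof -
  interpret linear \<iota> by (rule \<iota>_linear)
  have 1: "(norm (\<iota> (x + s *\<^sub>R e k)))\<^sup>2 = (\<Sum>j. (x \<bullet> e j)\<^sup>2 / \<alpha> j) + (2 * s * (x \<bullet> e k) + s\<^sup>2) / \<alpha> k" for s
  proof -
    have "(\<lambda>j. (x \<bullet> e j)\<^sup>2 / \<alpha> j + (if j = k then (2 * s * (x \<bullet> e k) + s\<^sup>2) / \<alpha> k else 0)) sums
       ((\<Sum>j. (x \<bullet> e j)\<^sup>2 / \<alpha> j) + (2 * s * (x \<bullet> e k) + s\<^sup>2) / \<alpha> k)"
      by (intro sums_add summable_sums \<iota>_summable sums_single)
    moreover have "(x \<bullet> e j)\<^sup>2 / \<alpha> j + (if j = k then (2 * s * (x \<bullet> e k) + s\<^sup>2) / \<alpha> k else 0)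
       = ((x + s *\<^sub>R e k) \<bullet> e j)\<^sup>2 / \<alpha> j" for j
      by (simp add: inner_add_left e_orthonormal power2_eq_square algebra_simps add_divide_distrib)
    ultimately show ?thesis unfolding norm_\<iota> by (simp add: sums_iff)
  qed
  have "(norm (\<iota> (x + 1 *\<^sub>R e k)))\<^sup>2 - (norm (\<iota> (x + (-1) *\<^sub>R e k)))\<^sup>2 = 4 * (\<iota> x \<bullet> \<iota> (e k))"
    by (simp add: power2_norm_eq_inner diff add inner_add_left inner_add_right inner_diff_left inner_diff_right inner_commute)
  then show ?thesis unfolding 1 by (simp add: add_divide_distrib diff_divide_distrib)
qed

lemma \<iota>_inj: "inj \<iota>"
proof (rule injI)
  fix x y assume "\<iota> x = \<iota> y"
  then have "(x \<bullet> e k) / \<alpha> k = (y \<bullet> e k) / \<alpha> k" for k by (simp flip: \<iota>_inner)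
  then have "x \<bullet> e k = y \<bullet> e k" for k by simp
  then show "x = y" by (simp add: E.eq_iff)
qed

sublocale F: onb "\<lambda>k. sqrt (\<alpha> k) *\<^sub>R \<iota> (e k)"
proof
  interpret linear \<iota> by (rule \<iota>_linear)
  fix j k
  show "sqrt (\<alpha> j) *\<^sub>R \<iota> (e j) \<bullet> sqrt (\<alpha> k) *\<^sub>R \<iota> (e k) = (if j = k then 1 else 0)"
    using \<alpha>_pos[of k] by (simp add: \<iota>_inner e_orthonormal)
  have "\<iota> ` span (range e) \<subseteq> span (range (\<lambda>k. sqrt (\<alpha> k) *\<^sub>R \<iota> (e k)))"
  proof -
    have "\<iota> (e k) \<in> span (range (\<lambda>k. sqrt (\<alpha> k) *\<^sub>R \<iota> (e k)))" for k
    proof -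
      have "\<iota> (e k) = (1 / sqrt (\<alpha> k)) *\<^sub>R (sqrt (\<alpha> k) *\<^sub>R \<iota> (e k))" using \<alpha>_pos[of k] by simp
      moreover have "sqrt (\<alpha> k) *\<^sub>R \<iota> (e k) \<in> span (range (\<lambda>k. sqrt (\<alpha> k) *\<^sub>R \<iota> (e k)))"
        by (rule span_base) (rule rangeI)
      ultimately show ?thesis using span_mul[of "sqrt (\<alpha> k) *\<^sub>R \<iota> (e k)" _ "1 / sqrt (\<alpha> k)"] by simp
    qed
    then have "\<iota> ` range e \<subseteq> span (range (\<lambda>k. sqrt (\<alpha> k) *\<^sub>R \<iota> (e k)))" by auto
    then have "span (\<iota> ` range e) \<subseteq> span (range (\<lambda>k. sqrt (\<alpha> k) *\<^sub>R \<iota> (e k)))"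
      by (simp add: span_minimal)
    then show ?thesis by (simp add: linear_span_image[OF \<iota>_linear])
  qed
  then have "closure (\<iota> ` span (range e)) \<subseteq> closure (span (range (\<lambda>k. sqrt (\<alpha> k) *\<^sub>R \<iota> (e k))))"
    by (rule closure_mono)
  then show "closure (span (range (\<lambda>k. sqrt (\<alpha> k) *\<^sub>R \<iota> (e k)))) = UNIV"
    using Hminus1 by (auto simp: is_Hminus1_def)
qed

text \<open>Both components are read in the basis \<open>e\<close>: since \<open>\<iota> x \<bullet> \<iota> (e k) = (x \<bullet> e k) / \<alpha> k\<close>, the factor \<open>\<alpha> k\<close>
  makes \<open>vm k (u, \<iota> x) = x \<bullet> e k\<close>.\<close>

definition um :: "nat \<Rightarrow> 'h \<times> 'm \<Rightarrow> real" where "um k z = fst z \<bullet> e k"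
definition vm :: "nat \<Rightarrow> 'h \<times> 'm \<Rightarrow> real" where "vm k z = \<alpha> k * (snd z \<bullet> \<iota> (e k))"

lemma um_bounded_linear: "bounded_linear (um k)"
  unfolding um_def by (rule bounded_linear_compose[OF bounded_linear_inner_left bounded_linear_fst])

lemma vm_bounded_linear: "bounded_linear (vm k)"
  unfolding vm_def
  by (intro bounded_linear_const_mult bounded_linear_compose[OF bounded_linear_inner_left bounded_linear_snd])

lemma vm_F: "vm k z = sqrt (\<alpha> k) * (snd z \<bullet> (sqrt (\<alpha> k) *\<^sub>R \<iota> (e k)))"
  using \<alpha>_pos[of k] by (simp add: vm_def)

lemma norm_modes: "(\<lambda>k. (um k z)\<^sup>2 + (vm k z)\<^sup>2 / \<alpha> k) sums (norm z)\<^sup>2"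
proof -
  have "(vm k z)\<^sup>2 / \<alpha> k = (snd z \<bullet> (sqrt (\<alpha> k) *\<^sub>R \<iota> (e k)))\<^sup>2" for k
    using \<alpha>_pos[of k] unfolding vm_F by (simp add: power_mult_distrib)
  moreover have "(norm z)\<^sup>2 = (norm (fst z))\<^sup>2 + (norm (snd z))\<^sup>2"
    by (cases z) (simp add: norm_Pair)
  ultimately show ?thesis
    using sums_add[OF E.Parseval[of "fst z"] F.Parseval[of "snd z"]] by (simp add: um_def)
qed

lemma modes_eqI:
  assumes "\<And>k. um k z = um k w" "\<And>k. vm k z = vm k w"
  shows "z = w"
proof (rule prod_eqI)
  show "fst z = fst w" using assms(1) by (subst E.eq_iff) (simp add: um_def)
  show "snd z = snd w" using assms(2) \<alpha>_pos unfolding vm_F by (subst F.eq_iff) (simp add: less_imp_neq[symmetric])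
qed

lemma um_\<iota>: "um k (x, \<iota> y) = x \<bullet> e k" and vm_\<iota>: "vm k (x, \<iota> y) = y \<bullet> e k"
  using \<alpha>_pos[of k] by (auto simp: um_def vm_def \<iota>_inner)

text \<open>In coordinates the generator is the first order system of the oscillator. In the
  normalized basis of index -1 the series \<open>lap_ext\<close> has coefficients - sqrt(\<alpha>)
  times those of u, and they are square summable precisely because u lies in the space of index
  1.\<close>

lemma A_op_modes:
  assumes "p \<in> A_dom e \<alpha> \<iota>"
  shows "um k (A_op e \<alpha> \<iota> \<mu> p) = vm k p" "vm k (A_op e \<alpha> \<iota> \<mu> p) = (- \<alpha> k * um k p - vm k p) / \<mu>"
proof -
  obtain u x where p: "p = (u, \<iota> x)" and u: "summable (\<lambda>k. \<alpha> k * (u \<bullet> e k)\<^sup>2)"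
    using assms \<alpha>_pos by (auto simp: A_dom_def Hsp_def less_imp_le)
  show "um k (A_op e \<alpha> \<iota> \<mu> p) = vm k p"
    by (simp add: p A_op_def um_\<iota> vm_\<iota> um_def inv_f_f[OF \<iota>_inj])
  have "summable (\<lambda>j. (- sqrt (\<alpha> j) * (u \<bullet> e j))\<^sup>2)"
    using u \<alpha>_pos by (simp add: power_mult_distrib less_imp_le)
  from F.series_sums(2)[OF this, of k]
  have "(\<Sum>j. (- \<alpha> j * (u \<bullet> e j)) *\<^sub>R \<iota> (e j)) \<bullet> (sqrt (\<alpha> k) *\<^sub>R \<iota> (e k)) = - sqrt (\<alpha> k) * (u \<bullet> e k)"
    using \<alpha>_pos by (simp add: less_imp_le mult.commute mult.left_commute flip: mult.assoc)
  then have "vm k (0, lap_ext e \<alpha> \<iota> u) = - \<alpha> k * (u \<bullet> e k)"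
    unfolding vm_F using \<alpha>_pos[of k] by (simp add: lap_ext_def less_imp_le flip: mult.assoc)
  then show "vm k (A_op e \<alpha> \<iota> \<mu> p) = (- \<alpha> k * um k p - vm k p) / \<mu>"
    using \<mu>_pos by (simp add: p A_op_def um_\<iota> vm_\<iota> vm_def inner_diff_left field_simps \<iota>_inner)
qed

text \<open>The semigroup is given only through its generator. Orbits that start in the domain are
  differentiable and stay there, so applying the coordinate functionals to the orbit yields the
  scalar equations.\<close>

lemma S_osc:
  assumes "p \<in> A_dom e \<alpha> \<iota>"
  shows "oscillator \<mu> (\<alpha> k) 0 T (\<lambda>t. um k (S \<mu> t p)) (\<lambda>t. vm k (S \<mu> t p)) (\<lambda>_. 0)"
proof -
  let ?A = "A_op e \<alpha> \<iota> \<mu>"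
  have der: "((\<lambda>t. g (S \<mu> t p)) has_real_derivative g (?A (S \<mu> t p))) (at t within {0..T})"
    if "bounded_linear g" "t \<in> {0..T}" for g t
  proof -
    have "((\<lambda>t. S \<mu> t p) has_vector_derivative ?A (S \<mu> t p)) (at t within {0..})"
      using C0_generator_derivative[OF S_C0 S_generator assms, of t] C0_generator_invariant(2)[OF S_C0 S_generator assms, of t] that
      by simp
    then have "((\<lambda>t. S \<mu> t p) has_vector_derivative ?A (S \<mu> t p)) (at t within {0..T})"
      by (rule has_vector_derivative_within_subset) auto
    from bounded_linear.has_vector_derivative[OF that(1) this] show ?thesis
      by (simp add: has_real_derivative_iff_has_vector_derivative)
  qed
  have dom: "S \<mu> t p \<in> A_dom e \<alpha> \<iota>" if "t \<ge> 0" for t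
    by (rule C0_generator_invariant(1)[OF S_C0 S_generator assms that])
  have cont: "continuous_on {0..T} (\<lambda>t. S \<mu> t p)"
    by (rule C0_continuous_on[OF S_C0]) (auto intro: continuous_intros)
  have cu: "continuous_on {0..T} (\<lambda>t. um k (S \<mu> t p))" and cv: "continuous_on {0..T} (\<lambda>t. vm k (S \<mu> t p))"
    using bounded_linear.continuous_on[OF um_bounded_linear cont] bounded_linear.continuous_on[OF vm_bounded_linear cont] by auto
  show ?thesis unfolding oscillator_def
  proof
    show "primitive_on 0 T (\<lambda>t. um k (S \<mu> t p)) (\<lambda>t. vm k (S \<mu> t p))"
      using der[OF um_bounded_linear, of _ k] dom
      by (intro primitive_on_derivative cv) (auto simp: A_op_modes)
    show "primitive_on 0 T (\<lambda>t. vm k (S \<mu> t p)) (\<lambda>t. (- \<alpha> k * um k (S \<mu> t p) - vm k (S \<mu> t p) + 0) / \<mu>)"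
      using der[OF vm_bounded_linear, of _ k] dom \<mu>_pos
      by (intro primitive_on_derivative continuous_intros cu cv) (auto simp: A_op_modes)
  qed
qed

text \<open>Orbits whose coordinates in mode k form the fundamental system of the oscillator, with
  initial data (1, 0) for \<open>E1\<close> and (0, 1) for \<open>E2\<close>. Forcing acts on the
  velocity, so \<open>E2\<close> is the Duhamel kernel.\<close>

definition E1 where "E1 k t = S \<mu> t (e k, 0)"
definition E2 where "E2 k t = S \<mu> t (0, \<iota> (e k))"

lemma basis_A_dom: "(e k, 0) \<in> A_dom e \<alpha> \<iota>" "(0, \<iota> (e k)) \<in> A_dom e \<alpha> \<iota>"
proof -
  have "summable (\<lambda>j. \<alpha> j powr 1 * (e k \<bullet> e j)\<^sup>2)"
    by (rule summable_finite[of "{k}"]) (auto simp: e_orthonormal)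
  moreover have "(0::'m) = \<iota> 0" by (simp add: linear_0[OF \<iota>_linear])
  ultimately show "(e k, 0) \<in> A_dom e \<alpha> \<iota>" "(0, \<iota> (e k)) \<in> A_dom e \<alpha> \<iota>"
    by (auto simp: A_dom_def Hsp_def)
qed

lemma E_osc:
  "oscillator \<mu> (\<alpha> k) 0 T (\<lambda>t. um k (E1 k t)) (\<lambda>t. vm k (E1 k t)) (\<lambda>_. 0)"
  "oscillator \<mu> (\<alpha> k) 0 T (\<lambda>t. um k (E2 k t)) (\<lambda>t. vm k (E2 k t)) (\<lambda>_. 0)"
  unfolding E1_def E2_def by (rule S_osc basis_A_dom)+

lemma E_zero: "um k (E1 k 0) = 1" "vm k (E1 k 0) = 0" "um k (E2 k 0) = 0" "vm k (E2 k 0) = 1"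
proof -
  have "(e k, 0) = (e k, \<iota> 0)" by (simp add: linear_0[OF \<iota>_linear])
  then show "um k (E1 k 0) = 1" "vm k (E1 k 0) = 0" "um k (E2 k 0) = 0" "vm k (E2 k 0) = 1"
    by (simp_all only: E1_def E2_def C0_zero[OF S_C0] um_\<iota> vm_\<iota>) (simp_all add: e_orthonormal)
qed

lemma S_modes_dom:
  assumes p: "p \<in> A_dom e \<alpha> \<iota>" and t: "t \<ge> 0"
  shows "um k (S \<mu> t p) = um k p * um k (E1 k t) + vm k p * um k (E2 k t)"
    "vm k (S \<mu> t p) = um k p * vm k (E1 k t) + vm k p * vm k (E2 k t)"
proof -
  have 1: "oscillator \<mu> (\<alpha> k) 0 t (\<lambda>t. um k (S \<mu> t p)) (\<lambda>t. vm k (S \<mu> t p)) (\<lambda>_. 0)"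
    by (rule S_osc[OF p])
  have 2: "oscillator \<mu> (\<alpha> k) 0 t (\<lambda>t. um k p * um k (E1 k t) + vm k p * um k (E2 k t))
      (\<lambda>t. um k p * vm k (E1 k t) + vm k p * vm k (E2 k t)) (\<lambda>_. 0)"
    using oscillator_cmult_add[OF E_osc(1)[of k t] E_osc(2)[of k t], of "um k p" "vm k p"] by simp
  show "um k (S \<mu> t p) = um k p * um k (E1 k t) + vm k p * um k (E2 k t)"
    by (rule oscillator_unique(1)[OF 1 2 \<mu>_pos \<alpha>_pos]) (use t in \<open>auto simp: E_zero C0_zero[OF S_C0]\<close>)
  show "vm k (S \<mu> t p) = um k p * vm k (E1 k t) + vm k p * vm k (E2 k t)"
    by (rule oscillator_unique(2)[OF 1 2 \<mu>_pos \<alpha>_pos]) (use t in \<open>auto simp: E_zero C0_zero[OF S_C0]\<close>)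
qed

definition trunc where "trunc n p = (E.proj n (fst p), F.proj n (snd p))" for p :: "'h \<times> 'm"

lemma trunc_dom: "trunc n p \<in> A_dom e \<alpha> \<iota>"
proof -
  interpret linear \<iota> by (rule \<iota>_linear)
  have "E.proj n (fst p) \<bullet> e j = 0" if "j \<ge> n" for j
    using that by (auto simp: E.proj_def inner_sum_left e_orthonormal intro!: sum.neutral)
  then have "summable (\<lambda>j. \<alpha> j powr 1 * (E.proj n (fst p) \<bullet> e j)\<^sup>2)"
    by (intro summable_finite[of "{..<n}"]) auto
  moreover have "F.proj n (snd p) = \<iota> (\<Sum>k<n. ((snd p \<bullet> sqrt (\<alpha> k) *\<^sub>R \<iota> (e k)) * sqrt (\<alpha> k)) *\<^sub>R e k)"
    by (simp add: F.proj_def sum scale)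
  ultimately show ?thesis by (auto simp: trunc_def A_dom_def Hsp_def)
qed

lemma trunc_tendsto: "(\<lambda>n. trunc n p) \<longlonglongrightarrow> p"
  unfolding trunc_def using tendsto_Pair[OF E.proj_tendsto[of "fst p"] F.proj_tendsto[of "snd p"]] by simp

text \<open>Truncations to finitely many modes lie in the domain and are dense, and both sides
  depend continuously on p; so the formula extends from the domain to the whole space.\<close>

lemma S_modes:
  assumes t: "t \<ge> 0"
  shows "um k (S \<mu> t p) = um k p * um k (E1 k t) + vm k p * um k (E2 k t)"
    "vm k (S \<mu> t p) = um k p * vm k (E1 k t) + vm k p * vm k (E2 k t)"
proof -
  note bl = C0_linear[OF S_C0 t]
  have 1: "(\<lambda>n. g (S \<mu> t (trunc n p))) \<longlonglongrightarrow> g (S \<mu> t p)" if "bounded_linear g" for g :: "_ \<Rightarrow> real"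
    by (intro bounded_linear.tendsto[OF that] bounded_linear.tendsto[OF bl] trunc_tendsto)
  have 2: "(\<lambda>n. um k (trunc n p) * x + vm k (trunc n p) * y) \<longlonglongrightarrow> um k p * x + vm k p * y" for x y
    by (intro tendsto_intros bounded_linear.tendsto[OF um_bounded_linear] bounded_linear.tendsto[OF vm_bounded_linear] trunc_tendsto)
  show "um k (S \<mu> t p) = um k p * um k (E1 k t) + vm k p * um k (E2 k t)"
    by (rule LIMSEQ_unique[OF 1[OF um_bounded_linear, of k]]) (simp only: S_modes_dom(1)[OF trunc_dom t] 2)
  show "vm k (S \<mu> t p) = um k p * vm k (E1 k t) + vm k p * vm k (E2 k t)"
    by (rule LIMSEQ_unique[OF 1[OF vm_bounded_linear, of k]]) (simp only: S_modes_dom(2)[OF trunc_dom t] 2)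
qed

section \<open>Equivalence of mild solutions and mode-wise solutions\<close>

lemma B_continuous: "continuous_on UNIV B"
proof (rule lipschitz_on_continuous_on)
  show "\<gamma>-lipschitz_on UNIV B" 
    by (rule lipschitz_onI) (use B_Lipschitz \<gamma>_nonneg in \<open>auto simp: dist_norm\<close>)
qed

lemma norm_B: "norm (B x) \<le> \<gamma> * norm x"
  using B_Lipschitz[of x 0] by (simp add: B_zero)

lemma Q_modes: "Q x \<bullet> e k = lam k * (x \<bullet> e k)"
proof -
  have bl: "bounded_linear (\<lambda>x. Q x \<bullet> e k)"
    by (rule bounded_linear_compose[OF bounded_linear_inner_left Q_linear])
  interpret Q: bounded_linear Q by (rule Q_linear)
  have "(\<lambda>j. Q ((x \<bullet> e j) *\<^sub>R e j) \<bullet> e k) sums (Q x \<bullet> e k)"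
    by (rule bounded_linear.sums[OF bl E.expansion])
  moreover have "(\<lambda>j. Q ((x \<bullet> e j) *\<^sub>R e j) \<bullet> e k) = (\<lambda>j. if j = k then lam k * (x \<bullet> e k) else 0)"
    by (auto simp: Q.scaleR Q_e e_orthonormal)
  then have "(\<lambda>j. Q ((x \<bullet> e j) *\<^sub>R e j) \<bullet> e k) sums (lam k * (x \<bullet> e k))"
    using sums_single[of k "\<lambda>_. lam k * (x \<bullet> e k)"] by simp
  ultimately show ?thesis by (rule sums_unique2)
qed

definition mode_force :: "(real \<Rightarrow> 'h) \<Rightarrow> (real \<Rightarrow> 'h \<times> 'm) \<Rightarrow> nat \<Rightarrow> real \<Rightarrow> real" where
  "mode_force \<psi> z k t = B (fst (z t)) \<bullet> e k + lam k * (\<psi> t \<bullet> e k)"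

text \<open>The working form of a mild solution: scalar oscillators coupled only through B. For a
  continuous path and a square integrable control, \<open>mild_iff_mode_sol\<close> identifies the
  two notions.\<close>

definition mode_sol :: "real \<Rightarrow> real \<Rightarrow> (real \<Rightarrow> 'h) \<Rightarrow> (real \<Rightarrow> 'h \<times> 'm) \<Rightarrow> bool" where
  "mode_sol a b \<psi> z \<longleftrightarrow>
     (\<forall>k. oscillator \<mu> (\<alpha> k) a b (\<lambda>t. um k (z t)) (\<lambda>t. vm k (z t)) (mode_force \<psi> z k))"

text \<open>Duhamel's formula for one mode with arbitrary initial values x and y. The derivative of
  the convolution with the position of \<open>E2\<close> has no boundary term, since that position
  is 0 at time 0; for the velocity the boundary term is f/\<mu>, the forcing in the equation for
  v.\<close>

lemma mode_convolution:
  assumes "set_integrable lborel {a..b} f"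
  shows "oscillator \<mu> (\<alpha> k) a b
     (\<lambda>t. x * um k (E1 k (t - a)) + y * um k (E2 k (t - a)) + (LINT s:{a..t}|lborel. um k (E2 k (t - s)) * (f s / \<mu>)))
     (\<lambda>t. x * vm k (E1 k (t - a)) + y * vm k (E2 k (t - a)) + (LINT s:{a..t}|lborel. vm k (E2 k (t - s)) * (f s / \<mu>))) f"
proof -
  let ?g = "\<lambda>t. f t / \<mu>"
  have g: "set_integrable lborel {a..b} ?g" using assms by simp
  note E1o = E_osc(1)[of k "b - a", unfolded oscillator_def] and E2o = E_osc(2)[of k "b - a", unfolded oscillator_def]
  note cont = primitive_on_continuous[OF conjunct1[OF E2o]] primitive_on_continuous[OF conjunct2[OF E2o]]
  let ?U = "\<lambda>t. LINT s:{a..t}|lborel. um k (E2 k (t - s)) * ?g s" and ?V = "\<lambda>t. LINT s:{a..t}|lborel. vm k (E2 k (t - s)) * ?g s"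
  have U: "primitive_on a b ?U ?V"
    using primitive_on_convolution[OF g conjunct1[OF E2o] cont(2)] by (simp add: E_zero)
  have V: "primitive_on a b ?V (\<lambda>t. (- \<alpha> k * ?U t - ?V t + f t) / \<mu>)"
  proof (rule primitive_on_cong)
    show "primitive_on a b ?V (\<lambda>t. vm k (E2 k 0) * ?g t +
       (LINT s:{a..t}|lborel. (- \<alpha> k * um k (E2 k (t - s)) - vm k (E2 k (t - s)) + 0) / \<mu> * ?g s))"
      by (rule primitive_on_convolution[OF g conjunct2[OF E2o]]) (intro continuous_intros cont; use \<mu>_pos in simp)
    fix t assume t: "t \<in> {a..b}"
    have int: "set_integrable lborel {a..t} (\<lambda>s. h (t - s) * ?g s)" if h: "continuous_on {0..b - a} h" for h
    proof -
      have "continuous_on {a..t} (\<lambda>s. h (t - s))"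
        by (rule continuous_on_compose2[OF h]) (use t in \<open>auto intro!: continuous_intros\<close>)
      then obtain C where C: "C \<ge> 0" "\<And>s. a \<le> s \<Longrightarrow> s \<le> t \<Longrightarrow> \<bar>h (t - s)\<bar> \<le> C"
        using continuous_on_Icc_bounded by blast
      have gt: "set_integrable lborel {a..t} ?g" using set_integrable_subinterval[OF g, of a t] t by simp
      show ?thesis
      proof (rule set_integrable_bound[where f = "\<lambda>s. C * ?g s"])
        show "set_integrable lborel {a..t} (\<lambda>s. C * ?g s)" using gt by (rule set_integrable_mult_right)
        have "(\<lambda>s. (indicator {a..t} s *\<^sub>R h (t - s)) * (indicator {a..t} s *\<^sub>R ?g s)) \<in> borel_measurable lborel"
          using gt set_measurable_continuous_on[OF _ \<open>continuous_on {a..t} (\<lambda>s. h (t - s))\<close>]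
          unfolding set_integrable_def set_borel_measurable_def by (intro borel_measurable_times) auto
        moreover have "(\<lambda>s. (indicator {a..t} s *\<^sub>R h (t - s)) * (indicator {a..t} s *\<^sub>R ?g s)) = (\<lambda>s. indicator {a..t} s *\<^sub>R (h (t - s) * ?g s))"
          by (auto simp: indicator_def)
        ultimately show "set_borel_measurable lborel {a..t} (\<lambda>s. h (t - s) * ?g s)"
          unfolding set_borel_measurable_def by metis
        show "AE x in lborel. x \<in> {a..t} \<longrightarrow> norm (h (t - x) * ?g x) \<le> norm (C * ?g x)"
          using C by (intro AE_I2) (auto simp: abs_mult intro!: mult_right_mono divide_right_mono)
      qed
    qed
    have "(LINT s:{a..t}|lborel. (- \<alpha> k * um k (E2 k (t - s)) - vm k (E2 k (t - s)) + 0) / \<mu> * ?g s)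
        = (LINT s:{a..t}|lborel. (- \<alpha> k / \<mu>) * (um k (E2 k (t - s)) * ?g s) - (1 / \<mu>) * (vm k (E2 k (t - s)) * ?g s))"
      by (intro set_lebesgue_integral_cong) (auto simp: diff_divide_distrib algebra_simps)
    also have "\<dots> = (- \<alpha> k / \<mu>) * ?U t - (1 / \<mu>) * ?V t"
      by (subst set_integral_diff(2); (intro set_integrable_mult_right int cont)?) (simp only: set_integral_mult_right)
    finally show "vm k (E2 k 0) * ?g t +
       (LINT s:{a..t}|lborel. (- \<alpha> k * um k (E2 k (t - s)) - vm k (E2 k (t - s)) + 0) / \<mu> * ?g s) = (- \<alpha> k * ?U t - ?V t + f t) / \<mu>"
      using \<mu>_pos by (simp add: E_zero field_simps)
  qed simp
  have 1: "oscillator \<mu> (\<alpha> k) a b ?U ?V f" using U V by (simp add: oscillator_def)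
  have "oscillator \<mu> (\<alpha> k) 0 (b - a) (\<lambda>t. x * um k (E1 k t) + y * um k (E2 k t)) (\<lambda>t. x * vm k (E1 k t) + y * vm k (E2 k t)) (\<lambda>_. 0)"
    using oscillator_cmult_add[OF E_osc(1)[of k "b - a"] E_osc(2)[of k "b - a"], of x y] by simp
  then have 2: "oscillator \<mu> (\<alpha> k) a b (\<lambda>t. x * um k (E1 k (t - a)) + y * um k (E2 k (t - a)))
      (\<lambda>t. x * vm k (E1 k (t - a)) + y * vm k (E2 k (t - a))) (\<lambda>_. 0)"
    unfolding oscillator_def using primitive_on_shift[where c = "-a" and a = 0 and b = "b - a"] by fastforce
  from oscillator_cmult_add[OF 2 1, of 1 1] show ?thesis by simp
qed

lemma Q_op_bounded_linear: "bounded_linear (Q_op \<iota> Q \<mu>)"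
  unfolding Q_op_def
  by (intro bounded_linear_const_scaleR bounded_linear_Pair bounded_linear_zero
      bounded_linear_compose[OF \<iota>_bounded_linear Q_linear])

lemma op_modes:
  "um k (B_op \<iota> B \<mu> p) = 0" "vm k (B_op \<iota> B \<mu> p) = (B (fst p) \<bullet> e k) / \<mu>"
  "um k (Q_op \<iota> Q \<mu> x) = 0" "vm k (Q_op \<iota> Q \<mu> x) = lam k * (x \<bullet> e k) / \<mu>"
  using \<alpha>_pos[of k] by (auto simp: B_op_def Q_op_def um_def vm_def \<iota>_inner Q_modes)

text \<open>Coordinate functionals are bounded and linear, so they pass through the two
  vector-valued integrals once these are known to exist. \<open>B_op\<close> and \<open>Q_op\<close>
  produce vectors with zero first component, hence only the kernel \<open>E2\<close> appears in the
  integrals.\<close>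

lemma mild_modes:
  assumes z: "continuous_on {a..b} z" and \<psi>[measurable]: "\<psi> \<in> borel_measurable borel"
    and \<psi>2: "sq_integral {a..b} \<psi> < \<infinity>" and t: "t \<in> {a..b}"
  defines "R \<equiv> S \<mu> (t - a) (z a) + (LINT s:{a..t}|lborel. S \<mu> (t - s) (B_op \<iota> B \<mu> (z s)))
        + (LINT s:{a..t}|lborel. S \<mu> (t - s) (Q_op \<iota> Q \<mu> (\<psi> s)))"
  shows "um k R = um k (z a) * um k (E1 k (t - a)) + vm k (z a) * um k (E2 k (t - a))
      + (LINT s:{a..t}|lborel. um k (E2 k (t - s)) * (mode_force \<psi> z k s / \<mu>))"
    "vm k R = um k (z a) * vm k (E1 k (t - a)) + vm k (z a) * vm k (E2 k (t - a))
      + (LINT s:{a..t}|lborel. vm k (E2 k (t - s)) * (mode_force \<psi> z k s / \<mu>))"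
proof -
  have zt: "continuous_on {a..t} z" using z t by (auto intro: continuous_on_subset)
  have cB: "continuous_on {a..t} (\<lambda>s. B_op \<iota> B \<mu> (z s))"
  proof -
    have "continuous_on {a..t} (\<lambda>s. \<iota> (B (fst (z s))))"
      by (intro bounded_linear.continuous_on[OF \<iota>_bounded_linear] continuous_on_compose2[OF B_continuous]
          continuous_intros zt) auto
    then show ?thesis unfolding B_op_def by (intro continuous_intros)
  qed
  have iB: "set_integrable lborel {a..t} (\<lambda>s. S \<mu> (t - s) (B_op \<iota> B \<mu> (z s)))"
    by (intro borel_integrable_atLeastAtMost' C0_continuous_on[OF S_C0] cB continuous_intros) auto
  have iQ: "set_integrable lborel {a..t} (\<lambda>s. S \<mu> (t - s) (Q_op \<iota> Q \<mu> (\<psi> s)))"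
  proof -
    obtain M where M: "M \<ge> 0" "\<And>r x. 0 \<le> r \<Longrightarrow> r \<le> b - a \<Longrightarrow> norm (S \<mu> r x) \<le> M * norm x"
      using C0_bounded[OF S_C0, of "b - a"] by auto
    obtain K where K: "\<And>x. norm (Q_op \<iota> Q \<mu> x) \<le> norm x * K" "K \<ge> 0"
      using bounded_linear.nonneg_bounded[OF Q_op_bounded_linear] by blast
    have \<psi>i: "set_integrable lborel {a..t} \<psi>"
      using set_integrable_subinterval[OF L2_Icc_integrable[OF \<psi> \<psi>2], of a t] t by auto
    then have "set_integrable lborel {a..t} (\<lambda>s. (M * K) *\<^sub>R \<psi> s)" by (rule set_integrable_scaleR_right)
    then show ?thesis
    proof (rule set_integrable_bound)
      \<comment> \<open>Replacing t - s by its positive part makes the map continuous on the whole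
        product space, so its composition with the measurable control is measurable; on the interval
        of integration nothing changes.\<close>
      let ?h = "\<lambda>(s, x). S \<mu> (max (t - s) 0) (Q_op \<iota> Q \<mu> x)"
      have "continuous_on UNIV ?h"
        unfolding case_prod_beta
        by (intro C0_continuous_on[OF S_C0] bounded_linear.continuous_on[OF Q_op_bounded_linear] continuous_intros) auto
      then have [measurable]: "?h \<in> borel_measurable borel" by (rule borel_measurable_continuous_onI)
      have "(\<lambda>s. (s, \<psi> s)) \<in> borel_measurable borel" by (intro borel_measurable_Pair) measurable
      then have "(\<lambda>s. ?h (s, \<psi> s)) \<in> borel_measurable borel" by (rule measurable_compose) measurable
      then have "(\<lambda>s. indicator {a..t} s *\<^sub>R ?h (s, \<psi> s)) \<in> borel_measurable borel" by measurable
      moreover have "(\<lambda>s. indicator {a..t} s *\<^sub>R ?h (s, \<psi> s)) = (\<lambda>s. indicator {a..t} s *\<^sub>R S \<mu> (t - s) (Q_op \<iota> Q \<mu> (\<psi> s)))"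
        by (auto simp: indicator_def max_def fun_eq_iff)
      ultimately show "set_borel_measurable lborel {a..t} (\<lambda>s. S \<mu> (t - s) (Q_op \<iota> Q \<mu> (\<psi> s)))"
        unfolding set_borel_measurable_def by simp
      show "AE x in lborel. x \<in> {a..t} \<longrightarrow> norm (S \<mu> (t - x) (Q_op \<iota> Q \<mu> (\<psi> x))) \<le> norm ((M * K) *\<^sub>R \<psi> x)"
      proof (intro AE_I2 impI)
        fix x assume "x \<in> {a..t}"
        then have "norm (S \<mu> (t - x) (Q_op \<iota> Q \<mu> (\<psi> x))) \<le> M * norm (Q_op \<iota> Q \<mu> (\<psi> x))" using M t by auto
        also have "\<dots> \<le> M * (norm (\<psi> x) * K)" using K M by (intro mult_left_mono) auto
        finally show "norm (S \<mu> (t - x) (Q_op \<iota> Q \<mu> (\<psi> x))) \<le> norm ((M * K) *\<^sub>R \<psi> x)"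
          using M K by (simp add: ac_simps)
      qed
    qed
  qed
  have main: "g R = g (S \<mu> (t - a) (z a)) + (LINT s:{a..t}|lborel. h (t - s) * (mode_force \<psi> z k s / \<mu>))"
    if g: "bounded_linear g" and gh: "\<And>s p. s \<in> {a..t} \<Longrightarrow> um k p = 0 \<Longrightarrow> g (S \<mu> (t - s) p) = vm k p * h (t - s)"
    for g h
  proof -
    interpret g: bounded_linear g by fact
    have "g R = g (S \<mu> (t - a) (z a)) + (LINT s:{a..t}|lborel. g (S \<mu> (t - s) (B_op \<iota> B \<mu> (z s))))
        + (LINT s:{a..t}|lborel. g (S \<mu> (t - s) (Q_op \<iota> Q \<mu> (\<psi> s))))"
      unfolding R_def by (simp add: g.add bounded_linear_set_integral(1)[OF g iB] bounded_linear_set_integral(1)[OF g iQ])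
    also have "\<dots> = g (S \<mu> (t - a) (z a)) + (LINT s:{a..t}|lborel. g (S \<mu> (t - s) (B_op \<iota> B \<mu> (z s)))
        + g (S \<mu> (t - s) (Q_op \<iota> Q \<mu> (\<psi> s))))"
      using set_integral_add(2)[OF bounded_linear_set_integral(2)[OF g iB] bounded_linear_set_integral(2)[OF g iQ]] by simp
    also have "(LINT s:{a..t}|lborel. g (S \<mu> (t - s) (B_op \<iota> B \<mu> (z s))) + g (S \<mu> (t - s) (Q_op \<iota> Q \<mu> (\<psi> s))))
        = (LINT s:{a..t}|lborel. h (t - s) * (mode_force \<psi> z k s / \<mu>))"
      by (intro set_lebesgue_integral_cong)
        (auto simp: gh op_modes mode_force_def algebra_simps add_divide_distrib)
    finally show ?thesis .
  qed
  show "um k R = um k (z a) * um k (E1 k (t - a)) + vm k (z a) * um k (E2 k (t - a))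
      + (LINT s:{a..t}|lborel. um k (E2 k (t - s)) * (mode_force \<psi> z k s / \<mu>))"
    using main[OF um_bounded_linear, of k "\<lambda>s. um k (E2 k s)"] t by (simp add: S_modes)
  show "vm k R = um k (z a) * vm k (E1 k (t - a)) + vm k (z a) * vm k (E2 k (t - a))
      + (LINT s:{a..t}|lborel. vm k (E2 k (t - s)) * (mode_force \<psi> z k s / \<mu>))"
    using main[OF vm_bounded_linear, of k "\<lambda>s. vm k (E2 k s)"] t by (simp add: S_modes)
qed

lemma mode_force_integrable:
  assumes z: "continuous_on {a..b} z" and \<psi>[measurable]: "\<psi> \<in> borel_measurable borel"
    and \<psi>2: "sq_integral {a..b} \<psi> < \<infinity>"
  shows "set_integrable lborel {a..b} (mode_force \<psi> z k)"
proof -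
  have "continuous_on {a..b} (\<lambda>s. B (fst (z s)) \<bullet> e k)"
    by (intro continuous_intros continuous_on_compose2[OF B_continuous] z) auto
  then have "set_integrable lborel {a..b} (\<lambda>s. B (fst (z s)) \<bullet> e k)"
    by (rule borel_integrable_atLeastAtMost')
  moreover have "set_integrable lborel {a..b} (\<lambda>s. lam k * (\<psi> s \<bullet> e k))"
    using bounded_linear_set_integral(2)[OF bounded_linear_inner_left L2_Icc_integrable[OF \<psi> \<psi>2]]
    by (rule set_integrable_mult_right)
  ultimately show ?thesis unfolding mode_force_def by (rule set_integral_add(1))
qed

text \<open>The forcing is frozen along z. The right side R of the mild equation then solves the
  linear oscillators with this forcing and starts at \<open>z a\<close>, so z solves the same
  oscillators if and only if z = R: one direction substitutes, the other uses uniqueness mode by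
  mode.\<close>

lemma mild_iff_mode_sol:
  assumes ab: "a \<le> b" and z: "continuous_on {a..b} z" and \<psi>: "\<psi> \<in> borel_measurable borel"
    and \<psi>2: "sq_integral {a..b} \<psi> < \<infinity>"
  shows "is_mild_solution S \<iota> B Q \<mu> a b \<psi> z \<longleftrightarrow> mode_sol a b \<psi> z"
proof -
  define R where "R t = S \<mu> (t - a) (z a) + (LINT s:{a..t}|lborel. S \<mu> (t - s) (B_op \<iota> B \<mu> (z s)))
        + (LINT s:{a..t}|lborel. S \<mu> (t - s) (Q_op \<iota> Q \<mu> (\<psi> s)))" for t
  note R_modes = mild_modes[OF z \<psi> \<psi>2, folded R_def]
  have R_osc: "oscillator \<mu> (\<alpha> k) a b (\<lambda>t. um k (R t)) (\<lambda>t. vm k (R t)) (mode_force \<psi> z k)" for k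
  proof -
    note osc = mode_convolution[OF mode_force_integrable[OF z \<psi> \<psi>2], of k "um k (z a)" "vm k (z a)", unfolded oscillator_def]
    show ?thesis unfolding oscillator_def
    proof
      show "primitive_on a b (\<lambda>t. um k (R t)) (\<lambda>t. vm k (R t))"
        by (rule primitive_on_cong[OF conjunct1[OF osc]]) (simp_all only: R_modes)
      show "primitive_on a b (\<lambda>t. vm k (R t)) (\<lambda>t. (- \<alpha> k * um k (R t) - vm k (R t) + mode_force \<psi> z k t) / \<mu>)"
        by (rule primitive_on_cong[OF conjunct2[OF osc]]) (simp_all only: R_modes)
    qed
  qed
  have Ra: "R a = z a" unfolding R_def by (simp only: set_integral_zero_length C0_zero[OF S_C0] add_0_right diff_self)
  show ?thesis
  proof
    assume "is_mild_solution S \<iota> B Q \<mu> a b \<psi> z"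
    then have zR: "z t = R t" if "t \<in> {a..b}" for t using that unfolding is_mild_solution_def R_def by blast
    show "mode_sol a b \<psi> z"
      unfolding mode_sol_def oscillator_def
    proof (intro allI conjI)
      fix k
      show "primitive_on a b (\<lambda>t. um k (z t)) (\<lambda>t. vm k (z t))"
        by (rule primitive_on_cong[OF conjunct1[OF R_osc[of k, unfolded oscillator_def]]]) (simp_all add: zR)
      show "primitive_on a b (\<lambda>t. vm k (z t)) (\<lambda>t. (- \<alpha> k * um k (z t) - vm k (z t) + mode_force \<psi> z k t) / \<mu>)"
        by (rule primitive_on_cong[OF conjunct2[OF R_osc[of k, unfolded oscillator_def]]]) (simp_all add: zR)
    qed
  next
    assume ms: "mode_sol a b \<psi> z"
    have "z t = R t" if t: "t \<in> {a..b}" for t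
    proof (rule modes_eqI)
      fix k
      have osc: "oscillator \<mu> (\<alpha> k) a b (\<lambda>t. um k (z t)) (\<lambda>t. vm k (z t)) (mode_force \<psi> z k)"
        using ms by (simp add: mode_sol_def)
      show "um k (z t) = um k (R t)"
        by (rule oscillator_unique(1)[OF osc R_osc \<mu>_pos \<alpha>_pos]) (use t in \<open>auto simp: Ra\<close>)
      show "vm k (z t) = vm k (R t)"
        by (rule oscillator_unique(2)[OF osc R_osc \<mu>_pos \<alpha>_pos]) (use t in \<open>auto simp: Ra\<close>)
    qed
    then show "is_mild_solution S \<iota> B Q \<mu> a b \<psi> z" unfolding is_mild_solution_def R_def by blast
  qed
qed

end

subsection \<open>Energy estimates\<close>

lemma borel_measurable_ennreal_indicator:
  fixes g :: "real \<Rightarrow> real"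
  assumes "continuous_on A g" "A \<in> sets borel"
  shows "(\<lambda>t. ennreal (g t) * indicator A t) \<in> borel_measurable lborel"
proof -
  have "(\<lambda>t. ennreal (indicator A t *\<^sub>R g t)) \<in> borel_measurable lborel"
    using set_measurable_continuous_on[OF assms(2,1)] by (simp add: set_borel_measurable_def)
  moreover have "(\<lambda>t. ennreal (indicator A t *\<^sub>R g t)) = (\<lambda>t. ennreal (g t) * indicator A t)"
    by (auto simp: indicator_def)
  ultimately show ?thesis by metis
qed

lemma ennreal_suminf_bounded:
  fixes f :: "nat \<Rightarrow> ennreal"
  assumes "\<And>n. (\<Sum>k<n. f k) \<le> C"
  shows "(\<Sum>k. f k) \<le> C"
  unfolding suminf_eq_SUP by (rule SUP_least) (rule assms)

lemma ennreal_sum_le_suminf: "(\<Sum>k<n. f k) \<le> (\<Sum>k. f k :: ennreal)"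
  unfolding suminf_eq_SUP by (rule SUP_upper) simp

lemma nn_integral_half_line_le:
  assumes [measurable]: "(\<lambda>t. f t * indicator {..0} t) \<in> borel_measurable lborel"
    and le: "\<And>T. T > 0 \<Longrightarrow> (\<integral>\<^sup>+t\<in>{-T..0}. f t \<partial>lborel) \<le> C"
  shows "(\<integral>\<^sup>+t\<in>{..0::real}. f t \<partial>lborel) \<le> (C::ennreal)"
proof -
  let ?g = "\<lambda>n::nat. \<lambda>t. f t * indicator {..0} t * indicator {-real (Suc n)..} t"
  have eq: "(\<integral>\<^sup>+t\<in>{..0}. f t \<partial>lborel) = (\<integral>\<^sup>+t. (SUP n. ?g n t) \<partial>lborel)"
  proof (rule nn_integral_cong)
    fix t :: real
    obtain m :: nat where "- t \<le> real m" using real_arch_simple by blast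
    then have "?g m t = f t * indicator {..0} t" by (auto simp: indicator_def)
    then have "f t * indicator {..0} t \<le> (SUP n. ?g n t)"
      using SUP_upper[of m UNIV "\<lambda>n. ?g n t"] by simp
    moreover have "(SUP n. ?g n t) \<le> f t * indicator {..0} t" by (rule SUP_least) (auto simp: indicator_def)
    ultimately show "f t * indicator {..0} t = (SUP n. ?g n t)" by (rule antisym)
  qed
  have "incseq ?g" by (auto simp: incseq_def le_fun_def indicator_def)
  then have "(\<integral>\<^sup>+t. (SUP n. ?g n t) \<partial>lborel) = (SUP n. \<integral>\<^sup>+t. ?g n t \<partial>lborel)"
    by (intro nn_integral_monotone_convergence_SUP) measurable
  also have "\<dots> \<le> C"
  proof (rule SUP_least)
    fix n
    have "(\<integral>\<^sup>+t. ?g n t \<partial>lborel) = (\<integral>\<^sup>+t\<in>{-real (Suc n)..0}. f t \<partial>lborel)"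
      by (intro nn_integral_cong) (auto simp: indicator_def)
    then show "(\<integral>\<^sup>+t. ?g n t \<partial>lborel) \<le> C" using le[of "real (Suc n)"] by simp
  qed
  finally show ?thesis unfolding eq .
qed

lemma suminf_ennreal_sums:
  assumes "f sums s" "\<And>k. f k \<ge> 0" shows "(\<Sum>k. ennreal (f k)) = ennreal s"
  using suminf_ennreal_eq[OF assms(2,1)] .

context damped_wave
begin

text \<open>\<open>N2 \<delta>\<close> and \<open>W \<delta>\<close> are the squared norms of \<open>H\<^sup>\<delta>\<close> and of \<open>\<H>\<^sub>1\<^sub>+\<^sub>\<delta>\<close>, with value \<open>\<infinity>\<close> outside
  these spaces.\<close>

definition N2 :: "real \<Rightarrow> 'h \<Rightarrow> ennreal" where
  "N2 \<delta> x = (\<Sum>k. ennreal (\<alpha> k powr \<delta> * (x \<bullet> e k)\<^sup>2))"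

definition wk :: "nat \<Rightarrow> 'h \<times> 'm \<Rightarrow> real" where
  "wk k z = \<alpha> k * (um k z)\<^sup>2 + (vm k z)\<^sup>2"

definition W :: "real \<Rightarrow> 'h \<times> 'm \<Rightarrow> ennreal" where
  "W \<delta> z = (\<Sum>k. ennreal (\<alpha> k powr \<delta> * wk k z))"

section \<open>Weighted norms and the action of B and Q on them\<close>

lemma wk_nonneg: "0 \<le> wk k z"
  using \<alpha>_pos[of k] by (simp add: wk_def)

lemma Parseval_ennreal: "(\<Sum>k. ennreal ((x \<bullet> e k)\<^sup>2)) = ennreal ((norm x)\<^sup>2)"
  by (rule suminf_ennreal_sums[OF E.Parseval]) simp

lemma N2_zero: "N2 0 x = ennreal ((norm x)\<^sup>2)"
  by (simp add: N2_def Parseval_ennreal)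

lemma N2_Hsp: 
  assumes "x \<in> Hsp e \<alpha> \<delta>" shows "N2 \<delta> x = ennreal ((Hnorm e \<alpha> \<delta> x)\<^sup>2)"
proof -
  have s: "summable (\<lambda>k. \<alpha> k powr \<delta> * (x \<bullet> e k)\<^sup>2)" using assms by (simp add: Hsp_def)
  have "0 \<le> (\<Sum>k. \<alpha> k powr \<delta> * (x \<bullet> e k)\<^sup>2)" by (intro suminf_nonneg s) simp
  then show ?thesis
    unfolding N2_def Hnorm_def
    by (subst suminf_ennreal_sums[OF summable_sums[OF s]]) simp_all
qed

lemma Hsp_N2: "N2 \<delta> x < \<infinity> \<Longrightarrow> x \<in> Hsp e \<alpha> \<delta>"
  unfolding N2_def Hsp_def by (simp, intro summable_suminf_not_top) auto

lemma N2_scaleR: "N2 \<delta> (r *\<^sub>R x) = ennreal (r\<^sup>2) * N2 \<delta> x"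
  unfolding N2_def ennreal_suminf_cmult[symmetric]
  by (simp add: power_mult_distrib ennreal_mult' mult.left_commute)

lemma N2_add_le: "N2 \<delta> (x + y) \<le> 2 * N2 \<delta> x + 2 * N2 \<delta> y"
proof -
  have "N2 \<delta> (x + y) \<le> (\<Sum>k. 2 * ennreal (\<alpha> k powr \<delta> * (x \<bullet> e k)\<^sup>2) + 2 * ennreal (\<alpha> k powr \<delta> * (y \<bullet> e k)\<^sup>2))"
    unfolding N2_def
  proof (intro suminf_le allI summableI)
    fix k
    have "0 \<le> (x \<bullet> e k - y \<bullet> e k)\<^sup>2" by simp
    then have "((x + y) \<bullet> e k)\<^sup>2 \<le> 2 * (x \<bullet> e k)\<^sup>2 + 2 * (y \<bullet> e k)\<^sup>2"
      by (simp add: inner_add_left power2_eq_square algebra_simps)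
    then have "\<alpha> k powr \<delta> * ((x + y) \<bullet> e k)\<^sup>2 \<le> \<alpha> k powr \<delta> * (2 * (x \<bullet> e k)\<^sup>2 + 2 * (y \<bullet> e k)\<^sup>2)"
      by (rule mult_left_mono) simp
    then have "ennreal (\<alpha> k powr \<delta> * ((x + y) \<bullet> e k)\<^sup>2)
        \<le> ennreal (2 * (\<alpha> k powr \<delta> * (x \<bullet> e k)\<^sup>2) + 2 * (\<alpha> k powr \<delta> * (y \<bullet> e k)\<^sup>2))"
      by (intro ennreal_leI) (simp add: algebra_simps)
    then show "ennreal (\<alpha> k powr \<delta> * ((x + y) \<bullet> e k)\<^sup>2)
        \<le> 2 * ennreal (\<alpha> k powr \<delta> * (x \<bullet> e k)\<^sup>2) + 2 * ennreal (\<alpha> k powr \<delta> * (y \<bullet> e k)\<^sup>2)"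
      by (simp add: ennreal_plus ennreal_mult)
  qed
  also have "\<dots> = 2 * N2 \<delta> x + 2 * N2 \<delta> y"
    by (simp only: suminf_add[OF summableI summableI, symmetric] ennreal_suminf_cmult N2_def)
  finally show ?thesis .
qed

lemma N2_B_diff:
  assumes \<delta>: "0 \<le> \<delta>" "\<delta> \<le> 2 * \<beta>" and x: "N2 \<delta> x < \<infinity>" and y: "N2 \<delta> y < \<infinity>"
  shows "N2 \<delta> (B x - B y) \<le> ennreal ((\<alpha> 0)\<^sup>2) * N2 \<delta> (x - y)"
proof -
  note x' = Hsp_N2[OF x] and y' = Hsp_N2[OF y]
  have diff: "a - b \<in> Hsp e \<alpha> \<delta>" if "a \<in> Hsp e \<alpha> \<delta>" "b \<in> Hsp e \<alpha> \<delta>" for a b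
  proof (rule Hsp_N2)
    have "N2 \<delta> (a + (- 1) *\<^sub>R b) \<le> 2 * N2 \<delta> a + 2 * (ennreal ((- 1)\<^sup>2) * N2 \<delta> b)"
      unfolding N2_scaleR[symmetric] by (rule N2_add_le)
    also have "\<dots> < \<infinity>" using that by (simp add: N2_Hsp ennreal_mult_less_top)
    finally show "N2 \<delta> (a - b) < \<infinity>" by simp
  qed
  have "(Hnorm e \<alpha> \<delta> (B x - B y))\<^sup>2 \<le> (\<alpha> 0 * Hnorm e \<alpha> \<delta> (x - y))\<^sup>2"
  proof (rule power_mono[OF B_Hnorm[OF \<delta> x' y']])
    show "0 \<le> Hnorm e \<alpha> \<delta> (B x - B y)"
      using diff[OF B_Hsp[OF \<delta> x'] B_Hsp[OF \<delta> y']] unfolding Hnorm_def Hsp_def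
      by (intro real_sqrt_ge_zero suminf_nonneg) auto
  qed
  then show ?thesis
    by (simp add: N2_Hsp[OF diff[OF x' y']] N2_Hsp[OF diff[OF B_Hsp[OF \<delta> x'] B_Hsp[OF \<delta> y']]]
        power_mult_distrib ennreal_leI flip: ennreal_mult)
qed

lemma N2_B:
  assumes "0 \<le> \<delta>" "\<delta> \<le> 2 * \<beta>"
  shows "N2 \<delta> (B x) \<le> ennreal ((\<alpha> 0)\<^sup>2) * N2 \<delta> x"
proof (cases "N2 \<delta> x < \<infinity>")
  case True
  have "N2 \<delta> 0 < \<infinity>" by (simp add: N2_def)
  from N2_B_diff[OF assms True this] show ?thesis by (simp add: B_zero)
next
  case False
  then have "N2 \<delta> x = \<infinity>" by (metis infinity_ennreal_def less_top)
  then show ?thesis using \<alpha>_0 by (simp add: ennreal_mult_top)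
qed

lemma \<alpha>_powr_mono:
  assumes "\<delta> \<le> \<delta>'" shows "\<alpha> k powr \<delta> \<le> \<alpha> 0 powr (\<delta> - \<delta>') * \<alpha> k powr \<delta>'"
proof -
  have "\<alpha> k powr \<delta> = \<alpha> k powr (\<delta> - \<delta>') * \<alpha> k powr \<delta>'" by (simp flip: powr_add)
  also have "\<dots> \<le> \<alpha> 0 powr (\<delta> - \<delta>') * \<alpha> k powr \<delta>'"
    using \<alpha>_ge[of k] \<alpha>_0 assms by (intro mult_right_mono powr_mono2') auto
  finally show ?thesis .
qed

lemma N2_mono:
  assumes "\<delta> \<le> \<delta>'" shows "N2 \<delta> x \<le> ennreal (\<alpha> 0 powr (\<delta> - \<delta>')) * N2 \<delta>' x"
  unfolding N2_def ennreal_suminf_cmult[symmetric]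
proof (intro suminf_le allI summableI)
  fix k
  have "\<alpha> k powr \<delta> * (x \<bullet> e k)\<^sup>2 \<le> \<alpha> 0 powr (\<delta> - \<delta>') * \<alpha> k powr \<delta>' * (x \<bullet> e k)\<^sup>2"
    by (rule mult_right_mono[OF \<alpha>_powr_mono[OF assms]]) simp
  then show "ennreal (\<alpha> k powr \<delta> * (x \<bullet> e k)\<^sup>2) \<le> ennreal (\<alpha> 0 powr (\<delta> - \<delta>')) * ennreal (\<alpha> k powr \<delta>' * (x \<bullet> e k)\<^sup>2)"
    by (simp add: ennreal_leI mult.assoc flip: ennreal_mult)
qed

lemma N2_fst_le_W: "N2 (\<delta> + 1) (fst z) \<le> W \<delta> z"
  unfolding N2_def W_def
proof (intro suminf_le allI summableI ennreal_leI)
  fix k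
  have "\<alpha> k powr (\<delta> + 1) * (fst z \<bullet> e k)\<^sup>2 = \<alpha> k powr \<delta> * (\<alpha> k * (um k z)\<^sup>2)"
    using \<alpha>_pos[of k] by (simp add: powr_add um_def)
  also have "\<dots> \<le> \<alpha> k powr \<delta> * wk k z" by (intro mult_left_mono) (auto simp: wk_def)
  finally show "\<alpha> k powr (\<delta> + 1) * (fst z \<bullet> e k)\<^sup>2 \<le> \<alpha> k powr \<delta> * wk k z" .
qed

lemma W_zero: "W 0 z = (\<Sum>k. ennreal (wk k z))"
  unfolding W_def by simp

lemma mode_norm_le_wk: "(um k z)\<^sup>2 + (vm k z)\<^sup>2 / \<alpha> k \<le> (1 / \<alpha> 0) * wk k z"
proof -
  have "(um k z)\<^sup>2 + (vm k z)\<^sup>2 / \<alpha> k = (1 / \<alpha> k) * wk k z"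
    by (simp add: wk_def field_simps)
  also have "\<dots> \<le> (1 / \<alpha> 0) * wk k z"
    using \<alpha>_ge[of k] \<alpha>_0 wk_nonneg by (intro mult_right_mono divide_left_mono) (auto simp: \<alpha>_pos)
  finally show ?thesis .
qed

lemma norm_le_W: "ennreal ((norm z)\<^sup>2) \<le> ennreal (1 / \<alpha> 0) * W 0 z"
proof -
  have "ennreal ((norm z)\<^sup>2) = (\<Sum>k. ennreal ((um k z)\<^sup>2 + (vm k z)\<^sup>2 / \<alpha> k))"
    using \<alpha>_pos by (intro suminf_ennreal_sums[symmetric] norm_modes) (simp add: less_imp_le)
  also have "\<dots> \<le> (\<Sum>k. ennreal (1 / \<alpha> 0) * ennreal (wk k z))"
  proof (intro suminf_le allI summableI)
    fix k
    show "ennreal ((um k z)\<^sup>2 + (vm k z)\<^sup>2 / \<alpha> k) \<le> ennreal (1 / \<alpha> 0) * ennreal (wk k z)"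
      using ennreal_leI[OF mode_norm_le_wk[of k z]] \<alpha>_0 wk_nonneg[of k z] by (simp only: ennreal_mult zero_le_divide_1_iff less_imp_le)
  qed
  also have "\<dots> = ennreal (1 / \<alpha> 0) * W 0 z" by (simp add: W_zero)
  finally show ?thesis .
qed

lemma lam_pos: "lam k > 0"
proof -
  have "0 < (1/c) * \<alpha> k powr (- \<beta>)" using c_pos \<alpha>_pos[of k] by simp
  then show ?thesis using lam_bounds(1)[of k] by linarith
qed

text \<open>The upper bound on the eigenvalues says that Q maps H boundedly into the space of index
  \<open>2 * \<beta>\<close>. This fixes the highest index at which the control can be treated as a
  forcing.\<close>

lemma lam_sq_le: "\<delta> \<le> 2 * \<beta> \<Longrightarrow> \<alpha> k powr \<delta> * (lam k)\<^sup>2 \<le> c\<^sup>2 * \<alpha> 0 powr (\<delta> - 2 * \<beta>)"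
proof -
  assume "\<delta> \<le> 2 * \<beta>"
  have "(lam k)\<^sup>2 \<le> (c * \<alpha> k powr (- \<beta>))\<^sup>2" using lam_pos[of k] lam_bounds(2)[of k] by (intro power_mono) auto
  also have "\<dots> = c\<^sup>2 * \<alpha> k powr (- 2 * \<beta>)"
    by (simp add: power_mult_distrib powr_power mult.commute)
  finally have "\<alpha> k powr \<delta> * (lam k)\<^sup>2 \<le> \<alpha> k powr \<delta> * (c\<^sup>2 * \<alpha> k powr (- 2 * \<beta>))" by (rule mult_left_mono) simp
  also have "\<dots> = c\<^sup>2 * \<alpha> k powr (\<delta> - 2 * \<beta>)" by (simp flip: powr_add)
  also have "\<dots> \<le> c\<^sup>2 * \<alpha> 0 powr (\<delta> - 2 * \<beta>)"
    using \<alpha>_ge[of k] \<alpha>_0 \<open>\<delta> \<le> 2 * \<beta>\<close> by (intro mult_left_mono powr_mono2') auto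
  finally show ?thesis .
qed

text \<open>A bound for the squared norm of Q as a map from H to the space of index \<delta>, for
  \<delta> up to \<open>2 * \<beta>\<close>.\<close>

definition CQ where "CQ \<delta> = c\<^sup>2 * \<alpha> 0 powr (\<delta> - 2 * \<beta>)"

definition force2 where "force2 \<delta> \<psi> z t = (\<Sum>k. ennreal (\<alpha> k powr \<delta> * (mode_force \<psi> z k t)\<^sup>2))"

lemma force2_le:
  assumes "0 \<le> \<delta>" "\<delta> \<le> 2 * \<beta>"
  shows "force2 \<delta> \<psi> z t \<le> ennreal (2 * (\<alpha> 0)\<^sup>2) * N2 \<delta> (fst (z t)) + ennreal (2 * CQ \<delta>) * ennreal ((norm (\<psi> t))\<^sup>2)"
proof -
  have "force2 \<delta> \<psi> z t \<le> (\<Sum>k. 2 * ennreal (\<alpha> k powr \<delta> * (B (fst (z t)) \<bullet> e k)\<^sup>2) + ennreal (2 * CQ \<delta>) * ennreal ((\<psi> t \<bullet> e k)\<^sup>2))"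
    unfolding force2_def
  proof (intro suminf_le allI summableI)
    fix k
    have "(mode_force \<psi> z k t)\<^sup>2 \<le> 2 * (B (fst (z t)) \<bullet> e k)\<^sup>2 + 2 * (lam k)\<^sup>2 * (\<psi> t \<bullet> e k)\<^sup>2"
    proof -
      have "0 \<le> (B (fst (z t)) \<bullet> e k - lam k * (\<psi> t \<bullet> e k))\<^sup>2" by simp
      then show ?thesis by (simp add: mode_force_def power2_eq_square algebra_simps)
    qed
    then have "\<alpha> k powr \<delta> * (mode_force \<psi> z k t)\<^sup>2
       \<le> \<alpha> k powr \<delta> * (2 * (B (fst (z t)) \<bullet> e k)\<^sup>2 + 2 * (lam k)\<^sup>2 * (\<psi> t \<bullet> e k)\<^sup>2)"
      by (rule mult_left_mono) simp
    also have "\<dots> = 2 * (\<alpha> k powr \<delta> * (B (fst (z t)) \<bullet> e k)\<^sup>2) + 2 * (\<alpha> k powr \<delta> * (lam k)\<^sup>2) * (\<psi> t \<bullet> e k)\<^sup>2"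
      by (simp add: algebra_simps)
    also have "\<dots> \<le> 2 * (\<alpha> k powr \<delta> * (B (fst (z t)) \<bullet> e k)\<^sup>2) + 2 * CQ \<delta> * (\<psi> t \<bullet> e k)\<^sup>2"
      unfolding CQ_def by (intro add_left_mono mult_right_mono mult_left_mono lam_sq_le assms) auto
    finally have "ennreal (\<alpha> k powr \<delta> * (mode_force \<psi> z k t)\<^sup>2)
      \<le> ennreal (2 * (\<alpha> k powr \<delta> * (B (fst (z t)) \<bullet> e k)\<^sup>2) + 2 * CQ \<delta> * (\<psi> t \<bullet> e k)\<^sup>2)" by (rule ennreal_leI)
    also have "\<dots> = 2 * ennreal (\<alpha> k powr \<delta> * (B (fst (z t)) \<bullet> e k)\<^sup>2) + ennreal (2 * CQ \<delta>) * ennreal ((\<psi> t \<bullet> e k)\<^sup>2)"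
    proof -
      have "0 \<le> 2 * CQ \<delta>" by (simp add: CQ_def)
      then show ?thesis by (simp add: ennreal_plus ennreal_mult)
    qed
    finally show "ennreal (\<alpha> k powr \<delta> * (mode_force \<psi> z k t)\<^sup>2)
      \<le> 2 * ennreal (\<alpha> k powr \<delta> * (B (fst (z t)) \<bullet> e k)\<^sup>2) + ennreal (2 * CQ \<delta>) * ennreal ((\<psi> t \<bullet> e k)\<^sup>2)" .
  qed
  also have "\<dots> = 2 * N2 \<delta> (B (fst (z t))) + ennreal (2 * CQ \<delta>) * ennreal ((norm (\<psi> t))\<^sup>2)"
    by (simp only: suminf_add[OF summableI summableI, symmetric] ennreal_suminf_cmult N2_def Parseval_ennreal)
  also have "\<dots> \<le> 2 * (ennreal ((\<alpha> 0)\<^sup>2) * N2 \<delta> (fst (z t))) + ennreal (2 * CQ \<delta>) * ennreal ((norm (\<psi> t))\<^sup>2)"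
    by (intro add_right_mono mult_left_mono N2_B assms) auto
  also have "2 * (ennreal ((\<alpha> 0)\<^sup>2) * N2 \<delta> (fst (z t))) = ennreal (2 * (\<alpha> 0)\<^sup>2) * N2 \<delta> (fst (z t))"
    by (simp add: ennreal_mult mult.assoc)
  finally show ?thesis .
qed

text \<open>\<open>K3\<close> bounds \<open>osc_lyap\<close> from above in terms of
  \<open>wk\<close>. In \<open>KE\<close> the numerator dominates both coefficients on the right
  side of the oscillator estimate, and the minimum bounds from below the coefficients on its left
  side. None of these constants depends on k.\<close>

definition K3 where "K3 = 2 * \<mu>\<^sup>2 + 3 * \<mu> / 2 + 1 / \<alpha> 0"
definition KE where "KE = (K3 + 1 / (2 * \<alpha> 0) + 9 * \<mu> / 4) / min (min (\<mu>\<^sup>2) (3 * \<mu> / 2)) (min (1/2) \<mu>)"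

lemma K3_pos: "K3 > 0"
  unfolding K3_def using \<mu>_pos \<alpha>_0 by (intro add_nonneg_pos add_nonneg_nonneg) auto

lemma KE_pos: "KE > 0"
  unfolding KE_def using \<mu>_pos \<alpha>_0 K3_pos by (intro divide_pos_pos add_pos_pos) auto

lemma osc_lyap_le_wk: "osc_lyap \<mu> (\<alpha> k) (um k z) (vm k z) \<le> K3 * wk k z"
proof -
  have "osc_lyap \<mu> (\<alpha> k) (um k z) (vm k z) \<le> (um k z)\<^sup>2 + 2 * \<mu>\<^sup>2 * (vm k z)\<^sup>2 + 3 / 2 * \<mu> * \<alpha> k * (um k z)\<^sup>2"
    by (rule osc_lyap_upper)
  also have "\<dots> \<le> (1 / \<alpha> 0) * wk k z + 2 * \<mu>\<^sup>2 * wk k z + 3 / 2 * \<mu> * wk k z"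
  proof (intro add_mono)
    have "(um k z)\<^sup>2 \<le> (um k z)\<^sup>2 + (vm k z)\<^sup>2 / \<alpha> k" using \<alpha>_pos[of k] by simp
    then show "(um k z)\<^sup>2 \<le> (1 / \<alpha> 0) * wk k z" using mode_norm_le_wk[of k z] by linarith
    show "2 * \<mu>\<^sup>2 * (vm k z)\<^sup>2 \<le> 2 * \<mu>\<^sup>2 * wk k z"
      using \<alpha>_pos[of k] by (intro mult_left_mono) (auto simp: wk_def)
    have "3 / 2 * \<mu> * (\<alpha> k * (um k z)\<^sup>2) \<le> 3 / 2 * \<mu> * wk k z"
      using \<mu>_pos by (intro mult_left_mono) (auto simp: wk_def)
    then show "3 / 2 * \<mu> * \<alpha> k * (um k z)\<^sup>2 \<le> 3 / 2 * \<mu> * wk k z" by (simp add: mult.assoc)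
  qed
  finally show ?thesis by (simp add: K3_def algebra_simps)
qed

lemma mode_sol_osc: "mode_sol a b \<psi> z \<Longrightarrow> oscillator \<mu> (\<alpha> k) a b (\<lambda>t. um k (z t)) (\<lambda>t. vm k (z t)) (mode_force \<psi> z k)"
  by (simp add: mode_sol_def)

text \<open>Upper and lower comparison of the Lyapunov function and its dissipation with
  \<open>wk\<close> cost constants uniform in k, so the estimate may be multiplied by any weight in
  k and summed. The factor is also independent of the length of the interval.\<close>

lemma mode_energy:
  assumes ms: "mode_sol a b \<psi> z" and ab: "a \<le> b"
  shows "ennreal (wk k (z b)) + (\<integral>\<^sup>+t\<in>{a..b}. ennreal (wk k (z t)) \<partial>lborel)
    \<le> ennreal KE * (ennreal (wk k (z a)) + (\<integral>\<^sup>+t\<in>{a..b}. ennreal ((mode_force \<psi> z k t)\<^sup>2) \<partial>lborel))"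
proof -
  define m where "m = min (min (\<mu>\<^sup>2) (3 * \<mu> / 2)) (min (1/2) \<mu>)"
  define M where "M = K3 + 1 / (2 * \<alpha> 0) + 9 * \<mu> / 4"
  have m: "m > 0" using \<mu>_pos by (simp add: m_def)
  have M: "M > 0" unfolding M_def using \<mu>_pos \<alpha>_0 K3_pos by (intro add_pos_pos) auto
  let ?F = "\<integral>\<^sup>+t\<in>{a..b}. ennreal ((mode_force \<psi> z k t)\<^sup>2) \<partial>lborel"
  have "ennreal m * (ennreal (wk k (z b)) + (\<integral>\<^sup>+t\<in>{a..b}. ennreal (wk k (z t)) \<partial>lborel))
     \<le> ennreal (osc_lyap \<mu> (\<alpha> k) (um k (z b)) (vm k (z b)))
       + (\<integral>\<^sup>+t\<in>{a..b}. ennreal (\<alpha> k / 2 * (um k (z t))\<^sup>2 + \<mu> * (vm k (z t))\<^sup>2) \<partial>lborel)"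
    unfolding distrib_left
  proof (rule add_mono)
    have "m * wk k (z b) \<le> \<mu>\<^sup>2 * (vm k (z b))\<^sup>2 + 3 / 2 * \<mu> * \<alpha> k * (um k (z b))\<^sup>2"
    proof -
      have "m * (vm k (z b))\<^sup>2 \<le> \<mu>\<^sup>2 * (vm k (z b))\<^sup>2" by (intro mult_right_mono) (auto simp: m_def)
      moreover have "m * (\<alpha> k * (um k (z b))\<^sup>2) \<le> 3 * \<mu> / 2 * (\<alpha> k * (um k (z b))\<^sup>2)"
        using \<alpha>_pos[of k] by (intro mult_right_mono) (auto simp: m_def)
      ultimately show ?thesis by (simp add: wk_def algebra_simps)
    qed
    also have "\<dots> \<le> osc_lyap \<mu> (\<alpha> k) (um k (z b)) (vm k (z b))" by (rule osc_lyap_lower)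
    finally show "ennreal m * ennreal (wk k (z b)) \<le> ennreal (osc_lyap \<mu> (\<alpha> k) (um k (z b)) (vm k (z b)))"
      using m wk_nonneg by (simp add: ennreal_leI flip: ennreal_mult)
    have "ennreal m * (\<integral>\<^sup>+t\<in>{a..b}. ennreal (wk k (z t)) \<partial>lborel) = (\<integral>\<^sup>+t\<in>{a..b}. ennreal (m * wk k (z t)) \<partial>lborel)"
    proof -
      have "continuous_on {a..b} (\<lambda>t. um k (z t))" "continuous_on {a..b} (\<lambda>t. vm k (z t))"
        using mode_sol_osc[OF ms, of k] primitive_on_continuous by (auto simp: oscillator_def)
      then have "(\<lambda>t. ennreal (wk k (z t)) * indicator {a..b} t) \<in> borel_measurable lborel"
        unfolding wk_def by (intro borel_measurable_ennreal_indicator continuous_intros) auto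
      then show ?thesis
        using m wk_nonneg by (subst nn_integral_cmult[symmetric]) (auto simp: ennreal_mult mult.assoc)
    qed
    also have "\<dots> \<le> (\<integral>\<^sup>+t\<in>{a..b}. ennreal (\<alpha> k / 2 * (um k (z t))\<^sup>2 + \<mu> * (vm k (z t))\<^sup>2) \<partial>lborel)"
    proof (intro nn_integral_mono mult_right_mono ennreal_leI)
      fix t
      have "m * (vm k (z t))\<^sup>2 \<le> \<mu> * (vm k (z t))\<^sup>2" by (intro mult_right_mono) (auto simp: m_def)
      moreover have "m * (\<alpha> k * (um k (z t))\<^sup>2) \<le> 1 / 2 * (\<alpha> k * (um k (z t))\<^sup>2)"
        using \<alpha>_pos[of k] by (intro mult_right_mono) (auto simp: m_def)
      ultimately show "m * wk k (z t) \<le> \<alpha> k / 2 * (um k (z t))\<^sup>2 + \<mu> * (vm k (z t))\<^sup>2"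
        by (simp add: wk_def algebra_simps)
    qed auto
    finally show "ennreal m * (\<integral>\<^sup>+t\<in>{a..b}. ennreal (wk k (z t)) \<partial>lborel)
      \<le> (\<integral>\<^sup>+t\<in>{a..b}. ennreal (\<alpha> k / 2 * (um k (z t))\<^sup>2 + \<mu> * (vm k (z t))\<^sup>2) \<partial>lborel)" .
  qed
  also have "\<dots> \<le> ennreal (osc_lyap \<mu> (\<alpha> k) (um k (z a)) (vm k (z a))) + ennreal (1 / (2 * \<alpha> k) + 9 * \<mu> / 4) * ?F"
    by (rule oscillator_energy[OF mode_sol_osc[OF ms] \<mu>_pos \<alpha>_pos ab])
  also have "\<dots> \<le> ennreal M * ennreal (wk k (z a)) + ennreal M * ?F"
  proof (intro add_mono mult_right_mono)
    have "osc_lyap \<mu> (\<alpha> k) (um k (z a)) (vm k (z a)) \<le> K3 * wk k (z a)" by (rule osc_lyap_le_wk)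
    also have "\<dots> \<le> M * wk k (z a)"
      using \<mu>_pos \<alpha>_0 wk_nonneg by (intro mult_right_mono) (auto simp: M_def)
    finally show "ennreal (osc_lyap \<mu> (\<alpha> k) (um k (z a)) (vm k (z a))) \<le> ennreal M * ennreal (wk k (z a))"
      using M wk_nonneg by (simp add: ennreal_leI flip: ennreal_mult)
    have "1 / (2 * \<alpha> k) \<le> 1 / (2 * \<alpha> 0)" using \<alpha>_ge[of k] \<alpha>_0 \<alpha>_pos[of k] by (intro divide_left_mono) auto
    then show "ennreal (1 / (2 * \<alpha> k) + 9 * \<mu> / 4) \<le> ennreal M"
      using K3_pos by (intro ennreal_leI) (simp add: M_def)
  qed simp
  also have "\<dots> = ennreal M * (ennreal (wk k (z a)) + ?F)" by (simp add: distrib_left)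
  finally have 1: "ennreal m * (ennreal (wk k (z b)) + (\<integral>\<^sup>+t\<in>{a..b}. ennreal (wk k (z t)) \<partial>lborel))
    \<le> ennreal M * (ennreal (wk k (z a)) + ?F)" .
  have "ennreal (1 / m) * (ennreal m * (ennreal (wk k (z b)) + (\<integral>\<^sup>+t\<in>{a..b}. ennreal (wk k (z t)) \<partial>lborel)))
    \<le> ennreal (1 / m) * (ennreal M * (ennreal (wk k (z a)) + ?F))"
    by (rule mult_left_mono[OF 1]) simp
  moreover have "ennreal (1 / m) * (ennreal m * X) = X" for X
    using m by (simp add: mult.assoc[symmetric] ennreal_mult[symmetric])
  moreover have "ennreal (1 / m) * (ennreal M * X) = ennreal KE * X" for X
    using m M by (simp add: mult.assoc[symmetric] ennreal_mult[symmetric] KE_def m_def M_def)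
  ultimately show ?thesis by simp
qed

section \<open>Summation of the mode estimates\<close>

lemma mode_continuous:
  assumes "continuous_on A z"
  shows "continuous_on A (\<lambda>t. um k (z t))" "continuous_on A (\<lambda>t. vm k (z t))" "continuous_on A (\<lambda>t. wk k (z t))"
proof -
  show 1: "continuous_on A (\<lambda>t. um k (z t))" "continuous_on A (\<lambda>t. vm k (z t))"
    using bounded_linear.continuous_on[OF um_bounded_linear assms] bounded_linear.continuous_on[OF vm_bounded_linear assms] by auto
  show "continuous_on A (\<lambda>t. wk k (z t))" unfolding wk_def by (intro continuous_intros 1)
qed

lemma W_measurable:
  fixes z :: "real \<Rightarrow> 'h \<times> 'm"
  assumes "continuous_on A z" "A \<in> sets borel"
  shows "(\<lambda>t. W \<delta> (z t) * indicator A t) \<in> borel_measurable lborel"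
    "(\<lambda>t. N2 \<delta> (fst (z t)) * indicator A t) \<in> borel_measurable lborel"
    "(\<lambda>t. ennreal (\<alpha> k powr \<delta> * wk k (z t)) * indicator A t) \<in> borel_measurable lborel"
proof -
  have 1: "(\<lambda>t. ennreal (\<alpha> k powr \<delta> * wk k (z t)) * indicator A t) \<in> borel_measurable lborel" for k
    by (intro borel_measurable_ennreal_indicator continuous_intros mode_continuous assms)
  have 2: "(\<lambda>t. ennreal (\<alpha> k powr \<delta> * (fst (z t) \<bullet> e k)\<^sup>2) * indicator A t) \<in> borel_measurable lborel" for k
    by (intro borel_measurable_ennreal_indicator continuous_intros assms)
  show "(\<lambda>t. W \<delta> (z t) * indicator A t) \<in> borel_measurable lborel"
    unfolding W_def ennreal_suminf_multc[symmetric] using 1 by (rule borel_measurable_suminf_order)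
  show "(\<lambda>t. N2 \<delta> (fst (z t)) * indicator A t) \<in> borel_measurable lborel"
    unfolding N2_def ennreal_suminf_multc[symmetric] using 2 by (rule borel_measurable_suminf_order)
  show "(\<lambda>t. ennreal (\<alpha> k powr \<delta> * wk k (z t)) * indicator A t) \<in> borel_measurable lborel" by (rule 1)
qed

lemma mode_force_measurable:
  fixes z :: "real \<Rightarrow> 'h \<times> 'm"
  assumes z: "continuous_on A z" and A: "A \<in> sets borel" and [measurable]: "\<psi> \<in> borel_measurable borel"
  shows "(\<lambda>t. ennreal (r * (mode_force \<psi> z k t)\<^sup>2) * indicator A t) \<in> borel_measurable lborel"
proof -
  have "continuous_on A (\<lambda>s. B (fst (z s)) \<bullet> e k)"
    by (intro continuous_intros continuous_on_compose2[OF B_continuous] z) auto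
  then have [measurable]: "(\<lambda>s. indicator A s *\<^sub>R (B (fst (z s)) \<bullet> e k)) \<in> borel_measurable lborel"
    using set_measurable_continuous_on[OF A, of "\<lambda>s. B (fst (z s)) \<bullet> e k"] by (simp add: set_borel_measurable_def)
  have [measurable]: "A \<in> sets lborel" using A by simp
  have "(\<lambda>t. ennreal (r * (indicator A t *\<^sub>R (B (fst (z t)) \<bullet> e k) + lam k * (\<psi> t \<bullet> e k))\<^sup>2) * indicator A t) \<in> borel_measurable lborel"
    by measurable
  moreover have "(\<lambda>t. ennreal (r * (indicator A t *\<^sub>R (B (fst (z t)) \<bullet> e k) + lam k * (\<psi> t \<bullet> e k))\<^sup>2) * indicator A t)
     = (\<lambda>t. ennreal (r * (mode_force \<psi> z k t)\<^sup>2) * indicator A t)"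
    by (auto simp: indicator_def mode_force_def)
  ultimately show ?thesis by metis
qed

lemma integral_force2:
  assumes "continuous_on {a..b} z" "\<psi> \<in> borel_measurable borel"
  shows "(\<integral>\<^sup>+t\<in>{a..b}. force2 \<delta> \<psi> z t \<partial>lborel)
    = (\<Sum>k. ennreal (\<alpha> k powr \<delta>) * (\<integral>\<^sup>+t\<in>{a..b}. ennreal ((mode_force \<psi> z k t)\<^sup>2) \<partial>lborel))"
proof -
  have "(\<integral>\<^sup>+t\<in>{a..b}. force2 \<delta> \<psi> z t \<partial>lborel) = (\<Sum>k. \<integral>\<^sup>+t\<in>{a..b}. ennreal (\<alpha> k powr \<delta> * (mode_force \<psi> z k t)\<^sup>2) \<partial>lborel)"
    unfolding force2_def ennreal_suminf_multc[symmetric]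
    by (intro nn_integral_suminf mode_force_measurable assms) auto
  also have "(\<lambda>k. \<integral>\<^sup>+t\<in>{a..b}. ennreal (\<alpha> k powr \<delta> * (mode_force \<psi> z k t)\<^sup>2) \<partial>lborel)
      = (\<lambda>k. ennreal (\<alpha> k powr \<delta>) * (\<integral>\<^sup>+t\<in>{a..b}. ennreal ((mode_force \<psi> z k t)\<^sup>2) \<partial>lborel))"
  proof
    fix k
    have "(\<lambda>t. ennreal ((mode_force \<psi> z k t)\<^sup>2) * indicator {a..b} t) \<in> borel_measurable lborel"
      using mode_force_measurable[OF assms(1) _ assms(2), of 1 k] by simp
    then show "(\<integral>\<^sup>+t\<in>{a..b}. ennreal (\<alpha> k powr \<delta> * (mode_force \<psi> z k t)\<^sup>2) \<partial>lborel)
      = ennreal (\<alpha> k powr \<delta>) * (\<integral>\<^sup>+t\<in>{a..b}. ennreal ((mode_force \<psi> z k t)\<^sup>2) \<partial>lborel)"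
      by (subst nn_integral_cmult[symmetric]) (auto simp: ennreal_mult mult.assoc)
  qed
  finally show ?thesis .
qed

lemma integral_W:
  fixes z :: "real \<Rightarrow> 'h \<times> 'm"
  assumes "continuous_on A z" "A \<in> sets borel"
  shows "(\<integral>\<^sup>+t\<in>A. W \<delta> (z t) \<partial>lborel) = (\<Sum>k. ennreal (\<alpha> k powr \<delta>) * (\<integral>\<^sup>+t\<in>A. ennreal (wk k (z t)) \<partial>lborel))"
proof -
  have "(\<integral>\<^sup>+t\<in>A. W \<delta> (z t) \<partial>lborel) = (\<Sum>k. \<integral>\<^sup>+t\<in>A. ennreal (\<alpha> k powr \<delta> * wk k (z t)) \<partial>lborel)"
    unfolding W_def ennreal_suminf_multc[symmetric]
    by (intro nn_integral_suminf W_measurable assms)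
  also have "(\<lambda>k. \<integral>\<^sup>+t\<in>A. ennreal (\<alpha> k powr \<delta> * wk k (z t)) \<partial>lborel)
      = (\<lambda>k. ennreal (\<alpha> k powr \<delta>) * (\<integral>\<^sup>+t\<in>A. ennreal (wk k (z t)) \<partial>lborel))"
  proof
    fix k
    have "(\<lambda>t. ennreal (wk k (z t)) * indicator A t) \<in> borel_measurable lborel"
      by (intro borel_measurable_ennreal_indicator mode_continuous assms)
    then show "(\<integral>\<^sup>+t\<in>A. ennreal (\<alpha> k powr \<delta> * wk k (z t)) \<partial>lborel) = ennreal (\<alpha> k powr \<delta>) * (\<integral>\<^sup>+t\<in>A. ennreal (wk k (z t)) \<partial>lborel)"
      using wk_nonneg by (subst nn_integral_cmult[symmetric]) (auto simp: ennreal_mult mult.assoc)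
  qed
  finally show ?thesis .
qed

lemma W_eq: "W \<delta> z = (\<Sum>k. ennreal (\<alpha> k powr \<delta>) * ennreal (wk k z))"
  unfolding W_def using wk_nonneg by (simp add: ennreal_mult)

lemma energy_estimate:
  assumes ms: "mode_sol a b \<psi> z" and ab: "a \<le> b" and z: "continuous_on {a..b} z" and \<psi>: "\<psi> \<in> borel_measurable borel"
  shows "W \<delta> (z b) + (\<integral>\<^sup>+t\<in>{a..b}. W \<delta> (z t) \<partial>lborel)
    \<le> ennreal KE * (W \<delta> (z a) + (\<integral>\<^sup>+t\<in>{a..b}. force2 \<delta> \<psi> z t \<partial>lborel))"
proof -
  have "W \<delta> (z b) + (\<integral>\<^sup>+t\<in>{a..b}. W \<delta> (z t) \<partial>lborel)
    = (\<Sum>k. ennreal (\<alpha> k powr \<delta>) * (ennreal (wk k (z b)) + (\<integral>\<^sup>+t\<in>{a..b}. ennreal (wk k (z t)) \<partial>lborel)))"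
    unfolding integral_W[OF z borel_closed[OF closed_atLeastAtMost]]
    unfolding distrib_left W_eq by (rule suminf_add[OF summableI summableI])
  also have "\<dots> \<le> (\<Sum>k. ennreal KE * (ennreal (\<alpha> k powr \<delta>) * (ennreal (wk k (z a)) + (\<integral>\<^sup>+t\<in>{a..b}. ennreal ((mode_force \<psi> z k t)\<^sup>2) \<partial>lborel))))"
  proof (intro suminf_le allI summableI)
    fix k
    show "ennreal (\<alpha> k powr \<delta>) * (ennreal (wk k (z b)) + (\<integral>\<^sup>+t\<in>{a..b}. ennreal (wk k (z t)) \<partial>lborel))
      \<le> ennreal KE * (ennreal (\<alpha> k powr \<delta>) * (ennreal (wk k (z a)) + (\<integral>\<^sup>+t\<in>{a..b}. ennreal ((mode_force \<psi> z k t)\<^sup>2) \<partial>lborel)))"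
      using mult_left_mono[OF mode_energy[OF ms ab, of k], of "ennreal (\<alpha> k powr \<delta>)"] by (simp add: mult.left_commute)
  qed
  also have "\<dots> = ennreal KE * (W \<delta> (z a) + (\<integral>\<^sup>+t\<in>{a..b}. force2 \<delta> \<psi> z t \<partial>lborel))"
    unfolding ennreal_suminf_cmult distrib_left integral_force2[OF z \<psi>] W_eq
    by (subst suminf_add[OF summableI summableI, symmetric]) (simp add: distrib_left)
  finally show ?thesis .
qed

text \<open>Feedback through B is absorbed. Summing the oscillator estimates bounds the squared norm
  of u by \<kappa> times that of B(u) + Q \<psi>, and the forcing is at most (1 + \<eta>) \<gamma>^2
  |u|^2 + (1 + 1/\<eta>) q^2 |\<psi>|^2. As \<kappa> \<gamma>^2 < 1, a small \<eta> keeps the factor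
  \<theta> of |u|^2 below 1 and the term moves to the left. The constant does not depend on the
  interval, which permits starting times arbitrarily far back.\<close>

lemma small_gain_estimate:
  "\<exists>K1\<ge>0. \<forall>a b \<psi> z. a \<le> b \<longrightarrow> continuous_on {a..b} z \<longrightarrow> \<psi> \<in> borel_measurable borel \<longrightarrow> mode_sol a b \<psi> z \<longrightarrow>
     (\<integral>\<^sup>+t\<in>{a..b}. ennreal ((norm (fst (z t)))\<^sup>2) \<partial>lborel)
       \<le> ennreal K1 * (ennreal ((norm (z a))\<^sup>2) + sq_integral {a..b} \<psi>)"
proof -
  obtain q where q: "q > 0" "\<And>x. norm (Q x) \<le> norm x * q"
    using bounded_linear.pos_bounded[OF Q_linear] by blast
  define \<kappa> where "\<kappa> = 1 / (\<alpha> 0)\<^sup>2 + 9 * \<mu> / (2 * \<alpha> 0)"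
  have \<kappa>: "\<kappa> > 0" unfolding \<kappa>_def using \<alpha>_0 \<mu>_pos by (intro add_pos_pos) auto
  have \<kappa>\<gamma>: "\<kappa> * \<gamma>\<^sup>2 < 1" using small_gain by (simp add: \<kappa>_def)
  \<comment> \<open>With X = \<kappa> \<gamma>^2 this gives (X + 1) \<eta> = (1 - X)/2, so X (1 +
    \<eta>) stays below 1. The summand 1 in the denominator covers X = 0.\<close>
  define \<eta> where "\<eta> = (1 - \<kappa> * \<gamma>\<^sup>2) / (2 * (\<kappa> * \<gamma>\<^sup>2 + 1))"
  have \<eta>: "\<eta> > 0" unfolding \<eta>_def using \<kappa>\<gamma> \<kappa> by (intro divide_pos_pos) (auto intro: add_nonneg_pos)
  define \<theta> where "\<theta> = \<kappa> * ((1 + \<eta>) * \<gamma>\<^sup>2)"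
  have \<theta>: "0 \<le> \<theta>" "\<theta> < 1"
  proof -
    show "0 \<le> \<theta>" using \<kappa> \<eta> by (simp add: \<theta>_def)
    have p: "0 \<le> \<kappa> * \<gamma>\<^sup>2" using \<kappa> by simp
    have "(X + 1) * ((1 - X) / (2 * (X + 1))) = (1 - X) / 2" if "0 \<le> X" for X :: real
      using that by (simp add: field_simps)
    from this[OF p] have "(\<kappa> * \<gamma>\<^sup>2 + 1) * \<eta> = (1 - \<kappa> * \<gamma>\<^sup>2) / 2" by (simp only: \<eta>_def)
    then have "\<kappa> * \<gamma>\<^sup>2 * \<eta> < 1 - \<kappa> * \<gamma>\<^sup>2" using \<eta> \<kappa>\<gamma> by (simp add: algebra_simps)
    then show "\<theta> < 1" by (simp add: \<theta>_def algebra_simps)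
  qed
  define C where "C = \<kappa> * ((1 + 1 / \<eta>) * q\<^sup>2)"
  have C: "C \<ge> 0" using \<kappa> \<eta> by (simp add: C_def)
  define K1 where "K1 = (2 * K3 + C) / (1 - \<theta>)"
  have "K1 \<ge> 0" using C K3_pos \<theta> by (simp add: K1_def)
  moreover have "(\<integral>\<^sup>+t\<in>{a..b}. ennreal ((norm (fst (z t)))\<^sup>2) \<partial>lborel)
       \<le> ennreal K1 * (ennreal ((norm (z a))\<^sup>2) + sq_integral {a..b} \<psi>)"
    if ab: "a \<le> b" and z: "continuous_on {a..b} z" and \<psi>[measurable]: "\<psi> \<in> borel_measurable borel" and ms: "mode_sol a b \<psi> z" for a b \<psi> z
  proof -
    let ?X = "\<integral>\<^sup>+t\<in>{a..b}. ennreal ((norm (fst (z t)))\<^sup>2) \<partial>lborel"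
    let ?P = "\<integral>\<^sup>+t\<in>{a..b}. ennreal ((norm (\<psi> t))\<^sup>2) \<partial>lborel"
    let ?I = "\<lambda>k. \<integral>\<^sup>+t\<in>{a..b}. ennreal ((mode_force \<psi> z k t)\<^sup>2) \<partial>lborel"
    have cf: "continuous_on {a..b} (\<lambda>t. fst (z t))" using z by (intro continuous_intros)
    have Xm: "(\<lambda>t. ennreal ((norm (fst (z t)))\<^sup>2) * indicator {a..b} t) \<in> borel_measurable lborel"
      by (intro borel_measurable_ennreal_indicator continuous_intros z) auto
    have mode: "(\<integral>\<^sup>+t\<in>{a..b}. ennreal ((um k (z t))\<^sup>2) \<partial>lborel)
       \<le> ennreal (2 * K3) * ennreal ((um k (z a))\<^sup>2 + (vm k (z a))\<^sup>2 / \<alpha> k) + ennreal \<kappa> * ?I k" for k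
    proof -
      note ak = \<alpha>_pos[of k]
      have "ennreal (\<alpha> k / 2) * (\<integral>\<^sup>+t\<in>{a..b}. ennreal ((um k (z t))\<^sup>2) \<partial>lborel) = (\<integral>\<^sup>+t\<in>{a..b}. ennreal (\<alpha> k / 2 * (um k (z t))\<^sup>2) \<partial>lborel)"
      proof -
        have "(\<lambda>t. ennreal ((um k (z t))\<^sup>2) * indicator {a..b} t) \<in> borel_measurable lborel"
          by (intro borel_measurable_ennreal_indicator continuous_intros mode_continuous z) auto
        then show ?thesis using ak by (subst nn_integral_cmult[symmetric]) (auto simp: ennreal_mult[symmetric] mult.assoc[symmetric])
      qed
      also have "\<dots> \<le> (\<integral>\<^sup>+t\<in>{a..b}. ennreal (\<alpha> k / 2 * (um k (z t))\<^sup>2 + \<mu> * (vm k (z t))\<^sup>2) \<partial>lborel)"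
        using \<mu>_pos by (intro nn_integral_mono mult_right_mono ennreal_leI) auto
      also have "\<dots> \<le> ennreal (osc_lyap \<mu> (\<alpha> k) (um k (z b)) (vm k (z b))) + (\<integral>\<^sup>+t\<in>{a..b}. ennreal (\<alpha> k / 2 * (um k (z t))\<^sup>2 + \<mu> * (vm k (z t))\<^sup>2) \<partial>lborel)"
        by (rule add_increasing) auto
      also have "\<dots> \<le> ennreal (osc_lyap \<mu> (\<alpha> k) (um k (z a)) (vm k (z a))) + ennreal (1 / (2 * \<alpha> k) + 9 * \<mu> / 4) * ?I k"
        by (rule oscillator_energy[OF mode_sol_osc[OF ms] \<mu>_pos \<alpha>_pos ab])
      also have "\<dots> \<le> ennreal (K3 * wk k (z a)) + ennreal (1 / (2 * \<alpha> k) + 9 * \<mu> / 4) * ?I k"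
        by (intro add_right_mono ennreal_leI osc_lyap_le_wk)
      finally have "ennreal (2 / \<alpha> k) * (ennreal (\<alpha> k / 2) * (\<integral>\<^sup>+t\<in>{a..b}. ennreal ((um k (z t))\<^sup>2) \<partial>lborel))
        \<le> ennreal (2 / \<alpha> k) * (ennreal (K3 * wk k (z a)) + ennreal (1 / (2 * \<alpha> k) + 9 * \<mu> / 4) * ?I k)"
        by (rule mult_left_mono) simp
      also have "ennreal (2 / \<alpha> k) * (ennreal (\<alpha> k / 2) * (\<integral>\<^sup>+t\<in>{a..b}. ennreal ((um k (z t))\<^sup>2) \<partial>lborel)) = (\<integral>\<^sup>+t\<in>{a..b}. ennreal ((um k (z t))\<^sup>2) \<partial>lborel)"
        using ak by (simp add: mult.assoc[symmetric] ennreal_mult[symmetric])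
      also have "ennreal (2 / \<alpha> k) * (ennreal (K3 * wk k (z a)) + ennreal (1 / (2 * \<alpha> k) + 9 * \<mu> / 4) * ?I k)
        = ennreal (2 / \<alpha> k * (K3 * wk k (z a))) + ennreal (2 / \<alpha> k * (1 / (2 * \<alpha> k) + 9 * \<mu> / 4)) * ?I k"
      proof -
        have "0 \<le> 2 / \<alpha> k" "0 \<le> K3 * wk k (z a)" "0 \<le> 1 / (2 * \<alpha> k) + 9 * \<mu> / 4"
          using ak K3_pos wk_nonneg \<mu>_pos by auto
        then show ?thesis by (simp only: ennreal_mult distrib_left[of "ennreal (2 / \<alpha> k)"] mult.assoc)
      qed
      also have "\<dots> \<le> ennreal (2 * K3) * ennreal ((um k (z a))\<^sup>2 + (vm k (z a))\<^sup>2 / \<alpha> k) + ennreal \<kappa> * ?I k"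
      proof (intro add_mono mult_right_mono ennreal_leI)
        \<comment> \<open>Dividing by \<alpha>/2 turns the energy of the mode into its contribution
          to the norm of \<open>'h \<times> 'm\<close>. Therefore the starting point enters through
          \<open>norm (z a)\<close>, the only norm known to be small far in the past.\<close>
        have "2 / \<alpha> k * (K3 * wk k (z a)) = 2 * K3 * ((um k (z a))\<^sup>2 + (vm k (z a))\<^sup>2 / \<alpha> k)"
          using ak by (simp add: wk_def field_simps)
        moreover have "0 \<le> 2 * K3" "0 \<le> (um k (z a))\<^sup>2 + (vm k (z a))\<^sup>2 / \<alpha> k" using K3_pos ak by auto
        ultimately show "ennreal (2 / \<alpha> k * (K3 * wk k (z a))) \<le> ennreal (2 * K3) * ennreal ((um k (z a))\<^sup>2 + (vm k (z a))\<^sup>2 / \<alpha> k)"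
          by (simp only: ennreal_mult order_refl)
        have "2 / \<alpha> k * (1 / (2 * \<alpha> k) + 9 * \<mu> / 4) = 1 / (\<alpha> k)\<^sup>2 + 9 * \<mu> / (2 * \<alpha> k)"
          by (simp add: field_simps power2_eq_square)
        also have "\<dots> \<le> \<kappa>"
          unfolding \<kappa>_def using \<alpha>_0 \<alpha>_ge[of k] \<mu>_pos ak
          by (intro add_mono divide_left_mono power_mono mult_left_mono) auto
        finally show "2 / \<alpha> k * (1 / (2 * \<alpha> k) + 9 * \<mu> / 4) \<le> \<kappa>" .
      qed auto
      finally show ?thesis .
    qed
    have "?X = (\<integral>\<^sup>+t. (\<Sum>k. ennreal ((um k (z t))\<^sup>2) * indicator {a..b} t) \<partial>lborel)"
    proof (intro nn_integral_cong)
      fix t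
      have "ennreal ((norm (fst (z t)))\<^sup>2) = (\<Sum>k. ennreal ((um k (z t))\<^sup>2))"
        by (simp only: um_def Parseval_ennreal)
      then show "ennreal ((norm (fst (z t)))\<^sup>2) * indicator {a..b} t = (\<Sum>k. ennreal ((um k (z t))\<^sup>2) * indicator {a..b} t)"
        by simp
    qed
    also have "\<dots> = (\<Sum>k. \<integral>\<^sup>+t\<in>{a..b}. ennreal ((um k (z t))\<^sup>2) \<partial>lborel)"
      by (intro nn_integral_suminf borel_measurable_ennreal_indicator continuous_intros mode_continuous z) auto
    also have "\<dots> \<le> (\<Sum>k. ennreal (2 * K3) * ennreal ((um k (z a))\<^sup>2 + (vm k (z a))\<^sup>2 / \<alpha> k) + ennreal \<kappa> * ?I k)"
      by (intro suminf_le allI summableI mode)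
    also have "\<dots> = ennreal (2 * K3) * ennreal ((norm (z a))\<^sup>2) + ennreal \<kappa> * (\<integral>\<^sup>+t\<in>{a..b}. force2 0 \<psi> z t \<partial>lborel)"
    proof -
      have "(\<Sum>k. ennreal ((um k (z a))\<^sup>2 + (vm k (z a))\<^sup>2 / \<alpha> k)) = ennreal ((norm (z a))\<^sup>2)"
        using \<alpha>_pos by (intro suminf_ennreal_sums norm_modes) (simp add: less_imp_le)
      moreover have "(\<integral>\<^sup>+t\<in>{a..b}. force2 0 \<psi> z t \<partial>lborel) = (\<Sum>k. ?I k)"
        using integral_force2[OF z \<psi>, of 0] by simp
      ultimately show ?thesis
        by (subst suminf_add[OF summableI summableI, symmetric]) simp
    qed
    also have "\<dots> \<le> ennreal (2 * K3) * ennreal ((norm (z a))\<^sup>2) + (ennreal \<theta> * ?X + ennreal C * ?P)"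
    proof (rule add_left_mono)
      have "force2 0 \<psi> z t \<le> ennreal ((1 + \<eta>) * \<gamma>\<^sup>2) * ennreal ((norm (fst (z t)))\<^sup>2) + ennreal ((1 + 1 / \<eta>) * q\<^sup>2) * ennreal ((norm (\<psi> t))\<^sup>2)" for t
      proof -
        let ?x = "B (fst (z t))" and ?y = "Q (\<psi> t)"
        have f: "force2 0 \<psi> z t = ennreal ((norm (?x + ?y))\<^sup>2)"
          by (simp add: force2_def mode_force_def inner_add_left Q_modes flip: Parseval_ennreal)
        have "(norm (?x + ?y))\<^sup>2 \<le> (norm ?x + norm ?y)\<^sup>2" by (intro power_mono norm_triangle_ineq) auto
        also have "\<dots> \<le> (1 + \<eta>) * (norm ?x)\<^sup>2 + (1 + 1 / \<eta>) * (norm ?y)\<^sup>2"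
        proof -
          have "0 \<le> (\<eta> * norm ?x - norm ?y)\<^sup>2 / \<eta>" using \<eta> by simp
          then show ?thesis using \<eta> by (simp add: power2_eq_square field_simps)
        qed
        also have "\<dots> \<le> (1 + \<eta>) * (\<gamma>\<^sup>2 * (norm (fst (z t)))\<^sup>2) + (1 + 1 / \<eta>) * (q\<^sup>2 * (norm (\<psi> t))\<^sup>2)"
        proof (intro add_mono mult_left_mono)
          show "(norm ?x)\<^sup>2 \<le> \<gamma>\<^sup>2 * (norm (fst (z t)))\<^sup>2"
            using power_mono[OF norm_B[of "fst (z t)"], of 2] by (simp add: power_mult_distrib)
          show "(norm ?y)\<^sup>2 \<le> q\<^sup>2 * (norm (\<psi> t))\<^sup>2"
            using power_mono[OF q(2)[of "\<psi> t"], of 2] by (simp add: power_mult_distrib mult.commute)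
        qed (use \<eta> in auto)
        finally have "force2 0 \<psi> z t \<le> ennreal ((1 + \<eta>) * (\<gamma>\<^sup>2 * (norm (fst (z t)))\<^sup>2) + (1 + 1 / \<eta>) * (q\<^sup>2 * (norm (\<psi> t))\<^sup>2))"
          unfolding f by (rule ennreal_leI)
        also have "\<dots> = ennreal ((1 + \<eta>) * \<gamma>\<^sup>2) * ennreal ((norm (fst (z t)))\<^sup>2) + ennreal ((1 + 1 / \<eta>) * q\<^sup>2) * ennreal ((norm (\<psi> t))\<^sup>2)"
        proof -
          have "0 \<le> 1 + \<eta>" "0 \<le> 1 + 1 / \<eta>" using \<eta> by auto
          then show ?thesis by (simp only: ennreal_plus ennreal_mult mult_nonneg_nonneg zero_le_power2 mult.assoc)
        qed
        finally show ?thesis .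
      qed
      then have "(\<integral>\<^sup>+t\<in>{a..b}. force2 0 \<psi> z t \<partial>lborel)
        \<le> (\<integral>\<^sup>+t. ennreal ((1 + \<eta>) * \<gamma>\<^sup>2) * (ennreal ((norm (fst (z t)))\<^sup>2) * indicator {a..b} t)
            + ennreal ((1 + 1 / \<eta>) * q\<^sup>2) * (ennreal ((norm (\<psi> t))\<^sup>2) * indicator {a..b} t) \<partial>lborel)"
        by (intro nn_integral_mono) (auto simp: indicator_def)
      also have "\<dots> = ennreal ((1 + \<eta>) * \<gamma>\<^sup>2) * ?X + ennreal ((1 + 1 / \<eta>) * q\<^sup>2) * ?P"
        using Xm by (subst nn_integral_add) (auto simp: nn_integral_cmult)
      finally have "ennreal \<kappa> * (\<integral>\<^sup>+t\<in>{a..b}. force2 0 \<psi> z t \<partial>lborel)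
        \<le> ennreal \<kappa> * (ennreal ((1 + \<eta>) * \<gamma>\<^sup>2) * ?X + ennreal ((1 + 1 / \<eta>) * q\<^sup>2) * ?P)" by (rule mult_left_mono) simp
      also have "\<dots> = ennreal \<theta> * ?X + ennreal C * ?P"
      proof -
        have "0 \<le> \<kappa>" "0 \<le> (1 + \<eta>) * \<gamma>\<^sup>2" "0 \<le> (1 + 1 / \<eta>) * q\<^sup>2" using \<kappa> \<eta> by auto
        then show ?thesis unfolding \<theta>_def C_def by (simp only: ennreal_mult distrib_left mult.assoc)
      qed
      finally show "ennreal \<kappa> * (\<integral>\<^sup>+t\<in>{a..b}. force2 0 \<psi> z t \<partial>lborel) \<le> ennreal \<theta> * ?X + ennreal C * ?P" .
    qed
    finally have le: "?X \<le> ennreal (2 * K3) * ennreal ((norm (z a))\<^sup>2) + (ennreal \<theta> * ?X + ennreal C * ?P)" .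
    show ?thesis
    proof (cases "?P < \<infinity>")
      case True
      then obtain p where p: "?P = ennreal p" "p \<ge> 0" by (cases ?P) auto
      \<comment> \<open>Finiteness of the left side, by continuity on a compact interval, is what
        allows the term with \<theta> to be subtracted.\<close>
      have "set_integrable lborel {a..b} (\<lambda>t. (norm (fst (z t)))\<^sup>2)"
        by (intro borel_integrable_atLeastAtMost' continuous_intros z)
      then obtain x where x: "?X = ennreal x" "x \<ge> 0"
        using nn_set_integral_eq_LINT[of "{a..b}" "\<lambda>t. (norm (fst (z t)))\<^sup>2"]
        by (metis (no_types, lifting) ennreal_eq_0_iff linear order_refl zero_le_power2 ennreal_0)
      have "ennreal x \<le> ennreal (2 * K3 * (norm (z a))\<^sup>2 + (\<theta> * x + C * p))"
        using le x(2) p(2) K3_pos \<theta>(1) C unfolding x(1) p(1)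
        by (simp add: ennreal_plus ennreal_mult)
      then have "x \<le> 2 * K3 * (norm (z a))\<^sup>2 + (\<theta> * x + C * p)"
        using x(2) p(2) K3_pos \<theta>(1) C by (subst (asm) ennreal_le_iff) auto
      then have "(1 - \<theta>) * x \<le> (2 * K3 + C) * ((norm (z a))\<^sup>2 + p)"
      proof -
        have "0 \<le> C * (norm (z a))\<^sup>2" "0 \<le> 2 * K3 * p" using C K3_pos p by auto
        then show ?thesis using \<open>x \<le> _\<close> by (simp add: algebra_simps)
      qed
      then have "x \<le> K1 * ((norm (z a))\<^sup>2 + p)"
        using \<theta> by (simp add: K1_def field_simps)
      then have "ennreal x \<le> ennreal (K1 * ((norm (z a))\<^sup>2 + p))" by (rule ennreal_leI)
      then show ?thesis using x p \<open>K1 \<ge> 0\<close> by (simp add: ennreal_mult)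
    next
      case False
      have "K1 > 0" using C K3_pos \<theta> by (simp add: K1_def)
      moreover have "?P = \<infinity>" using False by (metis infinity_ennreal_def less_top)
      ultimately show ?thesis by (simp only:) (simp add: ennreal_mult_top)
    qed
  qed
  ultimately show ?thesis by blast
qed

end

subsection \<open>Paths of finite action starting at minus infinity\<close>

lemma set_integral_Icc_Ioo:
  fixes f g :: "real \<Rightarrow> 'x::{banach, second_countable_topology}"
  assumes "\<And>s. s \<in> {a<..<b} \<Longrightarrow> f s = g s"
  shows "(LINT s:{a..b}|lborel. f s) = (LINT s:{a..b}|lborel. g s)"
proof -
  have "(LINT s:{a..b}|lborel. f s) = (LINT s:{a<..<b}|lborel. f s)" for f :: "real \<Rightarrow> 'x"
    by (rule set_integral_discrete_difference[of "{a, b}"]) auto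
  moreover have "(LINT s:{a<..<b}|lborel. f s) = (LINT s:{a<..<b}|lborel. g s)"
    using assms by (intro set_lebesgue_integral_cong) auto
  ultimately show ?thesis by simp
qed

text \<open>\<open>cut T\<close> rises smoothly from \<open>0\<close> at time \<open>- T\<close> to \<open>1\<close> at time \<open>0\<close>; the other two are its
  derivatives.\<close>

definition cut :: "real \<Rightarrow> real \<Rightarrow> real" where "cut T t = (1 + t / T)\<^sup>2 * (3 - 2 * (1 + t / T))"
definition cut1 :: "real \<Rightarrow> real \<Rightarrow> real" where "cut1 T t = 6 * (1 + t / T) * (- t / T) / T"
definition cut2 :: "real \<Rightarrow> real \<Rightarrow> real" where "cut2 T t = (- 6 - 12 * (t / T)) / T\<^sup>2"

lemma cut_derivatives:
  assumes "T > 0"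
  shows "(cut T has_real_derivative cut1 T t) (at t within A)" "(cut1 T has_real_derivative cut2 T t) (at t within A)"
  unfolding cut_def[abs_def] cut1_def[abs_def] cut2_def
  by (rule derivative_eq_intros refl | (use assms in \<open>simp add: field_simps power2_eq_square\<close>))+

text \<open>The cut-off is the cubic r^2 (3 - 2 r) with r = 1 + t/T, which is flat at both ends.
  Hence position and velocity of the cut-off path both vanish at -T, and both are unchanged at time
  0; every derivative gains a factor 1/T.\<close>

lemma cut_values: "T > 0 \<Longrightarrow> cut T (- T) = 0" "T > 0 \<Longrightarrow> cut1 T (- T) = 0" "cut T 0 = 1" "cut1 T 0 = 0"
  by (auto simp: cut_def cut1_def)

lemma cut_continuous: "T > 0 \<Longrightarrow> continuous_on A (cut T)" "T > 0 \<Longrightarrow> continuous_on A (cut1 T)" "T > 0 \<Longrightarrow> continuous_on A (cut2 T)"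
  unfolding cut_def[abs_def] cut1_def[abs_def] cut2_def[abs_def] by (auto intro!: continuous_intros)

lemma cut_range:
  assumes "T > 0" "- T \<le> t" "t \<le> 0"
  shows "0 \<le> cut T t" "cut T t \<le> 1"
proof -
  define r where "r = 1 + t / T"
  have r: "0 \<le> r" "r \<le> 1" using assms by (auto simp: r_def field_simps)
  have c: "cut T t = r\<^sup>2 * (3 - 2 * r)" by (simp add: cut_def r_def)
  show "0 \<le> cut T t" using r unfolding c by simp
  have "1 - r\<^sup>2 * (3 - 2 * r) = (1 - r)\<^sup>2 * (1 + 2 * r)" by (simp add: power2_eq_square algebra_simps)
  also have "\<dots> \<ge> 0" using r by simp
  finally show "cut T t \<le> 1" unfolding c by simp
qed

text \<open>The added terms are the commutator of multiplication by the cut-off with \<mu> d^2/dt^2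
  + d/dt. They involve only u and v, with no second derivative of u, and become part of what the new
  control has to supply.\<close>

lemma oscillator_cut:
  assumes osc: "oscillator \<mu> \<omega> a b u v f" and T: "T > 0" and \<mu>: "\<mu> \<noteq> 0"
  shows "oscillator \<mu> \<omega> a b (\<lambda>t. cut T t * u t) (\<lambda>t. cut T t * v t + cut1 T t * u t)
    (\<lambda>t. cut T t * f t + 2 * \<mu> * cut1 T t * v t + (\<mu> * cut2 T t + cut1 T t) * u t)"
proof -
  have pu: "primitive_on a b u v" and pv: "primitive_on a b v (\<lambda>t. (- \<omega> * u t - v t + f t) / \<mu>)"
    using osc by (auto simp: oscillator_def)
  have p0: "primitive_on a b (cut T) (cut1 T)" and p1: "primitive_on a b (cut1 T) (cut2 T)"
    by (intro primitive_on_derivative cut_derivatives cut_continuous T)+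
  have "primitive_on a b (\<lambda>t. cut T t * u t) (\<lambda>t. cut T t * v t + cut1 T t * u t)"
    by (rule primitive_on_cong[OF primitive_on_mult[OF p0 pu]]) auto
  moreover have "primitive_on a b (\<lambda>t. cut T t * v t + cut1 T t * u t)
    (\<lambda>t. (- \<omega> * (cut T t * u t) - (cut T t * v t + cut1 T t * u t)
       + (cut T t * f t + 2 * \<mu> * cut1 T t * v t + (\<mu> * cut2 T t + cut1 T t) * u t)) / \<mu>)"
    by (rule primitive_on_cong[OF primitive_on_add[OF primitive_on_mult[OF p0 pv] primitive_on_mult[OF p1 pu]]])
      (use \<mu> in \<open>auto simp: field_simps\<close>)
  ultimately show ?thesis by (simp add: oscillator_def)
qed

context damped_wave
begin

lemma mode_sol_subinterval: "mode_sol a b \<psi> z \<Longrightarrow> a \<le> a' \<Longrightarrow> b' \<le> b \<Longrightarrow> mode_sol a' b' \<psi> z"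
  unfolding mode_sol_def using oscillator_subinterval by blast

lemma mode_sol_shift:
  assumes "mode_sol a b \<psi> z"
  shows "mode_sol (a - d) (b - d) (\<lambda>t. \<psi> (t + d)) (\<lambda>t. z (t + d))"
  unfolding mode_sol_def oscillator_def
proof (intro allI conjI)
  fix k
  note osc = mode_sol_osc[OF assms, of k, unfolded oscillator_def]
  show "primitive_on (a - d) (b - d) (\<lambda>t. um k (z (t + d))) (\<lambda>t. vm k (z (t + d)))"
    by (rule primitive_on_shift[OF conjunct1[OF osc]])
  show "primitive_on (a - d) (b - d) (\<lambda>t. vm k (z (t + d)))
     (\<lambda>t. (- \<alpha> k * um k (z (t + d)) - vm k (z (t + d)) + mode_force (\<lambda>t. \<psi> (t + d)) (\<lambda>t. z (t + d)) k t) / \<mu>)"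
    using primitive_on_shift[OF conjunct2[OF osc], of d] by (simp add: mode_force_def)
qed

abbreviation act where "act \<equiv> action S \<iota> B Q \<mu>"

lemma action_nonneg: "0 \<le> act a b z"
proof -
  have "0 \<le> (INF \<psi>\<in>{\<psi>\<in>controls a b. is_mild_solution S \<iota> B Q \<mu> a b \<psi> z}. ereal (LINT s:{a<..<b}|lborel. (norm (\<psi> s))\<^sup>2))"
    by (rule INF_greatest) (auto simp: set_lebesgue_integral_def intro!: integral_nonneg_AE)
  then show ?thesis unfolding action_def by (intro ereal_0_le_mult) auto
qed

text \<open>A finite bound forces the set of controls to be nonempty, as the infimum over the empty
  set is infinite; the factor 2 undoes the 1/2 in the action. Multiplication by the indicator of the
  open interval makes the control Borel measurable on the line and zero outside, as extension by 0
  will require, and changes the mild equation only on null sets.\<close>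

lemma action_less_imp_control:
  assumes ab: "a < b" and z: "continuous_on {a..b} z" and less: "act a b z < ereal r"
  obtains \<psi> where "\<psi> \<in> borel_measurable borel" "\<And>t. t \<notin> {a<..<b} \<Longrightarrow> \<psi> t = 0"
    "(\<integral>\<^sup>+t. ennreal ((norm (\<psi> t))\<^sup>2) \<partial>lborel) \<le> ennreal (2 * r)" "mode_sol a b \<psi> z"
proof -
  let ?A = "{\<psi>\<in>controls a b. is_mild_solution S \<iota> B Q \<mu> a b \<psi> z}"
  let ?f = "\<lambda>\<psi>. ereal (LINT s:{a<..<b}|lborel. (norm (\<psi> s))\<^sup>2)"
  have "Inf (?f ` ?A) < ereal (2 * r)"
  proof (rule ccontr)
    assume "\<not> ?thesis"
    then have "ereal (2 * r) \<le> Inf (?f ` ?A)" by simp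
    then have "ereal (1/2) * ereal (2 * r) \<le> act a b z" unfolding action_def by (intro ereal_mult_left_mono) auto
    then show False using less by simp
  qed
  then obtain \<psi>0 where \<psi>0: "\<psi>0 \<in> controls a b" "is_mild_solution S \<iota> B Q \<mu> a b \<psi>0 z"
    and e: "(LINT s:{a<..<b}|lborel. (norm (\<psi>0 s))\<^sup>2) < 2 * r"
    unfolding Inf_less_iff by auto
  define \<psi> where "\<psi> t = indicator {a<..<b} t *\<^sub>R \<psi>0 t" for t
  have m: "\<psi> \<in> borel_measurable borel"
    using \<psi>0(1) by (simp add: controls_def set_borel_measurable_def \<psi>_def[abs_def])
  have i: "set_integrable lborel {a<..<b} (\<lambda>s. (norm (\<psi>0 s))\<^sup>2)" using \<psi>0(1) by (simp add: controls_def)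
  have "(\<integral>\<^sup>+t. ennreal ((norm (\<psi> t))\<^sup>2) \<partial>lborel) = sq_integral {a<..<b} \<psi>0"
    by (intro nn_integral_cong) (auto simp: \<psi>_def indicator_def)
  also have "\<dots> = ennreal (LINT s:{a<..<b}|lborel. (norm (\<psi>0 s))\<^sup>2)"
    by (rule nn_set_integral_eq_LINT[OF i]) simp
  also have "\<dots> \<le> ennreal (2 * r)" using e by (intro ennreal_leI) simp
  finally have n: "(\<integral>\<^sup>+t. ennreal ((norm (\<psi> t))\<^sup>2) \<partial>lborel) \<le> ennreal (2 * r)" .
  have "sq_integral {a..b} \<psi> \<le> (\<integral>\<^sup>+t. ennreal ((norm (\<psi> t))\<^sup>2) \<partial>lborel)"
    by (intro nn_integral_mono) (auto simp: indicator_def)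
  also have "\<dots> < \<infinity>" using n by (simp add: order_le_less_trans)
  finally have fin: "sq_integral {a..b} \<psi> < \<infinity>" .
  have "is_mild_solution S \<iota> B Q \<mu> a b \<psi> z"
    unfolding is_mild_solution_def
  proof
    fix t assume t: "t \<in> {a..b}"
    have eq: "(LINT s:{a..t}|lborel. S \<mu> (t - s) (Q_op \<iota> Q \<mu> (\<psi> s))) = (LINT s:{a..t}|lborel. S \<mu> (t - s) (Q_op \<iota> Q \<mu> (\<psi>0 s)))"
      by (rule set_integral_Icc_Ioo) (use t in \<open>auto simp: \<psi>_def\<close>)
    show "z t = S \<mu> (t - a) (z a) + (LINT s:{a..t}|lborel. S \<mu> (t - s) (B_op \<iota> B \<mu> (z s)))
      + (LINT s:{a..t}|lborel. S \<mu> (t - s) (Q_op \<iota> Q \<mu> (\<psi> s)))"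
      unfolding eq by (rule bspec[OF \<psi>0(2)[unfolded is_mild_solution_def] t])
  qed
  then have "mode_sol a b \<psi> z" using mild_iff_mode_sol[OF _ z m fin] ab by simp
  moreover have "\<psi> t = 0" if "t \<notin> {a<..<b}" for t using that by (simp add: \<psi>_def)
  ultimately show ?thesis using that[OF m _ n] by blast
qed

lemma action_le_control:
  assumes ab: "a < b" and z: "continuous_on {a..b} z" and \<psi>[measurable]: "\<psi> \<in> borel_measurable borel"
    and le: "sq_integral {a..b} \<psi> \<le> ennreal r" and r: "r \<ge> 0" and ms: "mode_sol a b \<psi> z"
  shows "act a b z \<le> ereal (r / 2)"
proof -
  have fin: "sq_integral {a..b} \<psi> < \<infinity>" using le by (simp add: order_le_less_trans)
  have le': "sq_integral {a<..<b} \<psi> \<le> ennreal r"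
    by (rule order_trans[OF nn_integral_mono le]) (auto simp: indicator_def)
  have i: "set_integrable lborel {a<..<b} (\<lambda>s. (norm (\<psi> s))\<^sup>2)"
    by (rule set_integrable_if_nn_finite) (use le' in \<open>auto simp: set_borel_measurable_def order_le_less_trans\<close>)
  have "ennreal (LINT s:{a<..<b}|lborel. (norm (\<psi> s))\<^sup>2) \<le> ennreal r"
    using le' nn_set_integral_eq_LINT[OF i] by simp
  then have e: "(LINT s:{a<..<b}|lborel. (norm (\<psi> s))\<^sup>2) \<le> r" using r by (simp add: ennreal_le_iff)
  have "\<psi> \<in> controls a b" using i by (simp add: controls_def set_borel_measurable_def)
  moreover have "is_mild_solution S \<iota> B Q \<mu> a b \<psi> z"
    using mild_iff_mode_sol[OF _ z \<psi> fin] ab ms by simp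
  ultimately have "(INF \<psi>\<in>{\<psi>\<in>controls a b. is_mild_solution S \<iota> B Q \<mu> a b \<psi> z}. ereal (LINT s:{a<..<b}|lborel. (norm (\<psi> s))\<^sup>2))
    \<le> ereal r"
    using e by (intro INF_lower2[of \<psi>]) auto
  then have "act a b z \<le> ereal (1/2) * ereal r" unfolding action_def by (intro ereal_mult_left_mono) auto
  then show ?thesis by simp
qed

text \<open>The control may depend on \<open>T\<close>, so that its uniqueness is not needed.\<close>

definition tame :: "real \<Rightarrow> (real \<Rightarrow> 'h \<times> 'm) \<Rightarrow> bool" where
  "tame R z \<longleftrightarrow> continuous_on {..0} z \<and> ((\<lambda>t. norm (z t)) \<longlongrightarrow> 0) at_bot \<and>
     (\<forall>T>0. \<exists>\<psi>\<in>borel_measurable borel. sq_integral {-T..0} \<psi> \<le> ennreal R \<and> mode_sol (- T) 0 \<psi> z)"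

lemma tame_control:
  assumes "tame R z" "T > 0"
  obtains \<psi> where "\<psi> \<in> borel_measurable borel"
    "sq_integral {-T..0} \<psi> \<le> ennreal R" "mode_sol (- T) 0 \<psi> z"
  using assms unfolding tame_def by blast

text \<open>The small gain estimate is started so far back that the path has norm at most 1 there.
  The bound depends only on R, so it survives the passage to the half line.\<close>

lemma tame_L2:
  assumes "tame R z"
  shows "(\<integral>\<^sup>+t\<in>{..0}. N2 0 (fst (z t)) \<partial>lborel) < \<infinity>"
proof -
  obtain K1 where K1: "K1 \<ge> 0" "\<And>a b \<psi> z. a \<le> b \<Longrightarrow> continuous_on {a..b} z \<Longrightarrow> \<psi> \<in> borel_measurable borel \<Longrightarrow> mode_sol a b \<psi> z \<Longrightarrow>
     (\<integral>\<^sup>+t\<in>{a..b}. ennreal ((norm (fst (z t)))\<^sup>2) \<partial>lborel)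
       \<le> ennreal K1 * (ennreal ((norm (z a))\<^sup>2) + sq_integral {a..b} \<psi>)"
    using small_gain_estimate by blast
  have z: "continuous_on {..0} z" and z0: "((\<lambda>t. norm (z t)) \<longlongrightarrow> 0) at_bot" using assms by (auto simp: tame_def)
  have "\<forall>\<^sub>F t in at_bot. norm (z t) < 1" using order_tendstoD(2)[OF z0, of 1] by simp
  then obtain T0 where T0: "\<And>t. t \<le> T0 \<Longrightarrow> norm (z t) < 1" by (auto simp: eventually_at_bot_linorder)
  have "(\<integral>\<^sup>+t\<in>{..0}. N2 0 (fst (z t)) \<partial>lborel) \<le> ennreal K1 * (1 + ennreal R)"
  proof (rule nn_integral_half_line_le)
    show "(\<lambda>t. N2 0 (fst (z t)) * indicator {..0} t) \<in> borel_measurable lborel"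
      by (rule W_measurable(2)[OF z]) simp
    fix T :: real assume T: "T > 0"
    define T' where "T' = max T (- T0)"
    obtain \<psi> where \<psi>: "\<psi> \<in> borel_measurable borel" "sq_integral {-T'..0} \<psi> \<le> ennreal R" "mode_sol (- T') 0 \<psi> z"
      by (rule tame_control[OF assms, of T']) (use T in \<open>auto simp: T'_def\<close>)
    have "(\<integral>\<^sup>+t\<in>{-T..0}. N2 0 (fst (z t)) \<partial>lborel) \<le> (\<integral>\<^sup>+t\<in>{-T'..0}. ennreal ((norm (fst (z t)))\<^sup>2) \<partial>lborel)"
      unfolding N2_zero by (intro nn_integral_mono) (auto simp: indicator_def T'_def)
    also have "\<dots> \<le> ennreal K1 * (ennreal ((norm (z (- T')))\<^sup>2) + sq_integral {-T'..0} \<psi>)"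
      by (rule K1(2)) (use T \<psi> in \<open>auto simp: T'_def intro: continuous_on_subset[OF z]\<close>)
    also have "\<dots> \<le> ennreal K1 * (1 + ennreal R)"
    proof (intro mult_left_mono add_mono \<psi>(2))
      have "- T0 \<le> T'" by (simp add: T'_def)
      then have "norm (z (- T')) \<le> 1" using T0[of "- T'"] by simp
      then have "(norm (z (- T')))\<^sup>2 \<le> 1\<^sup>2" by (intro power_mono) auto
      then show "ennreal ((norm (z (- T')))\<^sup>2) \<le> 1" by (simp add: ennreal_le_1)
    qed simp
    finally show "(\<integral>\<^sup>+t\<in>{-T..0}. N2 0 (fst (z t)) \<partial>lborel) \<le> ennreal K1 * (1 + ennreal R)" .
  qed
  also have "\<dots> < \<infinity>" by (simp add: ennreal_mult_less_top)
  finally show ?thesis .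
qed

text \<open>A finite sum on the left needs only finitely many modes at the starting time, whose
  weighted sum is always finite and small far in the past. The full weighted energy at the starting
  time could be infinite.\<close>

lemma energy_partial:
  assumes ms: "mode_sol a b \<psi> z" and ab: "a \<le> b" and z: "continuous_on {a..b} z" and \<psi>: "\<psi> \<in> borel_measurable borel"
  shows "(\<Sum>k<n. ennreal (\<alpha> k powr \<delta>) * (ennreal (wk k (z b)) + (\<integral>\<^sup>+t\<in>{a..b}. ennreal (wk k (z t)) \<partial>lborel)))
    \<le> ennreal KE * (ennreal (\<Sum>k<n. \<alpha> k powr \<delta> * wk k (z a)) + (\<integral>\<^sup>+t\<in>{a..b}. force2 \<delta> \<psi> z t \<partial>lborel))"
proof -
  let ?I = "\<lambda>k. \<integral>\<^sup>+t\<in>{a..b}. ennreal ((mode_force \<psi> z k t)\<^sup>2) \<partial>lborel"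
  have "(\<Sum>k<n. ennreal (\<alpha> k powr \<delta>) * (ennreal (wk k (z b)) + (\<integral>\<^sup>+t\<in>{a..b}. ennreal (wk k (z t)) \<partial>lborel)))
    \<le> (\<Sum>k<n. ennreal KE * (ennreal (\<alpha> k powr \<delta>) * ennreal (wk k (z a)) + ennreal (\<alpha> k powr \<delta>) * ?I k))"
  proof (rule sum_mono)
    fix k
    show "ennreal (\<alpha> k powr \<delta>) * (ennreal (wk k (z b)) + (\<integral>\<^sup>+t\<in>{a..b}. ennreal (wk k (z t)) \<partial>lborel))
      \<le> ennreal KE * (ennreal (\<alpha> k powr \<delta>) * ennreal (wk k (z a)) + ennreal (\<alpha> k powr \<delta>) * ?I k)"
      using mult_left_mono[OF mode_energy[OF ms ab, of k], of "ennreal (\<alpha> k powr \<delta>)"]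
      by (simp only: mult.left_commute[of "ennreal (\<alpha> k powr \<delta>)" "ennreal KE"] distrib_left[of "ennreal (\<alpha> k powr \<delta>)"] zero_le)
  qed
  also have "\<dots> = ennreal KE * ((\<Sum>k<n. ennreal (\<alpha> k powr \<delta>) * ennreal (wk k (z a))) + (\<Sum>k<n. ennreal (\<alpha> k powr \<delta>) * ?I k))"
    by (simp only: sum_distrib_left[symmetric] sum.distrib)
  also have "(\<Sum>k<n. ennreal (\<alpha> k powr \<delta>) * ennreal (wk k (z a))) = ennreal (\<Sum>k<n. \<alpha> k powr \<delta> * wk k (z a))"
    using wk_nonneg by (simp add: ennreal_mult[symmetric] sum_ennreal)
  also have "ennreal KE * (ennreal (\<Sum>k<n. \<alpha> k powr \<delta> * wk k (z a)) + (\<Sum>k<n. ennreal (\<alpha> k powr \<delta>) * ?I k))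
     \<le> ennreal KE * (ennreal (\<Sum>k<n. \<alpha> k powr \<delta> * wk k (z a)) + (\<integral>\<^sup>+t\<in>{a..b}. force2 \<delta> \<psi> z t \<partial>lborel))"
    unfolding integral_force2[OF z \<psi>] by (intro mult_left_mono add_left_mono ennreal_sum_le_suminf) auto
  finally show ?thesis .
qed

lemma integral_force2_le:
  assumes \<delta>: "0 \<le> \<delta>" "\<delta> \<le> 2 * \<beta>" and z: "continuous_on {a..b} z" and [measurable]: "\<psi> \<in> borel_measurable borel"
  shows "(\<integral>\<^sup>+t\<in>{a..b}. force2 \<delta> \<psi> z t \<partial>lborel)
    \<le> ennreal (2 * (\<alpha> 0)\<^sup>2) * (\<integral>\<^sup>+t\<in>{a..b}. N2 \<delta> (fst (z t)) \<partial>lborel)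
      + ennreal (2 * CQ \<delta>) * sq_integral {a..b} \<psi>"
proof -
  have m: "(\<lambda>t. N2 \<delta> (fst (z t)) * indicator {a..b} t) \<in> borel_measurable lborel"
    by (rule W_measurable(2)[OF z]) simp
  have "(\<integral>\<^sup>+t\<in>{a..b}. force2 \<delta> \<psi> z t \<partial>lborel) \<le> (\<integral>\<^sup>+t. ennreal (2 * (\<alpha> 0)\<^sup>2) * (N2 \<delta> (fst (z t)) * indicator {a..b} t)
      + ennreal (2 * CQ \<delta>) * (ennreal ((norm (\<psi> t))\<^sup>2) * indicator {a..b} t) \<partial>lborel)"
  proof (rule nn_integral_mono)
    fix t
    show "force2 \<delta> \<psi> z t * indicator {a..b} t \<le> ennreal (2 * (\<alpha> 0)\<^sup>2) * (N2 \<delta> (fst (z t)) * indicator {a..b} t)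
      + ennreal (2 * CQ \<delta>) * (ennreal ((norm (\<psi> t))\<^sup>2) * indicator {a..b} t)"
      using force2_le[OF \<delta>, of \<psi> z t] by (cases "t \<in> {a..b}") auto
  qed
  also have "\<dots> = ennreal (2 * (\<alpha> 0)\<^sup>2) * (\<integral>\<^sup>+t\<in>{a..b}. N2 \<delta> (fst (z t)) \<partial>lborel)
      + ennreal (2 * CQ \<delta>) * sq_integral {a..b} \<psi>"
    using m by (subst nn_integral_add) (auto simp: nn_integral_cmult)
  finally show ?thesis .
qed

text \<open>Square integrability of u at index \<delta> makes the forcing square integrable at index
  \<delta>, and the oscillators return one order more. For a fixed number n of modes each
  \<open>wk\<close> tends to 0 at minus infinity, so a starting time exists at which the weighted
  partial sum is below 1; this is the summand 1 in C. Since C is independent of n, all modes may be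
  summed afterwards.\<close>

lemma tame_step:
  assumes tame: "tame R z" and \<delta>: "0 \<le> \<delta>" "\<delta> \<le> 2 * \<beta>" and fin: "(\<integral>\<^sup>+t\<in>{..0}. N2 \<delta> (fst (z t)) \<partial>lborel) < \<infinity>"
  shows "\<exists>C<\<infinity>. (\<forall>t\<le>0. W \<delta> (z t) \<le> C) \<and> (\<integral>\<^sup>+t\<in>{..0}. W \<delta> (z t) \<partial>lborel) \<le> C"
proof -
  define C where "C = ennreal KE * (1 + (ennreal (2 * (\<alpha> 0)\<^sup>2) * (\<integral>\<^sup>+t\<in>{..0}. N2 \<delta> (fst (z t)) \<partial>lborel) + ennreal (2 * CQ \<delta>) * ennreal R))"
  have z: "continuous_on {..0} z" and z0: "((\<lambda>t. norm (z t)) \<longlongrightarrow> 0) at_bot" using tame by (auto simp: tame_def)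
  have z0': "(z \<longlongrightarrow> 0) at_bot" using z0 by (simp add: tendsto_norm_zero_iff)
  have wk0: "((\<lambda>t. wk k (z t)) \<longlongrightarrow> 0) at_bot" for k
  proof -
    have "((\<lambda>t. \<alpha> k * (um k (z t))\<^sup>2 + (vm k (z t))\<^sup>2) \<longlongrightarrow> \<alpha> k * (um k 0)\<^sup>2 + (vm k 0)\<^sup>2) at_bot"
      by (intro tendsto_intros bounded_linear.tendsto[OF um_bounded_linear z0'] bounded_linear.tendsto[OF vm_bounded_linear z0'])
    then show ?thesis by (simp add: wk_def um_def vm_def)
  qed
  have part: "(\<Sum>k<n. ennreal (\<alpha> k powr \<delta>) * (ennreal (wk k (z b)) + (\<integral>\<^sup>+t\<in>{-T..b}. ennreal (wk k (z t)) \<partial>lborel))) \<le> C"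
    if b: "b \<le> 0" for n b T
  proof -
    have "((\<lambda>t. \<Sum>k<n. \<alpha> k powr \<delta> * wk k (z t)) \<longlongrightarrow> (\<Sum>k<n. \<alpha> k powr \<delta> * 0)) at_bot"
      by (intro tendsto_intros wk0)
    then have "\<forall>\<^sub>F t in at_bot. (\<Sum>k<n. \<alpha> k powr \<delta> * wk k (z t)) < 1"
      by (rule order_tendstoD) simp
    then obtain T0 where T0: "\<And>t. t \<le> T0 \<Longrightarrow> (\<Sum>k<n. \<alpha> k powr \<delta> * wk k (z t)) < 1" by (auto simp: eventually_at_bot_linorder)
    define T' where "T' = max (max T (1 - b)) (- T0)"
    have T': "T' > 0" "T' \<ge> T" "- T' \<le> b" "- T' \<le> T0" using b by (auto simp: T'_def)
    obtain \<psi> where \<psi>: "\<psi> \<in> borel_measurable borel" "sq_integral {-T'..0} \<psi> \<le> ennreal R" "mode_sol (- T') 0 \<psi> z"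
      by (rule tame_control[OF tame T'(1)])
    have zc: "continuous_on {-T'..b} z" by (rule continuous_on_subset[OF z]) (use b in auto)
    have msb: "mode_sol (- T') b \<psi> z" using mode_sol_subinterval[OF \<psi>(3)] b by auto
    have "(\<Sum>k<n. ennreal (\<alpha> k powr \<delta>) * (ennreal (wk k (z b)) + (\<integral>\<^sup>+t\<in>{-T..b}. ennreal (wk k (z t)) \<partial>lborel)))
      \<le> (\<Sum>k<n. ennreal (\<alpha> k powr \<delta>) * (ennreal (wk k (z b)) + (\<integral>\<^sup>+t\<in>{-T'..b}. ennreal (wk k (z t)) \<partial>lborel)))"
      using T' by (intro sum_mono mult_left_mono add_left_mono nn_integral_mono) (auto simp: indicator_def)
    also have "\<dots> \<le> ennreal KE * (ennreal (\<Sum>k<n. \<alpha> k powr \<delta> * wk k (z (- T'))) + (\<integral>\<^sup>+t\<in>{-T'..b}. force2 \<delta> \<psi> z t \<partial>lborel))"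
      by (rule energy_partial[OF msb T'(3) zc \<psi>(1)])
    also have "\<dots> \<le> C"
      unfolding C_def
    proof (intro mult_left_mono add_mono)
      show "ennreal (\<Sum>k<n. \<alpha> k powr \<delta> * wk k (z (- T'))) \<le> 1"
        using T0[OF T'(4)] by (simp add: ennreal_le_1)
      have "(\<integral>\<^sup>+t\<in>{-T'..b}. force2 \<delta> \<psi> z t \<partial>lborel)
        \<le> ennreal (2 * (\<alpha> 0)\<^sup>2) * (\<integral>\<^sup>+t\<in>{-T'..b}. N2 \<delta> (fst (z t)) \<partial>lborel)
          + ennreal (2 * CQ \<delta>) * sq_integral {-T'..b} \<psi>"
        by (rule integral_force2_le[OF \<delta> zc \<psi>(1)])
      also have "\<dots> \<le> ennreal (2 * (\<alpha> 0)\<^sup>2) * (\<integral>\<^sup>+t\<in>{..0}. N2 \<delta> (fst (z t)) \<partial>lborel) + ennreal (2 * CQ \<delta>) * ennreal R"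
      proof (intro add_mono mult_left_mono)
        show "(\<integral>\<^sup>+t\<in>{-T'..b}. N2 \<delta> (fst (z t)) \<partial>lborel) \<le> (\<integral>\<^sup>+t\<in>{..0}. N2 \<delta> (fst (z t)) \<partial>lborel)"
          using b by (intro nn_integral_mono) (auto simp: indicator_def)
        show "sq_integral {-T'..b} \<psi> \<le> ennreal R"
          by (rule order_trans[OF nn_integral_mono \<psi>(2)]) (use b in \<open>auto simp: indicator_def\<close>)
      qed auto
      finally show "(\<integral>\<^sup>+t\<in>{-T'..b}. force2 \<delta> \<psi> z t \<partial>lborel)
        \<le> ennreal (2 * (\<alpha> 0)\<^sup>2) * (\<integral>\<^sup>+t\<in>{..0}. N2 \<delta> (fst (z t)) \<partial>lborel) + ennreal (2 * CQ \<delta>) * ennreal R" .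
    qed auto
    finally show ?thesis .
  qed
  have "C < \<infinity>" using fin by (simp add: C_def ennreal_mult_less_top)
  moreover have "W \<delta> (z b) \<le> C" if "b \<le> 0" for b
    unfolding W_eq
  proof (rule ennreal_suminf_bounded)
    fix n
    have "(\<Sum>k<n. ennreal (\<alpha> k powr \<delta>) * ennreal (wk k (z b)))
      \<le> (\<Sum>k<n. ennreal (\<alpha> k powr \<delta>) * (ennreal (wk k (z b)) + (\<integral>\<^sup>+t\<in>{-1..b}. ennreal (wk k (z t)) \<partial>lborel)))"
      by (intro sum_mono mult_left_mono) auto
    also have "\<dots> \<le> C" by (rule part[OF that])
    finally show "(\<Sum>k<n. ennreal (\<alpha> k powr \<delta>) * ennreal (wk k (z b))) \<le> C" .
  qed
  moreover have "(\<integral>\<^sup>+t\<in>{..0}. W \<delta> (z t) \<partial>lborel) \<le> C"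
  proof (rule nn_integral_half_line_le)
    show "(\<lambda>t. W \<delta> (z t) * indicator {..0} t) \<in> borel_measurable lborel"
      by (rule W_measurable(1)[OF z]) simp
    fix T :: real assume "T > 0"
    have zc: "continuous_on {-T..0} z" by (rule continuous_on_subset[OF z]) auto
    show "(\<integral>\<^sup>+t\<in>{-T..0}. W \<delta> (z t) \<partial>lborel) \<le> C"
      unfolding integral_W[OF zc borel_closed[OF closed_atLeastAtMost]]
    proof (rule ennreal_suminf_bounded)
      fix n
      have "(\<Sum>k<n. ennreal (\<alpha> k powr \<delta>) * (\<integral>\<^sup>+t\<in>{-T..0}. ennreal (wk k (z t)) \<partial>lborel))
        \<le> (\<Sum>k<n. ennreal (\<alpha> k powr \<delta>) * (ennreal (wk k (z 0)) + (\<integral>\<^sup>+t\<in>{-T..0}. ennreal (wk k (z t)) \<partial>lborel)))"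
        by (intro sum_mono mult_left_mono) auto
      also have "\<dots> \<le> C" by (rule part) simp
      finally show "(\<Sum>k<n. ennreal (\<alpha> k powr \<delta>) * (\<integral>\<^sup>+t\<in>{-T..0}. ennreal (wk k (z t)) \<partial>lborel)) \<le> C" .
    qed
  qed
  ultimately show ?thesis by blast
qed

text \<open>Bootstrapping: each application of the previous lemma gains one order of regularity.\<close>

lemma tame_regularity:
  assumes tame: "tame R z"
  shows "\<exists>C<\<infinity>. (\<forall>t\<le>0. W (2 * \<beta>) (z t) \<le> C) \<and> (\<integral>\<^sup>+t\<in>{..0}. W (2 * \<beta>) (z t) \<partial>lborel) \<le> C"
proof -
  have z: "continuous_on {..0} z" using tame by (auto simp: tame_def)
  \<comment> \<open>The index is capped at \<open>2 * \<beta>\<close>, beyond which neither B nor Q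
    is controlled. When n passes this value the hypothesis of the last step, at exactly
    \<open>2 * \<beta>\<close>, is available.\<close>
  have fin: "(\<integral>\<^sup>+t\<in>{..0}. N2 (min (real n) (2 * \<beta>)) (fst (z t)) \<partial>lborel) < \<infinity>" for n :: nat
  proof (induction n)
    case 0
    then show ?case using tame_L2[OF tame] \<beta>_nonneg by simp
  next
    case (Suc n)
    define \<delta> where "\<delta> = min (real n) (2 * \<beta>)"
    define \<delta>' where "\<delta>' = min (real (Suc n)) (2 * \<beta>)"
    have le: "\<delta>' \<le> \<delta> + 1" by (auto simp: \<delta>_def \<delta>'_def)
    have "0 \<le> \<delta>" "\<delta> \<le> 2 * \<beta>" using \<beta>_nonneg by (auto simp: \<delta>_def)
    from tame_step[OF tame this] Suc.IH have "(\<integral>\<^sup>+t\<in>{..0}. W \<delta> (z t) \<partial>lborel) < \<infinity>"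
      by (auto simp: \<delta>_def intro: order_le_less_trans)
    moreover have "(\<integral>\<^sup>+t\<in>{..0}. N2 \<delta>' (fst (z t)) \<partial>lborel)
        \<le> (\<integral>\<^sup>+t. ennreal (\<alpha> 0 powr (\<delta>' - (\<delta> + 1))) * (W \<delta> (z t) * indicator {..0} t) \<partial>lborel)"
    proof (rule nn_integral_mono)
      fix t
      have "N2 \<delta>' (fst (z t)) \<le> ennreal (\<alpha> 0 powr (\<delta>' - (\<delta> + 1))) * N2 (\<delta> + 1) (fst (z t))" by (rule N2_mono[OF le])
      also have "\<dots> \<le> ennreal (\<alpha> 0 powr (\<delta>' - (\<delta> + 1))) * W \<delta> (z t)" by (intro mult_left_mono N2_fst_le_W) auto
      finally show "N2 \<delta>' (fst (z t)) * indicator {..0} t \<le> ennreal (\<alpha> 0 powr (\<delta>' - (\<delta> + 1))) * (W \<delta> (z t) * indicator {..0} t)"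
        by (cases "t \<le> 0") auto
    qed
    moreover have "\<dots> = ennreal (\<alpha> 0 powr (\<delta>' - (\<delta> + 1))) * (\<integral>\<^sup>+t\<in>{..0}. W \<delta> (z t) \<partial>lborel)"
      by (rule nn_integral_cmult) (rule W_measurable(1)[OF z], simp)
    ultimately show ?case unfolding \<delta>'_def[symmetric]
      by (simp add: order_le_less_trans ennreal_mult_less_top)
  qed
  obtain n :: nat where "2 * \<beta> \<le> real n" using real_arch_simple by blast
  then have "(\<integral>\<^sup>+t\<in>{..0}. N2 (2 * \<beta>) (fst (z t)) \<partial>lborel) < \<infinity>" using fin[of n] by (simp add: min_def split: if_splits)
  from tame_step[OF tame _ order_refl this] show ?thesis using \<beta>_nonneg by simp
qed

lemma \<iota>_modes_sum: "um k (a *\<^sub>R p + b *\<^sub>R (0, \<iota> x)) = a * um k p"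
  "vm k (a *\<^sub>R p + b *\<^sub>R (0, \<iota> x)) = a * vm k p + b * (x \<bullet> e k)"
proof -
  interpret um: bounded_linear "um k" by (rule um_bounded_linear)
  interpret vm: bounded_linear "vm k" by (rule vm_bounded_linear)
  show "um k (a *\<^sub>R p + b *\<^sub>R (0, \<iota> x)) = a * um k p"
    by (simp only: um.add um.scaleR um_\<iota>) simp
  show "vm k (a *\<^sub>R p + b *\<^sub>R (0, \<iota> x)) = a * vm k p + b * (x \<bullet> e k)"
    by (simp only: vm.add vm.scaleR vm_\<iota>) simp
qed

end

subsection \<open>The upper bound for the quasi-potential\<close>

text \<open>Collects the squared sizes of all that the cut-off adds: 1 - cut measures how far B
  fails to commute with the scaling, and the two derivatives come from the commutator with the
  equation.\<close>

definition cut_err :: "real \<Rightarrow> real \<Rightarrow> real" where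
  "cut_err T t = (1 - cut T t)\<^sup>2 + (cut1 T t)\<^sup>2 + (cut2 T t)\<^sup>2"

lemma cut_err_nonneg: "0 \<le> cut_err T t"
  by (simp add: cut_err_def)

lemma two_squares: "((x::real) + y)\<^sup>2 \<le> 2 * x\<^sup>2 + 2 * y\<^sup>2"
proof -
  have "0 \<le> (x - y)\<^sup>2" by simp
  then show ?thesis by (simp add: power2_eq_square algebra_simps)
qed

text \<open>73 = 1 + 6^2 + 6^2, from the extreme values of the cubic and its derivatives in r
  together with T >= 1. A bound independent of T serves as the dominating constant.\<close>

lemma cut_err_bound:
  assumes "T \<ge> 1" "-T \<le> t" "t \<le> 0"
  shows "cut_err T t \<le> 73"
proof -
  define r where "r = 1 + t / T"
  have r: "0 \<le> r" "r \<le> 1" using assms by (auto simp: r_def field_simps)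
  have T2: "1 \<le> T\<^sup>2" using assms by simp
  have 1: "(1 - cut T t)\<^sup>2 \<le> 1"
    using cut_range[of T t] assms by (intro power_le_one) auto
  have "\<bar>6 * r * (1 - r)\<bar> \<le> 6 * 1 * 1" using r by (simp add: abs_mult) (intro mult_mono[of r 1 "1 - r" 1, simplified]; simp)
  moreover have "cut1 T t = (6 * r * (1 - r)) / T" by (simp add: cut1_def r_def)
  ultimately have "\<bar>cut1 T t\<bar> \<le> 6 / T"
    using assms by (simp only: abs_divide) (auto intro!: divide_right_mono)
  also have "\<dots> \<le> 6" using assms by (simp add: field_simps)
  finally have 2: "(cut1 T t)\<^sup>2 \<le> 6\<^sup>2" using power_mono[of "\<bar>cut1 T t\<bar>" 6 2] by simp
  have "\<bar>cut2 T t\<bar> = \<bar>6 - 12 * r\<bar> / T\<^sup>2" by (simp add: cut2_def r_def)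
  also have "\<dots> \<le> 6 / T\<^sup>2" using r by (intro divide_right_mono) auto
  also have "\<dots> \<le> 6 / 1" using T2 assms(1) by (intro divide_left_mono) auto
  finally have 3: "(cut2 T t)\<^sup>2 \<le> 6\<^sup>2" using power_mono[of "\<bar>cut2 T t\<bar>" "6 / 1" 2] by simp
  show ?thesis using 1 2 3 by (simp add: cut_err_def)
qed

lemma cut_err_tendsto: "(\<lambda>n. cut_err (real (Suc n)) t) \<longlonglongrightarrow> 0"
proof -
  have i: "(\<lambda>n. 1 / real (Suc n)) \<longlonglongrightarrow> 0"
    using LIMSEQ_inverse_real_of_nat by (simp add: inverse_eq_divide)
  have tT: "(\<lambda>n. t / real (Suc n)) \<longlonglongrightarrow> 0"
    using tendsto_mult[OF tendsto_const[of t] i] by simp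
  have "(\<lambda>n. (1 - (1 + t / real (Suc n))\<^sup>2 * (3 - 2 * (1 + t / real (Suc n))))\<^sup>2
      + (6 * (1 + t / real (Suc n)) * (- (t / real (Suc n))) * (1 / real (Suc n)))\<^sup>2
      + ((- 6 - 12 * (t / real (Suc n))) * (1 / real (Suc n))\<^sup>2)\<^sup>2) \<longlonglongrightarrow>
     (1 - (1 + 0)\<^sup>2 * (3 - 2 * (1 + 0)))\<^sup>2 + (6 * (1 + 0) * (- 0) * 0)\<^sup>2 + ((- 6 - 12 * 0) * 0\<^sup>2)\<^sup>2"
    by (intro tendsto_intros tT i)
  then show ?thesis by (simp add: cut_err_def cut_def cut1_def cut2_def power_divide del: of_nat_Suc)
qed

context damped_wave
begin

text \<open>The control that produces the cut-off path is \<open>cut T t *\<^sub>R \<psi> t\<close> plus the correction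
  with modes \<open>cut_corr T z k t / lam k\<close>.\<close>

definition cut_corr :: "real \<Rightarrow> (real \<Rightarrow> 'h \<times> 'm) \<Rightarrow> nat \<Rightarrow> real \<Rightarrow> real" where
  "cut_corr T z k t = (cut T t *\<^sub>R B (fst (z t)) - B (cut T t *\<^sub>R fst (z t))) \<bullet> e k
     + (2 * \<mu> * cut1 T t * vm k (z t) + (\<mu> * cut2 T t + cut1 T t) * um k (z t))"

text \<open>The factor c^2 is the price of inverting Q. The summand with
  \<open>8 * \<alpha> 0\<close> comes from the Lipschitz bound on B, the remaining ones from Young's
  inequality applied to the commutator terms.\<close>

definition cut_const where "cut_const = c\<^sup>2 * (8 * \<alpha> 0 + 2 * (16 * \<mu>\<^sup>2 + (4 + 2 * \<mu>\<^sup>2) / \<alpha> 0))"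

lemma cut_const_nonneg: "0 \<le> cut_const"
  unfolding cut_const_def using \<alpha>_0 by (intro mult_nonneg_nonneg add_nonneg_nonneg) auto

text \<open>The lower bound on the eigenvalues says that the inverse of Q maps the space of index
  \<open>2 * \<beta>\<close> into H. This is why that regularity of the path is the target of the
  bootstrapping.\<close>

lemma inverse_lam_sq: "(1 / lam k)\<^sup>2 \<le> c\<^sup>2 * \<alpha> k powr (2 * \<beta>)"
proof -
  have "1 / lam k \<le> 1 / ((1/c) * \<alpha> k powr (- \<beta>))"
    using lam_bounds(1)[of k] lam_pos[of k] c_pos \<alpha>_pos[of k] by (intro divide_left_mono) auto
  also have "\<dots> = c * \<alpha> k powr \<beta>" by (simp add: powr_minus field_simps)
  finally have "(1 / lam k)\<^sup>2 \<le> (c * \<alpha> k powr \<beta>)\<^sup>2" using lam_pos[of k] by (intro power_mono) auto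
  also have "\<dots> = c\<^sup>2 * \<alpha> k powr (2 * \<beta>)" by (simp add: power_mult_distrib powr_power mult.commute)
  finally show ?thesis .
qed

lemma wk_bounds: "(um k z)\<^sup>2 \<le> (1 / \<alpha> 0) * wk k z" "(vm k z)\<^sup>2 \<le> wk k z"
proof -
  have "(um k z)\<^sup>2 \<le> (um k z)\<^sup>2 + (vm k z)\<^sup>2 / \<alpha> k" using \<alpha>_pos[of k] by simp
  then show "(um k z)\<^sup>2 \<le> (1 / \<alpha> 0) * wk k z" using mode_norm_le_wk[of k z] by linarith
  show "(vm k z)\<^sup>2 \<le> wk k z" using \<alpha>_pos[of k] by (simp add: wk_def)
qed

lemma N2_le_W: "N2 \<delta> (fst z) \<le> ennreal (1 / \<alpha> 0) * W \<delta> z"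
  unfolding N2_def W_def ennreal_suminf_cmult[symmetric]
proof (intro suminf_le allI summableI)
  fix k
  have "\<alpha> k powr \<delta> * (fst z \<bullet> e k)\<^sup>2 \<le> \<alpha> k powr \<delta> * ((1 / \<alpha> 0) * wk k z)"
    using wk_bounds(1)[of k z] by (intro mult_left_mono) (auto simp: um_def)
  then have "ennreal (\<alpha> k powr \<delta> * (fst z \<bullet> e k)\<^sup>2) \<le> ennreal ((1 / \<alpha> 0) * (\<alpha> k powr \<delta> * wk k z))"
    by (intro ennreal_leI) (simp add: mult.left_commute)
  also have "\<dots> = ennreal (1 / \<alpha> 0) * ennreal (\<alpha> k powr \<delta> * wk k z)"
    using \<alpha>_0 wk_nonneg by (intro ennreal_mult) auto
  finally show "ennreal (\<alpha> k powr \<delta> * (fst z \<bullet> e k)\<^sup>2) \<le> ennreal (1 / \<alpha> 0) * ennreal (\<alpha> k powr \<delta> * wk k z)" .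
qed

text \<open>Write p for the value of the cut-off. The nonlinear part of the correction is p B(u) -
  B(p u) = (B(u) - B(p u)) + (p - 1) B(u); by the Lipschitz bound and B 0 = 0 both summands are of
  size 1 - p times u at index \<open>2 * \<beta>\<close>. The commutator part contains only u and v
  of the same mode, hence is bounded by \<open>wk\<close>.\<close>

lemma cut_corr_bound:
  assumes fin: "W (2 * \<beta>) (z t) < \<infinity>"
  shows "(\<Sum>k. ennreal ((cut_corr T z k t / lam k)\<^sup>2)) \<le> ennreal (cut_const * cut_err T t) * W (2 * \<beta>) (z t)"
proof -
  let ?u = "fst (z t)" and ?r = "cut_err T t" and ?p = "cut T t"
  define x where "x = ?p *\<^sub>R B ?u - B (?p *\<^sub>R ?u)"
  define C1 where "C1 = 16 * \<mu>\<^sup>2 + (4 + 2 * \<mu>\<^sup>2) / \<alpha> 0"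
  have C1: "C1 \<ge> 0" using \<alpha>_0 by (simp add: C1_def)
  have \<delta>: "0 \<le> 2 * \<beta>" "2 * \<beta> \<le> 2 * \<beta>" using \<beta>_nonneg by auto
  have Nu: "N2 (2 * \<beta>) ?u < \<infinity>"
    using order_le_less_trans[OF N2_le_W[of "2 * \<beta>" "z t"]] fin by (simp add: ennreal_mult_less_top)
  have Npu: "N2 (2 * \<beta>) (?p *\<^sub>R ?u) < \<infinity>" using Nu by (simp add: N2_scaleR ennreal_mult_less_top)
  have Nx: "N2 (2 * \<beta>) x \<le> ennreal (4 * (\<alpha> 0)\<^sup>2 * (1 - ?p)\<^sup>2) * N2 (2 * \<beta>) ?u"
  proof -
    have "x = (B ?u - B (?p *\<^sub>R ?u)) + (?p - 1) *\<^sub>R B ?u" by (simp add: x_def algebra_simps)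
    then have "N2 (2 * \<beta>) x \<le> 2 * N2 (2 * \<beta>) (B ?u - B (?p *\<^sub>R ?u)) + 2 * (ennreal ((?p - 1)\<^sup>2) * N2 (2 * \<beta>) (B ?u))"
      by (metis N2_add_le N2_scaleR)
    also have "\<dots> \<le> 2 * (ennreal ((\<alpha> 0)\<^sup>2) * N2 (2 * \<beta>) (?u - ?p *\<^sub>R ?u)) + 2 * (ennreal ((?p - 1)\<^sup>2) * (ennreal ((\<alpha> 0)\<^sup>2) * N2 (2 * \<beta>) ?u))"
      by (intro add_mono mult_left_mono N2_B_diff[OF \<delta> Nu Npu] N2_B[OF \<delta>]) auto
    also have "?u - ?p *\<^sub>R ?u = (1 - ?p) *\<^sub>R ?u" by (simp add: algebra_simps)
    also have "2 * (ennreal ((\<alpha> 0)\<^sup>2) * N2 (2 * \<beta>) ((1 - ?p) *\<^sub>R ?u)) + 2 * (ennreal ((?p - 1)\<^sup>2) * (ennreal ((\<alpha> 0)\<^sup>2) * N2 (2 * \<beta>) ?u))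
       = ennreal (4 * (\<alpha> 0)\<^sup>2 * (1 - ?p)\<^sup>2) * N2 (2 * \<beta>) ?u"
    proof -
      have eq: "(?p - 1)\<^sup>2 = (1 - ?p)\<^sup>2" by (rule power2_commute)
      have "ennreal (4 * (\<alpha> 0)\<^sup>2 * (1 - ?p)\<^sup>2) = 4 * (ennreal ((\<alpha> 0)\<^sup>2) * ennreal ((1 - ?p)\<^sup>2))"
        by (simp add: ennreal_mult mult.assoc)
      moreover have "2 * (X * (Y * Z)) + 2 * (Y * (X * Z)) = 4 * (X * Y) * Z" for X Y Z :: ennreal
      proof -
        have "Y * (X * Z) = X * (Y * Z)" by (simp only: ac_simps)
        moreover have "4 * (X * Y) * Z = (2 + 2) * (X * (Y * Z))" by (simp add: mult.assoc)
        ultimately show ?thesis by (simp only: distrib_right)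
      qed
      ultimately show ?thesis unfolding N2_scaleR eq by simp
    qed
    finally show ?thesis .
  qed
  have "(\<Sum>k. ennreal ((cut_corr T z k t / lam k)\<^sup>2))
    \<le> (\<Sum>k. ennreal (2 * c\<^sup>2) * ennreal (\<alpha> k powr (2 * \<beta>) * (x \<bullet> e k)\<^sup>2) + ennreal (2 * c\<^sup>2 * C1 * ?r) * ennreal (\<alpha> k powr (2 * \<beta>) * wk k (z t)))"
  proof (intro suminf_le allI summableI)
    fix k
    let ?w = "wk k (z t)"
    define y where "y = 2 * \<mu> * cut1 T t * vm k (z t) + (\<mu> * cut2 T t + cut1 T t) * um k (z t)"
    have y: "y\<^sup>2 \<le> C1 * ?r * ?w"
    proof -
      have "y = cut1 T t * (2 * \<mu> * vm k (z t) + um k (z t)) + cut2 T t * (\<mu> * um k (z t))"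
        by (simp add: y_def algebra_simps)
      then have "y\<^sup>2 \<le> 2 * (cut1 T t)\<^sup>2 * (2 * \<mu> * vm k (z t) + um k (z t))\<^sup>2 + 2 * (cut2 T t)\<^sup>2 * (\<mu>\<^sup>2 * (um k (z t))\<^sup>2)"
        using two_squares[of "cut1 T t * (2 * \<mu> * vm k (z t) + um k (z t))" "cut2 T t * (\<mu> * um k (z t))"]
        by (simp add: power_mult_distrib mult.assoc)
      also have "\<dots> \<le> 2 * ?r * (2 * (2 * \<mu> * vm k (z t))\<^sup>2 + 2 * (um k (z t))\<^sup>2) + 2 * ?r * (\<mu>\<^sup>2 * (um k (z t))\<^sup>2)"
        by (intro add_mono mult_mono two_squares) (auto simp: cut_err_def)
      also have "\<dots> = ?r * (16 * \<mu>\<^sup>2 * (vm k (z t))\<^sup>2 + (4 + 2 * \<mu>\<^sup>2) * (um k (z t))\<^sup>2)"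
        by (simp add: power_mult_distrib algebra_simps)
      also have "\<dots> \<le> ?r * (16 * \<mu>\<^sup>2 * ?w + (4 + 2 * \<mu>\<^sup>2) * ((1 / \<alpha> 0) * ?w))"
        by (intro mult_left_mono add_mono wk_bounds cut_err_nonneg) auto
      also have "\<dots> = C1 * ?r * ?w" by (simp add: C1_def algebra_simps add_divide_distrib)
      finally show ?thesis .
    qed
    have "cut_corr T z k t = x \<bullet> e k + y" by (simp add: cut_corr_def x_def y_def)
    then have "(cut_corr T z k t / lam k)\<^sup>2 = (1 / lam k)\<^sup>2 * (x \<bullet> e k + y)\<^sup>2" by (simp add: power_divide)
    also have "\<dots> \<le> (c\<^sup>2 * \<alpha> k powr (2 * \<beta>)) * (2 * (x \<bullet> e k)\<^sup>2 + 2 * y\<^sup>2)"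
      by (intro mult_mono inverse_lam_sq two_squares) auto
    also have "\<dots> \<le> (c\<^sup>2 * \<alpha> k powr (2 * \<beta>)) * (2 * (x \<bullet> e k)\<^sup>2 + 2 * (C1 * ?r * ?w))"
      by (intro mult_left_mono add_left_mono y) auto
    also have "\<dots> = 2 * c\<^sup>2 * (\<alpha> k powr (2 * \<beta>) * (x \<bullet> e k)\<^sup>2) + 2 * c\<^sup>2 * C1 * ?r * (\<alpha> k powr (2 * \<beta>) * ?w)"
      by (simp add: algebra_simps)
    finally have "ennreal ((cut_corr T z k t / lam k)\<^sup>2) \<le> ennreal \<dots>" by (rule ennreal_leI)
    also have "\<dots> = ennreal (2 * c\<^sup>2) * ennreal (\<alpha> k powr (2 * \<beta>) * (x \<bullet> e k)\<^sup>2) + ennreal (2 * c\<^sup>2 * C1 * ?r) * ennreal (\<alpha> k powr (2 * \<beta>) * ?w)"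
    proof -
      have nn: "0 \<le> 2 * c\<^sup>2" "0 \<le> \<alpha> k powr (2 * \<beta>) * (x \<bullet> e k)\<^sup>2" "0 \<le> 2 * c\<^sup>2 * C1 * ?r" "0 \<le> \<alpha> k powr (2 * \<beta>) * ?w"
        using C1 cut_err_nonneg wk_nonneg by auto
      show ?thesis by (simp only: ennreal_plus[OF mult_nonneg_nonneg[OF nn(1,2)] mult_nonneg_nonneg[OF nn(3,4)]]
          ennreal_mult[OF nn(1,2)] ennreal_mult[OF nn(3,4)])
    qed
    finally show "ennreal ((cut_corr T z k t / lam k)\<^sup>2)
      \<le> ennreal (2 * c\<^sup>2) * ennreal (\<alpha> k powr (2 * \<beta>) * (x \<bullet> e k)\<^sup>2) + ennreal (2 * c\<^sup>2 * C1 * ?r) * ennreal (\<alpha> k powr (2 * \<beta>) * ?w)" .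
  qed
  also have "\<dots> = ennreal (2 * c\<^sup>2) * N2 (2 * \<beta>) x + ennreal (2 * c\<^sup>2 * C1 * ?r) * W (2 * \<beta>) (z t)"
    by (simp only: suminf_add[OF summableI summableI, symmetric] ennreal_suminf_cmult N2_def W_def)
  also have "\<dots> \<le> ennreal (2 * c\<^sup>2) * (ennreal (4 * (\<alpha> 0)\<^sup>2 * ?r) * (ennreal (1 / \<alpha> 0) * W (2 * \<beta>) (z t))) + ennreal (2 * c\<^sup>2 * C1 * ?r) * W (2 * \<beta>) (z t)"
  proof (intro add_right_mono mult_left_mono order_trans[OF Nx] mult_mono N2_le_W ennreal_leI)
    show "(1 - ?p)\<^sup>2 \<le> ?r" by (simp add: cut_err_def)
  qed (auto simp: cut_err_def)
  also have "\<dots> = ennreal (cut_const * ?r) * W (2 * \<beta>) (z t)"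
  proof -
    have nn: "0 \<le> 2 * c\<^sup>2" "0 \<le> 4 * (\<alpha> 0)\<^sup>2 * ?r" "0 \<le> 1 / \<alpha> 0" "0 \<le> 2 * c\<^sup>2 * C1 * ?r"
      using C1 cut_err_nonneg \<alpha>_0 by auto
    have "ennreal (2 * c\<^sup>2) * (ennreal (4 * (\<alpha> 0)\<^sup>2 * ?r) * (ennreal (1 / \<alpha> 0) * X)) + ennreal (2 * c\<^sup>2 * C1 * ?r) * X
      = ennreal (2 * c\<^sup>2 * (4 * (\<alpha> 0)\<^sup>2 * ?r) * (1 / \<alpha> 0) + 2 * c\<^sup>2 * C1 * ?r) * X" for X
    proof -
      have gen: "ennreal a * (ennreal b * (ennreal d * X)) + ennreal f * X = ennreal (a * b * d + f) * X"
        if "0 \<le> a" "0 \<le> b" "0 \<le> d" "0 \<le> f" for a b d f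
        using that by (simp add: ennreal_plus ennreal_mult distrib_right mult.assoc)
      show ?thesis by (rule gen[OF nn])
    qed
    moreover have "2 * c\<^sup>2 * (4 * (\<alpha> 0)\<^sup>2 * ?r) * (1 / \<alpha> 0) + 2 * c\<^sup>2 * C1 * ?r = cut_const * ?r"
      by (simp add: cut_const_def C1_def power2_eq_square field_simps)
    ultimately show ?thesis by simp
  qed
  finally show ?thesis .
qed

text \<open>The indicator makes every coefficient a Borel function of t on the whole line, so
  measurability of the series follows from that of its terms.\<close>

definition corr_vec :: "real \<Rightarrow> (real \<Rightarrow> 'h \<times> 'm) \<Rightarrow> real \<Rightarrow> 'h" where
  "corr_vec T z t = (\<Sum>k. (indicator {-T..0} t * (cut_corr T z k t / lam k)) *\<^sub>R e k)"

lemma corr_vec_modes: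
  assumes fin: "W (2 * \<beta>) (z t) < \<infinity>" and t: "t \<in> {-T..0}"
  shows "corr_vec T z t \<bullet> e j = cut_corr T z j t / lam j"
    "ennreal ((norm (corr_vec T z t))\<^sup>2) \<le> ennreal (cut_const * cut_err T t) * W (2 * \<beta>) (z t)"
proof -
  have "(\<Sum>k. ennreal ((cut_corr T z k t / lam k)\<^sup>2)) < \<infinity>"
    by (rule order_le_less_trans[OF cut_corr_bound[of z t T, OF fin]]) (use fin in \<open>simp add: ennreal_mult_less_top\<close>)
  then have s: "summable (\<lambda>k. (cut_corr T z k t / lam k)\<^sup>2)"
    by (intro summable_suminf_not_top) auto
  have v: "corr_vec T z t = (\<Sum>k. (cut_corr T z k t / lam k) *\<^sub>R e k)" using t by (simp add: corr_vec_def)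
  show 1: "corr_vec T z t \<bullet> e j = cut_corr T z j t / lam j" for j unfolding v by (rule E.series_sums(2)[OF s])
  show "ennreal ((norm (corr_vec T z t))\<^sup>2) \<le> ennreal (cut_const * cut_err T t) * W (2 * \<beta>) (z t)"
    unfolding Parseval_ennreal[symmetric] 1 by (rule cut_corr_bound[where z = z and t = t, OF fin])
qed

lemma corr_vec_measurable:
  assumes z: "continuous_on {..0} z" and T: "T > 0"
  shows "corr_vec T z \<in> borel_measurable borel"
proof -
  have zc: "continuous_on {-T..0} z" by (rule continuous_on_subset[OF z]) auto
  have "continuous_on {-T..0} (\<lambda>t. cut_corr T z k t / lam k)" for k
  proof -
    have "continuous_on {-T..0} (\<lambda>t. B (fst (z t)))" "continuous_on {-T..0} (\<lambda>t. B (cut T t *\<^sub>R fst (z t)))"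
      by (intro continuous_on_compose2[OF B_continuous] continuous_intros zc cut_continuous T; simp)+
    then show ?thesis unfolding cut_corr_def using lam_pos[of k]
      by (intro continuous_intros zc cut_continuous T mode_continuous) auto
  qed
  then have "(\<lambda>t. indicator {-T..0} t * (cut_corr T z k t / lam k)) \<in> borel_measurable borel" for k
    using set_measurable_continuous_on[of "{-T..0}" "\<lambda>t. cut_corr T z k t / lam k"] by (simp add: set_borel_measurable_def)
  then have "(\<lambda>t. (indicator {-T..0} t * (cut_corr T z k t / lam k)) *\<^sub>R e k) \<in> borel_measurable borel" for k
    by (intro borel_measurable_scaleR) auto
  then show ?thesis unfolding corr_vec_def[abs_def] by (rule borel_measurable_suminf)
qed

text \<open>The second component is the time derivative of the first: velocity times cut-off, plus
  position times the derivative of the cut-off, with the position embedded by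
  \<open>\<iota>\<close>.\<close>

definition cut_path :: "real \<Rightarrow> (real \<Rightarrow> 'h \<times> 'm) \<Rightarrow> real \<Rightarrow> 'h \<times> 'm" where
  "cut_path T z t = cut T t *\<^sub>R z t + cut1 T t *\<^sub>R (0, \<iota> (fst (z t)))"

text \<open>Applying Q to the correction cancels the division by \<open>lam k\<close>. What remains
  is the commutator, together with the exchange of the scaled B(u) for B at the scaled position,
  which is the nonlinearity along the new path.\<close>

lemma cut_path_mode_sol:
  assumes ms: "mode_sol (-T) 0 \<psi> z" and T: "T > 0" and fin: "\<And>t. t \<le> 0 \<Longrightarrow> W (2 * \<beta>) (z t) < \<infinity>"
  shows "mode_sol (-T) 0 (\<lambda>t. cut T t *\<^sub>R \<psi> t + corr_vec T z t) (cut_path T z)"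
  unfolding mode_sol_def
proof
  fix k
  show "oscillator \<mu> (\<alpha> k) (-T) 0 (\<lambda>t. um k (cut_path T z t)) (\<lambda>t. vm k (cut_path T z t))
     (mode_force (\<lambda>t. cut T t *\<^sub>R \<psi> t + corr_vec T z t) (cut_path T z) k)"
  proof (rule oscillator_cong[OF oscillator_cut[OF mode_sol_osc[OF ms, of k] T less_imp_neq[OF \<mu>_pos, symmetric]]])
    fix t assume t: "t \<in> {-T..0}"
    show "cut T t * um k (z t) = um k (cut_path T z t)" by (simp only: cut_path_def \<iota>_modes_sum)
    show "cut T t * vm k (z t) + cut1 T t * um k (z t) = vm k (cut_path T z t)"
      by (simp only: cut_path_def \<iota>_modes_sum um_def)
    have "corr_vec T z t \<bullet> e k = cut_corr T z k t / lam k" by (rule corr_vec_modes(1)[where z = z and t = t, OF fin t]) (use t in simp)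
    then have "lam k * (corr_vec T z t \<bullet> e k) = cut_corr T z k t" using lam_pos[of k] by simp
    then show "cut T t * mode_force \<psi> z k t + 2 * \<mu> * cut1 T t * vm k (z t) + (\<mu> * cut2 T t + cut1 T t) * um k (z t)
      = mode_force (\<lambda>t. cut T t *\<^sub>R \<psi> t + corr_vec T z t) (cut_path T z) k t"
      by (simp add: mode_force_def cut_path_def inner_add_left distrib_left cut_corr_def inner_diff_left)
  qed
qed

text \<open>The error factor tends to 0 pointwise but not uniformly, because 1 - cut equals 1 at the
  left end of every interval. Integrability of the energy of index \<open>2 * \<beta>\<close> over
  the half line supplies the majorant for dominated convergence.\<close>

lemma cut_cost_tendsto:
  assumes z: "continuous_on {..0} z" and fin: "\<And>t. t \<le> 0 \<Longrightarrow> W (2 * \<beta>) (z t) < \<infinity>"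
    and int: "(\<integral>\<^sup>+t\<in>{..0}. W (2 * \<beta>) (z t) \<partial>lborel) < \<infinity>"
  shows "(\<lambda>n. \<integral>\<^sup>+t\<in>{-real (Suc n)..0}. ennreal ((norm (corr_vec (real (Suc n)) z t))\<^sup>2) \<partial>lborel) \<longlonglongrightarrow> 0"
proof -
  have Wm [measurable]: "(\<lambda>t. W (2 * \<beta>) (z t) * indicator {..0} t) \<in> borel_measurable lborel"
    by (rule W_measurable(1)[OF z]) simp
  let ?W = "\<lambda>t. W (2 * \<beta>) (z t) * indicator {..0} t"
  let ?f = "\<lambda>n t. (?W t * ennreal (cut_const * cut_err (real (Suc n)) t)) * indicator {-real (Suc n)..0} t"
  have [measurable]: "cut_err (real (Suc n)) \<in> borel_measurable lborel" for n
  proof -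
    have "continuous_on UNIV (cut_err (real (Suc n)))"
      unfolding cut_err_def[abs_def] by (intro continuous_intros cut_continuous) auto
    then have "cut_err (real (Suc n)) \<in> borel_measurable borel" by (rule borel_measurable_continuous_onI)
    then show ?thesis by simp
  qed
  have "(\<lambda>n. \<integral>\<^sup>+t. ?f n t \<partial>lborel) \<longlonglongrightarrow> (\<integral>\<^sup>+(t::real). 0 \<partial>lborel)"
  proof (rule nn_integral_dominated_convergence[where w = "\<lambda>t. ?W t * ennreal (cut_const * 73)"])
    show "?f n \<in> borel_measurable lborel" for n by measurable
    show "(\<integral>\<^sup>+t. ?W t * ennreal (cut_const * 73) \<partial>lborel) < \<infinity>"
      using int by (simp add: nn_integral_multc ennreal_mult_less_top)
    show "AE t in lborel. ?f n t \<le> ?W t * ennreal (cut_const * 73)" for n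
    proof (rule AE_I2)
      fix t
      have "cut_const * cut_err (real (Suc n)) t \<le> cut_const * 73" if "t \<in> {-real (Suc n)..0}"
        using cut_err_bound[of "real (Suc n)" t] that cut_const_nonneg by (intro mult_left_mono) auto
      then show "?f n t \<le> ?W t * ennreal (cut_const * 73)"
        by (cases "t \<in> {-real (Suc n)..0}") (auto intro!: mult_left_mono ennreal_leI simp del: of_nat_Suc)
    qed
    show "AE t in lborel. (\<lambda>n. ?f n t) \<longlonglongrightarrow> 0"
    proof (rule AE_I2)
      fix t
      have Wf: "?W t < top" using fin[of t] by (cases "t \<le> 0") (auto simp: less_top)
      have "(\<lambda>n. cut_const * cut_err (real (Suc n)) t) \<longlonglongrightarrow> cut_const * 0"
        by (intro tendsto_intros cut_err_tendsto)
      then have "(\<lambda>n. ennreal (cut_const * cut_err (real (Suc n)) t)) \<longlonglongrightarrow> ennreal (cut_const * 0)"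
        by (rule tendsto_ennrealI)
      from ennreal_tendsto_cmult[OF Wf this]
      have "(\<lambda>n. ?W t * ennreal (cut_const * cut_err (real (Suc n)) t)) \<longlonglongrightarrow> 0" by simp
      then show "(\<lambda>n. ?f n t) \<longlonglongrightarrow> 0"
        by (rule tendsto_sandwich[OF _ _ tendsto_const, rotated 2]) (auto simp: indicator_def)
    qed
  qed auto
  then have lim: "(\<lambda>n. \<integral>\<^sup>+t. ?f n t \<partial>lborel) \<longlonglongrightarrow> 0" by simp
  show ?thesis
  proof (rule tendsto_sandwich[OF _ _ tendsto_const lim])
    show "\<forall>\<^sub>F n in sequentially. sq_integral {-real (Suc n)..0} (corr_vec (real (Suc n)) z) \<le> (\<integral>\<^sup>+t. ?f n t \<partial>lborel)"
    proof (intro always_eventually allI nn_integral_mono)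
      fix n t
      show "ennreal ((norm (corr_vec (real (Suc n)) z t))\<^sup>2) * indicator {-real (Suc n)..0} t \<le> ?f n t"
      proof (cases "t \<in> {-real (Suc n)..0}")
        case True
        then have "ennreal ((norm (corr_vec (real (Suc n)) z t))\<^sup>2) \<le> ennreal (cut_const * cut_err (real (Suc n)) t) * W (2 * \<beta>) (z t)"
          by (intro corr_vec_modes(2) fin) auto
        then show ?thesis using True by (simp add: mult.commute del: of_nat_Suc)
      qed simp
    qed
  qed simp
qed

abbreviation qpot where "qpot \<equiv> quasi_potential S \<iota> B Q \<mu>"
abbreviation act_inf where "act_inf \<equiv> action_neg_inf S \<iota> B Q \<mu>"

lemma qpot_le_path:
  assumes T: "T > 0" and z: "continuous_on {-T..0} z" and z0: "z (- T) = 0" and \<psi>[measurable]: "\<psi> \<in> borel_measurable borel"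
    and le: "sq_integral {-T..0} \<psi> \<le> ennreal r" and r: "r \<ge> 0" and ms: "mode_sol (-T) 0 \<psi> z"
  shows "qpot (z 0) \<le> ereal (r / 2)"
proof -
  let ?z = "\<lambda>t. z (t + - T)" and ?\<psi> = "\<lambda>t. \<psi> (t + - T)"
  have zc: "continuous_on {0..T} ?z"
    by (rule continuous_on_compose2[OF z]) (auto intro!: continuous_intros)
  have "sq_integral {0..T} ?\<psi> = sq_integral {-T..0} \<psi>"
  proof -
    have "sq_integral {-T..0} \<psi>
      = ennreal \<bar>1\<bar> * (\<integral>\<^sup>+t. ennreal ((norm (\<psi> (- T + 1 * t)))\<^sup>2) * indicator {-T..0} (- T + 1 * t) \<partial>lborel)"
      by (rule nn_integral_real_affine) auto
    also have "\<dots> = sq_integral {0..T} ?\<psi>"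
      by (simp, intro nn_integral_cong) (auto simp: indicator_def)
    finally show ?thesis by simp
  qed
  then have le': "sq_integral {0..T} ?\<psi> \<le> ennreal r" using le by simp
  have ms': "mode_sol 0 T ?\<psi> ?z" using mode_sol_shift[OF ms, of "- T"] by simp
  have "act 0 T ?z \<le> ereal (r / 2)"
    by (rule action_le_control[OF T zc _ le' r ms']) measurable
  moreover have "qpot (z 0) \<le> act 0 T ?z"
    unfolding quasi_potential_def
    by (intro Inf_lower CollectI exI[of _ T] exI[of _ ?z] conjI refl T zc) (use z0 in auto)
  ultimately show ?thesis by (rule order_trans[rotated])
qed

theorem qpot_le_act_inf:
  assumes z: "continuous_on {..0} z" and z0: "((\<lambda>t. norm (z t)) \<longlongrightarrow> 0) at_bot"
  shows "qpot (z 0) \<le> act_inf z"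
proof (cases "act_inf z = \<infinity>")
  case False
  have le_inf: "act (- t) 0 z \<le> act_inf z" if "t > 0" for t
    unfolding action_neg_inf_def by (rule SUP_upper) (use that in auto)
  then have "0 \<le> act_inf z" using action_nonneg[of "- 1" 0 z] by (rule order_trans[rotated]) simp
  then obtain I where I: "act_inf z = ereal I" "I \<ge> 0" using False by (cases "act_inf z") auto
  \<comment> \<open>The slack s is used three times: in choosing controls of energy at most 2 (I +
    s), as the weight in Young's inequality, and in making the correction cost less than s^2. The
    last choice keeps (1 + 1/s) s^2 = s^2 + s small.\<close>
  have main: "qpot (z 0) \<le> ereal ((1 + s) * (I + s) + (s + 1) * s / 2)" if s: "s > 0" for s :: real
  proof -
    define R where "R = 2 * (I + s)"
    have R: "R \<ge> 0" using I s by (simp add: R_def)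
    have tame: "tame R z"
      unfolding tame_def
    proof (intro conjI z z0 allI impI)
      fix T :: real assume T: "T > 0"
      have "act (- T) 0 z < ereal (I + s)" using le_inf[OF T] s by (auto simp: I intro: order_le_less_trans)
      then obtain \<psi> where \<psi>: "\<psi> \<in> borel_measurable borel"
        "(\<integral>\<^sup>+t. ennreal ((norm (\<psi> t))\<^sup>2) \<partial>lborel) \<le> ennreal (2 * (I + s))" "mode_sol (-T) 0 \<psi> z"
        by (rule action_less_imp_control[rotated 2]) (use T in \<open>auto intro: continuous_on_subset[OF z]\<close>)
      have "sq_integral {-T..0} \<psi> \<le> ennreal R"
        unfolding R_def by (rule order_trans[OF nn_integral_mono \<psi>(2)]) (auto simp: indicator_def)
      then show "\<exists>\<psi>\<in>borel_measurable borel. sq_integral {-T..0} \<psi> \<le> ennreal R \<and> mode_sol (- T) 0 \<psi> z"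
        using \<psi> by blast
    qed
    from tame_regularity[OF this] obtain C where C: "C < \<infinity>" "\<And>t. t \<le> 0 \<Longrightarrow> W (2 * \<beta>) (z t) \<le> C"
      "(\<integral>\<^sup>+t\<in>{..0}. W (2 * \<beta>) (z t) \<partial>lborel) \<le> C" by blast
    have fin: "W (2 * \<beta>) (z t) < \<infinity>" if "t \<le> 0" for t using C(2)[OF that] C(1) by (rule order_le_less_trans)
    have "(\<lambda>n. \<integral>\<^sup>+t\<in>{-real (Suc n)..0}. ennreal ((norm (corr_vec (real (Suc n)) z t))\<^sup>2) \<partial>lborel) \<longlonglongrightarrow> 0"
      by (rule cut_cost_tendsto[OF z fin order_le_less_trans[OF C(3) C(1)]])
    then have "\<forall>\<^sub>F n in sequentially. sq_integral {-real (Suc n)..0} (corr_vec (real (Suc n)) z) < ennreal (s\<^sup>2)"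
      by (rule order_tendstoD) (use s in simp)
    then obtain n where n: "sq_integral {-real (Suc n)..0} (corr_vec (real (Suc n)) z) < ennreal (s\<^sup>2)"
      by (auto simp: eventually_sequentially)
    define T where "T = real (Suc n)"
    have T: "T > 0" by (simp add: T_def)
    note n = n[folded T_def]
    obtain \<psi> where \<psi>[measurable]: "\<psi> \<in> borel_measurable borel"
      and \<psi>R: "sq_integral {-T..0} \<psi> \<le> ennreal R" and ms: "mode_sol (- T) 0 \<psi> z"
      by (rule tame_control[OF tame T])
    have [measurable]: "corr_vec T z \<in> borel_measurable borel" by (rule corr_vec_measurable[OF z T])
    have [measurable]: "cut T \<in> borel_measurable borel"
      by (rule borel_measurable_continuous_onI) (rule cut_continuous[OF T])
    let ?\<phi> = "\<lambda>t. cut T t *\<^sub>R \<psi> t + corr_vec T z t"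
    have zc: "continuous_on {-T..0} z" by (rule continuous_on_subset[OF z]) auto
    have wc: "continuous_on {-T..0} (cut_path T z)"
      unfolding cut_path_def[abs_def]
      by (intro continuous_intros cut_continuous T zc bounded_linear.continuous_on[OF \<iota>_bounded_linear])
    have "sq_integral {-T..0} ?\<phi>
      \<le> (\<integral>\<^sup>+t. ennreal (1 + s) * (ennreal ((norm (\<psi> t))\<^sup>2) * indicator {-T..0} t)
          + ennreal (1 + 1 / s) * (ennreal ((norm (corr_vec T z t))\<^sup>2) * indicator {-T..0} t) \<partial>lborel)"
    proof (rule nn_integral_mono)
      fix t
      show "ennreal ((norm (?\<phi> t))\<^sup>2) * indicator {-T..0} t \<le> ennreal (1 + s) * (ennreal ((norm (\<psi> t))\<^sup>2) * indicator {-T..0} t)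
          + ennreal (1 + 1 / s) * (ennreal ((norm (corr_vec T z t))\<^sup>2) * indicator {-T..0} t)"
      proof (cases "t \<in> {-T..0}")
        case True
        let ?x = "norm (\<psi> t)" and ?y = "norm (corr_vec T z t)"
        have "norm (?\<phi> t) \<le> cut T t * ?x + ?y"
          using cut_range(1)[OF T, of t] True norm_triangle_ineq[of "cut T t *\<^sub>R \<psi> t" "corr_vec T z t"] by simp
        also have "\<dots> \<le> ?x + ?y"
          using cut_range[OF T, of t] True by (simp add: mult_left_le_one_le)
        finally have "(norm (?\<phi> t))\<^sup>2 \<le> (?x + ?y)\<^sup>2" by (intro power_mono) auto
        also have "\<dots> \<le> (1 + s) * ?x\<^sup>2 + (1 + 1 / s) * ?y\<^sup>2"
        proof -
          have "0 \<le> (s * ?x - ?y)\<^sup>2 / s" using s by simp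
          then show ?thesis using s by (simp add: power2_eq_square field_simps)
        qed
        finally have "ennreal ((norm (?\<phi> t))\<^sup>2) \<le> ennreal ((1 + s) * ?x\<^sup>2 + (1 + 1 / s) * ?y\<^sup>2)" by (rule ennreal_leI)
        also have "\<dots> = ennreal (1 + s) * ennreal (?x\<^sup>2) + ennreal (1 + 1 / s) * ennreal (?y\<^sup>2)"
        proof -
          have nn: "0 \<le> 1 + s" "0 \<le> 1 + 1 / s" using s by auto
          show ?thesis
            by (simp only: ennreal_plus[OF mult_nonneg_nonneg[OF nn(1) zero_le_power2] mult_nonneg_nonneg[OF nn(2) zero_le_power2]]
                ennreal_mult[OF nn(1) zero_le_power2] ennreal_mult[OF nn(2) zero_le_power2])
        qed
        finally show ?thesis using True by simp
      qed simp
    qed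
    also have "\<dots> = ennreal (1 + s) * sq_integral {-T..0} \<psi>
        + ennreal (1 + 1 / s) * sq_integral {-T..0} (corr_vec T z)"
      by (subst nn_integral_add) (auto simp: nn_integral_cmult)
    also have "\<dots> \<le> ennreal (1 + s) * ennreal R + ennreal (1 + 1 / s) * ennreal (s\<^sup>2)"
      using n by (intro add_mono mult_left_mono \<psi>R) auto
    also have "\<dots> = ennreal ((1 + s) * R + (1 + 1 / s) * s\<^sup>2)"
      using s R by (simp add: ennreal_mult ennreal_plus)
    finally have cost: "sq_integral {-T..0} ?\<phi> \<le> ennreal ((1 + s) * R + (1 + 1 / s) * s\<^sup>2)" .
    have "qpot (cut_path T z 0) \<le> ereal (((1 + s) * R + (1 + 1 / s) * s\<^sup>2) / 2)"
    proof (rule qpot_le_path[OF T wc _ _ cost _ cut_path_mode_sol[OF ms T fin]])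
      show "cut_path T z (- T) = 0" using T by (simp add: cut_path_def cut_values flip: zero_prod_def)
      show "0 \<le> (1 + s) * R + (1 + 1 / s) * s\<^sup>2" using s R by simp
    qed auto
    moreover have "cut_path T z 0 = z 0" by (simp add: cut_path_def cut_values flip: zero_prod_def)
    moreover have "((1 + s) * R + (1 + 1 / s) * s\<^sup>2) / 2 = (1 + s) * (I + s) + (s + 1) * s / 2"
      using s by (simp add: R_def power2_eq_square field_simps)
    ultimately show ?thesis by simp
  qed
  have i: "(\<lambda>n. 1 / real (Suc n)) \<longlonglongrightarrow> 0"
    using LIMSEQ_inverse_real_of_nat by (simp add: inverse_eq_divide)
  have "(\<lambda>n. (1 + 1 / real (Suc n)) * (I + 1 / real (Suc n)) + (1 / real (Suc n) + 1) * (1 / real (Suc n)) / 2)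
     \<longlonglongrightarrow> (1 + 0) * (I + 0) + (0 + 1) * 0 / 2" by (intro tendsto_intros i) simp
  then have "(\<lambda>n. ereal ((1 + 1 / real (Suc n)) * (I + 1 / real (Suc n)) + (1 / real (Suc n) + 1) * (1 / real (Suc n)) / 2))
     \<longlonglongrightarrow> ereal I" by simp
  then show ?thesis unfolding I
    by (rule LIMSEQ_le_const) (intro exI[of _ 0] allI impI main, simp)
qed simp

end

subsection \<open>Compactness\<close>

lemma set_integral_const_Icc:
  fixes c :: real assumes "a \<le> b" shows "(LINT s:{a..b}|lborel. c) = c * (b - a)"
  using assms by (simp add: set_lebesgue_integral_def mult.commute)

lemma set_integral_abs_bound:
  fixes f g :: "real \<Rightarrow> real"
  assumes f: "set_integrable lborel {a..b} f" and g: "set_integrable lborel {a..b} g"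
    and le: "\<And>s. s \<in> {a..b} \<Longrightarrow> \<bar>f s\<bar> \<le> g s"
  shows "\<bar>LINT s:{a..b}|lborel. f s\<bar> \<le> (LINT s:{a..b}|lborel. g s)"
proof -
  have "(LINT s:{a..b}|lborel. f s) \<le> (LINT s:{a..b}|lborel. g s)"
    by (rule set_integral_mono[OF f g]) (use le in force)
  moreover have "(LINT s:{a..b}|lborel. - f s) \<le> (LINT s:{a..b}|lborel. g s)"
    by (rule set_integral_mono) (use f g le in \<open>force simp: set_integrable_def\<close>)+
  moreover have "(LINT s:{a..b}|lborel. - f s) = - (LINT s:{a..b}|lborel. f s)"
    by (rule set_integral_uminus[OF f])
  ultimately show ?thesis by linarith
qed

text \<open>The Arzela-Ascoli step: a modulus of continuity independent of n transfers the Cauchy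
  property from a nearby rational. The rational is taken to the left of t, so that it stays in the
  half line.\<close>

lemma convergent_from_rationals:
  fixes F :: "nat \<Rightarrow> real \<Rightarrow> real"
  assumes eq: "\<And>\<epsilon>. \<epsilon> > 0 \<Longrightarrow> \<exists>\<delta>>0. \<forall>n s t. s \<le> t \<and> t \<le> 0 \<and> t - s < \<delta> \<longrightarrow> \<bar>F n t - F n s\<bar> \<le> \<epsilon>"
    and rat: "\<And>q. q \<in> \<rat> \<Longrightarrow> q \<le> 0 \<Longrightarrow> convergent (\<lambda>n. F n q)" and t: "t \<le> 0"
  shows "convergent (\<lambda>n. F n t)"
proof (rule Cauchy_convergent, rule metric_CauchyI)
  fix e :: real assume e: "e > 0"
  then obtain \<delta> where \<delta>: "\<delta> > 0" "\<And>n s t. s \<le> t \<Longrightarrow> t \<le> 0 \<Longrightarrow> t - s < \<delta> \<Longrightarrow> \<bar>F n t - F n s\<bar> \<le> e / 4"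
    using eq[of "e / 4"] by (metis divide_pos_pos zero_less_numeral)
  obtain q where q: "q \<in> \<rat>" "t - \<delta> < q" "q < t" using Rats_dense_in_real[of "t - \<delta>" t] \<delta> by auto
  have "Cauchy (\<lambda>n. F n q)" using rat[OF q(1)] q t by (simp add: convergent_Cauchy)
  then obtain N where N: "\<And>m n. m \<ge> N \<Longrightarrow> n \<ge> N \<Longrightarrow> dist (F m q) (F n q) < e / 4"
    using e metric_CauchyD[of "\<lambda>n. F n q" "e / 4"] by (metis divide_pos_pos zero_less_numeral)
  have "dist (F m t) (F n t) < e" if "m \<ge> N" "n \<ge> N" for m n
  proof -
    have "\<bar>F m t - F m q\<bar> \<le> e / 4" "\<bar>F n t - F n q\<bar> \<le> e / 4" using \<delta>(2)[of q t] q t by auto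
    moreover have "\<bar>F m q - F n q\<bar> < e / 4" using N[OF that] by (simp add: dist_real_def)
    ultimately have "\<bar>F m t - F n t\<bar> < e" using e by linarith
    then show ?thesis by (simp add: dist_real_def)
  qed
  then show "\<exists>N. \<forall>m\<ge>N. \<forall>n\<ge>N. dist (F m t) (F n t) < e" by blast
qed

lemma continuous_limit_of_equicontinuous:
  fixes F :: "nat \<Rightarrow> real \<Rightarrow> real"
  assumes eq: "\<And>\<epsilon>. \<epsilon> > 0 \<Longrightarrow> \<exists>\<delta>>0. \<forall>n s t. s \<le> t \<and> t \<le> 0 \<and> t - s < \<delta> \<longrightarrow> \<bar>F n t - F n s\<bar> \<le> \<epsilon>"
    and lim: "\<And>t. t \<le> 0 \<Longrightarrow> (\<lambda>n. F n t) \<longlonglongrightarrow> G t"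
  shows "continuous_on {..0} G"
  unfolding continuous_on_iff
proof (intro ballI allI impI)
  fix t e :: real assume t: "t \<in> {..0}" and e: "e > 0"
  then obtain \<delta> where \<delta>: "\<delta> > 0" "\<And>n s t. s \<le> t \<Longrightarrow> t \<le> 0 \<Longrightarrow> t - s < \<delta> \<Longrightarrow> \<bar>F n t - F n s\<bar> \<le> e / 2"
    using eq[of "e / 2"] by (metis divide_pos_pos zero_less_numeral)
  have main: "\<bar>G b - G a\<bar> \<le> e / 2" if "a \<le> b" "b \<le> 0" "b - a < \<delta>" for a b
  proof -
    have "(\<lambda>n. \<bar>F n b - F n a\<bar>) \<longlonglongrightarrow> \<bar>G b - G a\<bar>" using that by (intro tendsto_intros lim) auto
    then show ?thesis by (rule LIMSEQ_le_const2) (use \<delta>(2)[OF that] in auto)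
  qed
  have "dist (G s) (G t) < e" if "s \<in> {..0}" "dist s t < \<delta>" for s
  proof (cases "s \<le> t")
    case True
    then show ?thesis using main[of s t] that t e by (simp add: dist_real_def abs_minus_commute)
  next
    case False
    then show ?thesis using main[of t s] that t e by (simp add: dist_real_def)
  qed
  then show "\<exists>d>0. \<forall>x'\<in>{..0}. dist x' t < d \<longrightarrow> dist (G x') (G t) < e" using \<delta>(1) by blast
qed

context damped_wave
begin

lemma mode_sol_cong:
  assumes "mode_sol a b \<psi> z" "\<And>t. t \<in> {a..b} \<Longrightarrow> z t = z2 t" "\<And>t. t \<in> {a..b} \<Longrightarrow> \<psi> t = \<psi>2 t"
  shows "mode_sol a b \<psi>2 z2"
  unfolding mode_sol_def
  by (intro allI oscillator_cong[OF mode_sol_osc[OF assms(1)]]) (simp_all add: assms mode_force_def)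

lemma mode_sol_combine:
  assumes "mode_sol a b \<psi> z" "mode_sol b d \<psi> z" "a \<le> b" "b \<le> d"
  shows "mode_sol a d \<psi> z"
  using assms unfolding mode_sol_def oscillator_def by (meson primitive_on_combine)

lemma mode_sol_zero: "mode_sol a b (\<lambda>_. 0) (\<lambda>_. 0)"
proof -
  have "primitive_on a b (\<lambda>_. 0) (\<lambda>_. 0)"
    by (rule primitive_on_derivative) auto
  then show ?thesis by (simp add: mode_sol_def oscillator_def mode_force_def B_zero um_def vm_def)
qed

text \<open>Since B 0 = 0, the zero path with zero control solves the equation, so a path that
  starts at 0 continues backwards as 0 at no cost. Clamping time at -T expresses this
  extension.\<close>

lemma mode_sol_extend:
  assumes ms: "mode_sol (-T) 0 \<psi> z" and T: "T > 0" and z0: "z (- T) = 0" and \<psi>0: "\<And>t. t \<notin> {-T<..<0} \<Longrightarrow> \<psi> t = 0"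
    and N: "N \<ge> T"
  shows "mode_sol (- N) 0 \<psi> (\<lambda>t. z (max t (- T)))"
proof (rule mode_sol_combine)
  show "mode_sol (- N) (- T) \<psi> (\<lambda>t. z (max t (- T)))"
    by (rule mode_sol_cong[OF mode_sol_zero]) (auto simp: max_def z0 \<psi>0)
  show "mode_sol (- T) 0 \<psi> (\<lambda>t. z (max t (- T)))"
    by (rule mode_sol_cong[OF ms]) (auto simp: max_def)
qed (use T N in auto)

lemma W_zero_value: "W \<delta> 0 = 0"
  by (simp add: W_def wk_def um_def vm_def)

text \<open>The starting times of a minimizing sequence may be unbounded, so the constant must not
  depend on the interval. The small gain estimate first bounds u in the square norm by the control
  alone, and the energy estimate at index 0 then raises this to \<open>W 0\<close>.\<close>

lemma uniform_bound:
  "\<exists>K\<ge>0. \<forall>a b \<psi> z M. a \<le> b \<longrightarrow> continuous_on {a..b} z \<longrightarrow> \<psi> \<in> borel_measurable borel \<longrightarrow> mode_sol a b \<psi> z \<longrightarrow> z a = 0 \<longrightarrow>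
     sq_integral {a..b} \<psi> \<le> ennreal M \<longrightarrow> M \<ge> 0 \<longrightarrow>
     W 0 (z b) + (\<integral>\<^sup>+t\<in>{a..b}. W 0 (z t) \<partial>lborel) \<le> ennreal (K * M)"
proof -
  obtain K1 where K1: "K1 \<ge> 0" "\<And>a b \<psi> z. a \<le> b \<Longrightarrow> continuous_on {a..b} z \<Longrightarrow> \<psi> \<in> borel_measurable borel \<Longrightarrow> mode_sol a b \<psi> z \<Longrightarrow>
     (\<integral>\<^sup>+t\<in>{a..b}. ennreal ((norm (fst (z t)))\<^sup>2) \<partial>lborel)
       \<le> ennreal K1 * (ennreal ((norm (z a))\<^sup>2) + sq_integral {a..b} \<psi>)"
    using small_gain_estimate by blast
  define K where "K = KE * (2 * (\<alpha> 0)\<^sup>2 * K1 + 2 * CQ 0)"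
  have CQ: "CQ 0 \<ge> 0" by (simp add: CQ_def)
  have "K \<ge> 0" using K1 KE_pos CQ by (simp add: K_def)
  moreover have "W 0 (z b) + (\<integral>\<^sup>+t\<in>{a..b}. W 0 (z t) \<partial>lborel) \<le> ennreal (K * M)"
    if ab: "a \<le> b" and z: "continuous_on {a..b} z" and \<psi>: "\<psi> \<in> borel_measurable borel" and ms: "mode_sol a b \<psi> z" and za: "z a = 0"
      and le: "sq_integral {a..b} \<psi> \<le> ennreal M" and M: "M \<ge> 0" for a b \<psi> z M
  proof -
    have 1: "(\<integral>\<^sup>+t\<in>{a..b}. N2 0 (fst (z t)) \<partial>lborel) \<le> ennreal K1 * ennreal M"
      unfolding N2_zero by (rule order_trans[OF K1(2)[OF ab z \<psi> ms]]) (use le in \<open>simp add: za mult_left_mono\<close>)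
    have "W 0 (z b) + (\<integral>\<^sup>+t\<in>{a..b}. W 0 (z t) \<partial>lborel) \<le> ennreal KE * (W 0 (z a) + (\<integral>\<^sup>+t\<in>{a..b}. force2 0 \<psi> z t \<partial>lborel))"
      by (rule energy_estimate[OF ms ab z \<psi>])
    also have "\<dots> \<le> ennreal KE * (ennreal (2 * (\<alpha> 0)\<^sup>2) * (ennreal K1 * ennreal M) + ennreal (2 * CQ 0) * ennreal M)"
    proof (rule mult_left_mono)
      have "(\<integral>\<^sup>+t\<in>{a..b}. force2 0 \<psi> z t \<partial>lborel) \<le> ennreal (2 * (\<alpha> 0)\<^sup>2) * (\<integral>\<^sup>+t\<in>{a..b}. N2 0 (fst (z t)) \<partial>lborel)
          + ennreal (2 * CQ 0) * sq_integral {a..b} \<psi>"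
        by (rule integral_force2_le[OF order_refl _ z \<psi>]) (use \<beta>_nonneg in simp)
      also have "\<dots> \<le> ennreal (2 * (\<alpha> 0)\<^sup>2) * (ennreal K1 * ennreal M) + ennreal (2 * CQ 0) * ennreal M"
        by (intro add_mono mult_left_mono 1 le) auto
      finally show "W 0 (z a) + (\<integral>\<^sup>+t\<in>{a..b}. force2 0 \<psi> z t \<partial>lborel) \<le> ennreal (2 * (\<alpha> 0)\<^sup>2) * (ennreal K1 * ennreal M) + ennreal (2 * CQ 0) * ennreal M"
        by (simp add: za W_zero_value)
    qed simp
    also have "\<dots> = ennreal (KE * (2 * (\<alpha> 0)\<^sup>2 * (K1 * M) + 2 * CQ 0 * M))"
    proof -
      have nn: "0 \<le> KE" "0 \<le> 2 * (\<alpha> 0)\<^sup>2" "0 \<le> K1" "0 \<le> 2 * CQ 0" using KE_pos K1 CQ by auto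
      show ?thesis using nn M by (simp only: ennreal_plus ennreal_mult mult_nonneg_nonneg add_nonneg_nonneg)
    qed
    also have "KE * (2 * (\<alpha> 0)\<^sup>2 * (K1 * M) + 2 * CQ 0 * M) = K * M" by (simp add: K_def algebra_simps)
    finally show ?thesis .
  qed
  ultimately show ?thesis by blast
qed

section \<open>Compactness from finitely many modes\<close>

lemma W_zero_sums:
  assumes "W 0 z \<le> ennreal K" "K \<ge> 0"
  shows "summable (\<lambda>k. wk k z)" "(\<Sum>k. wk k z) \<le> K" "wk k z \<le> K"
proof -
  have W: "(\<Sum>k. ennreal (wk k z)) \<le> ennreal K" using assms by (simp add: W_zero)
  then have "(\<Sum>k. ennreal (wk k z)) < top" by (simp add: order_le_less_trans)
  then show s: "summable (\<lambda>k. wk k z)" by (intro summable_suminf_not_top) (auto simp: wk_nonneg)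
  have "ennreal (\<Sum>k. wk k z) \<le> ennreal K"
    using W unfolding suminf_ennreal_sums[OF summable_sums[OF s] wk_nonneg] .
  then show le: "(\<Sum>k. wk k z) \<le> K" using assms by (simp add: ennreal_le_iff)
  have "(\<Sum>j\<in>{k}. wk j z) \<le> (\<Sum>j. wk j z)" by (rule sum_le_suminf[OF s]) (auto simp: wk_nonneg)
  then show "wk k z \<le> K" using le by simp
qed

text \<open>Balls of \<open>W 0\<close> are compact in \<open>'h \<times> 'm\<close>: on them, the norm is controlled by finitely many
  modes.\<close>

lemma finitely_many_modes:
  assumes \<epsilon>: "\<epsilon> > 0" and K: "K \<ge> 0"
  shows "\<exists>m. \<exists>\<eta>>0. \<forall>p q. W 0 p \<le> ennreal K \<longrightarrow> W 0 q \<le> ennreal K \<longrightarrow>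
    (\<forall>k<m. \<bar>um k p - um k q\<bar> \<le> \<eta> \<and> \<bar>vm k p - vm k q\<bar> \<le> \<eta>) \<longrightarrow> norm (p - q) < \<epsilon>"
proof -
  have "\<forall>\<^sub>F m in sequentially. \<alpha> m > 8 * (K + 1) / \<epsilon>\<^sup>2"
    using \<alpha>_lim by (simp add: filterlim_at_top_dense)
  \<comment> \<open>On the modes from m on, the norm of p - q costs a factor of at most 1/\<alpha> m
    relative to \<open>wk\<close>, and the sum of 2 \<open>wk\<close> of p and 2 \<open>wk\<close>
    of q is at most 4 K; so the tail is at most \<epsilon>^2/2. The choice of \<eta> below limits
    the first m modes to \<epsilon>^2/4.\<close>
  then obtain m where m: "\<alpha> m > 8 * (K + 1) / \<epsilon>\<^sup>2" by (auto simp: eventually_sequentially)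
  define X where "X = real m * (1 + 1 / \<alpha> 0) + 1"
  have X: "X > 0" using \<alpha>_0 by (auto simp: X_def intro!: add_nonneg_pos mult_nonneg_nonneg)
  define \<eta> where "\<eta> = sqrt (\<epsilon>\<^sup>2 / (4 * X))"
  have \<eta>: "\<eta> > 0" using \<epsilon> X by (simp add: \<eta>_def)
  have \<eta>2: "\<eta>\<^sup>2 = \<epsilon>\<^sup>2 / (4 * X)" using X by (simp add: \<eta>_def)
  have "norm (p - q) < \<epsilon>" if p: "W 0 p \<le> ennreal K" and q: "W 0 q \<le> ennreal K"
      and cl: "\<And>k. k < m \<Longrightarrow> \<bar>um k p - um k q\<bar> \<le> \<eta> \<and> \<bar>vm k p - vm k q\<bar> \<le> \<eta>" for p q
  proof -
    interpret um: bounded_linear "um k" for k by (rule um_bounded_linear)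
    interpret vm: bounded_linear "vm k" for k by (rule vm_bounded_linear)
    let ?n = "\<lambda>k. (um k (p - q))\<^sup>2 + (vm k (p - q))\<^sup>2 / \<alpha> k"
    have wkd: "wk k (p - q) \<le> 2 * wk k p + 2 * wk k q" for k
    proof -
      have "(a - b)\<^sup>2 \<le> 2 * a\<^sup>2 + 2 * b\<^sup>2" for a b :: real using two_squares[of a "- b"] by simp
      then have "(um k p - um k q)\<^sup>2 \<le> 2 * (um k p)\<^sup>2 + 2 * (um k q)\<^sup>2" "(vm k p - vm k q)\<^sup>2 \<le> 2 * (vm k p)\<^sup>2 + 2 * (vm k q)\<^sup>2" by auto
      then have "\<alpha> k * (um k p - um k q)\<^sup>2 + (vm k p - vm k q)\<^sup>2
        \<le> \<alpha> k * (2 * (um k p)\<^sup>2 + 2 * (um k q)\<^sup>2) + (2 * (vm k p)\<^sup>2 + 2 * (vm k q)\<^sup>2)"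
        using \<alpha>_pos[of k] by (intro add_mono mult_left_mono) auto
      then show ?thesis by (simp add: wk_def um.diff vm.diff algebra_simps)
    qed
    have sp: "summable (\<lambda>k. wk k p)" "(\<Sum>k. wk k p) \<le> K" and sq: "summable (\<lambda>k. wk k q)" "(\<Sum>k. wk k q) \<le> K"
      using W_zero_sums[OF p K] W_zero_sums[OF q K] by auto
    have spq: "summable (\<lambda>k. 2 * wk k p + 2 * wk k q)" by (intro summable_add summable_mult sp sq)
    have sumpq: "(\<Sum>k. 2 * wk k p + 2 * wk k q) \<le> 4 * K"
      using sp sq by (simp add: suminf_add[symmetric] suminf_mult summable_mult)
    have ns: "summable ?n" and nsum: "(norm (p - q))\<^sup>2 = (\<Sum>k. ?n k)" using norm_modes[of "p - q"] by (auto simp: sums_iff)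
    have "(\<Sum>k. ?n k) = (\<Sum>k. ?n (k + m)) + (\<Sum>k<m. ?n k)" by (rule suminf_split_initial_segment[OF ns])
    moreover have "(\<Sum>k<m. ?n k) \<le> \<epsilon>\<^sup>2 / 4"
    proof -
      have "(\<Sum>k<m. ?n k) \<le> (\<Sum>k<m. \<eta>\<^sup>2 + \<eta>\<^sup>2 / \<alpha> 0)"
      proof (rule sum_mono)
        fix k assume "k \<in> {..<m}"
        then have "\<bar>um k (p - q)\<bar> \<le> \<eta>" "\<bar>vm k (p - q)\<bar> \<le> \<eta>" using cl[of k] by (auto simp: um.diff vm.diff)
        then have "(um k (p - q))\<^sup>2 \<le> \<eta>\<^sup>2" "(vm k (p - q))\<^sup>2 \<le> \<eta>\<^sup>2"
          using power_mono[of "\<bar>um k (p - q)\<bar>" \<eta> 2] power_mono[of "\<bar>vm k (p - q)\<bar>" \<eta> 2] by auto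
        moreover have "(vm k (p - q))\<^sup>2 / \<alpha> k \<le> \<eta>\<^sup>2 / \<alpha> 0"
          using \<open>(vm k (p - q))\<^sup>2 \<le> \<eta>\<^sup>2\<close> \<alpha>_ge[of k] \<alpha>_0 by (intro frac_le) auto
        ultimately show "?n k \<le> \<eta>\<^sup>2 + \<eta>\<^sup>2 / \<alpha> 0" by simp
      qed
      also have "\<dots> = real m * (1 + 1 / \<alpha> 0) * \<eta>\<^sup>2" by (simp add: algebra_simps)
      also have "\<dots> \<le> X * \<eta>\<^sup>2" by (intro mult_right_mono) (auto simp: X_def)
      also have "\<dots> = \<epsilon>\<^sup>2 / 4" using X by (simp add: \<eta>2)
      finally show ?thesis .
    qed
    moreover have "(\<Sum>k. ?n (k + m)) \<le> \<epsilon>\<^sup>2 / 2"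
    proof -
      have "(\<Sum>k. ?n (k + m)) \<le> (\<Sum>k. (1 / \<alpha> m) * (2 * wk (k + m) p + 2 * wk (k + m) q))"
      proof (rule suminf_le)
        fix k
        have "?n (k + m) = (1 / \<alpha> (k + m)) * wk (k + m) (p - q)" by (simp add: wk_def field_simps)
        also have "\<dots> \<le> (1 / \<alpha> m) * (2 * wk (k + m) p + 2 * wk (k + m) q)"
          using \<alpha>_mono[of m "k + m"] \<alpha>_pos wk_nonneg by (intro mult_mono wkd divide_left_mono) (auto simp: less_imp_le)
        finally show "?n (k + m) \<le> (1 / \<alpha> m) * (2 * wk (k + m) p + 2 * wk (k + m) q)" .
        show "summable (\<lambda>k. ?n (k + m))" by (rule summable_ignore_initial_segment[OF ns])
        show "summable (\<lambda>k. (1 / \<alpha> m) * (2 * wk (k + m) p + 2 * wk (k + m) q))"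
          by (intro summable_mult summable_ignore_initial_segment[OF spq])
      qed
      also have "\<dots> = (1 / \<alpha> m) * (\<Sum>k. 2 * wk (k + m) p + 2 * wk (k + m) q)"
        by (rule suminf_mult[OF summable_ignore_initial_segment[OF spq]])
      also have "\<dots> \<le> (1 / \<alpha> m) * (4 * K)"
      proof (rule mult_left_mono)
        have "(\<Sum>k. 2 * wk (k + m) p + 2 * wk (k + m) q) \<le> (\<Sum>k. 2 * wk k p + 2 * wk k q)"
          unfolding suminf_split_initial_segment[OF spq, of m] by (simp add: sum_nonneg wk_nonneg)
        then show "(\<Sum>k. 2 * wk (k + m) p + 2 * wk (k + m) q) \<le> 4 * K" using sumpq by linarith
      qed (use \<alpha>_pos[of m] in simp)
      also have "\<dots> \<le> \<epsilon>\<^sup>2 / 2"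
      proof -
        have "8 * (K + 1) < \<alpha> m * \<epsilon>\<^sup>2" using m \<epsilon> by (simp add: field_simps)
        then show ?thesis using \<alpha>_pos[of m] K by (simp add: field_simps)
      qed
      finally show ?thesis .
    qed
    ultimately have "(norm (p - q))\<^sup>2 < \<epsilon>\<^sup>2" 
      using nsum zero_less_power[OF \<epsilon>, of 2] by linarith
    then show ?thesis using \<epsilon> by (simp add: power_less_imp_less_base)
  qed
  then show ?thesis using \<eta> by blast
qed

lemma modes_convergent:
  assumes W: "\<And>n. W 0 (p n) \<le> ennreal K" and K: "K \<ge> 0"
    and u: "\<And>k. convergent (\<lambda>n. um k (p n))" and v: "\<And>k. convergent (\<lambda>n. vm k (p n))"
  shows "convergent p"
proof (rule Cauchy_convergent, rule metric_CauchyI)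
  fix e :: real assume e: "e > 0"
  obtain m \<eta> where \<eta>: "\<eta> > 0" and cl: "\<And>p q. W 0 p \<le> ennreal K \<Longrightarrow> W 0 q \<le> ennreal K \<Longrightarrow>
    (\<forall>k<m. \<bar>um k p - um k q\<bar> \<le> \<eta> \<and> \<bar>vm k p - vm k q\<bar> \<le> \<eta>) \<Longrightarrow> norm (p - q) < e"
    using finitely_many_modes[OF e K] by blast
  have "\<exists>N. \<forall>i\<ge>N. \<forall>j\<ge>N. \<bar>um k (p i) - um k (p j)\<bar> \<le> \<eta> \<and> \<bar>vm k (p i) - vm k (p j)\<bar> \<le> \<eta>" for k
  proof -
    obtain N1 N2 where "\<And>i j. i \<ge> N1 \<Longrightarrow> j \<ge> N1 \<Longrightarrow> dist (um k (p i)) (um k (p j)) < \<eta>"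
      "\<And>i j. i \<ge> N2 \<Longrightarrow> j \<ge> N2 \<Longrightarrow> dist (vm k (p i)) (vm k (p j)) < \<eta>"
      using metric_CauchyD[OF convergent_Cauchy[OF u[of k]] \<eta>] metric_CauchyD[OF convergent_Cauchy[OF v[of k]] \<eta>] by metis
    then show ?thesis by (intro exI[of _ "max N1 N2"]) (auto simp: dist_real_def less_imp_le)
  qed
  then obtain N where N: "\<And>k i j. i \<ge> N k \<Longrightarrow> j \<ge> N k \<Longrightarrow> \<bar>um k (p i) - um k (p j)\<bar> \<le> \<eta> \<and> \<bar>vm k (p i) - vm k (p j)\<bar> \<le> \<eta>"
    by metis
  have "dist (p i) (p j) < e" if "i \<ge> (\<Sum>k<m. N k)" "j \<ge> (\<Sum>k<m. N k)" for i j
    unfolding dist_norm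
  proof (rule cl[OF W W], intro allI impI)
    fix k assume "k < m"
    then have "N k \<le> (\<Sum>k<m. N k)" by (intro member_le_sum) auto
    then show "\<bar>um k (p i) - um k (p j)\<bar> \<le> \<eta> \<and> \<bar>vm k (p i) - vm k (p j)\<bar> \<le> \<eta>" using N that by simp
  qed
  then show "\<exists>M. \<forall>m\<ge>M. \<forall>n\<ge>M. dist (p m) (p n) < e" by blast
qed

lemma modes_continuous_on:
  fixes z :: "real \<Rightarrow> 'h \<times> 'm"
  assumes W: "\<And>t. t \<in> A \<Longrightarrow> W 0 (z t) \<le> ennreal K" and K: "K \<ge> 0"
    and u: "\<And>k. continuous_on A (\<lambda>t. um k (z t))" and v: "\<And>k. continuous_on A (\<lambda>t. vm k (z t))"
  shows "continuous_on A z"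
  unfolding continuous_on_iff
proof (intro ballI allI impI)
  fix t e assume t: "t \<in> A" and e: "(e::real) > 0"
  obtain m \<eta> where \<eta>: "\<eta> > 0" and cl: "\<And>p q. W 0 p \<le> ennreal K \<Longrightarrow> W 0 q \<le> ennreal K \<Longrightarrow>
    (\<forall>k<m. \<bar>um k p - um k q\<bar> \<le> \<eta> \<and> \<bar>vm k p - vm k q\<bar> \<le> \<eta>) \<Longrightarrow> norm (p - q) < e"
    using finitely_many_modes[OF e K] by blast
  have ev: "\<forall>\<^sub>F s in at t within A. dist (um k (z s)) (um k (z t)) < \<eta> \<and> dist (vm k (z s)) (vm k (z t)) < \<eta>" for k
    using u[of k] v[of k] t \<eta> by (intro eventually_conj tendstoD) (auto simp: continuous_on_def)
  have "\<forall>\<^sub>F s in at t within A. \<forall>k\<in>{..<m}. dist (um k (z s)) (um k (z t)) < \<eta> \<and> dist (vm k (z s)) (vm k (z t)) < \<eta>"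
    using ev by (intro eventually_ball_finite) auto
  then obtain d where d: "d > 0" "\<And>s. s \<in> A \<Longrightarrow> s \<noteq> t \<Longrightarrow> dist s t < d \<Longrightarrow>
     \<forall>k\<in>{..<m}. dist (um k (z s)) (um k (z t)) < \<eta> \<and> dist (vm k (z s)) (vm k (z t)) < \<eta>"
    by (auto simp: eventually_at)
  have "dist (z s) (z t) < e" if "s \<in> A" "dist s t < d" for s
  proof (cases "s = t")
    case False
    show ?thesis unfolding dist_norm
      by (rule cl[OF W[OF that(1)] W[OF t]]) (use d(2)[OF that(1) False that(2)] in \<open>auto simp: dist_real_def less_imp_le\<close>)
  qed (use e in simp)
  then show "\<exists>d>0. \<forall>x'\<in>A. dist x' t < d \<longrightarrow> dist (z x') (z t) < e" using d(1) by blast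
qed

text \<open>The velocity is driven by a control that is only square integrable. From |\<psi>| <=
  \<eta> |\<psi>|^2 + 1/(4 \<eta>) its integral is at most \<eta> M + (t - s)/(4 \<eta>), small once
  \<eta> and then t - s are chosen small. The bound may depend on k, because the norm on bounded
  energy sets is governed by finitely many modes.\<close>

lemma mode_equicontinuous:
  assumes ms: "mode_sol s t \<psi> z" and st: "s \<le> t" and z: "continuous_on {s..t} z" and \<psi>[measurable]: "\<psi> \<in> borel_measurable borel"
    and bnd: "\<And>r. r \<in> {s..t} \<Longrightarrow> \<bar>um k (z r)\<bar> \<le> D \<and> \<bar>vm k (z r)\<bar> \<le> D \<and> \<bar>B (fst (z r)) \<bullet> e k\<bar> \<le> D"
    and le: "sq_integral {s..t} \<psi> \<le> ennreal M" and M: "M \<ge> 0" and \<eta>: "\<eta> > 0"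
  shows "\<bar>um k (z t) - um k (z s)\<bar> \<le> D * (t - s)"
    "\<bar>vm k (z t) - vm k (z s)\<bar> \<le> ((\<alpha> k + 2) * D * (t - s) + lam k * (\<eta> * M + (t - s) / (4 * \<eta>))) / \<mu>"
proof -
  note osc = mode_sol_osc[OF ms, of k, unfolded oscillator_def]
  have icon: "set_integrable lborel {s..t} (\<lambda>_. x :: real)" for x
    by (intro borel_integrable_atLeastAtMost' continuous_intros)
  have "um k (z t) - um k (z s) = (LINT r:{s..t}|lborel. vm k (z r))"
    by (rule primitive_on_diff[OF conjunct1[OF osc]]) (use st in auto)
  also have "\<bar>\<dots>\<bar> \<le> (LINT r:{s..t}|lborel. D)"
    by (rule set_integral_abs_bound[OF primitive_on_integrable[OF conjunct1[OF osc]] icon]) (use bnd in auto)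
  finally show "\<bar>um k (z t) - um k (z s)\<bar> \<le> D * (t - s)" using st by (simp add: set_integral_const_Icc)
  have i2: "set_integrable lborel {s..t} (\<lambda>r. (norm (\<psi> r))\<^sup>2)"
    by (rule set_integrable_if_nn_finite) (use le in \<open>auto simp: set_borel_measurable_def order_le_less_trans\<close>)
  have "ennreal (LINT r:{s..t}|lborel. (norm (\<psi> r))\<^sup>2) \<le> ennreal M"
    using le nn_set_integral_eq_LINT[OF i2] by simp
  then have M': "(LINT r:{s..t}|lborel. (norm (\<psi> r))\<^sup>2) \<le> M" using M by (simp add: ennreal_le_iff)
  let ?g = "\<lambda>r. ((\<alpha> k + 2) * D + lam k / (4 * \<eta>)) / \<mu> + (lam k * \<eta> / \<mu>) * (norm (\<psi> r))\<^sup>2"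
  have ig: "set_integrable lborel {s..t} (\<lambda>r. (lam k * \<eta> / \<mu>) * (norm (\<psi> r))\<^sup>2)" using i2 by (rule set_integrable_mult_right)
  have eq: "vm k (z t) - vm k (z s) = (LINT r:{s..t}|lborel. (- \<alpha> k * um k (z r) - vm k (z r) + mode_force \<psi> z k r) / \<mu>)"
    by (rule primitive_on_diff[OF conjunct2[OF osc]]) (use st in auto)
  have "\<bar>vm k (z t) - vm k (z s)\<bar> \<le> (LINT r:{s..t}|lborel. ?g r)"
    unfolding eq
  proof (rule set_integral_abs_bound[OF primitive_on_integrable[OF conjunct2[OF osc]] set_integral_add(1)[OF icon ig]])
    fix r assume r: "r \<in> {s..t}"
    have "\<bar>\<psi> r \<bullet> e k\<bar> \<le> norm (\<psi> r) * norm (e k)" by (rule Cauchy_Schwarz_ineq2)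
    also have "norm (e k) = 1" by (simp add: norm_eq_sqrt_inner e_orthonormal)
    finally have 1: "\<bar>\<psi> r \<bullet> e k\<bar> \<le> norm (\<psi> r)" by simp
    have "0 \<le> (2 * \<eta> * norm (\<psi> r) - 1)\<^sup>2 / (4 * \<eta>)" using \<eta> by simp
    then have "norm (\<psi> r) \<le> \<eta> * (norm (\<psi> r))\<^sup>2 + 1 / (4 * \<eta>)" using \<eta> by (simp add: power2_eq_square field_simps)
    then have "\<bar>lam k * (\<psi> r \<bullet> e k)\<bar> \<le> lam k * (\<eta> * (norm (\<psi> r))\<^sup>2 + 1 / (4 * \<eta>))"
      using 1 lam_pos[of k] by (simp add: abs_mult)
    moreover have "\<bar>\<alpha> k * um k (z r)\<bar> \<le> \<alpha> k * D" using bnd[OF r] \<alpha>_pos[of k] by (simp add: abs_mult)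
    ultimately have "\<bar>- \<alpha> k * um k (z r) - vm k (z r) + mode_force \<psi> z k r\<bar> \<le> \<alpha> k * D + D + D + lam k * (\<eta> * (norm (\<psi> r))\<^sup>2 + 1 / (4 * \<eta>))"
      using bnd[OF r] unfolding mode_force_def by linarith
    then have "\<bar>- \<alpha> k * um k (z r) - vm k (z r) + mode_force \<psi> z k r\<bar> / \<mu> \<le> (\<alpha> k * D + D + D + lam k * (\<eta> * (norm (\<psi> r))\<^sup>2 + 1 / (4 * \<eta>))) / \<mu>"
      using \<mu>_pos by (intro divide_right_mono) auto
    moreover have "(\<alpha> k * D + D + D + lam k * (\<eta> * (norm (\<psi> r))\<^sup>2 + 1 / (4 * \<eta>))) / \<mu> = ?g r"
      by (simp add: add_divide_distrib distrib_left distrib_right)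
    moreover have "\<bar>(- \<alpha> k * um k (z r) - vm k (z r) + mode_force \<psi> z k r) / \<mu>\<bar>
        = \<bar>- \<alpha> k * um k (z r) - vm k (z r) + mode_force \<psi> z k r\<bar> / \<mu>"
      using \<mu>_pos by (simp only: abs_divide abs_of_pos)
    ultimately show "\<bar>(- \<alpha> k * um k (z r) - vm k (z r) + mode_force \<psi> z k r) / \<mu>\<bar> \<le> ?g r" by linarith
  qed auto
  also have "\<dots> = ((\<alpha> k + 2) * D + lam k / (4 * \<eta>)) / \<mu> * (t - s) + (lam k * \<eta> / \<mu>) * (LINT r:{s..t}|lborel. (norm (\<psi> r))\<^sup>2)"
    by (subst set_integral_add(2)[OF icon ig]) (simp add: set_integral_const_Icc[OF st])
  also have "\<dots> \<le> ((\<alpha> k + 2) * D + lam k / (4 * \<eta>)) / \<mu> * (t - s) + (lam k * \<eta> / \<mu>) * M"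
    using lam_pos[of k] \<eta> \<mu>_pos by (intro add_left_mono mult_left_mono M') auto
  also have "\<dots> = ((\<alpha> k + 2) * D * (t - s) + lam k * (\<eta> * M + (t - s) / (4 * \<eta>))) / \<mu>"
    using \<eta> \<mu>_pos by (simp add: field_simps)
  finally show "\<bar>vm k (z t) - vm k (z s)\<bar> \<le> ((\<alpha> k + 2) * D * (t - s) + lam k * (\<eta> * M + (t - s) / (4 * \<eta>))) / \<mu>" .
qed

text \<open>The energy at t is bounded by the energy at any s in the preceding unit interval plus
  the forcing in between. Averaging over s replaces the energy at s by an integral, so the energy at
  t is at most a constant times a tail of a convergent integral.\<close>

lemma tendsto_zero_at_bot:
  assumes ms: "\<And>N. N > 0 \<Longrightarrow> mode_sol (- N) 0 \<psi> z" and z: "continuous_on {..0} z" and \<psi>[measurable]: "\<psi> \<in> borel_measurable borel"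
    and \<psi>2: "(\<integral>\<^sup>+t. ennreal ((norm (\<psi> t))\<^sup>2) \<partial>lborel) < \<infinity>" and W2: "(\<integral>\<^sup>+t\<in>{..0}. W 0 (z t) \<partial>lborel) < \<infinity>"
  shows "((\<lambda>t. norm (z t)) \<longlongrightarrow> 0) at_bot"
proof -
  have Wm [measurable]: "(\<lambda>t. W 0 (z t) * indicator {..0} t) \<in> borel_measurable lborel"
    by (rule W_measurable(1)[OF z]) simp
  define C where "C = KE * (1 + 2 * \<alpha> 0 + 2 * CQ 0)"
  have CQ: "CQ 0 \<ge> 0" by (simp add: CQ_def)
  have C: "C \<ge> 0" using KE_pos \<alpha>_0 CQ by (simp add: C_def)
  define G where "G t = (W 0 (z t) + ennreal ((norm (\<psi> t))\<^sup>2)) * indicator {..0} t" for t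
  have [measurable]: "G \<in> borel_measurable lborel"
  proof -
    have "G = (\<lambda>t. W 0 (z t) * indicator {..0} t + ennreal ((norm (\<psi> t))\<^sup>2) * indicator {..0} t)"
      by (auto simp: G_def distrib_right)
    then show ?thesis by simp
  qed
  have Gfin: "(\<integral>\<^sup>+t. G t \<partial>lborel) < \<infinity>"
  proof -
    have "(\<integral>\<^sup>+t. G t \<partial>lborel) \<le> (\<integral>\<^sup>+t. W 0 (z t) * indicator {..0} t + ennreal ((norm (\<psi> t))\<^sup>2) \<partial>lborel)"
      by (intro nn_integral_mono) (auto simp: G_def indicator_def)
    also have "\<dots> = (\<integral>\<^sup>+t\<in>{..0}. W 0 (z t) \<partial>lborel) + (\<integral>\<^sup>+t. ennreal ((norm (\<psi> t))\<^sup>2) \<partial>lborel)"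
      by (rule nn_integral_add) measurable
    also have "\<dots> < \<infinity>" using \<psi>2 W2 by simp
    finally show ?thesis .
  qed
  have point: "W 0 (z t) \<le> ennreal C * (\<integral>\<^sup>+r. G r * indicator {..t} r \<partial>lborel)" if t: "t \<le> 0" for t
  proof -
    let ?I = "\<integral>\<^sup>+r. G r * indicator {t-1..t} r \<partial>lborel"
    have le: "W 0 (z t) \<le> ennreal KE * (W 0 (z s) + ennreal (2 * \<alpha> 0 + 2 * CQ 0) * ?I)" if s: "s \<in> {t-1..t}" for s
    proof -
      have zc: "continuous_on {s..t} z" by (rule continuous_on_subset[OF z]) (use t in auto)
      have msst: "mode_sol s t \<psi> z" by (rule mode_sol_subinterval[OF ms[of "1 - s"]]) (use s t in auto)
      have "W 0 (z t) \<le> W 0 (z t) + (\<integral>\<^sup>+r\<in>{s..t}. W 0 (z r) \<partial>lborel)" by simp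
      also have "\<dots> \<le> ennreal KE * (W 0 (z s) + (\<integral>\<^sup>+r\<in>{s..t}. force2 0 \<psi> z r \<partial>lborel))"
        by (rule energy_estimate[OF msst _ zc \<psi>]) (use s in auto)
      also have "\<dots> \<le> ennreal KE * (W 0 (z s) + ennreal (2 * \<alpha> 0 + 2 * CQ 0) * ?I)"
      proof (intro mult_left_mono add_left_mono)
        have "(\<integral>\<^sup>+r\<in>{s..t}. force2 0 \<psi> z r \<partial>lborel) \<le> (\<integral>\<^sup>+r. ennreal (2 * \<alpha> 0 + 2 * CQ 0) * (G r * indicator {t-1..t} r) \<partial>lborel)"
        proof (rule nn_integral_mono)
          fix r
          show "force2 0 \<psi> z r * indicator {s..t} r \<le> ennreal (2 * \<alpha> 0 + 2 * CQ 0) * (G r * indicator {t-1..t} r)"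
          proof (cases "r \<in> {s..t}")
            case True
            have "force2 0 \<psi> z r \<le> ennreal (2 * (\<alpha> 0)\<^sup>2) * N2 0 (fst (z r)) + ennreal (2 * CQ 0) * ennreal ((norm (\<psi> r))\<^sup>2)"
              by (rule force2_le) (use \<beta>_nonneg in auto)
            also have "\<dots> \<le> ennreal (2 * (\<alpha> 0)\<^sup>2) * (ennreal (1 / \<alpha> 0) * W 0 (z r)) + ennreal (2 * CQ 0) * ennreal ((norm (\<psi> r))\<^sup>2)"
              by (intro add_right_mono mult_left_mono N2_le_W) auto
            also have "ennreal (2 * (\<alpha> 0)\<^sup>2) * (ennreal (1 / \<alpha> 0) * W 0 (z r)) = ennreal (2 * \<alpha> 0) * W 0 (z r)"
              using \<alpha>_0 by (simp add: mult.assoc[symmetric] ennreal_mult[symmetric] power2_eq_square)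
            also have "ennreal (2 * \<alpha> 0) * W 0 (z r) + ennreal (2 * CQ 0) * ennreal ((norm (\<psi> r))\<^sup>2)
              \<le> ennreal (2 * \<alpha> 0 + 2 * CQ 0) * W 0 (z r) + ennreal (2 * \<alpha> 0 + 2 * CQ 0) * ennreal ((norm (\<psi> r))\<^sup>2)"
              using \<alpha>_0 CQ by (intro add_mono mult_right_mono ennreal_leI) auto
            finally show ?thesis using True s t by (simp add: G_def distrib_left)
          qed simp
        qed
        also have "\<dots> = ennreal (2 * \<alpha> 0 + 2 * CQ 0) * ?I" by (rule nn_integral_cmult) measurable
        finally show "(\<integral>\<^sup>+r\<in>{s..t}. force2 0 \<psi> z r \<partial>lborel) \<le> ennreal (2 * \<alpha> 0 + 2 * CQ 0) * ?I" .
      qed auto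
      finally show ?thesis .
    qed
    \<comment> \<open>The interval of averaging has length 1, so integrating the constant over it
      changes nothing.\<close>
    have "W 0 (z t) = (\<integral>\<^sup>+s. W 0 (z t) * indicator {t-1..t} s \<partial>lborel)" by (simp add: nn_integral_cmult_indicator)
    also have "\<dots> \<le> (\<integral>\<^sup>+s. ennreal KE * ((W 0 (z s) * indicator {..0} s) * indicator {t-1..t} s + (ennreal (2 * \<alpha> 0 + 2 * CQ 0) * ?I) * indicator {t-1..t} s) \<partial>lborel)"
    proof (rule nn_integral_mono)
      fix s
      show "W 0 (z t) * indicator {t-1..t} s \<le> ennreal KE * ((W 0 (z s) * indicator {..0} s) * indicator {t-1..t} s + (ennreal (2 * \<alpha> 0 + 2 * CQ 0) * ?I) * indicator {t-1..t} s)"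
        using le[of s] t by (cases "s \<in> {t-1..t}") auto
    qed
    also have "\<dots> = ennreal KE * ((\<integral>\<^sup>+s. (W 0 (z s) * indicator {..0} s) * indicator {t-1..t} s \<partial>lborel) + (ennreal (2 * \<alpha> 0 + 2 * CQ 0) * ?I))"
      by (simp add: nn_integral_cmult nn_integral_add nn_integral_cmult_indicator)
    also have "\<dots> \<le> ennreal KE * (?I + ennreal (2 * \<alpha> 0 + 2 * CQ 0) * ?I)"
      by (intro mult_left_mono add_right_mono nn_integral_mono) (auto simp: G_def indicator_def)
    also have "\<dots> = ennreal C * ?I"
    proof -
      have nn: "0 \<le> KE" "0 \<le> 2 * \<alpha> 0 + 2 * CQ 0" using KE_pos \<alpha>_0 CQ by auto
      have "C = KE * (1 + (2 * \<alpha> 0 + 2 * CQ 0))" by (simp add: C_def)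
      then have "ennreal C = ennreal KE * (1 + ennreal (2 * \<alpha> 0 + 2 * CQ 0))"
        using nn by (simp only: ennreal_mult ennreal_plus add_nonneg_nonneg zero_le_one ennreal_1)
      then show ?thesis by (simp add: distrib_right mult.assoc)
    qed
    also have "\<dots> \<le> ennreal C * (\<integral>\<^sup>+r. G r * indicator {..t} r \<partial>lborel)"
      by (intro mult_left_mono nn_integral_mono) (auto simp: indicator_def)
    finally show ?thesis .
  qed
  have tail: "(\<lambda>n. \<integral>\<^sup>+r. G r * indicator {..- real n} r \<partial>lborel) \<longlonglongrightarrow> (\<integral>\<^sup>+(r::real). 0 \<partial>lborel)"
  proof (rule nn_integral_dominated_convergence[where w = G])
    show "AE r in lborel. (\<lambda>n. G r * indicator {..- real n} r) \<longlonglongrightarrow> 0"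
    proof (rule AE_I2)
      fix r :: real
      obtain m :: nat where m: "- r < real m" using reals_Archimedean2 by blast
      have "\<forall>\<^sub>F n in sequentially. G r * indicator {..- real n} r = 0"
        using m by (intro eventually_sequentiallyI[of m]) (auto simp: indicator_def)
      then show "(\<lambda>n. G r * indicator {..- real n} r) \<longlonglongrightarrow> 0" by (rule tendsto_eventually)
    qed
    show "AE x in lborel. G x * indicator {..- real j} x \<le> G x" for j by (auto simp: indicator_def)
  qed (use Gfin in auto)
  have "\<forall>\<^sub>F t in at_bot. norm (z t) < \<epsilon>" if \<epsilon>: "\<epsilon> > 0" for \<epsilon>
  proof -
    have "(\<lambda>n. ennreal (1 / \<alpha> 0 * C) * (\<integral>\<^sup>+r. G r * indicator {..- real n} r \<partial>lborel)) \<longlonglongrightarrow> ennreal (1 / \<alpha> 0 * C) * 0"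
      using tail by (intro ennreal_tendsto_cmult) auto
    then have "\<forall>\<^sub>F n in sequentially. ennreal (1 / \<alpha> 0 * C) * (\<integral>\<^sup>+r. G r * indicator {..- real n} r \<partial>lborel) < ennreal (\<epsilon>\<^sup>2)"
      by (rule order_tendstoD) (use \<epsilon> in simp)
    then obtain n where n: "ennreal (1 / \<alpha> 0 * C) * (\<integral>\<^sup>+r. G r * indicator {..- real n} r \<partial>lborel) < ennreal (\<epsilon>\<^sup>2)"
      by (auto simp: eventually_sequentially)
    have "norm (z t) < \<epsilon>" if t: "t \<le> - real n" for t
    proof -
      have "ennreal ((norm (z t))\<^sup>2) \<le> ennreal (1 / \<alpha> 0) * W 0 (z t)" by (rule norm_le_W)
      also have "\<dots> \<le> ennreal (1 / \<alpha> 0) * (ennreal C * (\<integral>\<^sup>+r. G r * indicator {..t} r \<partial>lborel))"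
        using t by (intro mult_left_mono point) auto
      also have "\<dots> \<le> ennreal (1 / \<alpha> 0) * (ennreal C * (\<integral>\<^sup>+r. G r * indicator {..- real n} r \<partial>lborel))"
        using t by (intro mult_left_mono nn_integral_mono) (auto simp: indicator_def)
      also have "\<dots> = ennreal (1 / \<alpha> 0 * C) * (\<integral>\<^sup>+r. G r * indicator {..- real n} r \<partial>lborel)"
        using \<alpha>_0 C by (simp only: ennreal_mult zero_le_divide_1_iff less_imp_le mult.assoc)
      also note n
      finally have "(norm (z t))\<^sup>2 < \<epsilon>\<^sup>2" using \<epsilon> by (simp add: ennreal_less_iff)
      then show ?thesis using \<epsilon> by (simp add: power_less_imp_less_base)
    qed
    then show ?thesis unfolding eventually_at_bot_linorder by blast
  qed
  then show ?thesis by (auto simp: tendsto_iff dist_norm)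
qed

end

subsection \<open>Existence of minimizers\<close>

lemma set_integral_dominated_Icc:
  fixes g :: "nat \<Rightarrow> real \<Rightarrow> real"
  assumes g: "\<And>n. continuous_on {a..b} (g n)" and G: "continuous_on {a..b} G"
    and lim: "\<And>t. t \<in> {a..b} \<Longrightarrow> (\<lambda>n. g n t) \<longlonglongrightarrow> G t" and bnd: "\<And>n t. t \<in> {a..b} \<Longrightarrow> \<bar>g n t\<bar> \<le> D"
  shows "(\<lambda>n. LINT t:{a..b}|lborel. g n t) \<longlonglongrightarrow> (LINT t:{a..b}|lborel. G t)"
  unfolding set_lebesgue_integral_def
proof (rule integral_dominated_convergence[where w = "\<lambda>t. indicator {a..b} t *\<^sub>R D"])
  show "(\<lambda>t. indicator {a..b} t *\<^sub>R G t) \<in> borel_measurable lborel"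
    using set_measurable_continuous_on[OF _ G] by (simp add: set_borel_measurable_def)
  show "(\<lambda>t. indicator {a..b} t *\<^sub>R g n t) \<in> borel_measurable lborel" for n
    using set_measurable_continuous_on[OF _ g[of n]] by (simp add: set_borel_measurable_def)
  have "set_integrable lborel {a..b} (\<lambda>t. D)"
    by (intro borel_integrable_atLeastAtMost' continuous_intros)
  then show "integrable lborel (\<lambda>t. indicator {a..b} t *\<^sub>R D)" by (simp add: set_integrable_def)
  show "AE t in lborel. (\<lambda>n. indicator {a..b} t *\<^sub>R g n t) \<longlonglongrightarrow> indicator {a..b} t *\<^sub>R G t"
    using lim by (intro AE_I2) (auto simp: indicator_def)
  show "AE t in lborel. norm (indicator {a..b} t *\<^sub>R g n t) \<le> indicator {a..b} t *\<^sub>R D" for n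
    using bnd by (intro AE_I2) (auto simp: indicator_def)
qed

context damped_wave
begin

lemma W_zero_pointwise_bounds:
  assumes W: "W 0 p \<le> ennreal K" and K: "K \<ge> 0"
  defines "D \<equiv> (1 + \<gamma>) * sqrt (K / \<alpha> 0) + sqrt K"
  shows "\<bar>um k p\<bar> \<le> D" "\<bar>vm k p\<bar> \<le> D" "\<bar>B (fst p) \<bullet> e k\<bar> \<le> D"
proof -
  have ek: "norm (e k) = 1" by (simp add: norm_eq_sqrt_inner e_orthonormal)
  have "ennreal ((norm p)\<^sup>2) \<le> ennreal (1 / \<alpha> 0) * ennreal K"
    by (rule order_trans[OF norm_le_W mult_left_mono[OF W]]) simp
  also have "\<dots> = ennreal (K / \<alpha> 0)" using \<alpha>_0 K by (simp add: ennreal_mult[symmetric])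
  finally have "(norm p)\<^sup>2 \<le> K / \<alpha> 0" using K \<alpha>_0 by (simp add: ennreal_le_iff)
  then have p: "norm p \<le> sqrt (K / \<alpha> 0)" by (rule real_le_rsqrt)
  have fp: "norm (fst p) \<le> sqrt (K / \<alpha> 0)" using norm_fst_le[of "fst p" "snd p"] p by simp
  have nn: "0 \<le> sqrt (K / \<alpha> 0)" "0 \<le> sqrt K" "0 \<le> \<gamma> * sqrt (K / \<alpha> 0)" using K \<alpha>_0 \<gamma>_nonneg by auto
  have D: "D = sqrt (K / \<alpha> 0) + \<gamma> * sqrt (K / \<alpha> 0) + sqrt K" by (simp add: D_def algebra_simps)
  have "\<bar>um k p\<bar> \<le> norm (fst p)" using Cauchy_Schwarz_ineq2[of "fst p" "e k"] by (simp add: um_def ek)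
  then show "\<bar>um k p\<bar> \<le> D" using fp nn unfolding D by linarith
  have "(vm k p)\<^sup>2 \<le> K" using wk_bounds(2)[of k p] W_zero_sums(3)[OF W K, of k] by linarith
  then have "\<bar>vm k p\<bar> \<le> sqrt K" by (simp add: real_le_rsqrt)
  then show "\<bar>vm k p\<bar> \<le> D" using nn unfolding D by linarith
  have "\<bar>B (fst p) \<bullet> e k\<bar> \<le> norm (B (fst p))" using Cauchy_Schwarz_ineq2[of "B (fst p)" "e k"] by (simp add: ek)
  also have "\<dots> \<le> \<gamma> * norm (fst p)" by (rule norm_B)
  also have "\<dots> \<le> \<gamma> * sqrt (K / \<alpha> 0)" by (rule mult_left_mono[OF fp \<gamma>_nonneg])
  finally show "\<bar>B (fst p) \<bullet> e k\<bar> \<le> D" using nn unfolding D by linarith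
qed

text \<open>Lower semicontinuity of a sum of nonnegative terms: each finite partial sum is
  continuous along the sequence and lies below the full sum.\<close>

lemma W_le_liminf:
  assumes "p \<longlonglongrightarrow> q"
  shows "W 0 q \<le> liminf (\<lambda>j. W 0 (p j))"
  unfolding W_zero[of q]
proof (rule ennreal_suminf_bounded)
  fix n
  have "(\<lambda>j. \<Sum>k<n. \<alpha> k * (um k (p j))\<^sup>2 + (vm k (p j))\<^sup>2) \<longlonglongrightarrow> (\<Sum>k<n. \<alpha> k * (um k q)\<^sup>2 + (vm k q)\<^sup>2)"
    by (intro tendsto_intros bounded_linear.tendsto[OF um_bounded_linear assms] bounded_linear.tendsto[OF vm_bounded_linear assms])
  then have "(\<lambda>j. ennreal (\<Sum>k<n. wk k (p j))) \<longlonglongrightarrow> ennreal (\<Sum>k<n. wk k q)"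
    unfolding wk_def by (rule tendsto_ennrealI)
  then have "liminf (\<lambda>j. ennreal (\<Sum>k<n. wk k (p j))) = ennreal (\<Sum>k<n. wk k q)"
    by (rule lim_imp_Liminf[OF sequentially_bot])
  then have "(\<Sum>k<n. ennreal (wk k q)) = liminf (\<lambda>j. ennreal (\<Sum>k<n. wk k (p j)))"
    by (simp add: sum_ennreal wk_nonneg)
  also have "\<dots> \<le> liminf (\<lambda>j. W 0 (p j))"
  proof (rule Liminf_mono, intro always_eventually allI)
    fix j
    have "ennreal (\<Sum>k<n. wk k (p j)) = (\<Sum>k<n. ennreal (wk k (p j)))" by (simp add: sum_ennreal wk_nonneg)
    also have "\<dots> \<le> W 0 (p j)" unfolding W_zero by (rule ennreal_sum_le_suminf)
    finally show "ennreal (\<Sum>k<n. wk k (p j)) \<le> W 0 (p j)" .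
  qed
  finally show "(\<Sum>k<n. ennreal (wk k q)) \<le> liminf (\<lambda>j. W 0 (p j))" .
qed

text \<open>The limit of the controls is identified through the equation. Integrated over an
  interval, the equation of mode k expresses the integral of \<psi> against \<open>e k\<close> by
  quantities that converge along the subsequence; therefore the weak limit has the matching
  integrals, and it drives the limit path. One control on the whole line serves every interval, so a
  single bound holds for all truncated actions.\<close>

lemma minimizing_limit:
  assumes l: "l \<ge> 0" and T: "\<And>n. T n > 0"
    and z: "\<And>n. continuous_on {- T n..0} (z n)" and z0: "\<And>n. z n (- T n) = 0"
    and \<psi>[measurable]: "\<And>n. \<psi> n \<in> borel_measurable borel" and \<psi>0: "\<And>n t. t \<notin> {- T n<..<0} \<Longrightarrow> \<psi> n t = 0"
    and bnd: "\<And>n. (\<integral>\<^sup>+t. ennreal ((norm (\<psi> n t))\<^sup>2) \<partial>lborel) \<le> ennreal (l + 1 / real (Suc n))"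
    and ms: "\<And>n. mode_sol (- T n) 0 (\<psi> n) (z n)"
  shows "\<exists>w r. strict_mono r \<and> continuous_on {..0} w \<and> ((\<lambda>t. norm (w t)) \<longlongrightarrow> 0) at_bot \<and>
    (\<lambda>n. z (r n) 0) \<longlonglongrightarrow> w 0 \<and> act_inf w \<le> ereal (l / 2)"
proof -
  define Z where "Z n t = z n (max t (- T n))" for n t
  have Zc: "continuous_on {..0} (Z n)" for n
    unfolding Z_def[abs_def] by (rule continuous_on_compose2[OF z]) (use T[of n] in \<open>auto intro!: continuous_intros\<close>)
  have Zc': "continuous_on {s..t} (Z n)" if "t \<le> 0" for n s t
    by (rule continuous_on_subset[OF Zc]) (use that in auto)
  have Zms: "mode_sol s t (\<psi> n) (Z n)" if "t \<le> 0" for n s t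
  proof (rule mode_sol_subinterval)
    show "mode_sol (- max (T n) (- s)) 0 (\<psi> n) (Z n)"
      unfolding Z_def[abs_def] by (rule mode_sol_extend[OF ms T z0 \<psi>0]) auto
  qed (use that in auto)
  define M where "M = l + 1"
  have M: "M \<ge> 0" using l by (simp add: M_def)
  have \<psi>M: "sq_integral A (\<psi> n) \<le> ennreal M" for n A
  proof -
    have "sq_integral A (\<psi> n) \<le> (\<integral>\<^sup>+t. ennreal ((norm (\<psi> n t))\<^sup>2) \<partial>lborel)"
      by (intro nn_integral_mono) (auto simp: indicator_def)
    also note bnd
    also have "ennreal (l + 1 / real (Suc n)) \<le> ennreal M" by (intro ennreal_leI) (simp add: M_def)
    finally show ?thesis .
  qed
  obtain KB where KB: "KB \<ge> 0" "\<And>a b \<psi> z M. a \<le> b \<Longrightarrow> continuous_on {a..b} z \<Longrightarrow> \<psi> \<in> borel_measurable borel \<Longrightarrow> mode_sol a b \<psi> z \<Longrightarrow> z a = 0 \<Longrightarrow>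
     sq_integral {a..b} \<psi> \<le> ennreal M \<Longrightarrow> M \<ge> 0 \<Longrightarrow>
     W 0 (z b) + (\<integral>\<^sup>+t\<in>{a..b}. W 0 (z t) \<partial>lborel) \<le> ennreal (KB * M)"
    using uniform_bound by blast
  define K where "K = KB * M"
  have K: "K \<ge> 0" using KB M by (simp add: K_def)
  have both: "W 0 (Z n t) + (\<integral>\<^sup>+r\<in>{- N..t}. W 0 (Z n r) \<partial>lborel) \<le> ennreal K" if t: "t \<le> 0" for n t N
  proof -
    \<comment> \<open>To the left of \<open>- T n\<close>, where the extended path is 0, and also to
      the left of t and of -N, so that the interval covers the requested one.\<close>
    define a where "a = min (min (- T n) t) (- N)"
    have "W 0 (Z n t) + (\<integral>\<^sup>+r\<in>{- N..t}. W 0 (Z n r) \<partial>lborel) \<le> W 0 (Z n t) + (\<integral>\<^sup>+r\<in>{a..t}. W 0 (Z n r) \<partial>lborel)"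
      by (intro add_left_mono nn_integral_mono) (auto simp: indicator_def a_def)
    also have "\<dots> \<le> ennreal K"
      unfolding K_def
    proof (rule KB(2)[OF _ Zc'[OF t] \<psi> Zms[OF t] _ \<psi>M M])
      show "Z n a = 0" using z0[of n] by (simp add: Z_def a_def max_def min_def)
    qed (simp add: a_def)
    finally show ?thesis .
  qed
  have WK: "W 0 (Z n t) \<le> ennreal K" if "t \<le> 0" for n t
    using both[OF that, of n 0] by (rule order_trans[rotated]) simp
  have WI: "(\<integral>\<^sup>+t\<in>{..0}. W 0 (Z n t) \<partial>lborel) \<le> ennreal K" for n
  proof (rule nn_integral_half_line_le)
    show "(\<lambda>t. W 0 (Z n t) * indicator {..0} t) \<in> borel_measurable lborel" by (rule W_measurable(1)[OF Zc]) simp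
    show "(\<integral>\<^sup>+t\<in>{- N..0}. W 0 (Z n t) \<partial>lborel) \<le> ennreal K" for N
      using both[OF order_refl, of n N] by (rule order_trans[rotated]) simp
  qed
  define D where "D = (1 + \<gamma>) * sqrt (K / \<alpha> 0) + sqrt K"
  note Db = W_zero_pointwise_bounds[OF _ K, folded D_def]
  have D: "D \<ge> 0" using K \<alpha>_0 \<gamma>_nonneg by (simp add: D_def)
  have eq: "\<exists>\<delta>>0. \<forall>n s t. s \<le> t \<and> t \<le> 0 \<and> t - s < \<delta> \<longrightarrow>
      \<bar>um k (Z n t) - um k (Z n s)\<bar> \<le> \<epsilon> \<and> \<bar>vm k (Z n t) - vm k (Z n s)\<bar> \<le> \<epsilon>" if \<epsilon>: "\<epsilon> > 0" for k \<epsilon>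
  proof -
    \<comment> \<open>Makes the part of the velocity increment that does not shrink with t - s at
      most \<epsilon>/2; the later choice of \<delta> handles the terms proportional to t -
      s.\<close>
    define \<eta> where "\<eta> = \<epsilon> * \<mu> / (2 * lam k * (M + 1))"
    have \<eta>: "\<eta> > 0" using \<epsilon> \<mu>_pos lam_pos[of k] M by (simp add: \<eta>_def)
    define X where "X = ((\<alpha> k + 2) * D + lam k / (4 * \<eta>)) / \<mu>"
    have X: "X \<ge> 0" using \<eta> lam_pos[of k] \<alpha>_pos[of k] D \<mu>_pos by (simp add: X_def)
    define \<delta> where "\<delta> = \<epsilon> / (2 * (X + D + 1))"
    have \<delta>: "\<delta> > 0" using \<epsilon> X D by (simp add: \<delta>_def)
    have "\<bar>um k (Z n t) - um k (Z n s)\<bar> \<le> \<epsilon> \<and> \<bar>vm k (Z n t) - vm k (Z n s)\<bar> \<le> \<epsilon>"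
      if st: "s \<le> t" "t \<le> 0" "t - s < \<delta>" for n s t
    proof -
      have b: "\<bar>um k (Z n r)\<bar> \<le> D \<and> \<bar>vm k (Z n r)\<bar> \<le> D \<and> \<bar>B (fst (Z n r)) \<bullet> e k\<bar> \<le> D" if "r \<in> {s..t}" for r
        using Db[OF WK] that st by auto
      note m = mode_equicontinuous[OF Zms[OF st(2)] st(1) Zc'[OF st(2)] \<psi> b \<psi>M M \<eta>]
      have X\<delta>: "(X + D + 1) * \<delta> = \<epsilon> / 2" using X D by (simp add: \<delta>_def field_simps)
      have "(X + D + 1) * (t - s) \<le> (X + D + 1) * \<delta>" using st X D by (intro mult_left_mono) auto
      moreover have "D * (t - s) \<le> (X + D + 1) * (t - s)" "X * (t - s) \<le> (X + D + 1) * (t - s)"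
        using st X D by (intro mult_right_mono; simp)+
      ultimately have 1: "D * (t - s) \<le> \<epsilon> / 2" "X * (t - s) \<le> \<epsilon> / 2" using X\<delta> by linarith+
      have "lam k * \<eta> * M / \<mu> \<le> lam k * \<eta> * (M + 1) / \<mu>"
        using lam_pos[of k] \<eta> \<mu>_pos by (intro divide_right_mono mult_left_mono) auto
      also have "\<dots> = \<epsilon> / 2"
      proof -
        have "lam k * (\<epsilon> * \<mu> / (2 * lam k * P)) * P / \<mu> = \<epsilon> / 2" if "P > 0" for P
          using that lam_pos[of k] \<mu>_pos by (simp add: field_simps)
        from this[of "M + 1"] show ?thesis using M by (simp add: \<eta>_def)
      qed
      finally have 2: "lam k * \<eta> * M / \<mu> \<le> \<epsilon> / 2" .
      have "((\<alpha> k + 2) * D * (t - s) + lam k * (\<eta> * M + (t - s) / (4 * \<eta>))) / \<mu> = X * (t - s) + lam k * \<eta> * M / \<mu>"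
        using \<mu>_pos \<eta> by (simp add: X_def field_simps)
      then show ?thesis using m 1 2 \<epsilon> by linarith
    qed
    then show ?thesis using \<delta> by blast
  qed
  \<comment> \<open>One diagonal extraction over pairs of a mode and a rational time; equicontinuity
    later supplies the other times.\<close>
  have cntS: "countable ((UNIV :: nat set) \<times> (\<rat> \<inter> {..0::real}))" by (intro countable_SIGMA countable_Int1 countable_rat) auto
  have fb: "norm (um (fst x) (Z n (snd x)), vm (fst x) (Z n (snd x))) \<le> D + D"
    if "x \<in> UNIV \<times> (\<rat> \<inter> {..0})" for n x
  proof -
    have "norm (um (fst x) (Z n (snd x)), vm (fst x) (Z n (snd x))) \<le> \<bar>um (fst x) (Z n (snd x))\<bar> + \<bar>vm (fst x) (Z n (snd x))\<bar>"
      using norm_Pair_le[of "um (fst x) (Z n (snd x))" "vm (fst x) (Z n (snd x))"] by simp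
    also have "\<dots> \<le> D + D" using that by (intro add_mono Db(1,2) WK) auto
    finally show ?thesis .
  qed
  obtain r :: "nat \<Rightarrow> nat" where r: "strict_mono r"
    and conv: "\<And>x. x \<in> UNIV \<times> (\<rat> \<inter> {..0}) \<Longrightarrow> \<exists>L. (\<lambda>n. (um (fst x) (Z (r n) (snd x)), vm (fst x) (Z (r n) (snd x)))) \<longlonglongrightarrow> L"
    using function_convergent_subsequence[OF cntS, of "\<lambda>n x. (um (fst x) (Z n (snd x)), vm (fst x) (Z n (snd x)))", OF fb] by blast
  have rat: "convergent (\<lambda>n. um k (Z (r n) q))" "convergent (\<lambda>n. vm k (Z (r n) q))" if q: "q \<in> \<rat>" "q \<le> 0" for k q
  proof -
    obtain L where L: "(\<lambda>n. (um k (Z (r n) q), vm k (Z (r n) q))) \<longlonglongrightarrow> L" using conv[of "(k, q)"] q by auto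
    show "convergent (\<lambda>n. um k (Z (r n) q))" "convergent (\<lambda>n. vm k (Z (r n) q))"
      using tendsto_fst[OF L] tendsto_snd[OF L] by (auto intro: convergentI)
  qed
  have equ: "\<exists>\<delta>>0. \<forall>n s t. s \<le> t \<and> t \<le> 0 \<and> t - s < \<delta> \<longrightarrow> \<bar>um k (Z (r n) t) - um k (Z (r n) s)\<bar> \<le> \<epsilon>"
    and eqv: "\<exists>\<delta>>0. \<forall>n s t. s \<le> t \<and> t \<le> 0 \<and> t - s < \<delta> \<longrightarrow> \<bar>vm k (Z (r n) t) - vm k (Z (r n) s)\<bar> \<le> \<epsilon>" if "\<epsilon> > 0" for k \<epsilon>
    using eq[OF that, of k] by blast+
  define w where "w t = lim (\<lambda>n. Z (r n) t)" for t
  have lim: "(\<lambda>n. Z (r n) t) \<longlonglongrightarrow> w t" if t: "t \<le> 0" for t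
  proof -
    have "convergent (\<lambda>n. Z (r n) t)"
      by (rule modes_convergent[OF WK[OF t] K]) (intro convergent_from_rationals[OF equ rat(1) t] convergent_from_rationals[OF eqv rat(2) t]; assumption)+
    then show ?thesis by (simp add: w_def convergent_LIMSEQ_iff)
  qed
  have limu: "(\<lambda>n. um k (Z (r n) t)) \<longlonglongrightarrow> um k (w t)" and limv: "(\<lambda>n. vm k (Z (r n) t)) \<longlonglongrightarrow> vm k (w t)" if "t \<le> 0" for k t
    using bounded_linear.tendsto[OF um_bounded_linear lim[OF that]] bounded_linear.tendsto[OF vm_bounded_linear lim[OF that]] by auto
  have Wliminf: "W 0 (w t) \<le> liminf (\<lambda>j. W 0 (Z (r j) t))" if "t \<le> 0" for t
    by (rule W_le_liminf[OF lim[OF that]])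
  have WwK: "W 0 (w t) \<le> ennreal K" if "t \<le> 0" for t
  proof -
    have "liminf (\<lambda>j. W 0 (Z (r j) t)) \<le> liminf (\<lambda>j. ennreal K)"
      by (intro Liminf_mono always_eventually allI WK that)
    then show ?thesis using Wliminf[OF that] by (simp add: Liminf_const order_trans)
  qed
  have wc: "continuous_on {..0} w"
    by (rule modes_continuous_on[OF WwK K])
      (auto intro: continuous_limit_of_equicontinuous[OF equ limu] continuous_limit_of_equicontinuous[OF eqv limv])
  have wc': "continuous_on {a..b} w" if "b \<le> 0" for a b by (rule continuous_on_subset[OF wc]) (use that in auto)
  have WIw: "(\<integral>\<^sup>+t\<in>{..0}. W 0 (w t) \<partial>lborel) \<le> ennreal K"
  proof -
    have "(\<integral>\<^sup>+t\<in>{..0}. W 0 (w t) \<partial>lborel) \<le> (\<integral>\<^sup>+t. liminf (\<lambda>j. W 0 (Z (r j) t) * indicator {..0} t) \<partial>lborel)"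
      using Wliminf by (intro nn_integral_mono) (auto simp: indicator_def)
    also have "\<dots> \<le> liminf (\<lambda>j. \<integral>\<^sup>+t\<in>{..0}. W 0 (Z (r j) t) \<partial>lborel)"
      by (rule nn_integral_liminf) (rule W_measurable(1)[OF Zc], simp)
    also have "\<dots> \<le> liminf (\<lambda>j. ennreal K)" by (intro Liminf_mono always_eventually allI WI)
    finally show ?thesis by (simp add: Liminf_const)
  qed
  have "(\<integral>\<^sup>+t. ennreal ((norm (\<psi> (r n) t))\<^sup>2) \<partial>lborel) \<le> ennreal (l + 1 / real (Suc n))" for n
  proof -
    \<comment> \<open>A strictly increasing r satisfies r n >= n, so the subsequence keeps the
      energy bound in the form that the weak limit lemma expects.\<close>
    have "1 / real (Suc (r n)) \<le> 1 / real (Suc n)" using seq_suble[OF r, of n] by (intro divide_left_mono) auto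
    then show ?thesis by (intro order_trans[OF bnd ennreal_leI]) simp
  qed
  then obtain \<psi>' where \<psi>'[measurable]: "\<psi>' \<in> borel_measurable borel" and \<psi>'l: "(\<integral>\<^sup>+t. ennreal ((norm (\<psi>' t))\<^sup>2) \<partial>lborel) \<le> ennreal l"
    and weak: "\<And>\<phi> J. \<phi> \<in> borel_measurable lborel \<Longrightarrow> (\<integral>\<^sup>+x. ennreal ((norm (\<phi> x))\<^sup>2) \<partial>lborel) < \<infinity> \<Longrightarrow>
       (\<lambda>n. \<integral>x. \<psi> (r n) x \<bullet> \<phi> x \<partial>lborel) \<longlonglongrightarrow> J \<Longrightarrow> (\<integral>x. \<psi>' x \<bullet> \<phi> x \<partial>lborel) = J"
    using L2_weak_limit[of "\<lambda>n. \<psi> (r n)" lborel l] l by auto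
  have \<psi>'A: "sq_integral A \<psi>' \<le> ennreal l" for A
    by (rule order_trans[OF nn_integral_mono \<psi>'l]) (auto simp: indicator_def)
  have inner: "(\<integral>x. f x \<bullet> (indicator {s..t} x *\<^sub>R e k) \<partial>lborel) = (LINT x:{s..t}|lborel. f x \<bullet> e k)" for f :: "real \<Rightarrow> 'h" and s t k
    by (simp add: set_lebesgue_integral_def)
  have wms: "mode_sol (- N) 0 \<psi>' w" for N
    unfolding mode_sol_def oscillator_def
  proof (intro allI conjI)
    fix k
    have limB: "(\<lambda>n. B (fst (Z (r n) t)) \<bullet> e k) \<longlonglongrightarrow> B (fst (w t)) \<bullet> e k" if "t \<le> 0" for t
      using continuous_on_tendsto_compose[OF B_continuous tendsto_fst[OF lim[OF that]]] by (intro tendsto_intros) auto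
    have cBk: "continuous_on {a..b} (\<lambda>t. B (fst (y t)) \<bullet> e k)" if "continuous_on {a..b} y" for a b :: real and y
      by (intro continuous_intros continuous_on_compose2[OF B_continuous] that) auto
    show "primitive_on (- N) 0 (\<lambda>t. um k (w t)) (\<lambda>t. vm k (w t))"
      unfolding primitive_on_def
    proof (intro conjI ballI)
      show "set_integrable lborel {- N..0} (\<lambda>t. vm k (w t))"
        by (intro borel_integrable_atLeastAtMost' mode_continuous wc') simp
      fix t assume t: "t \<in> {- N..0}"
      have "(\<lambda>n. LINT s:{- N..t}|lborel. vm k (Z (r n) s)) \<longlonglongrightarrow> (LINT s:{- N..t}|lborel. vm k (w s))"
        by (rule set_integral_dominated_Icc[where D = D]) (use t in \<open>auto intro!: mode_continuous Zc' wc' limv Db(2) WK\<close>)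
      moreover have "(LINT s:{- N..t}|lborel. vm k (Z (r n) s)) = um k (Z (r n) t) - um k (Z (r n) (- N))" for n
        using primitive_on_diff[OF conjunct1[OF mode_sol_osc[OF Zms[of t "- N" "r n"], of k, unfolded oscillator_def]], of "- N" t] t by simp
      moreover have "(\<lambda>n. um k (Z (r n) t) - um k (Z (r n) (- N))) \<longlonglongrightarrow> um k (w t) - um k (w (- N))"
        by (intro tendsto_intros limu) (use t in auto)
      ultimately show "um k (w t) - um k (w (- N)) = (LINT s:{- N..t}|lborel. vm k (w s))"
        using LIMSEQ_unique by simp
    qed
    have fin: "sq_integral A \<psi>' < \<infinity>" for A
      using \<psi>'A[of A] by (simp add: order_le_less_trans)
    let ?A = "\<lambda>y s. - \<alpha> k * um k (y s) - vm k (y s) + B (fst (y s)) \<bullet> e k"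
    have split: "(LINT s:{a..t}|lborel. (- \<alpha> k * um k (y s) - vm k (y s) + mode_force \<phi> y k s) / \<mu>)
        = ((LINT s:{a..t}|lborel. ?A y s) + lam k * (LINT s:{a..t}|lborel. \<phi> s \<bullet> e k)) / \<mu>"
      and int: "set_integrable lborel {a..t} (\<lambda>s. (- \<alpha> k * um k (y s) - vm k (y s) + mode_force \<phi> y k s) / \<mu>)"
      if y: "continuous_on {a..t} y" and \<phi>: "\<phi> \<in> borel_measurable borel" and \<phi>2: "sq_integral {a..t} \<phi> < \<infinity>" for a t y \<phi>
    proof -
      have i1: "set_integrable lborel {a..t} (\<lambda>s. ?A y s)"
        by (intro borel_integrable_atLeastAtMost' continuous_intros mode_continuous cBk y)
      have i2: "set_integrable lborel {a..t} (\<lambda>s. lam k * (\<phi> s \<bullet> e k))"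
        using bounded_linear_set_integral(2)[OF bounded_linear_inner_left L2_Icc_integrable[OF \<phi> \<phi>2]] by (rule set_integrable_mult_right)
      have e: "(- \<alpha> k * um k (y s) - vm k (y s) + mode_force \<phi> y k s) / \<mu> = (?A y s + lam k * (\<phi> s \<bullet> e k)) / \<mu>" for s
        by (simp add: mode_force_def)
      show "(LINT s:{a..t}|lborel. (- \<alpha> k * um k (y s) - vm k (y s) + mode_force \<phi> y k s) / \<mu>)
        = ((LINT s:{a..t}|lborel. ?A y s) + lam k * (LINT s:{a..t}|lborel. \<phi> s \<bullet> e k)) / \<mu>"
        unfolding e by (simp only: set_integral_divide_zero set_integral_add(2)[OF i1 i2] set_integral_mult_right)
      show "set_integrable lborel {a..t} (\<lambda>s. (- \<alpha> k * um k (y s) - vm k (y s) + mode_force \<phi> y k s) / \<mu>)"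
        unfolding e by (intro set_integrable_divide set_integral_add(1)[OF i1 i2])
    qed
    show "primitive_on (- N) 0 (\<lambda>t. vm k (w t)) (\<lambda>t. (- \<alpha> k * um k (w t) - vm k (w t) + mode_force \<psi>' w k t) / \<mu>)"
      unfolding primitive_on_def
    proof (intro conjI ballI)
      show "set_integrable lborel {- N..0} (\<lambda>t. (- \<alpha> k * um k (w t) - vm k (w t) + mode_force \<psi>' w k t) / \<mu>)"
        by (rule int[OF wc' \<psi>' fin]) simp
      fix t assume t: "t \<in> {- N..0}"
      then have t0: "t \<le> 0" "- N \<le> t" by auto
      \<comment> \<open>The integrated equation of mode k for the limit path, solved for the
        integral of the control. The same formula with \<open>Z (r n)\<close> gives the pairings of
        the controls, which converge to this value.\<close>
      let ?J = "(\<mu> * (vm k (w t) - vm k (w (- N))) - (LINT s:{- N..t}|lborel. ?A w s)) / lam k"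
      have limA: "(\<lambda>n. LINT s:{- N..t}|lborel. ?A (Z (r n)) s) \<longlonglongrightarrow> (LINT s:{- N..t}|lborel. ?A w s)"
      proof (rule set_integral_dominated_Icc[where D = "\<alpha> k * D + D + D"])
        show "continuous_on {- N..t} (\<lambda>s. ?A (Z (r n)) s)" for n
          by (intro continuous_intros mode_continuous cBk Zc' t0)
        show "continuous_on {- N..t} (\<lambda>s. ?A w s)"
          by (intro continuous_intros mode_continuous cBk wc' t0)
        show "(\<lambda>n. ?A (Z (r n)) s) \<longlonglongrightarrow> ?A w s" if "s \<in> {- N..t}" for s
          by (intro tendsto_intros limu limv limB) (use that t0 in auto)
        show "\<bar>?A (Z (r n)) s\<bar> \<le> \<alpha> k * D + D + D" if "s \<in> {- N..t}" for n s
        proof -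
          have s0: "s \<le> 0" using that t0 by simp
          have "\<bar>\<alpha> k * um k (Z (r n) s)\<bar> \<le> \<alpha> k * D" using Db(1)[OF WK[OF s0]] \<alpha>_pos[of k] by (simp add: abs_mult)
          then show ?thesis using Db(2)[OF WK[OF s0], of k "r n"] Db(3)[OF WK[OF s0], of "r n" k] by linarith
        qed
      qed
      have "(LINT s:{- N..t}|lborel. \<psi> (r n) s \<bullet> e k) = (\<mu> * (vm k (Z (r n) t) - vm k (Z (r n) (- N))) - (LINT s:{- N..t}|lborel. ?A (Z (r n)) s)) / lam k" for n
      proof -
        have "vm k (Z (r n) t) - vm k (Z (r n) (- N)) = ((LINT s:{- N..t}|lborel. ?A (Z (r n)) s) + lam k * (LINT s:{- N..t}|lborel. \<psi> (r n) s \<bullet> e k)) / \<mu>"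
          using primitive_on_diff[OF conjunct2[OF mode_sol_osc[OF Zms[of t "- N" "r n"], of k, unfolded oscillator_def]], of "- N" t] t0
            split[OF Zc'[OF t0(1)] \<psi> order_le_less_trans[OF \<psi>M], of "- N" "r n" "r n"] by simp
        then show ?thesis using \<mu>_pos lam_pos[of k] by (simp add: field_simps)
      qed
      moreover have "(\<lambda>n. (\<mu> * (vm k (Z (r n) t) - vm k (Z (r n) (- N))) - (LINT s:{- N..t}|lborel. ?A (Z (r n)) s)) / lam k) \<longlonglongrightarrow> ?J"
        by (intro tendsto_intros limv limA) (use t0 lam_pos[of k] in auto)
      ultimately have "(\<lambda>n. \<integral>x. \<psi> (r n) x \<bullet> (indicator {- N..t} x *\<^sub>R e k) \<partial>lborel) \<longlonglongrightarrow> ?J" unfolding inner by simp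
      then have "(\<integral>x. \<psi>' x \<bullet> (indicator {- N..t} x *\<^sub>R e k) \<partial>lborel) = ?J"
      proof (rule weak[rotated 2])
        have "(\<integral>\<^sup>+x. ennreal ((norm (indicator {- N..t} x *\<^sub>R e k))\<^sup>2) \<partial>lborel) = (\<integral>\<^sup>+x. indicator {- N..t} x \<partial>lborel)"
          by (intro nn_integral_cong) (auto simp: indicator_def norm_eq_sqrt_inner e_orthonormal)
        then show "(\<integral>\<^sup>+x. ennreal ((norm (indicator {- N..t} x *\<^sub>R e k))\<^sup>2) \<partial>lborel) < \<infinity>"
          by (simp add: emeasure_lborel_Icc_eq)
      qed simp
      then have "lam k * (LINT s:{- N..t}|lborel. \<psi>' s \<bullet> e k) = \<mu> * (vm k (w t) - vm k (w (- N))) - (LINT s:{- N..t}|lborel. ?A w s)"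
        unfolding inner using lam_pos[of k] by simp
      then show "vm k (w t) - vm k (w (- N)) = (LINT s:{- N..t}|lborel. (- \<alpha> k * um k (w s) - vm k (w s) + mode_force \<psi>' w k s) / \<mu>)"
        unfolding split[OF wc'[OF t0(1)] \<psi>' fin] using \<mu>_pos by simp
    qed
  qed
  have w0: "((\<lambda>t. norm (w t)) \<longlongrightarrow> 0) at_bot"
    by (rule tendsto_zero_at_bot[OF wms wc \<psi>']) (use \<psi>'l WIw in \<open>auto simp: order_le_less_trans\<close>)
  have "act_inf w \<le> ereal (l / 2)"
    unfolding action_neg_inf_def
  proof (rule SUP_least)
    fix N :: real assume "N \<in> {0<..}"
    then show "act (- N) 0 w \<le> ereal (l / 2)"
      by (intro action_le_control[OF _ wc' \<psi>' \<psi>'A l wms]) auto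
  qed
  moreover have "(\<lambda>n. z (r n) 0) \<longlonglongrightarrow> w 0"
  proof -
    have "Z n 0 = z n 0" for n using T[of n] by (simp add: Z_def max_def)
    then show ?thesis using lim[of 0] by simp
  qed
  ultimately show ?thesis using r wc w0 by blast
qed

lemma qpot_nonneg: "0 \<le> qpot p"
  unfolding quasi_potential_def by (rule Inf_greatest) (auto intro: action_nonneg)

text \<open>Stated for a closed set of end points so that it covers both claims: a single point for
  the potential of position and velocity, and all velocities over one position for the other.
  Closedness keeps the end point of the limit admissible.\<close>

theorem minimizer:
  assumes X: "closed X" and fin: "(INF p\<in>X. qpot p) < \<infinity>"
  shows "\<exists>w. continuous_on {..0} w \<and> ((\<lambda>t. norm (w t)) \<longlongrightarrow> 0) at_bot \<and> w 0 \<in> X \<and> act_inf w \<le> (INF p\<in>X. qpot p)"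
proof -
  have "0 \<le> (INF p\<in>X. qpot p)" by (rule INF_greatest) (rule qpot_nonneg)
  then obtain V where V: "(INF p\<in>X. qpot p) = ereal V" "V \<ge> 0" using fin by (cases "INF p\<in>X. qpot p") auto
  have "\<exists>T z \<psi>. T > 0 \<and> continuous_on {-T..0} z \<and> z (- T) = 0 \<and> z 0 \<in> X \<and> \<psi> \<in> borel_measurable borel \<and>
      (\<forall>t. t \<notin> {-T<..<0} \<longrightarrow> \<psi> t = 0) \<and> (\<integral>\<^sup>+t. ennreal ((norm (\<psi> t))\<^sup>2) \<partial>lborel) \<le> ennreal (2 * V + 1 / real (Suc n)) \<and>
      mode_sol (- T) 0 \<psi> z" for n
  proof -
    \<comment> \<open>Half of 2 V + 1/(n + 1): the action is half the energy of the control, and the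
      energy is what the compactness argument bounds.\<close>
    let ?r = "V + 1 / (2 * real (Suc n))"
    have "(INF p\<in>X. qpot p) < ereal ?r" unfolding V by simp
    then obtain p where p: "p \<in> X" "qpot p < ereal ?r" unfolding INF_less_iff by blast
    from p(2) obtain T z where T: "T > 0" and z: "continuous_on {0..T} z" "z 0 = 0" "z T = p" and a: "act 0 T z < ereal ?r"
      unfolding quasi_potential_def Inf_less_iff by auto
    obtain \<psi> where \<psi>[measurable]: "\<psi> \<in> borel_measurable borel" and \<psi>0: "\<And>t. t \<notin> {0<..<T} \<Longrightarrow> \<psi> t = 0"
      and \<psi>2: "(\<integral>\<^sup>+t. ennreal ((norm (\<psi> t))\<^sup>2) \<partial>lborel) \<le> ennreal (2 * ?r)" and ms: "mode_sol 0 T \<psi> z"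
      using action_less_imp_control[OF T z(1) a] by blast
    have "(\<integral>\<^sup>+t. ennreal ((norm (\<psi> (t + T)))\<^sup>2) \<partial>lborel) = (\<integral>\<^sup>+t. ennreal ((norm (\<psi> t))\<^sup>2) \<partial>lborel)"
      using nn_integral_real_affine[of "\<lambda>t. ennreal ((norm (\<psi> t))\<^sup>2)" 1 T] by (simp add: add.commute)
    moreover have "2 * ?r = 2 * V + 1 / real (Suc n)" by (simp add: field_simps)
    moreover have "continuous_on {-T..0} (\<lambda>t. z (t + T))"
      by (rule continuous_on_compose2[OF z(1)]) (auto intro!: continuous_intros)
    moreover have "mode_sol (- T) 0 (\<lambda>t. \<psi> (t + T)) (\<lambda>t. z (t + T))" using mode_sol_shift[OF ms, of T] by simp
    moreover have "\<psi> (t + T) = 0" if "t \<notin> {-T<..<0}" for t by (rule \<psi>0) (use that in auto)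
    ultimately show ?thesis using T z p \<psi>2
      by (intro exI[of _ T] exI[of _ "\<lambda>t. z (t + T)"] exI[of _ "\<lambda>t. \<psi> (t + T)"] conjI) (auto simp del: of_nat_Suc)
  qed
  then obtain T z \<psi> where P: "\<And>n. T n > 0" "\<And>n. continuous_on {-T n..0} (z n)" "\<And>n. z n (- T n) = 0" "\<And>n. z n 0 \<in> X"
      "\<And>n. \<psi> n \<in> borel_measurable borel" "\<And>n t. t \<notin> {-T n<..<0} \<Longrightarrow> \<psi> n t = 0"
      "\<And>n. (\<integral>\<^sup>+t. ennreal ((norm (\<psi> n t))\<^sup>2) \<partial>lborel) \<le> ennreal (2 * V + 1 / real (Suc n))" "\<And>n. mode_sol (- T n) 0 (\<psi> n) (z n)"
    by metis
  obtain w r where w: "strict_mono r" "continuous_on {..0} w" "((\<lambda>t. norm (w t)) \<longlongrightarrow> 0) at_bot"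
      "(\<lambda>n. z (r n) 0) \<longlonglongrightarrow> w 0" "act_inf w \<le> ereal (2 * V / 2)"
  proof -
    have "2 * V \<ge> 0" using V(2) by simp
    from minimizing_limit[OF this P(1,2,3,5,6,7,8)] show ?thesis using that by blast
  qed
  have "w 0 \<in> X" by (rule closed_sequentially[OF X _ w(4)]) (rule P(4))
  then show ?thesis using w V by auto
qed

section \<open>The two potentials as minima\<close>

lemma qpot_is_minimum:
  assumes "qpot (x, y) < \<infinity>"
  shows "is_minimum (qpot (x, y)) {act_inf z | z. continuous_on {..0} z \<and> ((\<lambda>t. norm (z t)) \<longlongrightarrow> 0) at_bot \<and> z 0 = (x, y)}"
    (is "is_minimum _ ?M")
proof -
  have lower: "qpot (x, y) \<le> act_inf z" if "continuous_on {..0} z" "((\<lambda>t. norm (z t)) \<longlongrightarrow> 0) at_bot" "z 0 = (x, y)" for z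
    using qpot_le_act_inf[OF that(1,2)] unfolding that(3) .
  obtain w where w: "continuous_on {..0} w" "((\<lambda>t. norm (w t)) \<longlongrightarrow> 0) at_bot" "w 0 \<in> {(x, y)}" "act_inf w \<le> (INF p\<in>{(x, y)}. qpot p)"
    using minimizer[of "{(x, y)}"] assms by auto
  then have w0: "w 0 = (x, y)" and eq: "qpot (x, y) = act_inf w" using lower[OF w(1,2)] by (auto intro: antisym)
  show ?thesis unfolding is_minimum_def
  proof (intro conjI ballI)
    show "qpot (x, y) \<in> ?M"
      unfolding eq by (intro CollectI exI[of _ w] conjI refl w(1,2) w0)
    fix v assume "v \<in> ?M"
    then obtain z where "v = act_inf z" "continuous_on {..0} z" "((\<lambda>t. norm (z t)) \<longlongrightarrow> 0) at_bot" "z 0 = (x, y)" by blast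
    then show "qpot (x, y) \<le> v" by (simp only: lower)
  qed
qed

lemma qpot_pos_is_minimum:
  assumes "quasi_potential_pos S \<iota> B Q \<mu> x < \<infinity>"
  shows "is_minimum (quasi_potential_pos S \<iota> B Q \<mu> x)
    {act_inf z | z. continuous_on {..0} z \<and> ((\<lambda>t. norm (z t)) \<longlongrightarrow> 0) at_bot \<and> fst (z 0) = x}"
    (is "is_minimum _ ?M")
proof -
  let ?X = "{x} \<times> (UNIV :: 'm set)"
  have inf: "(INF p\<in>?X. qpot p) = quasi_potential_pos S \<iota> B Q \<mu> x"
  proof -
    have "?X = range (Pair x)" by auto
    then show ?thesis by (simp add: quasi_potential_pos_def image_image)
  qed
  have lower: "quasi_potential_pos S \<iota> B Q \<mu> x \<le> act_inf z" if "continuous_on {..0} z" "((\<lambda>t. norm (z t)) \<longlongrightarrow> 0) at_bot" "fst (z 0) = x" for z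
  proof -
    have "quasi_potential_pos S \<iota> B Q \<mu> x \<le> qpot (x, snd (z 0))" unfolding quasi_potential_pos_def by (rule INF_lower) simp
    also have "(x, snd (z 0)) = z 0" using that(3) by auto
    also have "qpot (z 0) \<le> act_inf z" by (rule qpot_le_act_inf[OF that(1,2)])
    finally show ?thesis .
  qed
  have "closed ?X" by (intro closed_Times) auto
  then obtain w where w: "continuous_on {..0} w" "((\<lambda>t. norm (w t)) \<longlongrightarrow> 0) at_bot" "w 0 \<in> ?X" "act_inf w \<le> quasi_potential_pos S \<iota> B Q \<mu> x"
    using minimizer[of ?X] assms unfolding inf by auto
  then have "fst (w 0) = x" by auto
  from lower[OF w(1,2) this] w(4) have eq: "quasi_potential_pos S \<iota> B Q \<mu> x = act_inf w" by (rule antisym)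
  show ?thesis unfolding is_minimum_def
  proof (intro conjI ballI)
    show "quasi_potential_pos S \<iota> B Q \<mu> x \<in> ?M"
      unfolding eq by (intro CollectI exI[of _ w] conjI refl w(1,2) \<open>fst (w 0) = x\<close>)
    fix v assume "v \<in> ?M"
    then obtain z where "v = act_inf z" "continuous_on {..0} z" "((\<lambda>t. norm (z t)) \<longlongrightarrow> 0) at_bot" "fst (z 0) = x" by blast
    then show "quasi_potential_pos S \<iota> B Q \<mu> x \<le> v" by (simp only: lower)
  qed
qed

end

subsection \<open>The data of the theorem\<close>

lemma filterlim_powr_at_top:
  assumes "p > (0::real)" shows "filterlim (\<lambda>x. x powr p) at_top at_top"
  unfolding filterlim_at_top_ge[where c = 1]
proof (intro allI impI)
  fix Z :: real assume Z: "Z \<ge> 1"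
  have "Z \<le> x powr p" if "x \<ge> Z powr (1 / p)" for x
  proof -
    have "(Z powr (1 / p)) powr p \<le> x powr p" using that assms by (intro powr_mono2) auto
    then show ?thesis using assms Z by (simp add: powr_powr)
  qed
  then show "\<forall>\<^sub>F x in at_top. Z \<le> x powr p" unfolding eventually_at_top_linorder by blast
qed

lemma bigtheta_powr_at_top:
  fixes \<alpha> :: "nat \<Rightarrow> real"
  assumes "\<alpha> \<in> \<Theta>(\<lambda>k. real (Suc k) powr p)" "p > 0" "\<And>k. \<alpha> k > 0"
  shows "filterlim \<alpha> at_top sequentially"
proof -
  have "\<alpha> \<in> \<Omega>(\<lambda>k. real (Suc k) powr p)" using assms(1) by (rule bigthetaD2)
  then obtain c where c: "c > 0" "\<forall>\<^sub>F k in sequentially. norm (\<alpha> k) \<ge> c * norm (real (Suc k) powr p)"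
    by (rule landau_omega.bigE)
  have "filterlim (\<lambda>k. real (Suc k)) at_top sequentially"
    using filterlim_compose[OF filterlim_real_sequentially filterlim_Suc] .
  from filterlim_compose[OF filterlim_powr_at_top[OF assms(2)] this]
  have "filterlim (\<lambda>k. real (Suc k) powr p) at_top sequentially" .
  then have "filterlim (\<lambda>k. c * real (Suc k) powr p) at_top sequentially"
    by (rule filterlim_tendsto_pos_mult_at_top[OF tendsto_const c(1)])
  then show ?thesis
  proof (rule filterlim_at_top_mono)
    show "\<forall>\<^sub>F k in sequentially. c * real (Suc k) powr p \<le> \<alpha> k"
      using c(2) assms(3) by (auto elim!: eventually_mono simp: abs_of_pos)
  qed
qed

text \<open>With negative \<beta> the lower bound on the eigenvalues would grow without bound,
  against boundedness of Q. For d = 1 the lower bound assumed on \<beta> alone would admit negative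
  values, whereas the estimates use B at index \<open>2 * \<beta>\<close>, which must be
  nonnegative.\<close>

lemma bounded_eigenvalues_exponent_nonneg:
  fixes e :: "nat \<Rightarrow> 'h::real_inner"
  assumes \<alpha>: "filterlim \<alpha> at_top sequentially" and e: "\<And>k. e k \<bullet> e k = 1"
    and Q: "bounded_linear Q" "\<And>k. Q (e k) = lam k *\<^sub>R e k"
    and lam: "c > 0" "\<And>k. (1/c) * \<alpha> k powr (- \<beta>) \<le> lam k"
  shows "\<beta> \<ge> 0"
proof (rule ccontr)
  assume "\<not> \<beta> \<ge> 0"
  then have "filterlim (\<lambda>k. \<alpha> k powr (- \<beta>)) at_top sequentially"
    using filterlim_compose[OF filterlim_powr_at_top \<alpha>] by simp
  obtain K where K: "\<And>x. norm (Q x) \<le> norm x * K" using bounded_linear.bounded[OF Q(1)] by blast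
  have "\<forall>\<^sub>F k in sequentially. \<alpha> k powr (- \<beta>) > c * K"
    using \<open>filterlim (\<lambda>k. \<alpha> k powr (- \<beta>)) at_top sequentially\<close> by (simp add: filterlim_at_top_dense)
  then obtain k where k: "\<alpha> k powr (- \<beta>) > c * K" by (auto simp: eventually_sequentially)
  have "norm (e k) = 1" by (simp add: norm_eq_sqrt_inner e)
  then have "\<bar>lam k\<bar> \<le> K" using K[of "e k"] by (simp add: Q)
  then have "(1/c) * \<alpha> k powr (- \<beta>) \<le> K" using lam(2)[of k] by linarith
  then have "\<alpha> k powr (- \<beta>) \<le> c * K" using lam(1) by (simp add: field_simps)
  then show False using k by simp
qed

lemma Hsp_diff:
  assumes "x \<in> Hsp e \<alpha> \<delta>" "y \<in> Hsp e \<alpha> \<delta>" shows "x - y \<in> Hsp e \<alpha> \<delta>"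
proof -
  let ?f = "\<lambda>k. 2 * (\<alpha> k powr \<delta> * (x \<bullet> e k)\<^sup>2) + 2 * (\<alpha> k powr \<delta> * (y \<bullet> e k)\<^sup>2)"
  have s: "summable ?f" using assms by (intro summable_add summable_mult) (auto simp: Hsp_def)
  have "norm (\<alpha> k powr \<delta> * ((x - y) \<bullet> e k)\<^sup>2) \<le> ?f k" for k
  proof -
    have "0 \<le> (x \<bullet> e k + y \<bullet> e k)\<^sup>2" by simp
    then have "((x - y) \<bullet> e k)\<^sup>2 \<le> 2 * (x \<bullet> e k)\<^sup>2 + 2 * (y \<bullet> e k)\<^sup>2"
      by (simp add: inner_diff_left power2_eq_square algebra_simps)
    then have "\<alpha> k powr \<delta> * ((x - y) \<bullet> e k)\<^sup>2 \<le> \<alpha> k powr \<delta> * (2 * (x \<bullet> e k)\<^sup>2 + 2 * (y \<bullet> e k)\<^sup>2)"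
      by (rule mult_left_mono) simp
    then show ?thesis by (simp add: algebra_simps)
  qed
  then show ?thesis unfolding Hsp_def by (auto intro: summable_comparison_test'[OF s])
qed

lemma Hnorm_nonneg: "x \<in> Hsp e \<alpha> \<delta> \<Longrightarrow> 0 \<le> Hnorm e \<alpha> \<delta> x"
  unfolding Hnorm_def Hsp_def by (auto intro!: suminf_nonneg)

theorem theorem5p3:
  fixes D :: "(real^'d) set"
    and rep :: "'h::{real_inner,banach,second_countable_topology} \<Rightarrow> real^'d \<Rightarrow> real"
    and e :: "nat \<Rightarrow> 'h"
    and \<alpha> lam :: "nat \<Rightarrow> real"
    and \<iota> :: "'h \<Rightarrow> 'm::{real_inner,banach,second_countable_topology}"
    and Q B :: "'h \<Rightarrow> 'h"
    and DB :: "'h \<Rightarrow> 'h \<Rightarrow> 'h"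
    and \<beta> c :: real
    and \<gamma> :: "real \<Rightarrow> real"
    and S :: "real \<Rightarrow> real \<Rightarrow> 'h \<times> 'm \<Rightarrow> 'h \<times> 'm"
  assumes D: "open D" "bounded D" "D \<noteq> {}"
    and H: "is_L2_space D rep"
    and basis: "\<forall>j k. e j \<bullet> e k = (if j = k then 1 else 0)" "closure (span (range e)) = UNIV"
    and eigen: "\<forall>k. dirichlet_laplacian D rep (e k) (- \<alpha> k *\<^sub>R e k)"
    and \<alpha>: "0 < \<alpha> 0" "\<forall>k. \<alpha> k \<le> \<alpha> (Suc k)"
    and regular: "\<alpha> \<in> \<Theta>(\<lambda>k. real (Suc k) powr (2 / real CARD('d)))"
    and Hm1: "is_Hminus1 e \<alpha> \<iota>"
    and Q: "bounded_linear Q" "\<forall>k. Q (e k) = lam k *\<^sub>R e k"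
    and lam: "c > 0" "\<forall>k. (1/c) * \<alpha> k powr (- \<beta>) \<le> lam k \<and> lam k \<le> c * \<alpha> k powr (- \<beta>)"
    and \<beta>: "\<beta> > (real CARD('d) - 2) / 4"
    and B_Lipschitz: "\<forall>\<delta>\<in>{0..1 + 2*\<beta>}. \<gamma> \<delta> < \<alpha> 0 \<and>
          (\<forall>x\<in>Hsp e \<alpha> \<delta>. B x \<in> Hsp e \<alpha> \<delta>) \<and>
          (\<forall>x\<in>Hsp e \<alpha> \<delta>. \<forall>y\<in>Hsp e \<alpha> \<delta>. Hnorm e \<alpha> \<delta> (B x - B y) \<le> \<gamma> \<delta> * Hnorm e \<alpha> \<delta> (x - y))"
    and B_0: "B 0 = 0"
    and DB: "\<forall>x\<in>Hsp e \<alpha> (2*\<beta>). has_Hderivative e \<alpha> (2*\<beta>) B (DB x) x"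
          "(SUP x\<in>Hsp e \<alpha> (2*\<beta>). op_norm_on e \<alpha> (2*\<beta>) (DB x)) = ereal (\<gamma> (2*\<beta>))"
    and S: "\<forall>\<mu>>0. C0_semigroup (S \<mu>) \<and> has_generator (S \<mu>) (A_dom e \<alpha> \<iota>) (A_op e \<alpha> \<iota> \<mu>)"
  shows "\<exists>\<mu>0>0. \<forall>\<mu>. 0 < \<mu> \<and> \<mu> < \<mu>0 \<longrightarrow>
      (\<forall>x y. quasi_potential S \<iota> B Q \<mu> (x, y) < \<infinity> \<longrightarrow>
         is_minimum (quasi_potential S \<iota> B Q \<mu> (x, y))
           {action_neg_inf S \<iota> B Q \<mu> z | z.
              continuous_on {..0} z \<and> ((\<lambda>t. norm (z t)) \<longlongrightarrow> 0) at_bot \<and> z 0 = (x, y)}) \<and>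
      (\<forall>x. quasi_potential_pos S \<iota> B Q \<mu> x < \<infinity> \<longrightarrow>
         is_minimum (quasi_potential_pos S \<iota> B Q \<mu> x)
           {action_neg_inf S \<iota> B Q \<mu> z | z.
              continuous_on {..0} z \<and> ((\<lambda>t. norm (z t)) \<longlongrightarrow> 0) at_bot \<and> fst (z 0) = x})"
proof -
  have ortho: "e j \<bullet> e k = (if j = k then 1 else 0)" for j k using basis(1) by blast
  interpret onb e by standard (use ortho basis(2) in auto)
  have \<alpha>_ge: "\<alpha> 0 \<le> \<alpha> k" for k by (rule lift_Suc_mono_le[of \<alpha>]) (use \<alpha>(2) in auto)
  have \<alpha>_pos: "0 < \<alpha> k" for k using \<alpha>_ge[of k] \<alpha>(1) by linarith
  have \<alpha>_lim: "filterlim \<alpha> at_top sequentially"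
    by (rule bigtheta_powr_at_top[OF regular _ \<alpha>_pos]) simp
  have \<beta>0: "\<beta> \<ge> 0"
    by (rule bounded_eigenvalues_exponent_nonneg[OF \<alpha>_lim _ Q(1) _ lam(1)]) (use ortho Q(2) lam(2) in auto)
  have Hnorm0: "Hnorm e \<alpha> 0 x = norm x" for x
    using Parseval[of x] \<alpha>_pos by (simp add: Hnorm_def sums_iff less_imp_neq[OF \<alpha>_pos, symmetric])
  have Hsp0: "x \<in> Hsp e \<alpha> 0" for x
    using Parseval[of x] by (simp add: Hsp_def sums_iff less_imp_neq[OF \<alpha>_pos, symmetric])
  \<comment> \<open>The small gain condition involves the square of the Lipschitz constant, and
    squares compare only for nonnegative numbers.\<close>
  define g where "g = max (\<gamma> 0) 0"
  have \<gamma>0: "\<gamma> 0 < \<alpha> 0" and lip0: "norm (B x - B y) \<le> \<gamma> 0 * norm (x - y)" for x y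
  proof -
    have mem: "(0::real) \<in> {0..1 + 2*\<beta>}" using \<beta>0 by simp
    show "\<gamma> 0 < \<alpha> 0" using bspec[OF B_Lipschitz mem] by blast
    show "norm (B x - B y) \<le> \<gamma> 0 * norm (x - y)"
      using bspec[OF B_Lipschitz mem] Hsp0 unfolding Hnorm0 by blast
  qed
  have g: "0 \<le> g" "g < \<alpha> 0" using \<gamma>0 \<alpha>(1) by (auto simp: g_def)
  have lip: "norm (B x - B y) \<le> g * norm (x - y)" for x y
    by (rule order_trans[OF lip0 mult_right_mono]) (auto simp: g_def)
  \<comment> \<open>The threshold for \<mu>: the small gain condition solved for \<mu>, with g^2 + 1
    in place of g^2 in the denominator so that g = 0 is covered.\<close>
  define m where "m = (1 - g\<^sup>2 / (\<alpha> 0)\<^sup>2) * (2 * \<alpha> 0) / (9 * (g\<^sup>2 + 1))"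
  have "g\<^sup>2 < (\<alpha> 0)\<^sup>2" using g by (intro power_strict_mono) auto
  then have g1: "g\<^sup>2 / (\<alpha> 0)\<^sup>2 < 1" using \<alpha>(1) by simp
  have g2: "g\<^sup>2 + 1 > 0" by (rule add_nonneg_pos) auto
  have m: "m > 0" unfolding m_def using g1 g2 \<alpha>(1) by (intro divide_pos_pos mult_pos_pos) auto
  have wave: "damped_wave e \<alpha> lam \<iota> Q B \<beta> c g \<mu> S" if \<mu>: "0 < \<mu>" "\<mu> < m" for \<mu>
  proof (rule damped_wave.intro)
    have "9 * \<mu> / (2 * \<alpha> 0) * g\<^sup>2 \<le> 9 * \<mu> / (2 * \<alpha> 0) * (g\<^sup>2 + 1)"
      using \<mu> \<alpha>(1) by (intro mult_left_mono) auto
    also have "\<dots> < 9 * m / (2 * \<alpha> 0) * (g\<^sup>2 + 1)"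
      using \<mu> \<alpha>(1) g2 by (intro mult_strict_right_mono divide_strict_right_mono) auto
    also have "\<dots> = 1 - g\<^sup>2 / (\<alpha> 0)\<^sup>2"
    proof -
      have "9 * (x * (2 * a) / (9 * y)) / (2 * a) * y = x" if "a > 0" "y > 0" for a x y :: real
        using that by (simp add: field_simps)
      from this[OF \<alpha>(1) g2] show ?thesis by (simp only: m_def)
    qed
    finally show "(1 / (\<alpha> 0)\<^sup>2 + 9 * \<mu> / (2 * \<alpha> 0)) * g\<^sup>2 < 1" by (simp add: distrib_right)
    fix \<delta> :: real and x y :: 'h
    assume \<delta>: "0 \<le> \<delta>" "\<delta> \<le> 2 * \<beta>" and x: "x \<in> Hsp e \<alpha> \<delta>"
    then have "\<delta> \<in> {0..1 + 2*\<beta>}" by simp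
    note L = bspec[OF B_Lipschitz this]
    show "B x \<in> Hsp e \<alpha> \<delta>" using L x by blast
    assume y: "y \<in> Hsp e \<alpha> \<delta>"
    have "Hnorm e \<alpha> \<delta> (B x - B y) \<le> \<gamma> \<delta> * Hnorm e \<alpha> \<delta> (x - y)" using L x y by blast
    also have "\<dots> \<le> \<alpha> 0 * Hnorm e \<alpha> \<delta> (x - y)"
      using L Hnorm_nonneg[OF Hsp_diff[OF x y]] by (intro mult_right_mono) auto
    finally show "Hnorm e \<alpha> \<delta> (B x - B y) \<le> \<alpha> 0 * Hnorm e \<alpha> \<delta> (x - y)" .
  qed (use ortho basis(2) \<alpha> \<alpha>_lim Hm1 Q lam \<beta>0 lip g B_0 S \<mu> in auto)
  show ?thesis
  proof (intro exI[of _ m] conjI m allI impI)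
    fix \<mu> x y assume \<mu>: "0 < \<mu> \<and> \<mu> < m" and fin: "quasi_potential S \<iota> B Q \<mu> (x, y) < \<infinity>"
    interpret damped_wave e \<alpha> lam \<iota> Q B \<beta> c g \<mu> S by (rule wave) (use \<mu> in auto)
    show "is_minimum (quasi_potential S \<iota> B Q \<mu> (x, y))
       {action_neg_inf S \<iota> B Q \<mu> z | z. continuous_on {..0} z \<and> ((\<lambda>t. norm (z t)) \<longlongrightarrow> 0) at_bot \<and> z 0 = (x, y)}"
      by (rule qpot_is_minimum[OF fin])
  next
    fix \<mu> x assume \<mu>: "0 < \<mu> \<and> \<mu> < m" and fin: "quasi_potential_pos S \<iota> B Q \<mu> x < \<infinity>"
    interpret damped_wave e \<alpha> lam \<iota> Q B \<beta> c g \<mu> S by (rule wave) (use \<mu> in auto)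
    show "is_minimum (quasi_potential_pos S \<iota> B Q \<mu> x)
       {action_neg_inf S \<iota> B Q \<mu> z | z. continuous_on {..0} z \<and> ((\<lambda>t. norm (z t)) \<longlongrightarrow> 0) at_bot \<and> fst (z 0) = x}"
      by (rule qpot_pos_is_minimum[OF fin])
  qed
qed

end
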